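(* Let $\delta$ be an $I\times J$ matrix of free polynomials in $d$ variables and let $p=[\delta]$ be the corresponding matrix of commutative polynomials. Let $A$ be an algebraic set in $\mathbb{C}^d$ (the common zero set of a collection of polynomials in $d$ commuting variables) and let $V=A\cap G_p$. If $f\in\mathrm{Hol}^\infty_{p,V}$, then there exists a free holomorphic function $F$ on $B_\delta$ such that $$F([\lambda_1],\dots,[\lambda_d])=[f(\lambda_1,\dots,\lambda_d)]\ \text{ for all }\lambda\in V,\qquad\text{and}\qquad \sup_{x\in B_\delta}\|F(x)\|=\|f\|_{p,V}.$$ Conversely, if $F$ is a bounded free holomorphic function on $B_\delta$ and $f\in\mathrm{Hol}(V)$ is defined by $[f(\lambda_1,\dots,\lambda_d)]=F([\lambda_1],\dots,[\lambda_d])$ for $\lambda\in V$, then $f\in\mathrm{Hol}^\infty_{p,V}$ and $$\|f\|_{p,V}\le\sup_{x\in B_\delta}\|F(x)\|.$$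
   Context: Free setting. $\mathbb{P}_d$ is the free algebra over $\mathbb{C}$ on $d$ generators; $\mathcal{M}_n$ is the space of $n\times n$ complex matrices; $\mathcal{M}^{[d]}=\bigcup_{n\ge1}\mathcal{M}_n^d$. For a matrix $\delta=[\delta_{ij}]$ with entries in $\mathbb{P}_d$ and $x\in\mathcal{M}_n^d$, $\delta(x)=[\delta_{ij}(x)]$ is the block matrix, with operator norm. A basic set is a set $B_\delta=\{x\in\mathcal{M}^{[d]} : \|\delta(x)\|<1\}$. The basic sets form a basis of the free topology; a free domain is a set open in this topology. A function $f:D\to\mathcal{M}^{[1]}$ on a free domain $D$ is free holomorphic if for each $\lambda\in D$ there is a basic set $B_\eta$ with $\lambda\in B_\eta\subseteq D$ such that for every $\epsilon>0$ there is $\pi\in\mathbb{P}_d$ with $\|f(x)-\pi(x)\|<\epsilon$ for all $x\in B_\eta$. For a scalar $c$, $[c]$ denotes the $1\times1$ matrix with entry $c$. Commutative setting. $\mathrm{P}_d$ is the algebra of polynomials in $d$ commuting variables, identified with the quotient of $\mathbb{P}_d$ by the ideal generated by $x_ix_j-x_jx_i$; for $\delta\in\mathbb{P}_d$, $[\delta]\in\mathrm{P}_d$ denotes its image, applied entrywise to matrices. For a matrix $p$ over $\mathrm{P}_d$, $G_p=\{\lambda\in\mathbb{C}^d : \|p(\lambda)\|<1\}$ (operator norm). $\mathcal{M}^{[d]}_{\rm com}$ is the set of $x\in\mathcal{M}^{[d]}$ whose entries commute pairwise, and $\mathcal{F}_p=\{x\in\mathcal{M}^{[d]}_{\rm com}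 : \|p(x)\|<1\}$. $\sigma(x)\subset\mathbb{C}^d$ is the joint spectrum (set of joint eigenvalues) of $x\in\mathcal{M}^{[d]}_{\rm com}$. $V$-norms. For $V\subseteq G_p$, $\mathrm{Hol}(V)$ is the set of functions $f:V\to\mathbb{C}$ such that each $\lambda\in V$ has an open neighborhood in $\mathbb{C}^d$ on which some holomorphic function agrees with $f$ on $V$. $Y_V$ is the set of $y\in\mathcal{M}^{[d]}_{\rm com}$ with $\sigma(y)\subseteq V$; equivalently, $y$ is similar to a finite direct sum $\bigoplus_i x_i$ with $x_i\in\mathcal{M}^{[d]}_{\rm com}$, $\sigma(x_i)=\{\lambda_i\}$, $\lambda_i\in V$. If $g$ is holomorphic near $\lambda$ and $\sigma(x)=\{\lambda\}$, then $g(x)$ is obtained by inserting $x$ into the power series of $g$ at $\lambda$ (a finite sum); for $y=S^{-1}(\bigoplus_i x_i)S$ one sets $g(y)=S^{-1}(\bigoplus_i g(x_i))S$. An element $y\in Y_V$ is subordinate to $V$ if $g(y)=0$ whenever $g$ is holomorphic on a neighborhood $U$ of $\sigma(y)$ in $\mathbb{C}^d$ and vanishes on $U\cap V$. Let $\mathcal{F}_{p,V}=\{y\in Y_V : y\text{ is subordinate to }V\}\cap\mathcal{F}_p$. For $f\in\mathrm{Hol}(V)$ and $y=S^{-1}(\bigoplus_i x_i)S\in\mathcal{F}_{p,V}$ with $\sigma(x_i)=\{\lambda_i\}$, $\lambda_i\in V$, one sets $f(y)=S^{-1}(\bigoplus_i f_i(x_i))S$, where $f_i$ is a holomorphic function on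 a neighborhood of $\lambda_i$ in $\mathbb{C}^d$ that agrees with $f$ on $V$ there, and $f_i(x_i)$ is obtained by inserting $x_i$ into the power series of $f_i$ at $\lambda_i$ (well defined since $y$ is subordinate to $V$). Finally $\|f\|_{p,V}=\sup_{y\in\mathcal{F}_{p,V}}\|f(y)\|$ and $\mathrm{Hol}^\infty_{p,V}=\{f\in\mathrm{Hol}(V) : \|f\|_{p,V}<\infty\}$. *)

theory Defs
  imports
    "HOL-Analysis.Analysis"
    "HOL-Library.Poly_Mapping"
    "Jordan_Normal_Form.Jordan_Normal_Form"
begin

hide_const (open) Finite_Cartesian_Product.mat Finite_Cartesian_Product.vec
hide_type (open) Finite_Cartesian_Product.vec

no_notation vec_index (infixl "$" 100)

section \<open>Free and commutative polynomials\<close>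

text \<open>
  The finite type \<open>'d\<close> indexes the variables, so \<open>d = CARD('d) \<ge> 1\<close>. The free algebra is the monoid
  algebra of the free monoid of words; words are a type of their own because lists carry no
  \<open>monoid_add\<close> structure.
\<close>

datatype 'd free_word = Word (letters: "'d list")

instantiation free_word :: (type) monoid_add
begin

definition zero_free_word :: "'a free_word" where
  "0 = Word []"

definition plus_free_word :: "'a free_word \<Rightarrow> 'a free_word \<Rightarrow> 'a free_word" where
  "v + w = Word (letters v @ letters w)"

instance
  by standard (simp_all add: zero_free_word_def plus_free_word_def)

end

type_synonym 'd free_poly = "'d free_word \<Rightarrow>\<^sub>0 complex"
type_synonym 'd comm_poly = "('d \<Rightarrow>\<^sub>0 nat) \<Rightarrow>\<^sub>0 complex"

definition word_monomial :: "'d free_word \<Rightarrow> ('d \<Rightarrow>\<^sub>0 nat)" where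
  "word_monomial w = (\<Sum>i\<leftarrow>letters w. Poly_Mapping.single i 1)"

text \<open>The quotient map \<open>\<delta> \<mapsto> [\<delta>]\<close> killing all commutators \<open>x\<^sub>i x\<^sub>j - x\<^sub>j x\<^sub>i\<close>.\<close>

definition abelianize :: "'d free_poly \<Rightarrow> 'd comm_poly" where
  "abelianize q = (\<Sum>w\<in>Poly_Mapping.keys q.
     Poly_Mapping.single (word_monomial w) (Poly_Mapping.lookup q w))"

lemma word_monomial_plus: "word_monomial (v + w) = word_monomial v + word_monomial w"
  by (simp add: word_monomial_def plus_free_word_def)

lemma abelianize_superset:
  assumes "finite K" "Poly_Mapping.keys q \<subseteq> K"
  shows "abelianize q = (\<Sum>w\<in>K. Poly_Mapping.single (word_monomial w) (Poly_Mapping.lookup q w))"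
  unfolding abelianize_def using assms
  by (intro sum.mono_neutral_left) (auto simp: in_keys_iff)

lemma abelianize_single [simp]:
  "abelianize (Poly_Mapping.single w c) = Poly_Mapping.single (word_monomial w) c"
  by (cases "c = 0") (simp_all add: abelianize_def)

lemma abelianize_add: "abelianize (q + r) = abelianize q + abelianize r"
proof -
  let ?K = "Poly_Mapping.keys q \<union> Poly_Mapping.keys r"
  have "Poly_Mapping.keys (q + r) \<subseteq> ?K"
    by (rule Poly_Mapping.keys_add)
  then show ?thesis
    by (simp add: abelianize_superset[of ?K] lookup_add single_add sum.distrib)
qed

lemma abelianize_sum: "abelianize (\<Sum>k\<in>K. q k) = (\<Sum>k\<in>K. abelianize (q k))"
  by (induction K rule: infinite_finite_induct) (simp_all add: abelianize_add abelianize_def[of 0])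

lemma abelianize_mult: "abelianize (q * r) = abelianize q * abelianize r"
proof -
  have *: "p = (\<Sum>w\<in>Poly_Mapping.keys p. Poly_Mapping.single w (Poly_Mapping.lookup p w))"
    for p :: "'d free_poly"
    by (rule poly_mapping_eqI)
       (simp add: lookup_sum lookup_single when_def in_keys_iff)
  have "q * r = (\<Sum>v\<in>Poly_Mapping.keys q. \<Sum>w\<in>Poly_Mapping.keys r.
      Poly_Mapping.single (v + w) (Poly_Mapping.lookup q v * Poly_Mapping.lookup r w))"
    by (subst *[of q], subst *[of r]) (simp add: sum_product mult_single)
  then show ?thesis
    by (simp add: abelianize_sum word_monomial_plus)
       (simp add: abelianize_def sum_product mult_single)
qed


section \<open>Evaluation at tuples of matrices\<close>

definition matrix_tuples :: "nat \<Rightarrow> ('d \<Rightarrow> complex mat) set" where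
  "matrix_tuples n = {x. \<forall>i. x i \<in> carrier_mat n n}"

definition matrix_universe :: "('d \<Rightarrow> complex mat) set" where
  "matrix_universe = (\<Union>n\<in>{1..}. matrix_tuples n)"

definition level :: "('d \<Rightarrow> complex mat) \<Rightarrow> nat" where
  "level x = (THE n. x \<in> matrix_tuples n)"

definition comm_universe :: "('d \<Rightarrow> complex mat) set" where
  "comm_universe = {x \<in> matrix_universe. \<forall>i j. x i * x j = x j * x i}"

definition linear_combination ::
    "nat \<Rightarrow> ('m \<Rightarrow> complex) \<Rightarrow> ('m \<Rightarrow> complex mat) \<Rightarrow> 'm set \<Rightarrow> complex mat" where
  "linear_combination n c X K = mat n n (\<lambda>ab. \<Sum>k\<in>K. c k * X k $$ ab)"

definition word_value :: "('d \<Rightarrow> complex mat) \<Rightarrow> 'd free_word \<Rightarrow> complex mat" where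
  "word_value x w = foldr (\<lambda>i M. x i * M) (letters w) (1\<^sub>m (level x))"

definition free_eval :: "'d free_poly \<Rightarrow> ('d \<Rightarrow> complex mat) \<Rightarrow> complex mat" where
  "free_eval q x =
     linear_combination (level x) (Poly_Mapping.lookup q) (word_value x) (Poly_Mapping.keys q)"

text \<open>
  A monomial is evaluated at a commuting tuple by multiplying in the order of an arbitrary
  enumeration of the variables, which does not affect the value.
\<close>

definition variables :: "'d::finite list" where
  "variables = (SOME is. distinct is \<and> set is = UNIV)"

definition monomial_value :: "('d::finite \<Rightarrow> complex mat) \<Rightarrow> ('d \<Rightarrow>\<^sub>0 nat) \<Rightarrow> complex mat" where
  "monomial_value x m =
     foldr (\<lambda>i M. (x i ^\<^sub>m Poly_Mapping.lookup m i) * M) variables (1\<^sub>m (level x))"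

definition comm_eval :: "'d::finite comm_poly \<Rightarrow> ('d \<Rightarrow> complex mat) \<Rightarrow> complex mat" where
  "comm_eval q x =
     linear_combination (level x) (Poly_Mapping.lookup q) (monomial_value x) (Poly_Mapping.keys q)"

definition scalar_monomial :: "complex ^ 'd \<Rightarrow> ('d::finite \<Rightarrow>\<^sub>0 nat) \<Rightarrow> complex" where
  "scalar_monomial z m = (\<Prod>i\<in>UNIV. (z $ i) ^ Poly_Mapping.lookup m i)"

definition scalar_eval :: "'d::finite comm_poly \<Rightarrow> complex ^ 'd \<Rightarrow> complex" where
  "scalar_eval q z = (\<Sum>m\<in>Poly_Mapping.keys q. Poly_Mapping.lookup q m * scalar_monomial z m)"

definition block_eval :: "nat \<Rightarrow> ('q \<Rightarrow> complex mat) \<Rightarrow> 'q mat \<Rightarrow> complex mat" where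
  "block_eval n ev D = mat (dim_row D * n) (dim_col D * n)
     (\<lambda>(a, b). ev (D $$ (a div n, b div n)) $$ (a mod n, b mod n))"

definition euclid_norm :: "complex vec \<Rightarrow> real" where
  "euclid_norm v = L2_set (\<lambda>i. cmod (vec_index v i)) {..<dim_vec v}"

definition op_norm :: "complex mat \<Rightarrow> real" where
  "op_norm M = Sup {euclid_norm (M *\<^sub>v v) | v. v \<in> carrier_vec (dim_col M) \<and> euclid_norm v \<le> 1}"


section \<open>Free holomorphic functions\<close>

definition basic_set :: "'d free_poly mat \<Rightarrow> ('d \<Rightarrow> complex mat) set" where
  "basic_set D = {x \<in> matrix_universe. op_norm (block_eval (level x) (\<lambda>q. free_eval q x) D) < 1}"

definition free_topology :: "('d \<Rightarrow> complex mat) topology" where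
  "free_topology = topology_generated_by (range basic_set)"

text \<open>
  The difference \<open>F x - \<pi>(x)\<close> only makes sense if \<open>F\<close> maps \<open>n \<times> n\<close> tuples to \<open>n \<times> n\<close> matrices,
  hence the explicit grading condition.
\<close>

definition free_holomorphic ::
    "('d \<Rightarrow> complex mat) set \<Rightarrow> (('d \<Rightarrow> complex mat) \<Rightarrow> complex mat) \<Rightarrow> bool" where
  "free_holomorphic D F \<longleftrightarrow>
     openin free_topology D \<and>
     (\<forall>x\<in>D. F x \<in> carrier_mat (level x) (level x)) \<and>
     (\<forall>l\<in>D. \<exists>E. l \<in> basic_set E \<and> basic_set E \<subseteq> D \<and>
        (\<forall>\<epsilon>>0. \<exists>q. \<forall>x\<in>basic_set E. op_norm (F x - free_eval q x) < \<epsilon>))"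

text \<open>Norms are taken in \<open>ennreal\<close>: they may be infinite, and over an empty set they are 0.\<close>

definition sup_norm_on ::
    "('d \<Rightarrow> complex mat) set \<Rightarrow> (('d \<Rightarrow> complex mat) \<Rightarrow> complex mat) \<Rightarrow> ennreal" where
  "sup_norm_on D F = (SUP x\<in>D. ennreal (op_norm (F x)))"

definition scalar_tuple :: "complex ^ 'd \<Rightarrow> ('d \<Rightarrow> complex mat)" where
  "scalar_tuple z = (\<lambda>i. mat 1 1 (\<lambda>_. z $ i))"


section \<open>The commutative setting\<close>

definition comm_basic :: "'d::finite comm_poly mat \<Rightarrow> (complex ^ 'd) set" where
  "comm_basic p = {z. op_norm (map_mat (\<lambda>q. scalar_eval q z) p) < 1}"

definition comm_basic_matrices :: "'d::finite comm_poly mat \<Rightarrow> ('d \<Rightarrow> complex mat) set" where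
  "comm_basic_matrices p =
     {x \<in> comm_universe. op_norm (block_eval (level x) (\<lambda>q. comm_eval q x) p) < 1}"

definition algebraic_set :: "(complex ^ 'd::finite) set \<Rightarrow> bool" where
  "algebraic_set A \<longleftrightarrow> (\<exists>Q. A = {z. \<forall>q\<in>Q. scalar_eval q z = 0})"

definition joint_spectrum :: "('d::finite \<Rightarrow> complex mat) \<Rightarrow> (complex ^ 'd) set" where
  "joint_spectrum x = {z. \<exists>v. \<forall>i. eigenvector (x i) v (z $ i)}"

text \<open>Holomorphic = complex differentiable; \<open>c\<close> is the complex gradient.\<close>

definition holomorphic_several :: "(complex ^ 'd::finite \<Rightarrow> complex) \<Rightarrow> (complex ^ 'd) set \<Rightarrow> bool" where
  "holomorphic_several g U \<longleftrightarrow> open U \<and>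
     (\<forall>z\<in>U. \<exists>c :: complex ^ 'd. (g has_derivative (\<lambda>h. \<Sum>i\<in>UNIV. c $ i * h $ i)) (at z))"

definition local_extension ::
    "(complex ^ 'd::finite) set \<Rightarrow> (complex ^ 'd \<Rightarrow> complex) \<Rightarrow> complex ^ 'd \<Rightarrow>
     (complex ^ 'd \<Rightarrow> complex) \<Rightarrow> bool" where
  "local_extension V f l g \<longleftrightarrow>
     (\<exists>U. l \<in> U \<and> holomorphic_several g U \<and> (\<forall>z\<in>U \<inter> V. g z = f z))"

text \<open>Functions on \<open>V\<close> are represented by total functions whose values off \<open>V\<close> are irrelevant.\<close>

definition Hol :: "(complex ^ 'd::finite) set \<Rightarrow> (complex ^ 'd \<Rightarrow> complex) set" where
  "Hol V = {f. \<forall>l\<in>V. \<exists>g. local_extension V f l g}"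

definition power_series_at ::
    "(complex ^ 'd::finite \<Rightarrow> complex) \<Rightarrow> complex ^ 'd \<Rightarrow> (('d \<Rightarrow>\<^sub>0 nat) \<Rightarrow> complex) \<Rightarrow> bool" where
  "power_series_at g l c \<longleftrightarrow>
     (\<exists>r>0. \<forall>z\<in>ball l r. ((\<lambda>m. c m * scalar_monomial (z - l) m) has_sum g z) UNIV)"

text \<open>The value \<open>g(x)\<close> if \<open>\<sigma>(x) = {l}\<close>: all but finitely many monomials in \<open>x - l\<close> vanish.\<close>

definition local_value ::
    "(complex ^ 'd::finite \<Rightarrow> complex) \<Rightarrow> ('d \<Rightarrow> complex mat) \<Rightarrow> complex mat" where
  "local_value g x =
     (let n = level x;
          l = the_elem (joint_spectrum x);
          y = (\<lambda>i. x i - (l $ i) \<cdot>\<^sub>m 1\<^sub>m n)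
      in linear_combination n (SOME c. power_series_at g l c) (monomial_value y)
           {m. monomial_value y m \<noteq> 0\<^sub>m n n})"

text \<open>\<open>y = T (\<Oplus>\<^sub>k x\<^sub>k) S\<close> with \<open>T = S\<^sup>-\<^sup>1\<close> and each \<open>x\<^sub>k\<close> a commuting tuple with one-point spectrum.\<close>

definition decomposition ::
    "('d::finite \<Rightarrow> complex mat) \<Rightarrow> complex mat \<Rightarrow> complex mat \<Rightarrow> ('d \<Rightarrow> complex mat) list \<Rightarrow> bool" where
  "decomposition y T S xs \<longleftrightarrow>
     (\<forall>x\<in>set xs. x \<in> comm_universe \<and> is_singleton (joint_spectrum x)) \<and>
     (\<forall>i. similar_mat_wit (y i) (diag_block_mat (map (\<lambda>x. x i) xs)) T S)"

text \<open>The value \<open>g(y)\<close> for \<open>g\<close> holomorphic near \<open>\<sigma>(y)\<close>; it does not depend on the decomposition.\<close>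

definition hol_value ::
    "(complex ^ 'd::finite \<Rightarrow> complex) \<Rightarrow> ('d \<Rightarrow> complex mat) \<Rightarrow> complex mat" where
  "hol_value g y = (SOME M. \<exists>T S xs. decomposition y T S xs \<and>
     M = T * diag_block_mat (map (local_value g) xs) * S)"

definition spectrum_in :: "(complex ^ 'd::finite) set \<Rightarrow> ('d \<Rightarrow> complex mat) set" where
  "spectrum_in V = {y \<in> comm_universe. joint_spectrum y \<subseteq> V}"

definition subordinate :: "(complex ^ 'd::finite) set \<Rightarrow> ('d \<Rightarrow> complex mat) \<Rightarrow> bool" where
  "subordinate V y \<longleftrightarrow>
     (\<forall>U g. joint_spectrum y \<subseteq> U \<and> holomorphic_several g U \<and> (\<forall>z\<in>U \<inter> V. g z = 0) \<longrightarrow>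
        hol_value g y = 0\<^sub>m (level y) (level y))"

definition subordinate_matrices ::
    "'d::finite comm_poly mat \<Rightarrow> (complex ^ 'd) set \<Rightarrow> ('d \<Rightarrow> complex mat) set" where
  "subordinate_matrices p V = {y \<in> spectrum_in V. subordinate V y} \<inter> comm_basic_matrices p"

text \<open>
  The value \<open>f(y)\<close> for \<open>f \<in> Hol V\<close>; for \<open>y\<close> subordinate to \<open>V\<close> it depends neither on the
  decomposition nor on the local extensions \<open>gs\<close>.
\<close>

definition variety_value ::
    "(complex ^ 'd::finite) set \<Rightarrow> (complex ^ 'd \<Rightarrow> complex) \<Rightarrow> ('d \<Rightarrow> complex mat) \<Rightarrow> complex mat" where
  "variety_value V f y = (SOME M. \<exists>T S xs gs. decomposition y T S xs \<and>
     list_all2 (\<lambda>g x. local_extension V f (the_elem (joint_spectrum x)) g) gs xs \<and>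
     M = T * diag_block_mat (map2 local_value gs xs) * S)"

definition variety_norm ::
    "'d::finite comm_poly mat \<Rightarrow> (complex ^ 'd) set \<Rightarrow> (complex ^ 'd \<Rightarrow> complex) \<Rightarrow> ennreal" where
  "variety_norm p V f = sup_norm_on (subordinate_matrices p V) (variety_value V f)"

definition Hol_inf ::
    "'d::finite comm_poly mat \<Rightarrow> (complex ^ 'd) set \<Rightarrow> (complex ^ 'd \<Rightarrow> complex) set" where
  "Hol_inf p V = {f \<in> Hol V. variety_norm p V f < \<infinity>}"

end

theory Submission
  imports Defs "HOL-Complex_Analysis.Complex_Analysis" "Jordan_Normal_Form.Jordan_Normal_Form_Existence"
begin

hide_const (open) Finite_Cartesian_Product.mat Finite_Cartesian_Product.vec
hide_type (open) Finite_Cartesian_Product.vec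

no_notation vec_index (infixl "$" 100)
no_notation fps_nth (infixl "$" 75)

text \<open>
  Converse direction: near a point of \<open>B\<^sub>\<delta>\<close> the function \<open>F\<close> is a uniform limit of free polynomials, so
  its restriction to scalar points is a local uniform limit of polynomials and hence holomorphic. The
  coefficients of the power series converge as well, so the functional calculus applied to the
  restriction agrees with \<open>F\<close> on commuting matrix tuples, and the supremum defining \<open>\<parallel>f\<parallel>\<close> runs over a
  subset of \<open>B\<^sub>\<delta>\<close>.

  Forward direction: let \<open>c = \<parallel>f\<parallel>\<close>. The bound \<open>\<parallel>f(y)\<parallel> \<le> c\<close> on diagonalizable tuples \<open>y\<close> with spectrum in a
  finite subset \<open>{z\<^sub>a}\<close> of \<open>V\<close> says that every positive kernel \<open>K\<close> which makes multiplication by \<open>\<delta>\<close> strictly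
  contractive pairs nonnegatively with \<open>c\<^sup>2 - f(z\<^sub>a) cnj f(z\<^sub>b)\<close>. Separation from a convex cone turns this into
  an approximate decomposition of this kernel into a positive kernel and terms of the form
  \<open>g\<^sub>a g\<^sub>b\<^sup>* - (\<delta>(z\<^sub>a) g\<^sub>a) (\<delta>(z\<^sub>b) g\<^sub>b)\<^sup>*\<close>. The lurking isometry argument yields a contraction
  \<open>[A, B; C, E]\<close> whose transfer function \<open>A + B \<delta> (1 - E \<delta>)\<^sup>-\<^sup>1 C\<close>, times \<open>c\<close>, nearly interpolates \<open>f\<close>. It
  expands into a series of words in the entries of \<open>\<delta>\<close> with scalar coefficients bounded by \<open>1\<close>, which makes
  sense and is contractive on all of \<open>B\<^sub>\<delta>\<close>. A diagonal subsequence of the coefficients, along finite subsets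
  exhausting a countable dense subset of \<open>V\<close> and with errors tending to \<open>0\<close>, gives \<open>F\<close>.
\<close>

section \<open>Evaluation of free and commutative polynomials\<close>

text \<open>The two directions feed each other. The construction yields only
  \<open>sup_norm_on (basic_set D) F \<le> variety_norm p V f\<close>; the reverse inequality is the
  converse direction applied to the constructed \<open>F\<close>. The converse also puts the
  restriction of \<open>F\<close> into \<open>Hol V\<close>, so that \<open>F\<close> and
  \<open>f\<close> agree on \<open>V\<close> once they agree on a dense sequence.

  The obstacle in the construction is that each positivity certificate covers finitely many points,
  carries an error, and has a state space whose dimension \<open>M\<close> is uncontrolled, so no
  limit of colligations is available. What passes to the limit are scalar word coefficients,
  constrained by inequalities that do not mention \<open>M\<close>. Partial sums of such a series
  need not be contractive; only their squared norms are bounded on average, which is enough for the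
  limit of the partial sums.

  The tests are asymmetric: diagonalizable tuples suffice to construct \<open>F\<close>, while the
  converse bounds a supremum over all subordinate tuples, nilpotent parts included. This is what the
  Jordan decomposition and the power series in several variables are for.\<close>

lemma level_eq:
  assumes "x \<in> matrix_tuples n"
  shows "level x = n"
  unfolding level_def
proof (rule the_equality)
  show "x \<in> matrix_tuples n" by fact
  fix m assume "x \<in> matrix_tuples m"
  then show "m = n" using assms unfolding matrix_tuples_def by (auto dest!: spec[of _ undefined])
qed

lemma matrix_universeE:
  assumes "x \<in> matrix_universe"
  shows "level x \<ge> 1" "x i \<in> carrier_mat (level x) (level x)"
proof -
  obtain n where n: "n \<ge> 1" "x \<in> matrix_tuples n" using assms by (auto simp: matrix_universe_def)
  with level_eq[OF n(2)] show "level x \<ge> 1" "x i \<in> carrier_mat (level x) (level x)"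
    by (auto simp: matrix_tuples_def)
qed

lemma matrix_universeI:
  assumes "\<And>i. x i \<in> carrier_mat n n" "n \<ge> 1"
  shows "x \<in> matrix_universe" "level x = n"
proof -
  have "x \<in> matrix_tuples n" using assms by (auto simp: matrix_tuples_def)
  then show "x \<in> matrix_universe" "level x = n" using assms level_eq by (auto simp: matrix_universe_def)
qed

lemma comm_universeD:
  assumes "x \<in> comm_universe"
  shows "x \<in> matrix_universe" "x i * x j = x j * x i"
  using assms by (auto simp: comm_universe_def)

lemma linear_combination_carrier [simp]: "linear_combination n c X K \<in> carrier_mat n n"
  by (simp add: linear_combination_def)

lemma linear_combination_dim [simp]:
  "dim_row (linear_combination n c X K) = n" "dim_col (linear_combination n c X K) = n"
  by (simp_all add: linear_combination_def)

lemma linear_combination_index: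
  "a < n \<Longrightarrow> b < n \<Longrightarrow> linear_combination n c X K $$ (a, b) = (\<Sum>k\<in>K. c k * X k $$ (a, b))"
  by (simp add: linear_combination_def)

lemma linear_combination_mono_neutral:
  assumes "finite L" "K \<subseteq> L" "\<And>k. k \<in> L - K \<Longrightarrow> c k = 0 \<or> X k = 0\<^sub>m n n"
  shows "linear_combination n c X K = linear_combination n c X L"
proof (rule eq_matI)
  fix a b assume "a < dim_row (linear_combination n c X L)" "b < dim_col (linear_combination n c X L)"
  then have "a < n" "b < n" by simp_all
  then have "(\<Sum>k\<in>K. c k * X k $$ (a, b)) = (\<Sum>k\<in>L. c k * X k $$ (a, b))"
    using assms by (intro sum.mono_neutral_left) fastforce+
  with \<open>a < n\<close> \<open>b < n\<close> show "linear_combination n c X K $$ (a, b) = linear_combination n c X L $$ (a, b)"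
    by (simp add: linear_combination_index)
qed simp_all

lemma mat_mult_index:
  assumes "A \<in> carrier_mat n m" "B \<in> carrier_mat m k" "a < n" "b < k"
  shows "(A * B) $$ (a, b) = (\<Sum>s<m. A $$ (a, s) * B $$ (s, b))"
proof -
  have "(A * B) $$ (a, b) = (\<Sum>s\<in>{0..<m}. A $$ (a, s) * B $$ (s, b))"
    using assms by (auto simp: scalar_prod_def intro!: sum.cong)
  then show ?thesis by (simp add: atLeast0LessThan)
qed

lemma word_value_Nil [simp]: "word_value x (Word []) = 1\<^sub>m (level x)"
  by (simp add: word_value_def)

lemma word_value_Cons: "word_value x (Word (i # w)) = x i * word_value x (Word w)"
  by (simp add: word_value_def)

lemma word_value_carrier [simp]:
  assumes "x \<in> matrix_universe"
  shows "word_value x w \<in> carrier_mat (level x) (level x)"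
proof -
  have "word_value x (Word u) \<in> carrier_mat (level x) (level x)" for u
    using matrix_universeE[OF assms]
    by (induction u) (auto simp: word_value_Cons intro!: mult_carrier_mat)
  then show ?thesis by (metis free_word.collapse)
qed

lemma word_value_plus:
  assumes "x \<in> matrix_universe"
  shows "word_value x (v + w) = word_value x v * word_value x w"
proof -
  have "word_value x (Word (u @ u')) = word_value x (Word u) * word_value x (Word u')" for u u'
  proof (induction u)
    case Nil
    show ?case by (simp add: left_mult_one_mat[OF word_value_carrier[OF assms]])
  next
    case (Cons i u)
    then show ?case
      using word_value_carrier[OF assms] matrix_universeE[OF assms]
      by (simp add: word_value_Cons assoc_mult_mat[of _ "level x" "level x" _ "level x" _ "level x"])
  qed
  then show ?thesis
    by (cases v; cases w) (simp add: plus_free_word_def)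
qed

lemma free_eval_carrier [simp]: "free_eval q x \<in> carrier_mat (level x) (level x)"
  by (simp add: free_eval_def)

lemma free_eval_dim [simp]: "dim_row (free_eval q x) = level x" "dim_col (free_eval q x) = level x"
  by (simp_all add: free_eval_def)

lemma free_eval_superset:
  assumes "finite K" "Poly_Mapping.keys q \<subseteq> K"
  shows "free_eval q x = linear_combination (level x) (Poly_Mapping.lookup q) (word_value x) K"
  unfolding free_eval_def using assms
  by (intro linear_combination_mono_neutral) (auto simp: in_keys_iff)

lemma free_eval_zero [simp]: "free_eval 0 x = 0\<^sub>m (level x) (level x)"
  by (rule eq_matI) (auto simp: free_eval_def linear_combination_index)

lemma free_eval_single:
  assumes "x \<in> matrix_universe"
  shows "free_eval (Poly_Mapping.single w c) x = c \<cdot>\<^sub>m word_value x w"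
proof (rule eq_matI)
  show "dim_row (free_eval (Poly_Mapping.single w c) x) = dim_row (c \<cdot>\<^sub>m word_value x w)"
    "dim_col (free_eval (Poly_Mapping.single w c) x) = dim_col (c \<cdot>\<^sub>m word_value x w)"
    using word_value_carrier[OF assms, of w] by auto
  fix a b assume "a < dim_row (c \<cdot>\<^sub>m word_value x w)" "b < dim_col (c \<cdot>\<^sub>m word_value x w)"
  then have "a < level x" "b < level x" using word_value_carrier[OF assms, of w] by auto
  then show "free_eval (Poly_Mapping.single w c) x $$ (a, b) = (c \<cdot>\<^sub>m word_value x w) $$ (a, b)"
    using word_value_carrier[OF assms, of w]
    by (simp add: free_eval_superset[of "{w}"] linear_combination_index)
qed

lemma free_eval_add: "free_eval (q + r) x = free_eval q x + free_eval r x"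
proof -
  let ?K = "Poly_Mapping.keys q \<union> Poly_Mapping.keys r"
  have K: "Poly_Mapping.keys (q + r) \<subseteq> ?K" by (rule Poly_Mapping.keys_add)
  show ?thesis
    by (rule eq_matI)
      (simp_all add: free_eval_superset[OF _ K] free_eval_superset[of ?K q] free_eval_superset[of ?K r]
        linear_combination_index lookup_add distrib_right sum.distrib)
qed

lemma free_eval_sum_index:
  assumes "a < level x" "b < level x"
  shows "free_eval (\<Sum>k\<in>K. q k) x $$ (a, b) = (\<Sum>k\<in>K. free_eval (q k) x $$ (a, b))"
  using assms by (induction K rule: infinite_finite_induct) (simp_all add: free_eval_add)

lemma poly_mapping_sum_single:
  "(\<Sum>w\<in>Poly_Mapping.keys p. Poly_Mapping.single w (Poly_Mapping.lookup p w)) = p"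
  by (rule poly_mapping_eqI) (simp add: lookup_sum lookup_single when_def in_keys_iff)

lemma free_eval_index:
  assumes "a < level x" "b < level x"
  shows "free_eval q x $$ (a, b) = (\<Sum>w\<in>Poly_Mapping.keys q. Poly_Mapping.lookup q w * word_value x w $$ (a, b))"
  using assms by (simp add: free_eval_def linear_combination_index)

lemma free_eval_mult:
  assumes x: "x \<in> matrix_universe"
  shows "free_eval (q * r) x = free_eval q x * free_eval r x"
proof (rule eq_matI)
  let ?n = "level x"
  fix a b assume "a < dim_row (free_eval q x * free_eval r x)" "b < dim_col (free_eval q x * free_eval r x)"
  then have ab: "a < ?n" "b < ?n" by simp_all
  note wc = word_value_carrier[OF x]
  have "q * r = (\<Sum>v\<in>Poly_Mapping.keys q. \<Sum>w\<in>Poly_Mapping.keys r.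
      Poly_Mapping.single (v + w) (Poly_Mapping.lookup q v * Poly_Mapping.lookup r w))"
    by (subst poly_mapping_sum_single[symmetric, of q], subst poly_mapping_sum_single[symmetric, of r])
      (simp add: sum_product mult_single)
  then have "free_eval (q * r) x $$ (a, b) = (\<Sum>v\<in>Poly_Mapping.keys q. \<Sum>w\<in>Poly_Mapping.keys r.
      Poly_Mapping.lookup q v * Poly_Mapping.lookup r w * (word_value x v * word_value x w) $$ (a, b))"
    using ab carrier_matD[OF mult_carrier_mat[OF wc wc]]
    by (simp add: free_eval_sum_index free_eval_single[OF x] word_value_plus[OF x] del: index_mult_mat)
  also have "\<dots> = (\<Sum>v\<in>Poly_Mapping.keys q. \<Sum>w\<in>Poly_Mapping.keys r. \<Sum>s<?n.
      (Poly_Mapping.lookup q v * word_value x v $$ (a, s)) * (Poly_Mapping.lookup r w * word_value x w $$ (s, b)))"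
    by (simp add: mat_mult_index[OF wc wc ab] sum_distrib_left mult_ac)
  also have "\<dots> = (\<Sum>v\<in>Poly_Mapping.keys q. \<Sum>s<?n. \<Sum>w\<in>Poly_Mapping.keys r.
      (Poly_Mapping.lookup q v * word_value x v $$ (a, s)) * (Poly_Mapping.lookup r w * word_value x w $$ (s, b)))"
    by (intro sum.cong refl sum.swap)
  also have "\<dots> = (\<Sum>s<?n. \<Sum>v\<in>Poly_Mapping.keys q. \<Sum>w\<in>Poly_Mapping.keys r.
      (Poly_Mapping.lookup q v * word_value x v $$ (a, s)) * (Poly_Mapping.lookup r w * word_value x w $$ (s, b)))"
    by (rule sum.swap)
  also have "\<dots> = (free_eval q x * free_eval r x) $$ (a, b)"
    using ab by (simp add: mat_mult_index[OF free_eval_carrier free_eval_carrier ab] free_eval_index sum_product)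
  finally show "free_eval (q * r) x $$ (a, b) = (free_eval q x * free_eval r x) $$ (a, b)" .
qed simp_all

lemma free_eval_const_mult:
  assumes x: "x \<in> matrix_universe"
  shows "free_eval (Poly_Mapping.single 0 c * q) x = c \<cdot>\<^sub>m free_eval q x"
  using mult_smult_assoc_mat[OF one_carrier_mat free_eval_carrier[of q x], of c]
  by (simp add: free_eval_mult[OF x] free_eval_single[OF x] zero_free_word_def
      left_mult_one_mat[OF free_eval_carrier])

lemma free_eval_one:
  assumes x: "x \<in> matrix_universe"
  shows "free_eval 1 x = 1\<^sub>m (level x)"
proof -
  have "(1 :: 'a free_poly) = Poly_Mapping.single 0 1" by simp
  then show ?thesis using free_eval_single[OF x, of 0 1]
    by (auto simp: zero_free_word_def simp del: single_one intro!: eq_matI)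
qed

subsection \<open>Commuting tuples\<close>

lemma pow_mat_commute:
  assumes "A \<in> carrier_mat n n" "B \<in> carrier_mat n n" "A * B = B * A"
  shows "(A ^\<^sub>m k) * B = B * (A ^\<^sub>m k)"
proof (induction k)
  case (Suc k)
  have P: "A ^\<^sub>m k \<in> carrier_mat n n" using assms(1) by (rule pow_carrier_mat)
  note as = assoc_mult_mat[of _ n n _ n _ n]
  have "A ^\<^sub>m Suc k * B = A ^\<^sub>m k * (A * B)" using P assms by (simp add: as)
  also have "\<dots> = A ^\<^sub>m k * B * A" using P assms by (simp add: as)
  also have "\<dots> = B * (A ^\<^sub>m Suc k)" using P assms by (simp add: Suc as)
  finally show ?case .
qed (use assms in simp)

lemma monomial_value_carrier [simp]:
  assumes "x \<in> matrix_universe"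
  shows "monomial_value x m \<in> carrier_mat (level x) (level x)"
proof -
  have "foldr (\<lambda>i M. (x i ^\<^sub>m Poly_Mapping.lookup m i) * M) is (1\<^sub>m (level x)) \<in> carrier_mat (level x) (level x)"
    for "is" using matrix_universeE[OF assms]
    by (induction "is") (auto intro!: mult_carrier_mat pow_carrier_mat)
  then show ?thesis by (simp add: monomial_value_def)
qed

lemma variables: "distinct (variables :: 'd::finite list)" "set (variables :: 'd list) = UNIV"
proof -
  obtain vs :: "'d list" where vs: "set vs = UNIV" "distinct vs"
    using finite_distinct_list[OF finite] by blast
  then have "distinct (variables :: 'd list) \<and> set (variables :: 'd list) = UNIV"
    unfolding variables_def using someI[of "\<lambda>is. distinct is \<and> set is = UNIV" vs] vs by simp
  then show "distinct (variables :: 'd::finite list)" "set (variables :: 'd list) = UNIV" by simp_all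
qed

lemma monomial_value_zero [simp]:
  assumes "x \<in> matrix_universe"
  shows "monomial_value x 0 = 1\<^sub>m (level x)"
proof -
  have "foldr (\<lambda>i M. (x i ^\<^sub>m Poly_Mapping.lookup 0 i) * M) is (1\<^sub>m (level x)) = 1\<^sub>m (level x)"
    for "is" by (induction "is") (simp_all add: carrier_matD(1)[OF matrix_universeE(2)[OF assms]])
  then show ?thesis by (simp add: monomial_value_def)
qed

text \<open>The factors stand in the order of \<open>variables\<close>, so the new
  \<open>x i\<close> has to travel past the powers of all variables listed before \<open>i\<close>;
  commutativity makes this possible. The induction runs over arbitrary distinct lists, with
  \<open>notin\<close> covering the tail behind \<open>i\<close>.\<close>

lemma monomial_value_Suc:
  fixes x :: "'d::finite \<Rightarrow> complex mat"
  assumes x: "x \<in> comm_universe"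
  shows "monomial_value x (Poly_Mapping.single i 1 + m) = x i * monomial_value x m"
proof -
  let ?n = "level x"
  let ?F = "\<lambda>m. foldr (\<lambda>i M. (x i ^\<^sub>m Poly_Mapping.lookup m i) * M)"
  note xc = matrix_universeE(2)[OF comm_universeD(1)[OF x]]
  note pc = pow_carrier_mat[OF xc]
  note as = assoc_mult_mat[of _ ?n ?n _ ?n _ ?n]
  have car: "?F m is (1\<^sub>m ?n) \<in> carrier_mat ?n ?n" for m "is"
    by (induction "is") (auto intro!: mult_carrier_mat pc)
  have notin: "?F (Poly_Mapping.single i 1 + m) is (1\<^sub>m ?n) = ?F m is (1\<^sub>m ?n)" if "i \<notin> set is" for "is"
    using that by (induction "is") (auto simp: lookup_add lookup_single when_def)
  have "?F (Poly_Mapping.single i 1 + m) is (1\<^sub>m ?n) = x i * ?F m is (1\<^sub>m ?n)"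
    if "distinct is" "i \<in> set is" for "is"
    using that
  proof (induction "is")
    case (Cons j js)
    show ?case
    proof (cases "j = i")
      case True
      then have "i \<notin> set js" using Cons by auto
      have "x i ^\<^sub>m Suc (Poly_Mapping.lookup m i) = x i * x i ^\<^sub>m Poly_Mapping.lookup m i"
        using pow_mat_commute[OF xc xc refl, of i] by simp
      then show ?thesis using \<open>i \<notin> set js\<close> True notin car pc xc
        by (simp add: lookup_add lookup_single as)
    next
      case False
      have "?F (Poly_Mapping.single i 1 + m) (j # js) (1\<^sub>m ?n)
        = (x j ^\<^sub>m Poly_Mapping.lookup m j) * (x i * ?F m js (1\<^sub>m ?n))"
        using Cons False by (simp add: lookup_add lookup_single)
      also have "\<dots> = ((x j ^\<^sub>m Poly_Mapping.lookup m j) * x i) * ?F m js (1\<^sub>m ?n)"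
        using car pc xc by (simp add: as)
      also have "\<dots> = x i * ?F m (j # js) (1\<^sub>m ?n)"
        using pow_mat_commute[OF xc xc comm_universeD(2)[OF x]] car pc xc by (simp add: as)
      finally show ?thesis .
    qed
  qed simp
  then show ?thesis using variables[where 'd='d] by (simp add: monomial_value_def)
qed

text \<open>After this, facts about \<open>monomial_value\<close> can be read off from words, where
  induction on the letters is available.\<close>

lemma word_value_monomial:
  assumes x: "x \<in> comm_universe"
  shows "word_value x w = monomial_value x (word_monomial w)"
proof -
  have "word_value x (Word u) = monomial_value x (word_monomial (Word u))" for u
    by (induction u)
      (simp_all add: word_monomial_def monomial_value_zero comm_universeD[OF x] word_value_Cons
        monomial_value_Suc[OF x, simplified])
  then show ?thesis by (metis free_word.collapse)
qed

lemma comm_eval_carrier [simp]: "comm_eval q x \<in> carrier_mat (level x) (level x)"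
  by (simp add: comm_eval_def)

lemma comm_eval_superset:
  assumes "finite K" "Poly_Mapping.keys q \<subseteq> K"
  shows "comm_eval q x = linear_combination (level x) (Poly_Mapping.lookup q) (monomial_value x) K"
  unfolding comm_eval_def using assms
  by (intro linear_combination_mono_neutral) (auto simp: in_keys_iff)

lemma comm_eval_add: "comm_eval (q + r) x = comm_eval q x + comm_eval r x"
proof -
  let ?K = "Poly_Mapping.keys q \<union> Poly_Mapping.keys r"
  have K: "Poly_Mapping.keys (q + r) \<subseteq> ?K" by (rule Poly_Mapping.keys_add)
  show ?thesis
    by (rule eq_matI)
      (simp_all add: comm_eval_superset[OF _ K] comm_eval_superset[of ?K q] comm_eval_superset[of ?K r]
        linear_combination_index lookup_add distrib_right sum.distrib)
qed

lemma comm_eval_dim [simp]: "dim_row (comm_eval q x) = level x" "dim_col (comm_eval q x) = level x"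
  by (simp_all add: comm_eval_def)

lemma comm_eval_sum_index:
  assumes "a < level x" "b < level x"
  shows "comm_eval (\<Sum>k\<in>K. q k) x $$ (a, b) = (\<Sum>k\<in>K. comm_eval (q k) x $$ (a, b))"
  using assms
  by (induction K rule: infinite_finite_induct)
    (simp_all add: comm_eval_add, simp_all add: comm_eval_def linear_combination_index)

lemma comm_eval_single_index:
  assumes "a < level x" "b < level x"
  shows "comm_eval (Poly_Mapping.single m c) x $$ (a, b) = c * monomial_value x m $$ (a, b)"
  using assms by (simp add: comm_eval_superset[of "{m}"] linear_combination_index)

lemma comm_eval_abelianize:
  assumes x: "x \<in> comm_universe"
  shows "comm_eval (abelianize q) x = free_eval q x"
  by (rule eq_matI)
    (simp_all add: abelianize_def comm_eval_sum_index comm_eval_single_index free_eval_index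
      word_value_monomial[OF x])

section \<open>Points of \<open>\<complex>^d\<close> as tuples of one by one matrices\<close>

lemma scalar_eval_superset:
  assumes "finite K" "Poly_Mapping.keys q \<subseteq> K"
  shows "scalar_eval q z = (\<Sum>m\<in>K. Poly_Mapping.lookup q m * scalar_monomial z m)"
  unfolding scalar_eval_def using assms
  by (intro sum.mono_neutral_left) (auto simp: in_keys_iff)

lemma scalar_eval_add: "scalar_eval (q + r) z = scalar_eval q z + scalar_eval r z"
proof -
  let ?K = "Poly_Mapping.keys q \<union> Poly_Mapping.keys r"
  have "Poly_Mapping.keys (q + r) \<subseteq> ?K" by (rule Poly_Mapping.keys_add)
  then show ?thesis
    by (simp add: scalar_eval_superset[of ?K] lookup_add distrib_right sum.distrib)
qed

lemma mat_1_1_mult: "mat 1 1 (\<lambda>_. c :: complex) * mat 1 1 (\<lambda>_. d) = mat 1 1 (\<lambda>_. c * d)"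
  by (rule eq_matI) (auto simp: scalar_prod_def)

lemma scalar_tuple_universe [simp]: "scalar_tuple z \<in> matrix_universe" "level (scalar_tuple z) = 1"
  using matrix_universeI[of "scalar_tuple z" 1] by (simp_all add: scalar_tuple_def)

lemma scalar_tuple_comm [simp]: "scalar_tuple z \<in> comm_universe"
  using scalar_tuple_universe(1)[of z]
  by (simp add: comm_universe_def) (simp add: scalar_tuple_def mat_1_1_mult[simplified] mult.commute)

lemma scalar_monomial_Suc: "scalar_monomial z (Poly_Mapping.single i 1 + m) = z $ i * scalar_monomial z m"
proof -
  have "scalar_monomial z (Poly_Mapping.single i 1 + m)
    = (\<Prod>j\<in>UNIV. (z $ j) ^ (1 when j = i) * (z $ j) ^ Poly_Mapping.lookup m j)"
    unfolding scalar_monomial_def lookup_add lookup_single power_add by (simp add: when_def eq_commute[of i])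
  also have "\<dots> = (\<Prod>j\<in>UNIV. (z $ j) ^ (1 when j = i)) * scalar_monomial z m"
    by (simp add: scalar_monomial_def prod.distrib)
  also have "(\<Prod>j\<in>UNIV. (z $ j) ^ (1 when j = i)) = (\<Prod>j\<in>UNIV. if j = i then z $ j else 1)"
    by (intro prod.cong) (auto simp: when_def)
  finally show ?thesis by simp
qed

lemma scalar_monomial_zero [simp]: "scalar_monomial z 0 = 1"
  by (simp add: scalar_monomial_def)

lemma word_value_scalar:
  "word_value (scalar_tuple z) w = mat 1 1 (\<lambda>_. scalar_monomial z (word_monomial w))"
proof -
  have "word_value (scalar_tuple z) (Word u) = mat 1 1 (\<lambda>_. scalar_monomial z (word_monomial (Word u)))" for u
  proof (induction u)
    case Nil
    show ?case by (rule eq_matI) (auto simp: word_monomial_def)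
  next
    case (Cons i u)
    then show ?case
      by (simp add: word_value_Cons word_monomial_def scalar_monomial_Suc[simplified] mat_1_1_mult[simplified] scalar_tuple_def)
  qed
  then show ?thesis by (metis free_word.collapse)
qed

lemma scalar_eval_zero [simp]: "scalar_eval 0 z = 0"
  by (simp add: scalar_eval_def)

lemma scalar_eval_sum: "scalar_eval (\<Sum>k\<in>K. q k) z = (\<Sum>k\<in>K. scalar_eval (q k) z)"
  by (induction K rule: infinite_finite_induct) (simp_all add: scalar_eval_add)

lemma scalar_eval_single: "scalar_eval (Poly_Mapping.single m c) z = c * scalar_monomial z m"
  by (simp add: scalar_eval_superset[of "{m}"])

lemma free_eval_scalar:
  "free_eval q (scalar_tuple z) = mat 1 1 (\<lambda>_. scalar_eval (abelianize q) z)"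
  by (rule eq_matI)
    (simp_all add: free_eval_index word_value_scalar abelianize_def scalar_eval_sum scalar_eval_single)

section \<open>Operator norms\<close>

lemma euclid_norm_sq: "(euclid_norm v)\<^sup>2 = (\<Sum>i<dim_vec v. (cmod (vec_index v i))\<^sup>2)"
  by (simp add: euclid_norm_def L2_set_def sum_nonneg)

lemma euclid_norm_nonneg [simp]: "0 \<le> euclid_norm v"
  by (simp add: euclid_norm_def)

lemma euclid_norm_smult: "euclid_norm (c \<cdot>\<^sub>v v) = cmod c * euclid_norm v"
  by (simp add: euclid_norm_def L2_set_def norm_mult power_mult_distrib sum_distrib_left[symmetric] real_sqrt_mult)

lemma euclid_norm_add_le:
  assumes "dim_vec u = dim_vec v"
  shows "euclid_norm (u + v) \<le> euclid_norm u + euclid_norm v"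
proof -
  have "euclid_norm (u + v) \<le> L2_set (\<lambda>i. cmod (vec_index u i) + cmod (vec_index v i)) {..<dim_vec v}"
    unfolding euclid_norm_def using assms by (auto intro!: L2_set_mono norm_triangle_ineq)
  also have "\<dots> \<le> euclid_norm u + euclid_norm v"
    unfolding euclid_norm_def assms by (rule L2_set_triangle_ineq)
  finally show ?thesis .
qed

lemma norm_index_le_euclid_norm: "i < dim_vec v \<Longrightarrow> cmod (vec_index v i) \<le> euclid_norm v"
  unfolding euclid_norm_def
  by (rule member_le_L2_set[of "{..<dim_vec v}" i "\<lambda>i. cmod (vec_index v i)"]) auto

lemma euclid_norm_le_sum: "euclid_norm v \<le> (\<Sum>i<dim_vec v. cmod (vec_index v i))"
  unfolding euclid_norm_def by (rule L2_set_le_sum) simp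

lemma euclid_norm_mult_mat_le:
  assumes "v \<in> carrier_vec (dim_col M)"
  shows "euclid_norm (M *\<^sub>v v) \<le> (\<Sum>i<dim_row M. \<Sum>j<dim_col M. cmod (M $$ (i, j))) * euclid_norm v"
proof -
  have "euclid_norm (M *\<^sub>v v) \<le> (\<Sum>i<dim_row M. cmod (vec_index (M *\<^sub>v v) i))"
    using euclid_norm_le_sum[of "M *\<^sub>v v"] by simp
  also have "\<dots> \<le> (\<Sum>i<dim_row M. \<Sum>j<dim_col M. cmod (M $$ (i, j)) * euclid_norm v)"
  proof (rule sum_mono)
    fix i assume "i \<in> {..<dim_row M}"
    then have "vec_index (M *\<^sub>v v) i = (\<Sum>j<dim_col M. M $$ (i, j) * vec_index v j)"
      using assms by (auto simp: scalar_prod_def atLeast0LessThan)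
    then have "cmod (vec_index (M *\<^sub>v v) i) \<le> (\<Sum>j<dim_col M. cmod (M $$ (i, j)) * cmod (vec_index v j))"
      by (simp add: norm_mult sum_norm_le)
    also have "\<dots> \<le> (\<Sum>j<dim_col M. cmod (M $$ (i, j)) * euclid_norm v)"
      using assms by (intro sum_mono mult_left_mono norm_index_le_euclid_norm) auto
    finally show "cmod (vec_index (M *\<^sub>v v) i) \<le> (\<Sum>j<dim_col M. cmod (M $$ (i, j)) * euclid_norm v)" .
  qed
  also have "\<dots> = (\<Sum>i<dim_row M. \<Sum>j<dim_col M. cmod (M $$ (i, j))) * euclid_norm v"
    by (simp add: sum_distrib_right)
  finally show ?thesis .
qed

lemma op_norm_le:
  assumes "0 \<le> c" "\<And>v. v \<in> carrier_vec (dim_col M) \<Longrightarrow> euclid_norm (M *\<^sub>v v) \<le> c * euclid_norm v"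
  shows "op_norm M \<le> c"
  unfolding op_norm_def
proof (rule cSup_least)
  have "euclid_norm (M *\<^sub>v 0\<^sub>v (dim_col M)) \<in>
    {euclid_norm (M *\<^sub>v v) | v. v \<in> carrier_vec (dim_col M) \<and> euclid_norm v \<le> 1}"
    by (rule CollectI, rule exI[of _ "0\<^sub>v (dim_col M)"]) (simp add: euclid_norm_def L2_set_0')
  then show "{euclid_norm (M *\<^sub>v v) | v. v \<in> carrier_vec (dim_col M) \<and> euclid_norm v \<le> 1} \<noteq> {}" by blast
  fix y assume "y \<in> {euclid_norm (M *\<^sub>v v) | v. v \<in> carrier_vec (dim_col M) \<and> euclid_norm v \<le> 1}"
  then obtain v where v: "y = euclid_norm (M *\<^sub>v v)" "v \<in> carrier_vec (dim_col M)" "euclid_norm v \<le> 1" by auto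
  then have "y \<le> c * euclid_norm v" using assms by auto
  also have "\<dots> \<le> c * 1" using v assms by (intro mult_left_mono)
  finally show "y \<le> c" by simp
qed

lemma op_norm_ub:
  assumes "v \<in> carrier_vec (dim_col M)" "euclid_norm v \<le> 1"
  shows "euclid_norm (M *\<^sub>v v) \<le> op_norm M"
  unfolding op_norm_def
proof (rule cSup_upper)
  let ?c = "\<Sum>i<dim_row M. \<Sum>j<dim_col M. cmod (M $$ (i, j))"
  have c: "?c \<ge> 0" by (intro sum_nonneg) simp
  show "bdd_above {euclid_norm (M *\<^sub>v v) | v. v \<in> carrier_vec (dim_col M) \<and> euclid_norm v \<le> 1}"
  proof (rule bdd_aboveI)
    fix y assume "y \<in> {euclid_norm (M *\<^sub>v v) | v. v \<in> carrier_vec (dim_col M) \<and> euclid_norm v \<le> 1}"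
    then obtain v where v: "y = euclid_norm (M *\<^sub>v v)" "v \<in> carrier_vec (dim_col M)" "euclid_norm v \<le> 1" by auto
    have "y \<le> ?c * euclid_norm v" using euclid_norm_mult_mat_le v by auto
    also have "\<dots> \<le> ?c * 1" using v c by (intro mult_left_mono)
    finally show "y \<le> ?c" by simp
  qed
qed (use assms in auto)

lemma op_norm_nonneg [simp]: "0 \<le> op_norm M"
  using op_norm_ub[of "0\<^sub>v (dim_col M)" M] euclid_norm_nonneg[of "M *\<^sub>v 0\<^sub>v (dim_col M)"]
  by (simp add: euclid_norm_def L2_set_0')

lemma op_norm_bound:
  assumes v: "v \<in> carrier_vec (dim_col M)"
  shows "euclid_norm (M *\<^sub>v v) \<le> op_norm M * euclid_norm v"
proof (cases "euclid_norm v = 0")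
  case True
  then show ?thesis using euclid_norm_mult_mat_le[OF v] by simp
next
  case False
  let ?c = "complex_of_real (inverse (euclid_norm v))"
  have "euclid_norm (?c \<cdot>\<^sub>v v) = 1" using False by (simp add: euclid_norm_smult norm_inverse)
  then have "euclid_norm (M *\<^sub>v (?c \<cdot>\<^sub>v v)) \<le> op_norm M"
    using v by (intro op_norm_ub) auto
  moreover have "M *\<^sub>v (?c \<cdot>\<^sub>v v) = ?c \<cdot>\<^sub>v (M *\<^sub>v v)" using v by (intro mult_mat_vec) auto
  ultimately have "inverse (euclid_norm v) * euclid_norm (M *\<^sub>v v) \<le> op_norm M"
    by (simp add: euclid_norm_smult norm_inverse)
  then show ?thesis using False euclid_norm_nonneg[of v] by (simp add: field_simps)
qed

lemma norm_index_le_op_norm: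
  assumes "a < dim_row M" "b < dim_col M"
  shows "cmod (M $$ (a, b)) \<le> op_norm M"
proof -
  let ?v = "unit_vec (dim_col M) b :: complex vec"
  have v: "?v \<in> carrier_vec (dim_col M)" by simp
  have "euclid_norm ?v = 1"
  proof -
    have "(euclid_norm ?v)\<^sup>2 = (\<Sum>i<dim_col M. if i = b then 1 else 0)"
      unfolding euclid_norm_sq by (intro sum.cong) (auto simp: unit_vec_def)
    then have "(euclid_norm ?v)\<^sup>2 = 1\<^sup>2" using assms by simp
    then show ?thesis using euclid_norm_nonneg power2_eq_imp_eq zero_le_one by blast
  qed
  moreover have "vec_index (M *\<^sub>v ?v) a = M $$ (a, b)" using assms by simp
  ultimately show ?thesis
    using op_norm_bound[OF v] norm_index_le_euclid_norm[of a "M *\<^sub>v ?v"] assms by auto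
qed

lemma op_norm_iff:
  assumes "0 \<le> c"
  shows "op_norm M \<le> c \<longleftrightarrow> (\<forall>v\<in>carrier_vec (dim_col M). euclid_norm (M *\<^sub>v v) \<le> c * euclid_norm v)"
proof
  assume *: "op_norm M \<le> c"
  show "\<forall>v\<in>carrier_vec (dim_col M). euclid_norm (M *\<^sub>v v) \<le> c * euclid_norm v"
    using op_norm_bound mult_right_mono[OF * euclid_norm_nonneg] by (meson order.trans)
qed (use assms op_norm_le in auto)

text \<open>Norm bounds on block matrices are stated blockwise, which avoids the \<open>div\<close>/\<open>mod\<close> indexing of
  \<open>block_eval\<close>.\<close>

definition block_bounded :: "real \<Rightarrow> nat \<Rightarrow> nat \<Rightarrow> nat \<Rightarrow> (nat \<Rightarrow> nat \<Rightarrow> complex mat) \<Rightarrow> bool" where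
  "block_bounded c n I J U \<longleftrightarrow> (\<forall>\<zeta>.
     (\<Sum>i<I. \<Sum>a<n. (cmod (\<Sum>j<J. \<Sum>b<n. U i j $$ (a, b) * \<zeta> j b))\<^sup>2)
       \<le> c\<^sup>2 * (\<Sum>j<J. \<Sum>b<n. (cmod (\<zeta> j b))\<^sup>2))"

lemma sum_block: "(\<Sum>k<m * n. f k) = (\<Sum>i<m. \<Sum>a<(n::nat). f (i * n + a))"
proof -
  have "(\<Sum>k<m * n. f k) = (\<Sum>i<m. sum f {i * n..<i * n + n})" by (simp add: sum.nat_group)
  also have "\<dots> = (\<Sum>i<m. \<Sum>a<n. f (i * n + a))"
  proof (rule sum.cong[OF refl])
    fix i
    show "sum f {i * n..<i * n + n} = (\<Sum>a<n. f (i * n + a))"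
      using sum.shift_bounds_nat_ivl[of f 0 "i * n" n] by (simp add: atLeast0LessThan add.commute)
  qed
  finally show ?thesis .
qed

text \<open>A vector of length \<open>J * n\<close> is the same as a double family through the index
  \<open>j * n + b\<close>, and this correspondence preserves squared norms. Squaring both sides is
  reversible because \<open>0 \<le> c\<close>.\<close>

lemma op_norm_block_eval:
  assumes "0 \<le> c"
  shows "op_norm (block_eval n ev D) \<le> c \<longleftrightarrow>
    block_bounded c n (dim_row D) (dim_col D) (\<lambda>i j. ev (D $$ (i, j)))"
proof -
  let ?M = "block_eval n ev D" and ?I = "dim_row D" and ?J = "dim_col D"
  have dm: "dim_row ?M = ?I * n" "dim_col ?M = ?J * n" by (simp_all add: block_eval_def)
  have Mi: "?M $$ (i * n + a, j * n + b) = ev (D $$ (i, j)) $$ (a, b)"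
    if "i < ?I" "a < n" "j < ?J" "b < n" for i a j b
  proof -
    have *: "k * n + d < m * n" if "k < m" "d < n" for k m d
    proof -
      have "k * n + d < Suc k * n" using that by simp
      also have "\<dots> \<le> m * n" using that by (intro mult_right_mono) auto
      finally show ?thesis .
    qed
    show ?thesis using that *[of i ?I a] *[of j ?J b] by (simp add: block_eval_def)
  qed
  have lt: "k * n + d < m * n" if "k < m" "d < n" for k m d
  proof -
    have "k * n + d < Suc k * n" using that by simp
    also have "\<dots> \<le> m * n" using that by (intro mult_right_mono) auto
    finally show ?thesis .
  qed
  have N1: "(euclid_norm v)\<^sup>2 = (\<Sum>j<?J. \<Sum>b<n. (cmod (vec_index v (j * n + b)))\<^sup>2)"
    if "v \<in> carrier_vec (?J * n)" for v
    using that unfolding euclid_norm_sq by (simp add: sum_block)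
  have N2: "(euclid_norm (?M *\<^sub>v v))\<^sup>2 =
      (\<Sum>i<?I. \<Sum>a<n. (cmod (\<Sum>j<?J. \<Sum>b<n. ev (D $$ (i, j)) $$ (a, b) * vec_index v (j * n + b)))\<^sup>2)"
    if v: "v \<in> carrier_vec (?J * n)" for v
  proof -
    have "(euclid_norm (?M *\<^sub>v v))\<^sup>2 = (\<Sum>i<?I. \<Sum>a<n. (cmod (vec_index (?M *\<^sub>v v) (i * n + a)))\<^sup>2)"
      unfolding euclid_norm_sq by (simp only: dim_mult_mat_vec dm sum_block)
    also have "\<dots> = (\<Sum>i<?I. \<Sum>a<n. (cmod (\<Sum>j<?J. \<Sum>b<n. ev (D $$ (i, j)) $$ (a, b) * vec_index v (j * n + b)))\<^sup>2)"
    proof (intro sum.cong refl)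
      fix i a assume ia: "i \<in> {..<?I}" "a \<in> {..<n}"
      have "vec_index (?M *\<^sub>v v) (i * n + a) = (\<Sum>k<?J * n. ?M $$ (i * n + a, k) * vec_index v k)"
        using v dm lt[of i ?I a] ia by (simp add: scalar_prod_def atLeast0LessThan)
      also have "\<dots> = (\<Sum>j<?J. \<Sum>b<n. ev (D $$ (i, j)) $$ (a, b) * vec_index v (j * n + b))"
        unfolding sum_block using ia by (intro sum.cong refl) (simp add: Mi)
      finally show "(cmod (vec_index (?M *\<^sub>v v) (i * n + a)))\<^sup>2 =
        (cmod (\<Sum>j<?J. \<Sum>b<n. ev (D $$ (i, j)) $$ (a, b) * vec_index v (j * n + b)))\<^sup>2" by simp
    qed
    finally show ?thesis .
  qed
  have sq: "euclid_norm (?M *\<^sub>v v) \<le> c * euclid_norm v \<longleftrightarrow>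
    (euclid_norm (?M *\<^sub>v v))\<^sup>2 \<le> c\<^sup>2 * (euclid_norm v)\<^sup>2" for v
    using assms abs_le_square_iff[of "euclid_norm (?M *\<^sub>v v)" "c * euclid_norm v"]
    by (simp add: power_mult_distrib abs_mult)
  show ?thesis
    unfolding op_norm_iff[OF assms] block_bounded_def dm
  proof (intro iffI ballI allI)
    fix \<zeta> :: "nat \<Rightarrow> nat \<Rightarrow> complex"
    assume H: "\<forall>v\<in>carrier_vec (?J * n). euclid_norm (?M *\<^sub>v v) \<le> c * euclid_norm v"
    define v where "v = vec (?J * n) (\<lambda>k. \<zeta> (k div n) (k mod n))"
    have v: "v \<in> carrier_vec (?J * n)" by (simp add: v_def)
    have vi: "vec_index v (j * n + b) = \<zeta> j b" if "j < ?J" "b < n" for j b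
      using that lt[of j ?J b] by (simp add: v_def)
    have "(euclid_norm (?M *\<^sub>v v))\<^sup>2 \<le> c\<^sup>2 * (euclid_norm v)\<^sup>2" using H v sq by blast
    then show "(\<Sum>i<?I. \<Sum>a<n. (cmod (\<Sum>j<?J. \<Sum>b<n. ev (D $$ (i, j)) $$ (a, b) * \<zeta> j b))\<^sup>2)
       \<le> c\<^sup>2 * (\<Sum>j<?J. \<Sum>b<n. (cmod (\<zeta> j b))\<^sup>2)"
      unfolding N1[OF v] N2[OF v] by (simp add: vi)
  next
    fix v :: "complex vec"
    assume H: "\<forall>\<zeta>. (\<Sum>i<?I. \<Sum>a<n. (cmod (\<Sum>j<?J. \<Sum>b<n. ev (D $$ (i, j)) $$ (a, b) * \<zeta> j b))\<^sup>2)
       \<le> c\<^sup>2 * (\<Sum>j<?J. \<Sum>b<n. (cmod (\<zeta> j b))\<^sup>2)" and v: "v \<in> carrier_vec (?J * n)"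
    from H[rule_format, of "\<lambda>j b. vec_index v (j * n + b)"]
    show "euclid_norm (?M *\<^sub>v v) \<le> c * euclid_norm v"
      unfolding sq N1[OF v] N2[OF v] .
  qed
qed

text \<open>Trades the strict inequality for an explicit radius \<open>r < 1\<close>, which later
  serves as the rate of geometric series.\<close>

lemma basic_set_iff:
  "x \<in> basic_set D \<longleftrightarrow> x \<in> matrix_universe \<and>
    (\<exists>r. 0 \<le> r \<and> r < 1 \<and> block_bounded r (level x) (dim_row D) (dim_col D) (\<lambda>i j. free_eval (D $$ (i, j)) x))"
proof -
  have "op_norm M < 1 \<longleftrightarrow> (\<exists>r. 0 \<le> r \<and> r < 1 \<and> op_norm M \<le> r)" for M
    using op_norm_nonneg[of M] by (auto intro: exI[of _ "op_norm M"])
  moreover have "(\<exists>r. 0 \<le> r \<and> r < 1 \<and> op_norm (block_eval (level x) (\<lambda>q. free_eval q x) D) \<le> r) \<longleftrightarrow>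
    (\<exists>r. 0 \<le> r \<and> r < 1 \<and> block_bounded r (level x) (dim_row D) (dim_col D) (\<lambda>i j. free_eval (D $$ (i, j)) x))"
    by (intro ex_cong1 conj_cong refl op_norm_block_eval)
  ultimately show ?thesis unfolding basic_set_def by simp
qed

lemma comm_basic_iff: "z \<in> comm_basic (map_mat abelianize D) \<longleftrightarrow> scalar_tuple z \<in> basic_set D"
proof -
  have "block_eval 1 (\<lambda>q. free_eval q (scalar_tuple z)) D
    = map_mat (\<lambda>q. scalar_eval q z) (map_mat abelianize D)"
    by (rule eq_matI) (auto simp: block_eval_def free_eval_scalar)
  then show ?thesis by (simp add: comm_basic_def basic_set_def)
qed

lemma comm_basic_matrices_eq: "comm_basic_matrices (map_mat abelianize D) = comm_universe \<inter> basic_set D"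
proof -
  have "block_eval (level x) (\<lambda>q. comm_eval q x) (map_mat abelianize D) = block_eval (level x) (\<lambda>q. free_eval q x) D"
    if "x \<in> comm_universe" for x :: "'a \<Rightarrow> complex mat"
  proof (rule eq_matI)
    fix a b
    assume "a < dim_row (block_eval (level x) (\<lambda>q. free_eval q x) D)"
      "b < dim_col (block_eval (level x) (\<lambda>q. free_eval q x) D)"
    then have "a < dim_row D * level x" "b < dim_col D * level x" by (auto simp: block_eval_def)
    moreover from this have "a div level x < dim_row D" "b div level x < dim_col D"
      by (simp_all add: less_mult_imp_div_less)
    ultimately show "block_eval (level x) (\<lambda>q. comm_eval q x) (map_mat abelianize D) $$ (a, b)
      = block_eval (level x) (\<lambda>q. free_eval q x) D $$ (a, b)"
      by (simp add: block_eval_def comm_eval_abelianize[OF that])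
  qed (auto simp: block_eval_def)
  then show ?thesis
    by (auto simp: comm_basic_matrices_def basic_set_def comm_universeD)
qed

section \<open>Power series in several complex variables\<close>

definition mdeg :: "('d::finite \<Rightarrow>\<^sub>0 nat) \<Rightarrow> nat" where
  "mdeg m = (\<Sum>i\<in>UNIV. Poly_Mapping.lookup m i)"

definition monomials_on :: "'d set \<Rightarrow> ('d \<Rightarrow>\<^sub>0 nat) set" where
  "monomials_on X = {m. Poly_Mapping.keys m \<subseteq> X}"

definition polydisc :: "complex ^ 'd \<Rightarrow> real \<Rightarrow> (complex ^ 'd) set" where
  "polydisc l R = {z. \<forall>i. cmod (z $ i - l $ i) < R}"

definition coord_update :: "complex ^ 'd \<Rightarrow> 'd \<Rightarrow> complex \<Rightarrow> complex ^ 'd" where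
  "coord_update z i w = (\<chi> j. if j = i then w else z $ j)"

lemma coord_update_nth [simp]: "coord_update z i w $ j = (if j = i then w else z $ j)"
  by (simp add: coord_update_def)

lemma coord_update_commute:
  "i \<noteq> j \<Longrightarrow> coord_update (coord_update z i v) j w = coord_update (coord_update z j w) i v"
  by (auto simp: Finite_Cartesian_Product.vec_eq_iff)

lemma coord_update_self [simp]: "coord_update (coord_update z i v) i w = coord_update z i w"
  by (auto simp: Finite_Cartesian_Product.vec_eq_iff)

lemma coord_update_id [simp]: "coord_update z i (z $ i) = z"
  by (auto simp: Finite_Cartesian_Product.vec_eq_iff)

definition vec_support_in :: "'d set \<Rightarrow> complex ^ 'd \<Rightarrow> bool" where
  "vec_support_in X z \<longleftrightarrow> (\<forall>i. i \<notin> X \<longrightarrow> z $ i = 0)"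

lemma mdeg_add: "mdeg (m + m') = mdeg m + mdeg m'"
  by (simp add: mdeg_def lookup_add sum.distrib)

lemma mdeg_single [simp]: "mdeg (Poly_Mapping.single i k) = k"
  by (simp add: mdeg_def lookup_single when_def)

lemma scalar_monomial_add: "scalar_monomial z (m + m') = scalar_monomial z m * scalar_monomial z m'"
  by (simp add: scalar_monomial_def lookup_add power_add prod.distrib)

lemma scalar_monomial_single [simp]: "scalar_monomial z (Poly_Mapping.single i k) = (z $ i) ^ k"
proof -
  have "scalar_monomial z (Poly_Mapping.single i k) = (\<Prod>j\<in>UNIV. if j = i then z $ i ^ k else 1)"
    unfolding scalar_monomial_def by (intro prod.cong) (auto simp: lookup_single when_def)
  then show ?thesis by simp
qed

lemma norm_scalar_monomial_le:
  assumes "\<And>i. cmod (z $ i) \<le> \<rho>"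
  shows "cmod (scalar_monomial z m) \<le> \<rho> ^ mdeg m"
proof -
  have "cmod (scalar_monomial z m) = (\<Prod>i\<in>UNIV. cmod (z $ i) ^ Poly_Mapping.lookup m i)"
    by (simp add: scalar_monomial_def prod_norm[symmetric] norm_power)
  also have "\<dots> \<le> (\<Prod>i\<in>UNIV. \<rho> ^ Poly_Mapping.lookup m i)"
    using assms by (intro prod_mono) (auto intro!: power_mono)
  also have "\<dots> = \<rho> ^ mdeg m" by (simp add: mdeg_def power_sum)
  finally show ?thesis .
qed

text \<open>Peels the exponent of one variable off a monomial; through this bijection the
  multivariable series below become one-variable series of series.\<close>

lemma bij_betw_split_monomial:
  assumes "i \<notin> X"
  shows "bij_betw (\<lambda>(k, m). Poly_Mapping.single i k + m) (UNIV \<times> monomials_on X) (monomials_on (insert i X))"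
proof (rule bij_betwI)
  show "(\<lambda>(k, m). Poly_Mapping.single i k + m) \<in> UNIV \<times> monomials_on X \<rightarrow> monomials_on (insert i X)"
  proof (rule Pi_I)
    fix x assume "x \<in> (UNIV :: nat set) \<times> monomials_on X"
    then obtain k m where x: "x = (k, m)" "Poly_Mapping.keys m \<subseteq> X" by (auto simp: monomials_on_def)
    have "Poly_Mapping.keys (Poly_Mapping.single i k + m) \<subseteq> insert i X"
      using Poly_Mapping.keys_add[of "Poly_Mapping.single i k" m] x(2) by (auto split: if_splits)
    then show "(case x of (k, m) \<Rightarrow> Poly_Mapping.single i k + m) \<in> monomials_on (insert i X)"
      by (simp add: x monomials_on_def)
  qed
  show "(\<lambda>m. (Poly_Mapping.lookup m i, Poly_Mapping.update i 0 m)) \<in> monomials_on (insert i X) \<rightarrow> UNIV \<times> monomials_on X"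
    unfolding monomials_on_def by (auto simp: keys_update)
next
  fix x assume "x \<in> (UNIV :: nat set) \<times> monomials_on X"
  then obtain k m where x: "x = (k, m)" "Poly_Mapping.keys m \<subseteq> X" by (auto simp: monomials_on_def)
  then have "Poly_Mapping.lookup m i = 0" using assms by (auto simp: in_keys_iff)
  then show "(Poly_Mapping.lookup (case x of (k, m) \<Rightarrow> Poly_Mapping.single i k + m) i,
    Poly_Mapping.update i 0 (case x of (k, m) \<Rightarrow> Poly_Mapping.single i k + m)) = x"
    using x by (auto intro!: poly_mapping_eqI simp: lookup_update lookup_add lookup_single when_def)
next
  fix m :: "'a \<Rightarrow>\<^sub>0 nat"
  show "(case (Poly_Mapping.lookup m i, Poly_Mapping.update i 0 m) of
    (k, m) \<Rightarrow> Poly_Mapping.single i k + m) = m"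
    by (auto intro!: poly_mapping_eqI simp: lookup_update lookup_add lookup_single when_def)
qed

lemma monomials_on_empty [simp]: "monomials_on {} = {0}"
  by (auto simp: monomials_on_def)

lemma monomials_on_UNIV [simp]: "monomials_on UNIV = UNIV"
  by (auto simp: monomials_on_def)

text \<open>The family is a product of geometric series, one for each variable in
  \<open>X\<close>.\<close>

lemma summable_on_power_mdeg:
  fixes X :: "'d::finite set" and \<rho> :: real
  assumes "0 \<le> \<rho>" "\<rho> < 1"
  shows "(\<lambda>m. \<rho> ^ mdeg m) summable_on monomials_on X"
  using finite[of X]
proof (induction X rule: finite_induct)
  show "(\<lambda>m. \<rho> ^ mdeg m) summable_on monomials_on {}" by simp
next
  fix i and X :: "'d set"
  assume "i \<notin> X" and IH: "(\<lambda>m. \<rho> ^ mdeg m) summable_on monomials_on X"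
  have "((\<lambda>(k, m). \<rho> ^ k * \<rho> ^ mdeg m) summable_on Sigma UNIV (\<lambda>_. monomials_on X))"
  proof (rule summable_on_SigmaI)
    fix k :: nat
    show "((\<lambda>m. case (k, m) of (k, m) \<Rightarrow> \<rho> ^ k * \<rho> ^ mdeg m) has_sum (\<rho> ^ k * infsum (\<lambda>m. \<rho> ^ mdeg m) (monomials_on X)))
      (monomials_on X)"
      using has_sum_cmult_right[OF has_sum_infsum[OF IH]] by simp
  next
    show "(\<lambda>k. \<rho> ^ k * infsum (\<lambda>m. \<rho> ^ mdeg m) (monomials_on X)) summable_on UNIV"
      using assms by (intro summable_on_cmult_left norm_summable_imp_summable_on)
        (auto simp: norm_power intro!: summable_geometric)
  qed (use assms in auto)
  then have "(\<lambda>x. \<rho> ^ mdeg ((\<lambda>(k, m). Poly_Mapping.single i k + m) x)) summable_on (UNIV \<times> monomials_on X)"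
    by (simp add: case_prod_unfold mdeg_add power_add)
  then show "(\<lambda>m. \<rho> ^ mdeg m) summable_on monomials_on (insert i X)"
    by (subst (asm) summable_on_reindex_bij_betw[OF bij_betw_split_monomial[OF \<open>i \<notin> X\<close>]])
qed

lemma summable_on_monomials:
  fixes c :: "('d::finite \<Rightarrow>\<^sub>0 nat) \<Rightarrow> complex"
  assumes c: "\<And>m. m \<in> monomials_on X \<Longrightarrow> cmod (c m) \<le> M / R ^ mdeg m"
    and R: "0 < R" and z: "z \<in> polydisc 0 R"
  shows "(\<lambda>m. norm (c m * scalar_monomial z m)) summable_on monomials_on X"
proof -
  \<comment> \<open>The largest coordinate of \<open>z\<close> relative to \<open>R\<close>. As a
    maximum over finitely many variables it stays strictly below 1.\<close>
  define \<rho> where "\<rho> = Max (range (\<lambda>i. cmod (z $ i))) / R"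
  have le: "cmod (z $ i) \<le> \<rho> * R" for i unfolding \<rho>_def using R by simp
  have "0 \<le> Max (range (\<lambda>i. cmod (z $ i)))" by (intro Max_ge_iff[THEN iffD2]) auto
  have "Max (range (\<lambda>i. cmod (z $ i))) \<in> range (\<lambda>i. cmod (z $ i))" by (intro Max_in) auto
  with \<open>0 \<le> Max _\<close> have \<rho>: "0 \<le> \<rho>" "\<rho> < 1" using R z by (auto simp: \<rho>_def polydisc_def)
  show ?thesis
  proof (rule Infinite_Sum.abs_summable_on_comparison_test')
    show "(\<lambda>m. M * \<rho> ^ mdeg m) summable_on monomials_on X"
      using summable_on_power_mdeg[OF \<rho>] by (rule summable_on_cmult_right)
    fix m assume m: "m \<in> monomials_on X"
    have "norm (c m * scalar_monomial z m) \<le> (M / R ^ mdeg m) * (\<rho> * R) ^ mdeg m"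
      unfolding norm_mult using c[OF m] order.trans[OF norm_ge_zero c[OF m]]
      by (intro mult_mono norm_scalar_monomial_le le) auto
    also have "\<dots> = M * \<rho> ^ mdeg m" using R by (simp add: power_mult_distrib)
    finally show "norm (c m * scalar_monomial z m) \<le> M * \<rho> ^ mdeg m" .
  qed
qed

section \<open>One-variable estimates\<close>

lemma power_series_tail_bound:
  fixes a :: "nat \<Rightarrow> complex"
  assumes s: "(\<lambda>k. a k * w ^ k) sums S" and a: "\<And>k. cmod (a k) \<le> M / R ^ k"
    and R: "0 < R" and w: "cmod w < R"
  shows "cmod (S - (\<Sum>k<n. a k * w ^ k)) \<le> M * (cmod w / R) ^ n / (1 - cmod w / R)"
proof -
  let ?q = "cmod w / R"
  have q: "0 \<le> ?q" "?q < 1" using R w by auto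
  have s1: "(\<lambda>k. a (k + n) * w ^ (k + n)) sums (S - (\<Sum>k<n. a k * w ^ k))"
    using s by (subst sums_iff_shift) simp
  have b: "norm (a (k + n) * w ^ (k + n)) \<le> M * ?q ^ n * ?q ^ k" for k
  proof -
    have "norm (a (k + n) * w ^ (k + n)) \<le> (M / R ^ (k + n)) * cmod w ^ (k + n)"
      unfolding norm_mult norm_power using a by (intro mult_right_mono) auto
    also have "\<dots> = M * ?q ^ n * ?q ^ k" using R by (simp add: power_divide power_add field_simps)
    finally show ?thesis .
  qed
  have s2: "(\<lambda>k. M * ?q ^ n * ?q ^ k) sums (M * ?q ^ n * (1 / (1 - ?q)))"
    using q by (intro sums_mult geometric_sums) simp
  have "cmod (S - (\<Sum>k<n. a k * w ^ k)) \<le> M * ?q ^ n * (1 / (1 - ?q))"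
    by (rule norm_sums_le[OF s1 s2 b])
  then show ?thesis by simp
qed

text \<open>The Cauchy inequality wants continuity up to the boundary circle, hence a radius
  \<open>r < R\<close>; letting \<open>r\<close> tend to \<open>R\<close> from the left gives the
  bound with the full radius.\<close>

lemma Cauchy_coefficient_bound:
  assumes "h holomorphic_on ball 0 R" "0 < R" "\<And>w. w \<in> ball 0 R \<Longrightarrow> cmod (h w) \<le> M"
  shows "cmod ((deriv ^^ k) h 0 / fact k) \<le> M / R ^ k"
proof -
  have *: "cmod ((deriv ^^ k) h 0 / fact k) \<le> M / r ^ k" if "0 < r" "r < R" for r
  proof -
    have "norm ((deriv ^^ k) h 0) \<le> (fact k) * M / r ^ k"
    proof (rule Cauchy_inequality)
      show "h holomorphic_on ball 0 r" using assms(1) by (rule holomorphic_on_subset) (use that in auto)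
      show "continuous_on (cball 0 r) h"
        by (rule continuous_on_subset[OF holomorphic_on_imp_continuous_on[OF assms(1)]]) (use that in auto)
    qed (use that assms in auto)
    then show ?thesis by (simp add: norm_divide field_simps)
  qed
  have "((\<lambda>r. M / r ^ k) \<longlongrightarrow> M / R ^ k) (at_left R)"
    using assms(2) by (intro tendsto_intros) auto
  moreover have "eventually (\<lambda>r. cmod ((deriv ^^ k) h 0 / fact k) \<le> M / r ^ k) (at_left R)"
    using eventually_at_left_real[OF assms(2)] by eventually_elim (use * in auto)
  ultimately show ?thesis by (intro tendsto_lowerbound) auto
qed

text \<open>
  A bounded separately holomorphic function is expanded one variable at a time. The coefficients of
  the expansion in \<open>w = z\<^sub>i\<close> are uniform limits of \<open>(g - \<Sum>\<^sub>l\<^sub><\<^sub>k a\<^sub>l w\<^sup>l) / w\<^sup>k\<close> as \<open>w \<rightarrow> 0\<close> and hence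
  separately holomorphic in the remaining variables.
\<close>

lemma separately_holomorphic_coefficient:
  fixes g :: "complex ^ 'd::finite \<Rightarrow> complex"
  assumes R: "0 < R"
    and bd: "\<And>z. z \<in> polydisc 0 R \<Longrightarrow> vec_support_in (insert i X) z \<Longrightarrow> cmod (g z) \<le> M"
    and hol: "\<And>z j. z \<in> polydisc 0 R \<Longrightarrow> vec_support_in (insert i X) z \<Longrightarrow> j \<in> insert i X \<Longrightarrow>
      (\<lambda>w. g (coord_update z j w)) holomorphic_on ball 0 R"
    and iX: "i \<notin> X"
  defines "a \<equiv> \<lambda>k z. (deriv ^^ k) (\<lambda>w. g (coord_update z i w)) 0 / fact k"
  assumes z: "z \<in> polydisc 0 R" "vec_support_in X z"
  shows "cmod (a k z) \<le> M / R ^ k"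
    and "w \<in> ball 0 R \<Longrightarrow> (\<lambda>k. a k z * w ^ k) sums g (coord_update z i w)"
    and "j \<in> X \<Longrightarrow> (\<lambda>v. a k (coord_update z j v)) holomorphic_on ball 0 R"
proof -
  have supp: "vec_support_in (insert i X) (coord_update z i w)" if "vec_support_in X z" for z :: "complex ^ 'd" and w
    using that by (auto simp: vec_support_in_def)
  have pd: "coord_update z i w \<in> polydisc 0 R" if "z \<in> polydisc 0 R" "w \<in> ball 0 R"
    for z :: "complex ^ 'd" and i w
    using that by (auto simp: polydisc_def)
  have h1: "(\<lambda>w. g (coord_update z i w)) holomorphic_on ball 0 R"
    if "z \<in> polydisc 0 R" "vec_support_in X z" for z
    using hol[of z i] that by (auto simp: vec_support_in_def)
  have bound: "cmod (a k z) \<le> M / R ^ k" if "z \<in> polydisc 0 R" "vec_support_in X z" for z k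
    unfolding a_def using h1[OF that] R bd pd supp that by (intro Cauchy_coefficient_bound) auto
  then show "cmod (a k z) \<le> M / R ^ k" using z by auto
  have ser: "(\<lambda>k. a k z * w ^ k) sums g (coord_update z i w)"
    if "z \<in> polydisc 0 R" "vec_support_in X z" "w \<in> ball 0 R" for z w
    using holomorphic_power_series[OF h1[OF that(1,2)] that(3)] by (simp add: a_def)
  then show "w \<in> ball 0 R \<Longrightarrow> (\<lambda>k. a k z * w ^ k) sums g (coord_update z i w)" using z by auto
  assume j: "j \<in> X"
  then have "i \<noteq> j" using iX by auto
  have zj: "coord_update z j v \<in> polydisc 0 R" "vec_support_in X (coord_update z j v)" if "v \<in> ball 0 R" for v
    using z j that by (auto simp: polydisc_def vec_support_in_def)
  show "(\<lambda>v. a k (coord_update z j v)) holomorphic_on ball 0 R"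
  proof (induction k rule: less_induct)
    case (less k)
    \<comment> \<open>Nonzero points tending to 0 at which the new variable is evaluated. The
      summand 2 keeps \<open>cmod (w n) / R\<close> at most one half, so the denominator of the tail
      bound stays away from 0.\<close>
    define w :: "nat \<Rightarrow> complex" where "w = (\<lambda>n. complex_of_real (R / (real n + 2)))"
    have w: "w n \<noteq> 0" "cmod (w n) = R / (real n + 2)" "cmod (w n) < R" for n
    proof -
      show *: "cmod (w n) = R / (real n + 2)" using R unfolding w_def by (subst norm_of_real) simp
      have "R / (real n + 2) < R" using R by (simp add: divide_less_eq)
      with * show "w n \<noteq> 0" "cmod (w n) < R" using R by auto
    qed
    \<comment> \<open>Solves the expansion at \<open>w n\<close> for its coefficient of index
      \<open>k\<close>, up to a tail of order \<open>w n\<close>. The formula contains the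
      coefficients of smaller index, whence the strong induction on \<open>k\<close>. The error
      bound does not depend on \<open>v\<close>, so the convergence is uniform.\<close>
    define F where "F n v = (g (coord_update (coord_update z i (w n)) j v)
      - (\<Sum>l<k. a l (coord_update z j v) * w n ^ l)) / w n ^ k" for n v
    have err: "cmod (F n v - a k (coord_update z j v)) \<le> 2 * M / R ^ k / (real n + 2)" if v: "v \<in> ball 0 R" for n v
    proof -
      have eq: "coord_update (coord_update z i (w n)) j v = coord_update (coord_update z j v) i (w n)"
        using \<open>i \<noteq> j\<close> by (rule coord_update_commute)
      have "F n v - a k (coord_update z j v) = (g (coord_update (coord_update z j v) i (w n))
        - (\<Sum>l<Suc k. a l (coord_update z j v) * w n ^ l)) / w n ^ k"
        using w(1)[of n] unfolding F_def eq by (simp add: field_simps)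
      also have "cmod \<dots> \<le> (M * (cmod (w n) / R) ^ Suc k / (1 - cmod (w n) / R)) / cmod (w n) ^ k"
        unfolding norm_divide norm_power using w(3) R
        by (intro divide_right_mono power_series_tail_bound[OF ser[OF zj[OF v]]] bound[OF zj[OF v]]) auto
      also have "\<dots> = M / R ^ k * ((cmod (w n) / R) / (1 - cmod (w n) / R))"
        using w(1)[of n] by (simp add: power_divide)
      also have "cmod (w n) / R = 1 / (real n + 2)" using R by (simp add: w(2))
      also have "M / R ^ k * (1 / (real n + 2) / (1 - 1 / (real n + 2))) = M / R ^ k * (1 / (real n + 1))"
        by (simp add: field_simps)
      also have "\<dots> \<le> M / R ^ k * (2 / (real n + 2))"
        using order.trans[OF norm_ge_zero bound[OF zj[OF v], of k]]
        by (intro mult_left_mono) (auto simp: field_simps)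
      finally show ?thesis by (simp add: mult_ac)
    qed
    show ?case
    proof (rule holomorphic_uniform_sequence[where f = F])
      show "open (ball (0 :: complex) R)" by simp
      show "F n holomorphic_on ball 0 R" for n
      proof -
        have "(\<lambda>v. g (coord_update (coord_update z i (w n)) j v)) holomorphic_on ball 0 R"
          using w(3)[of n] z j by (intro hol supp pd) auto
        then show ?thesis unfolding F_def
          using less w(1) by (intro holomorphic_intros) auto
      qed
      fix x :: complex assume x: "x \<in> ball 0 R"
      then obtain d where d: "0 < d" "cball x d \<subseteq> ball 0 R" using open_contains_cball by blast
      have "uniform_limit (cball x d) F (\<lambda>v. a k (coord_update z j v)) sequentially"
        unfolding uniform_limit_iff
      proof (intro allI impI)
        fix e :: real assume "0 < e"
        have "(\<lambda>n. 2 * M / R ^ k / (real n + 2)) \<longlonglongrightarrow> 0" by real_asymp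
        then have "eventually (\<lambda>n. 2 * M / R ^ k / (real n + 2) < e) sequentially"
          using \<open>0 < e\<close> by (rule order_tendstoD)
        then show "\<forall>\<^sub>F n in sequentially. \<forall>v\<in>cball x d. dist (F n v) (a k (coord_update z j v)) < e"
        proof (eventually_elim, intro ballI)
          fix n v assume "2 * M / R ^ k / (real n + 2) < e" "v \<in> cball x d"
          with err[of v n] d(2) show "dist (F n v) (a k (coord_update z j v)) < e"
            unfolding dist_norm by (meson le_less_trans subsetD)
        qed
      qed
      with d show "\<exists>d. 0 < d \<and> cball x d \<subseteq> ball 0 R \<and>
        uniform_limit (cball x d) F (\<lambda>v. a k (coord_update z j v)) sequentially" by blast
    qed
  qed
qed

text \<open>Induction on the set \<open>X\<close> of active variables, the others being frozen at 0
  by \<open>vec_support_in\<close>. The coefficients of the expansion in a new variable satisfy the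
  hypotheses again, with \<open>M / R ^ k\<close> in place of \<open>M\<close>; the two decay
  factors multiply to \<open>M / R ^ mdeg m\<close>, and this bound makes the combined family
  absolutely summable, which justifies the regrouping.\<close>

lemma power_series_on_variables:
  fixes g :: "complex ^ 'd::finite \<Rightarrow> complex"
  assumes R: "0 < R"
    and "\<And>z. z \<in> polydisc 0 R \<Longrightarrow> vec_support_in X z \<Longrightarrow> cmod (g z) \<le> M"
    and "\<And>z j. z \<in> polydisc 0 R \<Longrightarrow> vec_support_in X z \<Longrightarrow> j \<in> X \<Longrightarrow>
      (\<lambda>w. g (coord_update z j w)) holomorphic_on ball 0 R"
  shows "\<exists>c. (\<forall>m\<in>monomials_on X. cmod (c m) \<le> M / R ^ mdeg m) \<and>
    (\<forall>z\<in>polydisc 0 R. vec_support_in X z \<longrightarrow> ((\<lambda>m. c m * scalar_monomial z m) has_sum g z) (monomials_on X))"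
proof -
  have "finite X" by simp
  then show ?thesis using assms(2,3)
  proof (induction X arbitrary: g M rule: finite_induct)
    case empty
    have 0: "z = 0" if "vec_support_in {} z" for z :: "complex ^ 'd"
      using that by (auto simp: vec_support_in_def Finite_Cartesian_Product.vec_eq_iff)
    have "0 \<in> polydisc (0 :: complex ^ 'd) R" using R by (auto simp: polydisc_def)
    with empty(1) have "cmod (g 0) \<le> M" by (auto simp: vec_support_in_def)
    then show ?case
      by (intro exI[of _ "\<lambda>_. g 0"]) (auto dest!: 0 simp: mdeg_def scalar_monomial_def has_sum_finiteI)
  next
    case (insert i X)
    define a where "a k z = (deriv ^^ k) (\<lambda>w. g (coord_update z i w)) 0 / fact k" for k z
    note A = separately_holomorphic_coefficient[OF R insert.prems(1) insert.prems(2) \<open>i \<notin> X\<close>, folded a_def]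
    have "\<exists>c. (\<forall>m\<in>monomials_on X. cmod (c m) \<le> (M / R ^ k) / R ^ mdeg m) \<and>
      (\<forall>z\<in>polydisc 0 R. vec_support_in X z \<longrightarrow> ((\<lambda>m. c m * scalar_monomial z m) has_sum a k z) (monomials_on X))" for k
      by (rule insert.IH) (auto intro!: A(1,3))
    then obtain C where C: "\<And>k m. m \<in> monomials_on X \<Longrightarrow> cmod (C k m) \<le> (M / R ^ k) / R ^ mdeg m"
      and C': "\<And>k z. z \<in> polydisc 0 R \<Longrightarrow> vec_support_in X z \<Longrightarrow>
        ((\<lambda>m. C k m * scalar_monomial z m) has_sum a k z) (monomials_on X)"
      by metis
    define c where "c m = C (Poly_Mapping.lookup m i) (Poly_Mapping.update i 0 m)" for m
    have split: "Poly_Mapping.lookup (Poly_Mapping.single i k + m) i = k"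
      "Poly_Mapping.update i 0 (Poly_Mapping.single i k + m) = m"
      if "m \<in> monomials_on X" for k m
    proof -
      have "Poly_Mapping.lookup m i = 0" using \<open>i \<notin> X\<close> that by (auto simp: in_keys_iff monomials_on_def)
      then show "Poly_Mapping.lookup (Poly_Mapping.single i k + m) i = k"
        "Poly_Mapping.update i 0 (Poly_Mapping.single i k + m) = m"
        by (auto intro!: poly_mapping_eqI simp: lookup_add lookup_update lookup_single when_def)
    qed
    have cb: "cmod (c m) \<le> M / R ^ mdeg m" if "m \<in> monomials_on (insert i X)" for m
    proof -
      have "m \<in> (\<lambda>(k, m). Poly_Mapping.single i k + m) ` (UNIV \<times> monomials_on X)"
        unfolding bij_betw_imp_surj_on[OF bij_betw_split_monomial[OF \<open>i \<notin> X\<close>]] by (rule that)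
      then obtain k m' where m: "m = Poly_Mapping.single i k + m'" "m' \<in> monomials_on X" by auto
      show ?thesis using C[OF m(2), of k] R
        unfolding m(1) c_def split[OF m(2)] mdeg_add by (simp add: power_add field_simps)
    qed
    have "((\<lambda>m. c m * scalar_monomial z m) has_sum g z) (monomials_on (insert i X))"
      if z: "z \<in> polydisc 0 R" "vec_support_in (insert i X) z" for z
    proof -
      define z0 where "z0 = coord_update z i 0"
      have z0: "z0 \<in> polydisc 0 R" "vec_support_in X z0"
        using z R by (auto simp: z0_def polydisc_def vec_support_in_def)
      have zi: "z $ i \<in> ball 0 R" using z by (auto simp: polydisc_def)
      have gz: "coord_update z0 i (z $ i) = z" by (simp add: z0_def)
      have mono: "scalar_monomial z m = scalar_monomial z0 m" if "m \<in> monomials_on X" for m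
      proof -
        have "Poly_Mapping.lookup m i = 0" using \<open>i \<notin> X\<close> that by (auto simp: in_keys_iff monomials_on_def)
        then show ?thesis unfolding scalar_monomial_def z0_def by (intro prod.cong) auto
      qed
      have "((\<lambda>(k, m). C k m * scalar_monomial z0 m * (z $ i) ^ k) has_sum g z) (Sigma UNIV (\<lambda>_. monomials_on X))"
      proof (rule has_sum_SigmaI)
        fix k :: nat
        show "((\<lambda>m. case (k, m) of (k, m) \<Rightarrow> C k m * scalar_monomial z0 m * (z $ i) ^ k) has_sum (a k z0 * (z $ i) ^ k))
          (monomials_on X)"
          using has_sum_cmult_left[OF C'[OF z0]] by simp
      next
        have "(\<lambda>k. a k z0 * (z $ i) ^ k) sums g z"
          using A(2)[OF _ _ _ _ _ z0 zi] gz by simp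
        moreover have "summable (\<lambda>k. norm (a k z0 * (z $ i) ^ k))"
        proof (rule summable_comparison_test'[where N = 0])
          show "summable (\<lambda>k. M * (cmod (z $ i) / R) ^ k)"
            using zi R by (intro summable_mult summable_geometric) auto
          fix k
          have "norm (a k z0 * (z $ i) ^ k) \<le> (M / R ^ k) * cmod (z $ i) ^ k"
            unfolding norm_mult norm_power using A(1)[OF _ _ _ _ _ z0] by (intro mult_right_mono) auto
          then show "norm (norm (a k z0 * (z $ i) ^ k)) \<le> M * (cmod (z $ i) / R) ^ k"
            by (simp add: power_divide)
        qed
        ultimately show "((\<lambda>k. a k z0 * (z $ i) ^ k) has_sum g z) UNIV"
          by (intro norm_summable_imp_has_sum)
      next
        have "(\<lambda>m. c m * scalar_monomial z m) summable_on monomials_on (insert i X)"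
          by (rule abs_summable_summable, rule summable_on_monomials[OF cb R z(1)])
        then have "(\<lambda>x. c ((\<lambda>(k, m). Poly_Mapping.single i k + m) x) *
          scalar_monomial z ((\<lambda>(k, m). Poly_Mapping.single i k + m) x)) summable_on (UNIV \<times> monomials_on X)"
          by (subst summable_on_reindex_bij_betw[OF bij_betw_split_monomial[OF \<open>i \<notin> X\<close>]])
        then show "(\<lambda>(k, m). C k m * scalar_monomial z0 m * (z $ i) ^ k) summable_on (UNIV \<times> monomials_on X)"
          by (rule summable_on_cong[THEN iffD1, rotated])
            (auto simp: c_def split scalar_monomial_add mono)
      qed
      then have "((\<lambda>x. c ((\<lambda>(k, m). Poly_Mapping.single i k + m) x) *
          scalar_monomial z ((\<lambda>(k, m). Poly_Mapping.single i k + m) x)) has_sum g z) (UNIV \<times> monomials_on X)"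
        by (rule has_sum_cong[THEN iffD1, rotated])
          (auto simp: c_def split scalar_monomial_add mono)
      then show ?thesis
        by (subst (asm) has_sum_reindex_bij_betw[OF bij_betw_split_monomial[OF \<open>i \<notin> X\<close>]])
    qed
    with cb show ?case by blast
  qed
qed

text \<open>With the remaining coordinates fixed, the sum is a one-variable power series in
  \<open>w\<close> that vanishes on a disc, so its coefficients \<open>b k\<close> vanish; each
  \<open>b k\<close> is itself a series in the remaining variables, to which the induction
  hypothesis applies.\<close>

lemma power_series_zero_on_variables:
  fixes c :: "('d::finite \<Rightarrow>\<^sub>0 nat) \<Rightarrow> complex"
  assumes R: "0 < R"
    and "\<And>z. z \<in> polydisc 0 R \<Longrightarrow> vec_support_in X z \<Longrightarrow>
      ((\<lambda>m. c m * scalar_monomial z m) has_sum 0) (monomials_on X)"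
    and "m \<in> monomials_on X"
  shows "c m = 0"
proof -
  have "finite X" by simp
  then show ?thesis using assms(2,3)
  proof (induction X arbitrary: c m rule: finite_induct)
    case empty
    have "0 \<in> polydisc (0 :: complex ^ 'd) R" using R by (auto simp: polydisc_def)
    with empty(1) have "((\<lambda>m. c m * scalar_monomial (0 :: complex ^ 'd) m) has_sum 0) {0}"
      by (auto simp: vec_support_in_def)
    from has_sum_unique[OF has_sum_finite this] have "c 0 = 0" by (simp add: scalar_monomial_def)
    with empty show ?case by simp
  next
    case (insert i X)
    define d where "d k m = c (Poly_Mapping.single i k + m)" for k m
    obtain k m' where m: "m = Poly_Mapping.single i k + m'" "m' \<in> monomials_on X"
      using bij_betw_imp_surj_on[OF bij_betw_split_monomial[OF \<open>i \<notin> X\<close>], symmetric] insert.prems(2) by auto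
    have "d k m' = 0"
    proof (rule insert.IH[OF _ m(2)])
      fix z :: "complex ^ 'd" assume z: "z \<in> polydisc 0 R" "vec_support_in X z"
      have joint: "((\<lambda>(k, m). d k m * scalar_monomial z m * w ^ k) has_sum 0) (Sigma UNIV (\<lambda>_. monomials_on X))"
        if "cmod w < R" for w
      proof -
        let ?z = "coord_update z i w"
        have mono: "scalar_monomial ?z m = scalar_monomial z m" if "m \<in> monomials_on X" for m
        proof -
          have "Poly_Mapping.lookup m i = 0" using \<open>i \<notin> X\<close> that by (auto simp: in_keys_iff monomials_on_def)
          then show ?thesis unfolding scalar_monomial_def by (intro prod.cong) auto
        qed
        have "((\<lambda>m. c m * scalar_monomial ?z m) has_sum 0) (monomials_on (insert i X))"
          using z that by (intro insert.prems(1)) (auto simp: polydisc_def vec_support_in_def)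
        then have "((\<lambda>x. c ((\<lambda>(k, m). Poly_Mapping.single i k + m) x) *
            scalar_monomial ?z ((\<lambda>(k, m). Poly_Mapping.single i k + m) x)) has_sum 0) (UNIV \<times> monomials_on X)"
          by (subst has_sum_reindex_bij_betw[OF bij_betw_split_monomial[OF \<open>i \<notin> X\<close>]])
        then show ?thesis
          by (rule has_sum_cong[THEN iffD1, rotated]) (auto simp: d_def scalar_monomial_add mono)
      qed
      define b where "b k = infsum (\<lambda>m. d k m * scalar_monomial z m) (monomials_on X)" for k
      have sb: "(\<lambda>m. d k m * scalar_monomial z m) summable_on monomials_on X" for k
      proof -
        \<comment> \<open>Any nonzero point of the disc serves: its power can be cancelled from the
          slice of index \<open>k\<close>.\<close>
        define w where "w = complex_of_real (R / 2)"
        have w: "cmod w < R" "w \<noteq> 0" using R by (auto simp: w_def)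
        have "(\<lambda>(k, m). d k m * scalar_monomial z m * w ^ k) summable_on (Sigma UNIV (\<lambda>_. monomials_on X))"
          using joint[OF w(1)] summable_on_def by blast
        then have "(\<lambda>m. d k m * scalar_monomial z m * w ^ k) summable_on monomials_on X"
          using summable_on_SigmaD1[where f = "\<lambda>k m. d k m * scalar_monomial z m * w ^ k"] by blast
        then have "(\<lambda>m. d k m * scalar_monomial z m * w ^ k * inverse (w ^ k)) summable_on monomials_on X"
          by (rule summable_on_cmult_left)
        then show ?thesis using w(2) by (simp add: mult.assoc)
      qed
      have hs: "((\<lambda>m. d k m * scalar_monomial z m) has_sum b k) (monomials_on X)" for k
        unfolding b_def using sb by (rule has_sum_infsum)
      have sums: "(\<lambda>k. b k * w ^ k) sums 0" if "cmod w < R" for w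
      proof (rule has_sum_imp_sums)
        show "((\<lambda>k. b k * w ^ k) has_sum 0) UNIV"
          by (rule has_sum_SigmaD[OF joint[OF that]]) (use has_sum_cmult_left[OF hs] in simp)
      qed
      have "b k = 0"
      proof (cases "k = 0")
        case True
        have "(\<lambda>k. b k * 0 ^ k) sums 0" using sums[of 0] R by simp
        then show ?thesis using True powser_sums_zero_iff[of b 0] by simp
      next
        case False
        show ?thesis
        proof (rule ccontr)
          assume "b k \<noteq> 0"
          \<comment> \<open>A nonzero coefficient of positive index would keep the sum, which is the
            zero function, away from 0 on a punctured disc; the coefficient of index 0 is read off
            at the centre.\<close>
          show False
          proof (rule powser_0_nonzero[of R 0 b "\<lambda>_. 0" k])
            fix s :: real
            assume "0 < s" "\<And>z :: complex. z \<in> cball 0 s - {0} \<Longrightarrow> (0 :: complex) \<noteq> 0"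
            from this(2)[of "complex_of_real s"] \<open>0 < s\<close> show False by auto
          next
            show "(\<lambda>n. b n * (w - 0) ^ n) sums 0" if "norm (w - 0) < R" for w using sums[of w] that by simp
          qed (use R \<open>b k \<noteq> 0\<close> False in simp_all)
        qed
      qed
      with hs[of k] show "((\<lambda>m. d k m * scalar_monomial z m) has_sum 0) (monomials_on X)" by simp
    qed
    then show ?case by (simp add: m d_def)
  qed
qed

section \<open>Expansions about arbitrary centres and their uniqueness\<close>

lemma polydisc_subset_ball:
  fixes l :: "complex ^ 'd::finite"
  assumes "0 < r"
  shows "\<exists>R>0. polydisc l R \<subseteq> ball l r"
proof (intro exI conjI subsetI)
  let ?R = "r / real CARD('d)"
  show "0 < ?R" using assms by simp
  fix z assume z: "z \<in> polydisc l ?R"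
  have "norm (z - l) \<le> (\<Sum>i\<in>UNIV. norm ((z - l) $ i))"
    unfolding norm_vec_def by (rule L2_set_le_sum) simp
  also have "\<dots> < (\<Sum>i\<in>(UNIV :: 'd set). ?R)"
    using z by (intro sum_strict_mono) (auto simp: polydisc_def)
  also have "\<dots> = r" by simp
  finally show "z \<in> ball l r" by (simp add: dist_norm norm_minus_commute)
qed

lemma has_sum_minus:
  fixes f g :: "'a \<Rightarrow> 'b :: real_normed_field"
  assumes "(f has_sum a) A" "(g has_sum b) A"
  shows "((\<lambda>x. f x - g x) has_sum (a - b)) A"
  using has_sum_add[OF assms(1) has_sum_cmult_right[OF assms(2), of "- 1"]] by simp

text \<open>This is what turns the choice of \<open>c\<close> in \<open>local_value\<close> into a
  well-defined value. The two radii of convergence may differ, so the comparison takes place in a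
  polydisc inside the smaller ball.\<close>

lemma power_series_at_unique:
  fixes g :: "complex ^ 'd::finite \<Rightarrow> complex"
  assumes "power_series_at g l c" "power_series_at g l c'"
  shows "c = c'"
proof
  fix m
  obtain r r' where r: "0 < r" "\<And>z. z \<in> ball l r \<Longrightarrow> ((\<lambda>m. c m * scalar_monomial (z - l) m) has_sum g z) UNIV"
    "0 < r'" "\<And>z. z \<in> ball l r' \<Longrightarrow> ((\<lambda>m. c' m * scalar_monomial (z - l) m) has_sum g z) UNIV"
    using assms unfolding power_series_at_def by blast
  obtain R where R: "R > 0" "polydisc l R \<subseteq> ball l (min r r')"
    using polydisc_subset_ball[of "min r r'" l] r by auto
  have "c m - c' m = 0"
  proof (rule power_series_zero_on_variables[OF R(1), where X = UNIV])
    fix z :: "complex ^ 'd" assume "z \<in> polydisc 0 R"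
    then have "l + z \<in> polydisc l R" by (simp add: polydisc_def)
    with R(2) have "l + z \<in> ball l (min r r')" by blast
    then have "((\<lambda>m. c m * scalar_monomial z m - c' m * scalar_monomial z m) has_sum (g (l + z) - g (l + z))) UNIV"
      using r(2)[of "l + z"] r(4)[of "l + z"] by (intro has_sum_minus) auto
    then show "((\<lambda>m. (c m - c' m) * scalar_monomial z m) has_sum 0) (monomials_on UNIV)"
      by (simp add: algebra_simps)
  qed simp
  then show "c m = c' m" by simp
qed

text \<open>The bound \<open>M\<close> belongs to the notion because the expansion and all
  coefficient estimates rest on it. The updated coordinate ranges over the full disc around
  \<open>l $ i\<close> while the other coordinates of \<open>z\<close> may stay off centre.\<close>

definition separately_holomorphic ::
    "(complex ^ 'd::finite \<Rightarrow> complex) \<Rightarrow> complex ^ 'd \<Rightarrow> real \<Rightarrow> real \<Rightarrow> bool" where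
  "separately_holomorphic g l R M \<longleftrightarrow> (\<forall>z\<in>polydisc l R. cmod (g z) \<le> M \<and>
     (\<forall>i. (\<lambda>w. g (coord_update z i w)) holomorphic_on ball (l $ i) R))"

lemma separately_holomorphic_power_series:
  fixes g :: "complex ^ 'd::finite \<Rightarrow> complex"
  assumes R: "0 < R" and g: "separately_holomorphic g l R M"
  shows "\<exists>c. (\<forall>m. cmod (c m) \<le> M / R ^ mdeg m) \<and>
    (\<forall>z\<in>polydisc l R. ((\<lambda>m. c m * scalar_monomial (z - l) m) has_sum g z) UNIV)"
proof -
  let ?h = "\<lambda>z. g (l + z)"
  have pd: "l + z \<in> polydisc l R" if "z \<in> polydisc 0 R" for z using that by (auto simp: polydisc_def)
  have "\<exists>c. (\<forall>m\<in>monomials_on UNIV. cmod (c m) \<le> M / R ^ mdeg m) \<and>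
    (\<forall>z\<in>polydisc 0 R. vec_support_in UNIV z \<longrightarrow> ((\<lambda>m. c m * scalar_monomial z m) has_sum ?h z) (monomials_on UNIV))"
  proof (rule power_series_on_variables[OF R])
    fix z :: "complex ^ 'd" and i assume z: "z \<in> polydisc 0 R"
    have "((\<lambda>w. g (coord_update (l + z) i w)) \<circ> (\<lambda>w. l $ i + w)) holomorphic_on ball 0 R"
    proof (rule holomorphic_on_compose_gen)
      show "(\<lambda>w. g (coord_update (l + z) i w)) holomorphic_on ball (l $ i) R"
        using g pd[OF z] by (auto simp: separately_holomorphic_def)
    qed (auto intro!: holomorphic_intros simp: dist_norm)
    moreover have "l + coord_update z i w = coord_update (l + z) i (l $ i + w)" for w
      by (auto simp: Finite_Cartesian_Product.vec_eq_iff)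
    ultimately show "(\<lambda>w. g (l + coord_update z i w)) holomorphic_on ball 0 R"
      by (simp add: o_def)
  qed (use g pd in \<open>auto simp: separately_holomorphic_def\<close>)
  then obtain c where c: "\<And>m. cmod (c m) \<le> M / R ^ mdeg m"
    "\<And>z. z \<in> polydisc 0 R \<Longrightarrow> ((\<lambda>m. c m * scalar_monomial z m) has_sum ?h z) UNIV"
    by (auto simp: vec_support_in_def)
  have "((\<lambda>m. c m * scalar_monomial (z - l) m) has_sum g z) UNIV" if "z \<in> polydisc l R" for z
    using c(2)[of "z - l"] that by (simp add: polydisc_def)
  with c(1) show ?thesis by blast
qed

lemma ball_subset_polydisc: "ball l R \<subseteq> polydisc (l :: complex ^ 'd::finite) R"
proof
  fix z assume "z \<in> ball l R"
  then show "z \<in> polydisc l R"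
    using Finite_Cartesian_Product.norm_nth_le[of "z - l"]
    by (auto simp: polydisc_def dist_norm norm_minus_commute intro: le_less_trans)
qed

lemma separately_holomorphic_power_series_at:
  assumes "0 < R" "separately_holomorphic g l R M"
  shows "\<exists>c. power_series_at g l c \<and> (\<forall>m. cmod (c m) \<le> M / R ^ mdeg m)"
  using separately_holomorphic_power_series[OF assms] ball_subset_polydisc[of l R] assms(1)
  unfolding power_series_at_def by blast

lemma separately_holomorphic_subset:
  assumes "separately_holomorphic g l R M" "r \<le> R"
  shows "separately_holomorphic g l r M"
proof -
  have "polydisc l r \<subseteq> polydisc l R" using assms(2) by (auto simp: polydisc_def intro: less_le_trans)
  moreover have "ball (l $ i) r \<subseteq> ball (l $ i) R" for i using assms(2) by auto
  ultimately show ?thesis using assms(1) unfolding separately_holomorphic_def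
    by (meson holomorphic_on_subset subsetD)
qed

text \<open>The remainder after the affine part of the power series is at most quadratic.\<close>

lemma separately_holomorphic_has_derivative:
  fixes g :: "complex ^ 'd::finite \<Rightarrow> complex"
  assumes R: "0 < R" and g: "separately_holomorphic g l R M"
  shows "\<exists>c :: complex ^ 'd. (g has_derivative (\<lambda>h. \<Sum>i\<in>UNIV. c $ i * h $ i)) (at l)"
proof -
  obtain c where c: "\<And>m. cmod (c m) \<le> M / R ^ mdeg m"
    "\<And>z. z \<in> polydisc l R \<Longrightarrow> ((\<lambda>m. c m * scalar_monomial (z - l) m) has_sum g z) UNIV"
    using separately_holomorphic_power_series[OF assms] by blast
  \<comment> \<open>If \<rho> = \<open>norm h / R\<close> is at most 1/2 and k is at least 2, then
    \<rho>^k is at most 4 \<rho>^2 2^(-k). Summing the factors 2^(-k) over all monomials gives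
    \<open>S\<close>, and the remaining 4 appears in \<open>rem\<close>.\<close>
  define S where "S = (\<Sum>\<^sub>\<infinity>m::'d \<Rightarrow>\<^sub>0 nat. (1 / 2 :: real) ^ mdeg m)"
  have S: "((\<lambda>m::'d \<Rightarrow>\<^sub>0 nat. (1 / 2 :: real) ^ mdeg m) has_sum S) UNIV"
    unfolding S_def using summable_on_power_mdeg[of "1/2" UNIV] by (intro has_sum_infsum) simp
  have M: "0 \<le> M" using order.trans[OF norm_ge_zero c(1)[of 0]] by (simp add: mdeg_def)
  let ?e = "\<lambda>i. Poly_Mapping.single i 1 :: 'd \<Rightarrow>\<^sub>0 nat"
  define L :: "('d \<Rightarrow>\<^sub>0 nat) set" where "L = insert 0 (range ?e)"
  have Lfin: "finite L" by (simp add: L_def)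
  have notL: "mdeg m \<ge> 2" if "m \<notin> L" for m :: "'d \<Rightarrow>\<^sub>0 nat"
  proof (rule ccontr)
    assume "\<not> mdeg m \<ge> 2"
    moreover have "mdeg m \<noteq> 0" using that by (auto simp: L_def mdeg_def intro!: poly_mapping_eqI)
    ultimately have "mdeg m = 1" by linarith
    then have 1: "(\<Sum>i\<in>UNIV. Poly_Mapping.lookup m i) = 1" unfolding mdeg_def .
    then obtain i where i: "Poly_Mapping.lookup m i = 1" "\<And>j. j \<noteq> i \<Longrightarrow> Poly_Mapping.lookup m j = 0"
      using sum_eq_1_iff[of "UNIV :: 'd set" "Poly_Mapping.lookup m"] by auto
    then have "m = ?e i" by (intro poly_mapping_eqI) (auto simp: lookup_single when_def)
    with that show False by (auto simp: L_def)
  qed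
  have inj: "inj ?e" by (rule injI) (metis lookup_single_eq lookup_single_not_eq zero_neq_one)
  have Lsum: "(\<Sum>m\<in>L. c m * scalar_monomial h m) = c 0 + (\<Sum>i\<in>UNIV. c (?e i) * h $ i)" for h
  proof -
    have "0 \<notin> range ?e"
    proof
      assume "0 \<in> range ?e"
      then obtain i where "0 = ?e i" by blast
      then have "mdeg (0 :: 'd \<Rightarrow>\<^sub>0 nat) = 1" using mdeg_single[of i 1] by argo
      then show False by (simp add: mdeg_def)
    qed
    then show ?thesis by (simp add: L_def sum.reindex[OF inj, simplified] o_def)
  qed
  have g0: "g l = c 0"
  proof -
    have "((\<lambda>m. c m * scalar_monomial (0 :: complex ^ 'd) m) has_sum g l) UNIV"
      using c(2)[of l] R by (simp add: polydisc_def)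
    moreover have "((\<lambda>m. c m * scalar_monomial (0 :: complex ^ 'd) m) has_sum c 0) UNIV"
    proof (rule has_sum_finite_neutralI[of "{0}"])
      fix m :: "'d \<Rightarrow>\<^sub>0 nat" assume "m \<in> UNIV - {0}"
      then obtain i where "Poly_Mapping.lookup m i \<noteq> 0" by (auto simp: poly_mapping_eq_iff fun_eq_iff)
      then show "c m * scalar_monomial (0 :: complex ^ 'd) m = 0"
        by (auto simp: scalar_monomial_def prod_zero_iff)
    qed auto
    ultimately show ?thesis by (rule has_sum_unique)
  qed
  define D where "D = (\<lambda>h :: complex ^ 'd. \<Sum>i\<in>UNIV. c (?e i) * h $ i)"
  have rem: "cmod (g (l + h) - g l - D h) \<le> (4 * M * S / R\<^sup>2) * (norm h)\<^sup>2" if h: "norm h < R / 2" for h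
  proof -
    define \<rho> where "\<rho> = norm h / R"
    have \<rho>: "0 \<le> \<rho>" "2 * \<rho> \<le> 1" using h R by (auto simp: \<rho>_def field_simps)
    have "l + h \<in> ball l R" using h R by (simp add: dist_norm)
    then have pd: "l + h \<in> polydisc l R" using ball_subset_polydisc by blast
    have s: "((\<lambda>m. c m * scalar_monomial h m) has_sum (g (l + h) - (\<Sum>m\<in>L. c m * scalar_monomial h m))) (UNIV - L)"
      using c(2)[OF pd] Lfin by (intro has_sum_Diff has_sum_finite) auto
    have b: "norm (c m * scalar_monomial h m) \<le> (4 * M * \<rho>\<^sup>2) * (1 / 2) ^ mdeg m" if "m \<in> UNIV - L" for m
    proof -
      have "cmod (h $ i) \<le> \<rho> * R" for i
        using Finite_Cartesian_Product.norm_nth_le[of h i] R by (simp add: \<rho>_def)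
      then have "norm (c m * scalar_monomial h m) \<le> (M / R ^ mdeg m) * (\<rho> * R) ^ mdeg m"
        unfolding norm_mult using c(1) M R by (intro mult_mono norm_scalar_monomial_le) auto
      also have "\<dots> = M * (2 * \<rho>) ^ mdeg m * (1 / 2) ^ mdeg m"
        using R by (simp add: power_mult_distrib power_divide)
      also have "\<dots> \<le> M * (2 * \<rho>) ^ 2 * (1 / 2) ^ mdeg m"
        using M \<rho> notL[of m] that by (intro mult_right_mono mult_left_mono power_decreasing) auto
      finally show ?thesis by (simp add: power_mult_distrib mult_ac)
    qed
    have sub: "(\<lambda>m. (4 * M * \<rho>\<^sup>2) * (1 / 2) ^ mdeg m) summable_on (UNIV - L)"
      using has_sum_imp_summable[OF S] by (intro summable_on_cmult_right) (rule summable_on_subset[OF _ subset_UNIV])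
    have "norm (infsum (\<lambda>m. c m * scalar_monomial h m) (UNIV - L)) \<le>
      infsum (\<lambda>m. norm (c m * scalar_monomial h m)) (UNIV - L)"
      by (rule norm_infsum_bound, rule Infinite_Sum.abs_summable_on_comparison_test'[OF sub b])
    also have "\<dots> \<le> infsum (\<lambda>m. (4 * M * \<rho>\<^sup>2) * (1 / 2) ^ mdeg m) (UNIV - L)"
      by (rule infsum_mono[OF Infinite_Sum.abs_summable_on_comparison_test'[OF sub b] sub b])
    also have "\<dots> \<le> infsum (\<lambda>m. (4 * M * \<rho>\<^sup>2) * (1 / 2) ^ mdeg m) (UNIV :: ('d \<Rightarrow>\<^sub>0 nat) set)"
      using M has_sum_imp_summable[OF S]
      by (intro infsum_mono2 sub summable_on_cmult_right) auto
    also have "\<dots> = (4 * M * \<rho>\<^sup>2) * S"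
      using has_sum_cmult_right[OF S] by (rule infsumI)
    finally have "cmod (g (l + h) - (\<Sum>m\<in>L. c m * scalar_monomial h m)) \<le> (4 * M * \<rho>\<^sup>2) * S"
      unfolding infsumI[OF s] .
    then show ?thesis
      unfolding Lsum g0 D_def \<rho>_def by (simp add: power_divide algebra_simps)
  qed
  have "(g has_derivative D) (at l)"
    unfolding has_derivative_at
  proof
    have "linear D"
      unfolding D_def by (intro linearI) (auto simp: sum.distrib algebra_simps scaleR_sum_right)
    then show "bounded_linear D" by (simp add: linear_conv_bounded_linear)
    show "(\<lambda>h. norm (g (l + h) - g l - D h) / norm h) \<midarrow>0\<rightarrow> 0"
    proof (rule real_tendsto_sandwich)
      show "((\<lambda>h. 0) \<longlongrightarrow> 0) (at 0)" by simp
      show "((\<lambda>h. (4 * M * S / R\<^sup>2) * norm h) \<longlongrightarrow> 0) (at (0 :: complex ^ 'd))"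
        by (rule tendsto_mult_right_zero[OF tendsto_norm_zero[OF tendsto_ident_at]])
      have "((\<lambda>h :: complex ^ 'd. norm h) \<longlongrightarrow> 0) (at 0)" by (rule tendsto_norm_zero[OF tendsto_ident_at])
      then have "\<forall>\<^sub>F h in at (0 :: complex ^ 'd). norm h < R / 2"
        by (rule order_tendstoD(2)) (use R in simp)
      then show "\<forall>\<^sub>F h in at (0 :: complex ^ 'd). norm (g (l + h) - g l - D h) / norm h \<le> (4 * M * S / R\<^sup>2) * norm h"
      proof eventually_elim
        case (elim h)
        have "norm (g (l + h) - g l - D h) / norm h \<le> (4 * M * S / R\<^sup>2) * (norm h)\<^sup>2 / norm h"
          by (intro divide_right_mono rem elim) simp
        then show ?case by (cases "h = 0") (auto simp: power2_eq_square)
      qed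
    qed auto
  qed
  then show ?thesis
    unfolding D_def by (intro exI[of _ "\<chi> i. c (?e i)"]) simp
qed

text \<open>Differentiability gives continuity, hence a bound on a compact ball, and the chain rule
  along a coordinate line gives holomorphy in each variable. Together with
  \<open>separately_holomorphic_imp_several\<close> this allows passage between the two notions in
  both directions.\<close>

lemma holomorphic_several_separately:
  fixes g :: "complex ^ 'd::finite \<Rightarrow> complex"
  assumes g: "holomorphic_several g U" and l: "l \<in> U"
  shows "\<exists>R>0. polydisc l R \<subseteq> U \<and> (\<exists>M. separately_holomorphic g l R M)"
proof -
  have oU: "open U" and der: "\<And>z. z \<in> U \<Longrightarrow> \<exists>c :: complex ^ 'd. (g has_derivative (\<lambda>h. \<Sum>i\<in>UNIV. c $ i * h $ i)) (at z)"
    using g by (auto simp: holomorphic_several_def)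
  obtain r where r: "0 < r" "cball l r \<subseteq> U" using oU l open_contains_cball by blast
  obtain R where R: "0 < R" "polydisc l R \<subseteq> ball l r" using polydisc_subset_ball[OF r(1)] by blast
  have "continuous_on (cball l r) g"
    using der r(2) by (intro continuous_at_imp_continuous_on ballI) (blast intro: has_derivative_continuous)
  then have "bounded (g ` cball l r)" by (intro compact_imp_bounded compact_continuous_image) auto
  then obtain M where "\<forall>w\<in>g ` cball l r. cmod w \<le> M" unfolding bounded_iff by blast
  then have M: "\<And>z. z \<in> cball l r \<Longrightarrow> cmod (g z) \<le> M" by blast
  have "(\<lambda>w. g (coord_update z i w)) holomorphic_on ball (l $ i) R" if z: "z \<in> polydisc l R" for z i
  proof (unfold holomorphic_on_def field_differentiable_def, intro ballI)
    fix w assume w: "w \<in> ball (l $ i) R"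
    have "coord_update z i w \<in> polydisc l R"
      using z w by (auto simp: polydisc_def dist_norm norm_minus_commute)
    then have "coord_update z i w \<in> U" using R(2) r(2) ball_subset_cball by blast
    then obtain c :: "complex ^ 'd" where c: "(g has_derivative (\<lambda>h. \<Sum>i\<in>UNIV. c $ i * h $ i)) (at (coord_update z i w))"
      using der by blast
    have "((\<lambda>w. coord_update z i w) has_derivative (\<lambda>h. \<chi> j. if j = i then h else 0)) (at w)"
    proof (subst has_derivative_componentwise_within, intro ballI)
      fix b :: "complex ^ 'd" assume "b \<in> Basis"
      then obtain u j where b: "b = axis j u" "u \<in> Basis" by (auto simp: Basis_vec_def)
      have *: "(x :: complex ^ 'd) \<bullet> b = (x $ j) \<bullet> u" for x by (simp add: b inner_axis)
      show "((\<lambda>x. coord_update z i x \<bullet> b) has_derivative (\<lambda>x. (\<chi> j. if j = i then x else 0) \<bullet> b)) (at w)"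
        unfolding * by (cases "j = i") (auto intro!: derivative_eq_intros)
    qed
    from has_derivative_compose[OF this c]
    have "((\<lambda>w. g (coord_update z i w)) has_derivative (\<lambda>h. \<Sum>j\<in>UNIV. c $ j * (if j = i then h else 0))) (at w)"
      by simp
    moreover have "(\<lambda>h. \<Sum>j\<in>UNIV. c $ j * (if j = i then h else 0)) = (*) (c $ i)"
      by (rule ext) (simp add: if_distrib[of "(*) _"] cong: if_cong)
    ultimately have "((\<lambda>w. g (coord_update z i w)) has_field_derivative c $ i) (at w)"
      by (simp add: has_field_derivative_def)
    then show "\<exists>f'. ((\<lambda>w. g (coord_update z i w)) has_field_derivative f') (at w within ball (l $ i) R)"
      using has_field_derivative_at_within by blast
  qed
  then have "separately_holomorphic g l R M"
    unfolding separately_holomorphic_def using M R(2) by auto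
  with R r show ?thesis by (meson ball_subset_cball order.trans)
qed

lemma holomorphic_several_power_series_at:
  assumes "holomorphic_several g U" "l \<in> U"
  shows "\<exists>c. power_series_at g l c"
  using holomorphic_several_separately[OF assms] separately_holomorphic_power_series_at by blast

lemma separately_holomorphic_imp_several:
  fixes g :: "complex ^ 'd::finite \<Rightarrow> complex"
  assumes "open U" "\<And>l. l \<in> U \<Longrightarrow> \<exists>R>0. \<exists>M. separately_holomorphic g l R M"
  shows "holomorphic_several g U"
  unfolding holomorphic_several_def using assms separately_holomorphic_has_derivative by blast

lemma separately_holomorphic_diff:
  assumes "separately_holomorphic f l R M" "separately_holomorphic g l R N"
    "\<And>z. z \<in> polydisc l R \<Longrightarrow> cmod (f z - g z) \<le> E"
  shows "separately_holomorphic (\<lambda>z. f z - g z) l R E"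
  using assms unfolding separately_holomorphic_def by (auto intro!: holomorphic_intros)

lemma separately_holomorphic_uniform_limit:
  fixes g :: "complex ^ 'd::finite \<Rightarrow> complex"
  assumes q: "\<And>n. \<exists>M. separately_holomorphic (q n) l R M"
    and lim: "uniform_limit (polydisc l R) q g sequentially"
  shows "\<exists>M. separately_holomorphic g l R M"
proof -
  \<comment> \<open>A single approximant at distance less than 1 passes its bound on to the
    limit.\<close>
  obtain n where n: "\<And>z. z \<in> polydisc l R \<Longrightarrow> dist (q n z) (g z) < 1"
    using uniform_limitD[OF lim, of 1] by (auto simp: eventually_sequentially)
  obtain M where M: "separately_holomorphic (q n) l R M" using q by blast
  have "cmod (g z) \<le> M + 1" if "z \<in> polydisc l R" for z
  proof -
    have "cmod (q n z) \<le> M" using M that by (auto simp: separately_holomorphic_def)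
    moreover have "cmod (g z) \<le> cmod (q n z) + cmod (q n z - g z)"
      using norm_triangle_ineq4[of "q n z" "q n z - g z"] by simp
    ultimately show ?thesis using n[OF that] by (simp add: dist_norm)
  qed
  moreover have "(\<lambda>w. g (coord_update z i w)) holomorphic_on ball (l $ i) R"
    if z: "z \<in> polydisc l R" for z i
  proof (rule holomorphic_uniform_sequence[where f = "\<lambda>n w. q n (coord_update z i w)"])
    show "open (ball (l $ i) R)" by simp
    show "(\<lambda>w. q n (coord_update z i w)) holomorphic_on ball (l $ i) R" for n
      using q[of n] z by (auto simp: separately_holomorphic_def)
    fix x assume "x \<in> ball (l $ i) R"
    then obtain d where d: "0 < d" "cball x d \<subseteq> ball (l $ i) R"
      using open_contains_cball_eq[OF open_ball] by blast
    have pd: "coord_update z i w \<in> polydisc l R" if "w \<in> cball x d" for w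
      using z d(2) that by (auto simp: polydisc_def dist_norm norm_minus_commute subset_iff)
    have "uniform_limit (cball x d) (\<lambda>n w. q n (coord_update z i w)) (\<lambda>w. g (coord_update z i w)) sequentially"
      using lim pd unfolding uniform_limit_iff by (force elim!: eventually_mono)
    with d show "\<exists>d. 0 < d \<and> cball x d \<subseteq> ball (l $ i) R \<and>
      uniform_limit (cball x d) (\<lambda>n w. q n (coord_update z i w)) (\<lambda>w. g (coord_update z i w)) sequentially"
      by blast
  qed
  ultimately have "separately_holomorphic g l R (M + 1)"
    by (auto simp: separately_holomorphic_def)
  then show ?thesis by blast
qed

lemma power_series_at_diff:
  fixes f g :: "complex ^ 'd::finite \<Rightarrow> complex"
  assumes "power_series_at f l c" "power_series_at g l c'"
  shows "power_series_at (\<lambda>z. f z - g z) l (\<lambda>m. c m - c' m)"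
proof -
  obtain r r' where r: "0 < r" "\<And>z. z \<in> ball l r \<Longrightarrow> ((\<lambda>m. c m * scalar_monomial (z - l) m) has_sum f z) UNIV"
    "0 < r'" "\<And>z. z \<in> ball l r' \<Longrightarrow> ((\<lambda>m. c' m * scalar_monomial (z - l) m) has_sum g z) UNIV"
    using assms unfolding power_series_at_def by blast
  show ?thesis
    unfolding power_series_at_def
  proof (intro exI[of _ "min r r'"] conjI ballI)
    show "0 < min r r'" using r by simp
    fix z assume z: "z \<in> ball l (min r r')"
    have "((\<lambda>m. c m * scalar_monomial (z - l) m - c' m * scalar_monomial (z - l) m) has_sum (f z - g z)) UNIV"
      using z by (intro has_sum_minus r) auto
    then show "((\<lambda>m. (c m - c' m) * scalar_monomial (z - l) m) has_sum (f z - g z)) UNIV"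
      by (simp add: left_diff_distrib)
  qed
qed

lemma power_series_at_cong:
  assumes "0 < e" "\<And>z. z \<in> ball l e \<Longrightarrow> f z = g z"
  shows "power_series_at f l c \<longleftrightarrow> power_series_at g l c"
proof -
  have "power_series_at g l c" if H: "power_series_at f l c" "\<And>z. z \<in> ball l e \<Longrightarrow> f z = g z" for f g
  proof -
    from H(1) obtain r where r: "0 < r" "\<And>z. z \<in> ball l r \<Longrightarrow> ((\<lambda>m. c m * scalar_monomial (z - l) m) has_sum f z) UNIV"
      unfolding power_series_at_def by blast
    show ?thesis unfolding power_series_at_def
    proof (intro exI[of _ "min r e"] conjI ballI)
      fix z assume z: "z \<in> ball l (min r e)"
      then have "f z = g z" using H(2) by simp
      then show "((\<lambda>m. c m * scalar_monomial (z - l) m) has_sum g z) UNIV" using r(2)[of z] z by simp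
    qed (use r assms(1) in simp)
  qed
  from this[of f g] this[of g f] show ?thesis using assms(2) by auto
qed

section \<open>Commuting tuples of matrices\<close>

definition shift_tuple :: "('d::finite \<Rightarrow> complex mat) \<Rightarrow> complex ^ 'd \<Rightarrow> 'd \<Rightarrow> complex mat" where
  "shift_tuple x l = (\<lambda>i. x i - (l $ i) \<cdot>\<^sub>m 1\<^sub>m (level x))"

section \<open>Intertwining relations, inverses and similarity\<close>

lemma mat_intertwine_shift:
  fixes A B R :: "complex mat"
  assumes "A \<in> carrier_mat n n" "B \<in> carrier_mat m m" "R \<in> carrier_mat m n" "R * A = B * R"
  shows "R * (A - c \<cdot>\<^sub>m 1\<^sub>m n) = (B - c \<cdot>\<^sub>m 1\<^sub>m m) * R"
proof -
  have "R * (A - c \<cdot>\<^sub>m 1\<^sub>m n) = R * A - R * (c \<cdot>\<^sub>m 1\<^sub>m n)"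
    using assms by (intro mult_minus_distrib_mat) auto
  also have "R * (c \<cdot>\<^sub>m 1\<^sub>m n) = c \<cdot>\<^sub>m R"
    using assms mult_smult_distrib[of R m n "1\<^sub>m n" n c] by simp
  also have "c \<cdot>\<^sub>m R = (c \<cdot>\<^sub>m 1\<^sub>m m) * R"
    using assms mult_smult_assoc_mat[of "1\<^sub>m m" m m R n c] by simp
  also have "R * A - \<dots> = (B - c \<cdot>\<^sub>m 1\<^sub>m m) * R"
    unfolding assms(4) using assms by (intro minus_mult_distrib_mat[symmetric]) auto
  finally show ?thesis .
qed

lemma mat_intertwine_mult:
  fixes A A' B B' R :: "complex mat"
  assumes "A \<in> carrier_mat n n" "A' \<in> carrier_mat n n" "B \<in> carrier_mat m m" "B' \<in> carrier_mat m m"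
    "R \<in> carrier_mat m n" "R * A = B * R" "R * A' = B' * R"
  shows "R * (A * A') = (B * B') * R"
proof -
  have "R * (A * A') = B * R * A'" using assms by (simp flip: assms(6))
  also have "\<dots> = B * (B' * R)" using assms by (simp flip: assms(7))
  finally show ?thesis using assms by simp
qed

lemma mat_intertwine_pow:
  fixes A B R :: "complex mat"
  assumes "A \<in> carrier_mat n n" "B \<in> carrier_mat m m" "R \<in> carrier_mat m n" "R * A = B * R"
  shows "R * (A ^\<^sub>m k) = (B ^\<^sub>m k) * R"
proof (induction k)
  case (Suc k)
  have "A ^\<^sub>m k \<in> carrier_mat n n" "B ^\<^sub>m k \<in> carrier_mat m m" using assms pow_carrier_mat by auto
  then show ?case using mat_intertwine_mult[OF _ assms(1) _ assms(2,3) Suc assms(4)] by simp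
qed (use assms in simp)

lemma mat_inverse_exists:
  fixes A :: "complex mat"
  assumes A: "A \<in> carrier_mat n n" and ker: "\<And>v. v \<in> carrier_vec n \<Longrightarrow> A *\<^sub>v v = 0\<^sub>v n \<Longrightarrow> v = 0\<^sub>v n"
  shows "\<exists>B. B \<in> carrier_mat n n \<and> A * B = 1\<^sub>m n \<and> B * A = 1\<^sub>m n"
proof -
  have "det A \<noteq> 0" using det_0_iff_vec_prod_zero_field[OF A] ker by auto
  from det_non_zero_imp_unit[OF A this, of "()"] show ?thesis
    by (auto simp: Units_def ring_mat_def)
qed

lemma pow_mult_eq_zero_cancel:
  fixes A X :: "complex mat"
  assumes A: "A \<in> carrier_mat n n" "B \<in> carrier_mat n n" "B * A = 1\<^sub>m n" and X: "X \<in> carrier_mat n m"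
    and "(A ^\<^sub>m k) * X = 0\<^sub>m n m"
  shows "X = 0\<^sub>m n m"
  using X assms(5)
proof (induction k arbitrary: X)
  case (Suc k)
  note X = Suc.prems(1)
  have P: "A ^\<^sub>m k \<in> carrier_mat n n" using A(1) by (rule pow_carrier_mat)
  have AX: "A * X \<in> carrier_mat n m" using A(1) X by (rule mult_carrier_mat)
  have "A ^\<^sub>m k * (A * X) = 0\<^sub>m n m"
    using Suc.prems(2) assoc_mult_mat[OF P A(1) X] by simp
  then have "A * X = 0\<^sub>m n m" by (rule Suc.IH[OF AX])
  then have "(B * A) * X = B * 0\<^sub>m n m" using assoc_mult_mat[OF A(2,1) X] by simp
  then show ?case using A X by simp
qed (use A in simp)

lemma mult_pow_eq_zero_cancel:
  fixes A X :: "complex mat"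
  assumes A: "A \<in> carrier_mat n n" "B \<in> carrier_mat n n" "A * B = 1\<^sub>m n" and X: "X \<in> carrier_mat m n"
    and "X * (A ^\<^sub>m k) = 0\<^sub>m m n"
  shows "X = 0\<^sub>m m n"
  using X assms(5)
proof (induction k arbitrary: X)
  case (Suc k)
  note X = Suc.prems(1)
  have P: "A ^\<^sub>m k \<in> carrier_mat n n" using A(1) by (rule pow_carrier_mat)
  have XP: "X * A ^\<^sub>m k \<in> carrier_mat m n" using X P by (rule mult_carrier_mat)
  have "(X * A ^\<^sub>m k) * A = 0\<^sub>m m n"
    using Suc.prems(2) assoc_mult_mat[OF X P A(1)] by simp
  then have "(X * A ^\<^sub>m k) * (A * B) = 0\<^sub>m m n * B" using assoc_mult_mat[OF XP A(1,2)] by simp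
  then have "X * A ^\<^sub>m k = 0\<^sub>m m n" using A XP by simp
  then show ?case by (rule Suc.IH[OF X])
qed (use A in simp)

lemma similar_mat_witE:
  fixes A :: "complex mat"
  assumes "similar_mat_wit A B T S" "A \<in> carrier_mat n n"
  shows "B \<in> carrier_mat n n" "T \<in> carrier_mat n n" "S \<in> carrier_mat n n" "T * S = 1\<^sub>m n" "S * T = 1\<^sub>m n"
    "A = T * B * S" "\<And>X. X \<in> carrier_mat n n \<Longrightarrow> S * (T * X) = X" "\<And>X. X \<in> carrier_mat n n \<Longrightarrow> T * (S * X) = X"
proof -
  note w = similar_mat_witD2[OF assms(2,1)]
  show "B \<in> carrier_mat n n" "T \<in> carrier_mat n n" "S \<in> carrier_mat n n" "T * S = 1\<^sub>m n" "S * T = 1\<^sub>m n"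
    "A = T * B * S"
    using w by auto
  fix X :: "complex mat" assume X: "X \<in> carrier_mat n n"
  show "S * (T * X) = X" using assoc_mult_mat[OF w(7,6) X] w(2) X by simp
  show "T * (S * X) = X" using assoc_mult_mat[OF w(6,7) X] w(1) X by simp
qed

lemma similar_mat_wit_intertwine:
  fixes A :: "complex mat"
  assumes "similar_mat_wit A B T S" "A \<in> carrier_mat n n"
  shows "S * A = B * S" "A * T = T * B"
proof -
  note s = similar_mat_witE[OF assms]
  have "S * A = (S * T) * B * S" unfolding s(6) using s(1-3)
    by (simp add: assoc_mult_mat[of _ n n _ n _ n])
  then show "S * A = B * S" using s(1,3) unfolding s(5) by simp
  have "A * T = T * B * (S * T)" unfolding s(6) using s(1-3)
    by (simp add: assoc_mult_mat[of _ n n _ n _ n])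
  then show "A * T = T * B" using s(1,2) unfolding s(5) by simp
qed

lemma diag_block_mat_carrier:
  assumes "\<And>x. x \<in> set xs \<Longrightarrow> f x \<in> carrier_mat (g x) (g x)"
  shows "diag_block_mat (map f xs) \<in> carrier_mat (sum_list (map g xs)) (sum_list (map g xs))"
proof -
  have "map (dim_row \<circ> f) xs = map g xs" "map (dim_col \<circ> f) xs = map g xs"
    using assms by auto
  then show ?thesis unfolding carrier_mat_def by (simp only: dim_diag_block_mat map_map mem_Collect_eq)
qed

lemma diag_block_mat_zero:
  assumes "\<And>A. A \<in> set As \<Longrightarrow> A = 0\<^sub>m (dim_row A) (dim_row A)"
  shows "diag_block_mat As = 0\<^sub>m (sum_list (map dim_row As)) (sum_list (map dim_row As))"
  using assms
proof (induction As)
  case (Cons A As)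
  then have IH: "diag_block_mat As = 0\<^sub>m (sum_list (map dim_row As)) (sum_list (map dim_row As))" by auto
  have A: "A = 0\<^sub>m (dim_row A) (dim_row A)" using Cons by auto
  obtain k where k: "A = 0\<^sub>m k k" using A by blast
  show ?case unfolding diag_block_mat.simps IH Let_def by (simp add: k)
qed simp

subsection \<open>Splitting off a generalized eigenspace\<close>

lemma similar_mat_swap_blocks:
  fixes A B :: "complex mat"
  assumes A: "A \<in> carrier_mat a a" and B: "B \<in> carrier_mat b b"
  shows "similar_mat (four_block_mat A (0\<^sub>m a b) (0\<^sub>m b a) B) (four_block_mat B (0\<^sub>m b a) (0\<^sub>m a b) A)"
proof -
  let ?P = "four_block_mat (0\<^sub>m a b) (1\<^sub>m a) (1\<^sub>m b) (0\<^sub>m b a) :: complex mat"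
  let ?Q = "four_block_mat (0\<^sub>m b a) (1\<^sub>m b) (1\<^sub>m a) (0\<^sub>m a b) :: complex mat"
  let ?M = "four_block_mat B (0\<^sub>m b a) (0\<^sub>m a b) A"
  note Pm = mult_four_block_mat[OF zero_carrier_mat[of a b] one_carrier_mat[of a] one_carrier_mat[of b] zero_carrier_mat[of b a]]
  note Qm = mult_four_block_mat[OF zero_carrier_mat[of b a] one_carrier_mat[of b] one_carrier_mat[of a] zero_carrier_mat[of a b]]
  have PQ: "?P * ?Q = 1\<^sub>m (a + b)"
    by (subst Pm[OF zero_carrier_mat[of b a] one_carrier_mat[of b] one_carrier_mat[of a] zero_carrier_mat[of a b]]) simp
  have "?Q * ?P = 1\<^sub>m (b + a)"
    by (subst Qm[OF zero_carrier_mat[of a b] one_carrier_mat[of a] one_carrier_mat[of b] zero_carrier_mat[of b a]]) simp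
  then have QP: "?Q * ?P = 1\<^sub>m (a + b)" by (simp only: add.commute)
  have PM: "?P * ?M = four_block_mat (0\<^sub>m a b) A B (0\<^sub>m b a)"
    using A B by (subst Pm[OF B zero_carrier_mat[of b a] zero_carrier_mat[of a b] A]) simp
  have "?P * ?M * ?Q = four_block_mat A (0\<^sub>m a b) (0\<^sub>m b a) B" unfolding PM
    using A B by (subst mult_four_block_mat[OF zero_carrier_mat[of a b] A B zero_carrier_mat[of b a]
        zero_carrier_mat[of b a] one_carrier_mat[of b] one_carrier_mat[of a] zero_carrier_mat[of a b]]) simp
  from this[symmetric] have "similar_mat_wit (four_block_mat A (0\<^sub>m a b) (0\<^sub>m b a) B) ?M ?P ?Q"
    by (rule similar_mat_witI[OF PQ QP]; intro carrier_matI; use A B in simp)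
  then show ?thesis unfolding similar_mat_def by blast
qed

text \<open>A Jordan form lists its blocks in no particular order. Collecting those with eigenvalue
  \<open>c\<close> in front displays the generalized eigenspace of \<open>c\<close> as a direct
  summand.\<close>

lemma similar_mat_jordan_partition:
  fixes nas :: "(nat \<times> complex) list" and c :: complex
  defines "F \<equiv> filter (\<lambda>na. snd na = c)" and "G \<equiv> filter (\<lambda>na. snd na \<noteq> c)"
  defines "k \<equiv> \<lambda>nas :: (nat \<times> complex) list. sum_list (map fst nas)"
  shows "similar_mat (jordan_matrix nas)
    (four_block_mat (jordan_matrix (F nas)) (0\<^sub>m (k (F nas)) (k (G nas))) (0\<^sub>m (k (G nas)) (k (F nas))) (jordan_matrix (G nas)))"
proof (induction nas)
  case Nil
  have "four_block_mat (jordan_matrix []) (0\<^sub>m 0 0) (0\<^sub>m 0 0) (jordan_matrix []) = (jordan_matrix [] :: complex mat)"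
    by (rule eq_matI) auto
  moreover have "jordan_matrix [] \<in> carrier_mat 0 (0::nat)" by (simp add: jordan_matrix_def)
  ultimately show ?case unfolding F_def G_def k_def using similar_mat_refl[of "jordan_matrix []" 0] by simp
next
  case (Cons na nas)
  obtain n a where na: "na = (n, a)" by force
  let ?A = "jordan_block n a" and ?f = "k (F nas)" and ?g = "k (G nas)"
  let ?JF = "jordan_matrix (F nas)" and ?JG = "jordan_matrix (G nas)"
  let ?I = "four_block_mat ?JF (0\<^sub>m ?f ?g) (0\<^sub>m ?g ?f) ?JG"
  have JF: "?JF \<in> carrier_mat ?f ?f" and JG: "?JG \<in> carrier_mat ?g ?g" unfolding k_def by simp_all
  have I: "?I \<in> carrier_mat (?f + ?g) (?f + ?g)" using JF JG by simp
  have kn: "k nas = ?f + ?g" unfolding k_def F_def G_def by (induction nas) auto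
  have J: "jordan_matrix nas \<in> carrier_mat (?f + ?g) (?f + ?g)"
    using jordan_matrix_carrier[of nas] kn unfolding k_def by simp
  have A: "?A \<in> carrier_mat n n" by simp
  have 1: "similar_mat (jordan_matrix (na # nas)) (four_block_mat ?A (0\<^sub>m n (?f + ?g)) (0\<^sub>m (?f + ?g) n) ?I)"
    using similar_mat_four_block_0_0[OF similar_mat_refl[OF A] Cons A J] kn
    unfolding na jordan_matrix_Cons k_def by simp
  \<comment> \<open>Regroups a direct sum of three blocks, so that only neighbouring blocks have to
    be exchanged.\<close>
  have assoc: "four_block_mat X (0\<^sub>m x (y + z)) (0\<^sub>m (y + z) x) (four_block_mat Y (0\<^sub>m y z) (0\<^sub>m z y) Z)
    = four_block_mat (four_block_mat X (0\<^sub>m x y) (0\<^sub>m y x) Y) (0\<^sub>m (x + y) z) (0\<^sub>m z (x + y)) Z"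
    if "X \<in> carrier_mat x x" "Y \<in> carrier_mat y y" "Z \<in> carrier_mat z z" for X Y Z :: "complex mat" and x y z
    using that by (intro eq_matI) auto
  show ?case
  proof (cases "a = c")
    case True
    have FF: "F (na # nas) = (n, a) # F nas" "G (na # nas) = G nas" using True by (simp_all add: F_def G_def na)
    then have "four_block_mat ?A (0\<^sub>m n (?f + ?g)) (0\<^sub>m (?f + ?g) n) ?I
      = four_block_mat (jordan_matrix (F (na # nas))) (0\<^sub>m (k (F (na # nas))) ?g) (0\<^sub>m ?g (k (F (na # nas)))) ?JG"
      unfolding assoc[OF A JF JG] FF jordan_matrix_Cons by (simp add: k_def)
    then show ?thesis using 1 FF by simp
  next
    case False
    have FF: "F (na # nas) = F nas" "G (na # nas) = (n, a) # G nas" using False by (simp_all add: F_def G_def na)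
    have swap: "four_block_mat (four_block_mat ?JF (0\<^sub>m ?f n) (0\<^sub>m n ?f) ?A) (0\<^sub>m (?f + n) ?g) (0\<^sub>m ?g (?f + n)) ?JG
      = four_block_mat ?JF (0\<^sub>m ?f (k (G (na # nas)))) (0\<^sub>m (k (G (na # nas))) ?f) (jordan_matrix (G (na # nas)))"
      unfolding assoc[OF JF A JG, symmetric] FF jordan_matrix_Cons by (simp add: k_def)
    have "similar_mat (four_block_mat ?A (0\<^sub>m n (?f + ?g)) (0\<^sub>m (?f + ?g) n) ?I)
      (four_block_mat (four_block_mat ?JF (0\<^sub>m ?f n) (0\<^sub>m n ?f) ?A) (0\<^sub>m (?f + n) ?g) (0\<^sub>m ?g (?f + n)) ?JG)"
      unfolding assoc[OF A JF JG]
      using similar_mat_four_block_0_0[OF similar_mat_swap_blocks[OF A JF] similar_mat_refl[OF JG], of "n + ?f" ?g] JF JG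
      by (simp add: add.commute)
    then show ?thesis using 1 similar_mat_trans unfolding swap FF by blast
  qed
qed

lemma jordan_matrix_shift:
  fixes nas :: "(nat \<times> complex) list"
  shows "jordan_matrix nas - c \<cdot>\<^sub>m 1\<^sub>m (sum_list (map fst nas)) = jordan_matrix (map (\<lambda>(n, a). (n, a - c)) nas)"
proof (induction nas)
  case Nil
  show ?case by (rule eq_matI) (auto simp: jordan_matrix_def)
next
  case (Cons na nas)
  obtain n a where na: "na = (n, a)" by force
  have s: "sum_list (map fst (map (\<lambda>(n, a). (n, a - c)) nas)) = sum_list (map fst nas)"
    by (induction nas) auto
  have ix: "(jordan_matrix nas - c \<cdot>\<^sub>m 1\<^sub>m (sum_list (map fst nas))) $$ (i, j)
    = jordan_matrix (map (\<lambda>(n, a). (n, a - c)) nas) $$ (i, j)" for i j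
    by (simp add: Cons)
  show ?case
  proof (rule eq_matI)
    fix i j
    assume ij: "i < dim_row (jordan_matrix (map (\<lambda>(n, a). (n, a - c)) (na # nas)))"
      "j < dim_col (jordan_matrix (map (\<lambda>(n, a). (n, a - c)) (na # nas)))"
    then have ij': "i < n + sum_list (map fst nas)" "j < n + sum_list (map fst nas)"
      using s by (simp_all add: na)
    show "(jordan_matrix (na # nas) - c \<cdot>\<^sub>m 1\<^sub>m (sum_list (map fst (na # nas)))) $$ (i, j)
      = jordan_matrix (map (\<lambda>(n, a). (n, a - c)) (na # nas)) $$ (i, j)"
    proof (cases "i - n = j - n \<and> \<not> i < n \<and> \<not> j < n")
      case True
      then have "i = j" by arith
      then show ?thesis
        using ij' ix[of "i - n" "j - n"] s unfolding na list.map prod.case jordan_matrix_Cons by auto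
    next
      case False
      then show ?thesis
        using ij' ix[of "i - n" "j - n"] s unfolding na list.map prod.case jordan_matrix_Cons by auto
    qed
  qed (use s in \<open>simp_all add: na\<close>)
qed

text \<open>The exponent may exceed the size because it will be the size of the surrounding
  matrix.\<close>

lemma jordan_matrix_nilpotent:
  fixes nas :: "(nat \<times> complex) list"
  assumes "\<And>na. na \<in> set nas \<Longrightarrow> snd na = c" "sum_list (map fst nas) \<le> r"
  shows "(jordan_matrix nas - c \<cdot>\<^sub>m 1\<^sub>m (sum_list (map fst nas))) ^\<^sub>m r
    = 0\<^sub>m (sum_list (map fst nas)) (sum_list (map fst nas))"
proof -
  let ?nas = "map (\<lambda>(n, a). (n, a - c)) nas"
  let ?Bs = "map (\<lambda>(n, a). jordan_block n (a - c) ^\<^sub>m r) nas"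
  have s: "sum_list (map fst ?nas) = sum_list (map fst nas)" by (induction nas) auto
  have "A = 0\<^sub>m (dim_row A) (dim_row A)" if A: "A \<in> set ?Bs" for A
  proof -
    obtain n a where na: "(n, a) \<in> set nas" "A = jordan_block n (a - c) ^\<^sub>m r"
      using A by auto
    have "n \<le> r" using na(1) assms(2) member_le_sum_list[of n "map fst nas"] by force
    then show ?thesis using na assms(1)[OF na(1)] by (auto simp: jordan_block_zero_pow intro!: eq_matI)
  qed
  then have "diag_block_mat ?Bs = 0\<^sub>m (sum_list (map dim_row ?Bs)) (sum_list (map dim_row ?Bs))"
    by (rule diag_block_mat_zero)
  moreover have "map dim_row ?Bs = map fst nas" by (auto simp: o_def split: prod.split)
  moreover have "map (\<lambda>(n, a). jordan_block n a ^\<^sub>m r) ?nas = ?Bs" by auto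
  ultimately show ?thesis unfolding jordan_matrix_shift jordan_matrix_pow by (simp only:)
qed

lemma jordan_matrix_not_eigenvalue:
  fixes nas :: "(nat \<times> complex) list"
  assumes "\<And>na. na \<in> set nas \<Longrightarrow> snd na \<noteq> c"
  shows "\<not> eigenvalue (jordan_matrix nas) c"
proof -
  have "poly (char_poly (jordan_matrix nas)) c \<noteq> 0"
    unfolding jordan_matrix_char_poly using assms by (fastforce simp: poly_prod_list prod_list_zero_iff o_def)
  then show ?thesis using eigenvalue_root_char_poly[OF jordan_matrix_carrier] by blast
qed

lemma shift_inverse_exists:
  fixes A :: "complex mat"
  assumes A: "A \<in> carrier_mat n n" and "\<not> eigenvalue A c"
  shows "\<exists>B. B \<in> carrier_mat n n \<and> (A - c \<cdot>\<^sub>m 1\<^sub>m n) * B = 1\<^sub>m n \<and> B * (A - c \<cdot>\<^sub>m 1\<^sub>m n) = 1\<^sub>m n"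
proof (rule mat_inverse_exists)
  show "A - c \<cdot>\<^sub>m 1\<^sub>m n \<in> carrier_mat n n" using A by auto
  fix v assume v: "v \<in> carrier_vec n" "(A - c \<cdot>\<^sub>m 1\<^sub>m n) *\<^sub>v v = 0\<^sub>v n"
  have "(A - c \<cdot>\<^sub>m 1\<^sub>m n) *\<^sub>v v = A *\<^sub>v v - (c \<cdot>\<^sub>m 1\<^sub>m n) *\<^sub>v v"
    using A v by (intro minus_mult_distrib_mat_vec) auto
  also have "(c \<cdot>\<^sub>m 1\<^sub>m n) *\<^sub>v v = c \<cdot>\<^sub>v v" 
    using v by (intro eq_vecI) (auto simp: scalar_prod_def mult_delta_left mult_delta_right)
  finally have eq0: "A *\<^sub>v v - c \<cdot>\<^sub>v v = 0\<^sub>v n" using v(2) by simp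
  have "A *\<^sub>v v = c \<cdot>\<^sub>v v"
  proof (rule eq_vecI)
    fix i assume "i < dim_vec (c \<cdot>\<^sub>v v)"
    then have i: "i < n" using v by simp
    have "vec_index (A *\<^sub>v v - c \<cdot>\<^sub>v v) i = 0" unfolding eq0 using i by simp
    then show "vec_index (A *\<^sub>v v) i = vec_index (c \<cdot>\<^sub>v v) i" using i v A by simp
  qed (use v A in simp)
  then show "v = 0\<^sub>v n" using assms(2) v A unfolding eigenvalue_def eigenvector_def by auto
qed

text \<open>The off-diagonal block \<open>Z2\<close> solves \<open>N * Z2 = Z2 * M\<close>, and the
  relation persists for powers of the matrices shifted by \<open>c\<close>. The shifted
  \<open>N\<close> has vanishing power \<open>r\<close> while the shifted \<open>M\<close> is
  invertible, so \<open>Z2\<close> is 0; \<open>Z3\<close> is treated in the same way.\<close>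

lemma commuting_block_split:
  fixes N M Z1 Z2 Z3 Z4 :: "complex mat"
  assumes N: "N \<in> carrier_mat k k" "(N - c \<cdot>\<^sub>m 1\<^sub>m k) ^\<^sub>m r = 0\<^sub>m k k"
    and M: "M \<in> carrier_mat m m" "\<not> eigenvalue M c"
    and Z: "Z1 \<in> carrier_mat k k" "Z2 \<in> carrier_mat k m" "Z3 \<in> carrier_mat m k" "Z4 \<in> carrier_mat m m"
    and comm: "four_block_mat N (0\<^sub>m k m) (0\<^sub>m m k) M * four_block_mat Z1 Z2 Z3 Z4
      = four_block_mat Z1 Z2 Z3 Z4 * four_block_mat N (0\<^sub>m k m) (0\<^sub>m m k) M"
  shows "Z2 = 0\<^sub>m k m" "Z3 = 0\<^sub>m m k"
proof -
  have l: "four_block_mat N (0\<^sub>m k m) (0\<^sub>m m k) M * four_block_mat Z1 Z2 Z3 Z4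
    = four_block_mat (N * Z1) (N * Z2) (M * Z3) (M * Z4)"
    using N M Z by (subst mult_four_block_mat[OF N(1) zero_carrier_mat zero_carrier_mat M(1) Z]) simp
  have rr: "four_block_mat Z1 Z2 Z3 Z4 * four_block_mat N (0\<^sub>m k m) (0\<^sub>m m k) M
    = four_block_mat (Z1 * N) (Z2 * M) (Z3 * N) (Z4 * M)"
    using N M Z by (subst mult_four_block_mat[OF Z N(1) zero_carrier_mat zero_carrier_mat M(1)]) simp
  have eq: "four_block_mat (N * Z1) (N * Z2) (M * Z3) (M * Z4) = four_block_mat (Z1 * N) (Z2 * M) (Z3 * N) (Z4 * M)"
    using comm unfolding l rr .
  have 2: "N * Z2 = Z2 * M"
  proof (rule eq_matI)
    fix i j assume "i < dim_row (Z2 * M)" "j < dim_col (Z2 * M)"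
    then have ij: "i < k" "j < m" using Z M by auto
    then show "(N * Z2) $$ (i, j) = (Z2 * M) $$ (i, j)"
      using arg_cong[OF eq, of "\<lambda>A. A $$ (i, j + k)"] N M Z by (simp del: index_mult_mat(1))
  qed (use N M Z in auto)
  have 3: "M * Z3 = Z3 * N"
  proof (rule eq_matI)
    fix i j assume "i < dim_row (Z3 * N)" "j < dim_col (Z3 * N)"
    then have ij: "i < m" "j < k" using Z N by auto
    then show "(M * Z3) $$ (i, j) = (Z3 * N) $$ (i, j)"
      using arg_cong[OF eq, of "\<lambda>A. A $$ (i + k, j)"] N M Z by (simp del: index_mult_mat(1))
  qed (use N M Z in auto)
  let ?N = "N - c \<cdot>\<^sub>m 1\<^sub>m k" and ?M = "M - c \<cdot>\<^sub>m 1\<^sub>m m"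
  have cN: "?N \<in> carrier_mat k k" and cM: "?M \<in> carrier_mat m m" using N M by auto
  obtain B where B: "B \<in> carrier_mat m m" "?M * B = 1\<^sub>m m" "B * ?M = 1\<^sub>m m"
    using shift_inverse_exists[OF M] by blast
  have "Z2 * ?M ^\<^sub>m r = 0\<^sub>m k m"
    using mat_intertwine_pow[OF cM cN Z(2) mat_intertwine_shift[OF M(1) N(1) Z(2) 2[symmetric]], of r] N(2) Z(2)
    by simp
  then show "Z2 = 0\<^sub>m k m" by (rule mult_pow_eq_zero_cancel[OF cM B(1,2) Z(2)])
  have "?M ^\<^sub>m r * Z3 = 0\<^sub>m m k"
    using mat_intertwine_pow[OF cN cM Z(3) mat_intertwine_shift[OF N(1) M(1) Z(3) 3[symmetric]], of r] N(2) Z(3)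
    by simp
  then show "Z3 = 0\<^sub>m m k" by (rule pow_mult_eq_zero_cancel[OF cM B(1,3) Z(3)])
qed

lemma similar_mat_wit_shift_pow:
  fixes A :: "complex mat"
  assumes s: "similar_mat_wit A B T S" and A: "A \<in> carrier_mat n n"
  shows "(A - c \<cdot>\<^sub>m 1\<^sub>m n) ^\<^sub>m r = 0\<^sub>m n n \<longleftrightarrow> (B - c \<cdot>\<^sub>m 1\<^sub>m n) ^\<^sub>m r = 0\<^sub>m n n"
proof -
  note w = similar_mat_witE[OF s A]
  have cA: "A - c \<cdot>\<^sub>m 1\<^sub>m n \<in> carrier_mat n n" and cB: "B - c \<cdot>\<^sub>m 1\<^sub>m n \<in> carrier_mat n n" using A w by auto
  note p = pow_carrier_mat[OF cA, of r] pow_carrier_mat[OF cB, of r]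
  have TB: "T * (B - c \<cdot>\<^sub>m 1\<^sub>m n) ^\<^sub>m r = (A - c \<cdot>\<^sub>m 1\<^sub>m n) ^\<^sub>m r * T"
    by (rule mat_intertwine_pow[OF cB cA w(2) mat_intertwine_shift[OF w(1) A w(2) similar_mat_wit_intertwine(2)[OF s A, symmetric]]])
  have "S * (A - c \<cdot>\<^sub>m 1\<^sub>m n) ^\<^sub>m r * T = S * (T * (B - c \<cdot>\<^sub>m 1\<^sub>m n) ^\<^sub>m r)"
    unfolding TB using w(2,3) p by (simp add: assoc_mult_mat[of _ n n _ n _ n])
  then have 1: "S * (A - c \<cdot>\<^sub>m 1\<^sub>m n) ^\<^sub>m r * T = (B - c \<cdot>\<^sub>m 1\<^sub>m n) ^\<^sub>m r" unfolding w(7)[OF p(2)] .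
  have "T * (B - c \<cdot>\<^sub>m 1\<^sub>m n) ^\<^sub>m r * S = (A - c \<cdot>\<^sub>m 1\<^sub>m n) ^\<^sub>m r * (T * S)"
    unfolding TB using w(2,3) p by (simp add: assoc_mult_mat[of _ n n _ n _ n])
  then have 2: "T * (B - c \<cdot>\<^sub>m 1\<^sub>m n) ^\<^sub>m r * S = (A - c \<cdot>\<^sub>m 1\<^sub>m n) ^\<^sub>m r" using w(4) p by simp
  show ?thesis
  proof
    assume "(A - c \<cdot>\<^sub>m 1\<^sub>m n) ^\<^sub>m r = 0\<^sub>m n n"
    with 1 w(1-3) show "(B - c \<cdot>\<^sub>m 1\<^sub>m n) ^\<^sub>m r = 0\<^sub>m n n" by simp
  next
    assume "(B - c \<cdot>\<^sub>m 1\<^sub>m n) ^\<^sub>m r = 0\<^sub>m n n"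
    with 2 w(1-3) show "(A - c \<cdot>\<^sub>m 1\<^sub>m n) ^\<^sub>m r = 0\<^sub>m n n" by simp
  qed
qed

lemma similar_mat_wit_common:
  fixes y :: "'d \<Rightarrow> complex mat"
  assumes "T \<in> carrier_mat n n" "S \<in> carrier_mat n n" "T * S = 1\<^sub>m n" "S * T = 1\<^sub>m n" "y i \<in> carrier_mat n n"
  shows "similar_mat_wit (y i) (S * y i * T) T S"
proof (rule similar_mat_witI[OF assms(3,4)])
  have "T * (S * y i) = y i" using assoc_mult_mat[OF assms(1,2,5)] assms(3,5) by simp
  then show "y i = T * (S * y i * T) * S" using assms by (simp add: assoc_mult_mat[of _ n n _ n _ n])
qed (use assms in auto)

lemma four_block_empty:
  fixes A M :: "complex mat"
  assumes "A \<in> carrier_mat k k" "M \<in> carrier_mat 0 0"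
  shows "four_block_mat A B C M = A"
  using assms by (intro eq_matI) auto

text \<open>A coordinate that is not a scalar plus a nilpotent has at least two eigenvalues, so the
  generalized eigenspace of one of them is proper. Whatever commutes with this coordinate respects
  the splitting, hence the whole tuple does.\<close>

lemma commuting_tuple_split:
  fixes y :: "'d \<Rightarrow> complex mat"
  assumes y: "\<And>i. y i \<in> carrier_mat n n" and comm: "\<And>i j. y i * y j = y j * y i"
    and n: "n > 0" and nonnil: "\<And>c. (y i0 - c \<cdot>\<^sub>m 1\<^sub>m n) ^\<^sub>m n \<noteq> 0\<^sub>m n n"
  shows "\<exists>k m T S u v. n = k + m \<and> k > 0 \<and> m > 0 \<and> (\<forall>i. u i \<in> carrier_mat k k) \<and> (\<forall>i. v i \<in> carrier_mat m m) \<and>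
    (\<forall>i j. u i * u j = u j * u i) \<and> (\<forall>i j. v i * v j = v j * v i) \<and>
    (\<forall>i. similar_mat_wit (y i) (four_block_mat (u i) (0\<^sub>m k m) (0\<^sub>m m k) (v i)) T S)"
proof -
  obtain as where "char_poly (y i0) = (\<Prod>a\<leftarrow>as. [:- a, 1:])" using char_poly_factorized[OF y] by auto
  then obtain nas where nas: "jordan_nf (y i0) nas" using jordan_nf_exists[OF y] by blast
  then have sim0: "similar_mat (y i0) (jordan_matrix nas)" and no0: "0 \<notin> fst ` set nas"
    by (auto simp: jordan_nf_def)
  have dim: "sum_list (map fst nas) = n"
  proof -
    obtain T S where "similar_mat_wit (y i0) (jordan_matrix nas) T S" using sim0 by (auto simp: similar_mat_def)
    from similar_mat_witE(1)[OF this y] show ?thesis by auto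
  qed
  then have "nas \<noteq> []" using n by auto
  \<comment> \<open>Any eigenvalue would do; taking the one of the first Jordan block makes it easy
    to see that the first summand is nonempty. That the second one is nonempty follows from
    \<open>nonnil\<close>.\<close>
  define c where "c = snd (hd nas)"
  define F where "F = filter (\<lambda>na. snd na = c) nas"
  define G where "G = filter (\<lambda>na. snd na \<noteq> c) nas"
  define k where "k = sum_list (map fst F)"
  define m where "m = sum_list (map fst G)"
  have nkm: "n = k + m" unfolding dim[symmetric] k_def m_def F_def G_def by (induction nas) auto
  let ?N = "jordan_matrix F" and ?M = "jordan_matrix G"
  let ?B = "four_block_mat ?N (0\<^sub>m k m) (0\<^sub>m m k) ?M"
  have N: "?N \<in> carrier_mat k k" and M: "?M \<in> carrier_mat m m" by (simp_all add: k_def m_def)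
  have Nnil: "(?N - c \<cdot>\<^sub>m 1\<^sub>m k) ^\<^sub>m n = 0\<^sub>m k k"
    using jordan_matrix_nilpotent[of F c n] nkm by (auto simp: F_def k_def)
  have Mev: "\<not> eigenvalue ?M c" by (rule jordan_matrix_not_eigenvalue) (simp add: G_def)
  have "similar_mat (y i0) ?B"
    using similar_mat_trans[OF sim0 similar_mat_jordan_partition[of nas c]]
    unfolding F_def[symmetric] G_def[symmetric] k_def[symmetric] m_def[symmetric] .
  then obtain T S where TS: "similar_mat_wit (y i0) ?B T S" by (auto simp: similar_mat_def)
  note w = similar_mat_witE[OF TS y]
  have k: "k > 0"
  proof -
    have hd: "hd nas \<in> set F" using \<open>nas \<noteq> []\<close> by (simp add: F_def c_def)
    then have "fst (hd nas) \<le> k" unfolding k_def by (intro member_le_sum_list) auto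
    moreover have "fst (hd nas) > 0" using no0 \<open>nas \<noteq> []\<close> by (metis gr0I hd_in_set imageI)
    ultimately show ?thesis by simp
  qed
  have m: "m > 0"
  proof (rule ccontr)
    assume "\<not> m > 0"
    then have "m = 0" "n = k" using nkm by auto
    then have "?B = ?N" using four_block_empty[OF N, of ?M] M by simp
    then have "(?B - c \<cdot>\<^sub>m 1\<^sub>m n) ^\<^sub>m n = 0\<^sub>m n n" using Nnil \<open>n = k\<close> by simp
    then show False using similar_mat_wit_shift_pow[OF TS y] nonnil by blast
  qed
  define z where "z i = S * y i * T" for i
  have zc: "z i \<in> carrier_mat n n" for i using w y by (auto simp: z_def)
  note as = assoc_mult_mat[of _ n n _ n _ n]
  have zz: "z i * z j = S * (y i * y j) * T" for i j
  proof -
    have c: "y j * T \<in> carrier_mat n n" using y w(2) by (rule mult_carrier_mat)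
    have "z i * z j = S * (y i * (T * (S * (y j * T))))" using w(2,3) y[of i] y[of j] c unfolding z_def by (simp add: as)
    also have "T * (S * (y j * T)) = y j * T" using c by (rule w(8))
    also have "S * (y i * (y j * T)) = S * (y i * y j) * T" using w(2,3) y[of i] y[of j] by (simp add: as)
    finally show ?thesis .
  qed
  have zcomm: "z i * z j = z j * z i" for i j unfolding zz comm[of i j] ..
  have z0: "z i0 = ?B"
  proof -
    have "z i0 = S * (T * (?B * (S * T)))" unfolding z_def using w(1-3) by (subst w(6)) (simp add: as)
    also have "?B * (S * T) = ?B" using w(1) unfolding w(5) by (rule right_mult_one_mat)
    finally show ?thesis unfolding w(7)[OF w(1)] .
  qed
  define Z where "Z i = split_block (z i) k k" for i
  obtain u z2 z3 v where Zi: "\<And>i. Z i = (u i, z2 i, z3 i, v i)"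
    by (rule that[of "\<lambda>i. fst (Z i)" "\<lambda>i. fst (snd (Z i))" "\<lambda>i. fst (snd (snd (Z i)))" "\<lambda>i. snd (snd (snd (Z i)))"]) simp
  have sb: "u i \<in> carrier_mat k k" "z2 i \<in> carrier_mat k m" "z3 i \<in> carrier_mat m k" "v i \<in> carrier_mat m m"
    "z i = four_block_mat (u i) (z2 i) (z3 i) (v i)" for i
    using split_block[OF Zi[unfolded Z_def], of i m m] zc[of i] nkm by auto
  have zero: "z2 i = 0\<^sub>m k m" "z3 i = 0\<^sub>m m k" for i
    using commuting_block_split[OF N Nnil M Mev sb(1-4)[of i]] zcomm[of i0 i] unfolding z0 sb(5)[symmetric] by blast+
  have zi: "z i = four_block_mat (u i) (0\<^sub>m k m) (0\<^sub>m m k) (v i)" for i using sb(5)[of i] unfolding zero .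
  have prod: "z i * z j = four_block_mat (u i * u j) (0\<^sub>m k m) (0\<^sub>m m k) (v i * v j)" for i j
    unfolding zi using sb(1,4)[of i] sb(1,4)[of j]
    by (subst mult_four_block_mat[OF sb(1) zero_carrier_mat zero_carrier_mat sb(4) sb(1) zero_carrier_mat zero_carrier_mat sb(4)]) simp
  have uc: "u i * u j = u j * u i" for i j
  proof (rule eq_matI)
    fix a b assume "a < dim_row (u j * u i)" "b < dim_col (u j * u i)"
    then have "a < k" "b < k" using sb(1)[of i] sb(1)[of j] by auto
    then show "(u i * u j) $$ (a, b) = (u j * u i) $$ (a, b)"
      using arg_cong[OF zcomm[of i j, unfolded prod], of "\<lambda>A. A $$ (a, b)"] sb(1,4)[of i] sb(1,4)[of j]
      by (simp del: index_mult_mat(1))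
  qed (use sb(1)[of i] sb(1)[of j] in auto)
  have vc: "v i * v j = v j * v i" for i j
  proof (rule eq_matI)
    fix a b assume "a < dim_row (v j * v i)" "b < dim_col (v j * v i)"
    then have "a < m" "b < m" using sb(4)[of i] sb(4)[of j] by auto
    then show "(v i * v j) $$ (a, b) = (v j * v i) $$ (a, b)"
      using arg_cong[OF zcomm[of i j, unfolded prod], of "\<lambda>A. A $$ (a + k, b + k)"] sb(1,4)[of i] sb(1,4)[of j]
      by (simp del: index_mult_mat(1))
  qed (use sb(4)[of i] sb(4)[of j] in auto)
  have "similar_mat_wit (y i) (four_block_mat (u i) (0\<^sub>m k m) (0\<^sub>m m k) (v i)) T S" for i
    using similar_mat_wit_common[where y = y, OF w(2,3,4,5) y] unfolding zi[symmetric] z_def .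
  with nkm k m sb(1,4) uc vc show ?thesis by blast
qed

text \<open>Induction on the size: either every coordinate is a scalar plus a nilpotent and the
  tuple is its own summand, or it splits into two smaller commuting tuples.\<close>

lemma nilpotent_decomposition_exists:
  fixes y :: "'d \<Rightarrow> complex mat"
  assumes "\<And>i. y i \<in> carrier_mat n n" "\<And>i j. y i * y j = y j * y i" "n > 0"
  shows "\<exists>T S xs. (\<forall>x\<in>set xs. x \<in> comm_universe \<and> (\<forall>i. \<exists>c. (x i - c \<cdot>\<^sub>m 1\<^sub>m (level x)) ^\<^sub>m level x = 0\<^sub>m (level x) (level x))) \<and>
    (\<forall>i. similar_mat_wit (y i) (diag_block_mat (map (\<lambda>x. x i) xs)) T S)"
  using assms
proof (induction n arbitrary: y rule: less_induct)
  case (less n)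
  show ?case
  proof (cases "\<forall>i. \<exists>c. (y i - c \<cdot>\<^sub>m 1\<^sub>m n) ^\<^sub>m n = 0\<^sub>m n n")
    case True
    have "n \<ge> 1" using less.prems(3) by simp
    note u = matrix_universeI[where x = y and n = n, OF less.prems(1) this]
    then have "y \<in> comm_universe" using less.prems(2) by (auto simp: comm_universe_def)
    moreover have "\<forall>i. similar_mat_wit (y i) (diag_block_mat (map (\<lambda>x. x i) [y])) (1\<^sub>m n) (1\<^sub>m n)"
      using similar_mat_wit_refl[OF less.prems(1)] by (simp only: list.map diag_block_mat_singleton) simp
    ultimately show ?thesis using True u(2)
      by (intro exI[of _ "1\<^sub>m n"] exI[of _ "[y]"]) auto
  next
    case False
    then obtain i0 where "\<And>c. (y i0 - c \<cdot>\<^sub>m 1\<^sub>m n) ^\<^sub>m n \<noteq> 0\<^sub>m n n" by blast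
    from commuting_tuple_split[where y = y and n = n, OF less.prems(1,2,3) this]
    obtain k m T S u v where kn: "n = k + m" "k > 0" "m > 0"
      and u: "\<And>i. u i \<in> carrier_mat k k" "\<And>i j. u i * u j = u j * u i"
      and v: "\<And>i. v i \<in> carrier_mat m m" "\<And>i j. v i * v j = v j * v i"
      and sim: "\<And>i. similar_mat_wit (y i) (four_block_mat (u i) (0\<^sub>m k m) (0\<^sub>m m k) (v i)) T S"
      by blast
    have "k < n" using kn by simp
    from less.IH[of k u, OF this u kn(2)]
    obtain T1 S1 us where us: "\<forall>x\<in>set us. x \<in> comm_universe \<and> (\<forall>i. \<exists>c. (x i - c \<cdot>\<^sub>m 1\<^sub>m (level x)) ^\<^sub>m level x = 0\<^sub>m (level x) (level x))"
      "\<forall>i. similar_mat_wit (u i) (diag_block_mat (map (\<lambda>x. x i) us)) T1 S1"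
      by (elim exE conjE)
    have "m < n" using kn by simp
    from less.IH[of m v, OF this v kn(3)]
    obtain T2 S2 vs where vs: "\<forall>x\<in>set vs. x \<in> comm_universe \<and> (\<forall>i. \<exists>c. (x i - c \<cdot>\<^sub>m 1\<^sub>m (level x)) ^\<^sub>m level x = 0\<^sub>m (level x) (level x))"
      "\<forall>i. similar_mat_wit (v i) (diag_block_mat (map (\<lambda>x. x i) vs)) T2 S2"
      by (elim exE conjE)
    let ?P = "four_block_mat T1 (0\<^sub>m k m) (0\<^sub>m m k) T2" and ?Q = "four_block_mat S1 (0\<^sub>m k m) (0\<^sub>m m k) S2"
    have "similar_mat_wit (four_block_mat (u i) (0\<^sub>m k m) (0\<^sub>m m k) (v i)) (diag_block_mat (map (\<lambda>x. x i) (us @ vs))) ?P ?Q" for i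
    proof -
      note wu = similar_mat_witE[OF us(2)[THEN spec] u(1)[of i]] and wv = similar_mat_witE[OF vs(2)[THEN spec] v(1)[of i]]
      have "diag_block_mat (map (\<lambda>x. x i) (us @ vs)) = four_block_mat (diag_block_mat (map (\<lambda>x. x i) us)) (0\<^sub>m k m) (0\<^sub>m m k) (diag_block_mat (map (\<lambda>x. x i) vs))"
        using wu(1) wv(1) unfolding map_append diag_block_mat_append Let_def by auto
      moreover have "0\<^sub>m k m = T1 * 0\<^sub>m k m * S2" "0\<^sub>m m k = T2 * 0\<^sub>m m k * S1" using wu(2,3) wv(2,3) by simp_all
      ultimately show ?thesis
        using similar_mat_wit_four_block[OF us(2)[THEN spec] vs(2)[THEN spec] _ _ u(1) v(1) zero_carrier_mat zero_carrier_mat, of "0\<^sub>m k m" "0\<^sub>m m k"] by simp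
    qed
    from similar_mat_wit_trans[OF sim this] us(1) vs(1) show ?thesis
      by (intro exI[of _ "T * ?P"] exI[of _ "?Q * S"] exI[of _ "us @ vs"]) auto
  qed
qed

subsection \<open>Nilpotent tuples and one-point spectra\<close>

lemma shift_tuple_universe:
  assumes "x \<in> matrix_universe"
  shows "shift_tuple x l \<in> matrix_universe" "level (shift_tuple x l) = level x"
proof -
  have "shift_tuple x l i \<in> carrier_mat (level x) (level x)" for i
    using matrix_universeE(2)[OF assms, of i] by (auto simp: shift_tuple_def)
  from matrix_universeI[where x = "shift_tuple x l", OF this matrix_universeE(1)[OF assms]]
  show "shift_tuple x l \<in> matrix_universe" "level (shift_tuple x l) = level x" by auto
qed

lemma shift_tuple_comm:
  assumes "x \<in> comm_universe"
  shows "shift_tuple x l \<in> comm_universe"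
proof -
  note u = comm_universeD(1)[OF assms]
  note c = matrix_universeE(2)[OF u]
  have "shift_tuple x l i * shift_tuple x l j = shift_tuple x l j * shift_tuple x l i" for i j
  proof -
    have "x i * shift_tuple x l j = shift_tuple x l j * x i"
      unfolding shift_tuple_def by (rule mat_intertwine_shift[OF c c c comm_universeD(2)[OF assms]])
    then have "shift_tuple x l j * x i = x i * shift_tuple x l j" ..
    moreover have "shift_tuple x l j \<in> carrier_mat (level x) (level x)"
      using c[of j] by (auto simp: shift_tuple_def)
    ultimately have "shift_tuple x l j * (x i - (l $ i) \<cdot>\<^sub>m 1\<^sub>m (level x)) = (x i - (l $ i) \<cdot>\<^sub>m 1\<^sub>m (level x)) * shift_tuple x l j"
      by (intro mat_intertwine_shift[OF c c])
    then show ?thesis by (simp add: shift_tuple_def)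
  qed
  then show ?thesis using shift_tuple_universe[OF u] by (simp add: comm_universe_def)
qed

lemma shift_mult_vec:
  fixes A :: "complex mat"
  assumes "A \<in> carrier_mat n n" "v \<in> carrier_vec n"
  shows "(A - c \<cdot>\<^sub>m 1\<^sub>m n) *\<^sub>v v = A *\<^sub>v v - c \<cdot>\<^sub>v v"
proof -
  have "(A - c \<cdot>\<^sub>m 1\<^sub>m n) *\<^sub>v v = A *\<^sub>v v - (c \<cdot>\<^sub>m 1\<^sub>m n) *\<^sub>v v"
    using assms by (intro minus_mult_distrib_mat_vec) auto
  also have "(c \<cdot>\<^sub>m 1\<^sub>m n) *\<^sub>v v = c \<cdot>\<^sub>v v"
    using assms by (intro eq_vecI) (auto simp: scalar_prod_def mult_delta_left mult_delta_right)
  finally show ?thesis .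
qed

lemma eigenvector_shift_iff:
  fixes A :: "complex mat"
  assumes "A \<in> carrier_mat n n"
  shows "eigenvector (A - c \<cdot>\<^sub>m 1\<^sub>m n) v (z - c) \<longleftrightarrow> eigenvector A v z"
proof -
  have "(A *\<^sub>v v - c \<cdot>\<^sub>v v = (z - c) \<cdot>\<^sub>v v) \<longleftrightarrow> A *\<^sub>v v = z \<cdot>\<^sub>v v" if v: "v \<in> carrier_vec n"
  proof
    assume *: "A *\<^sub>v v - c \<cdot>\<^sub>v v = (z - c) \<cdot>\<^sub>v v"
    show "A *\<^sub>v v = z \<cdot>\<^sub>v v"
    proof (rule eq_vecI)
      fix i assume "i < dim_vec (z \<cdot>\<^sub>v v)"
      then have i: "i < n" using v by simp
      have "vec_index (A *\<^sub>v v - c \<cdot>\<^sub>v v) i = vec_index ((z - c) \<cdot>\<^sub>v v) i" unfolding * ..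
      then show "vec_index (A *\<^sub>v v) i = vec_index (z \<cdot>\<^sub>v v) i" using i v assms by (simp add: algebra_simps)
    qed (use v assms in simp)
  next
    assume "A *\<^sub>v v = z \<cdot>\<^sub>v v"
    then show "A *\<^sub>v v - c \<cdot>\<^sub>v v = (z - c) \<cdot>\<^sub>v v"
      using v by (intro eq_vecI) (auto simp: left_diff_distrib)
  qed
  then show ?thesis using assms by (auto simp: eigenvector_def shift_mult_vec[OF assms])
qed

lemma monomial_value_zeroI:
  fixes x :: "'d::finite \<Rightarrow> complex mat"
  assumes x: "x \<in> matrix_universe" and z: "x i ^\<^sub>m Poly_Mapping.lookup m i = 0\<^sub>m (level x) (level x)"
  shows "monomial_value x m = 0\<^sub>m (level x) (level x)"
proof -
  let ?n = "level x"
  let ?F = "\<lambda>is. foldr (\<lambda>i M. (x i ^\<^sub>m Poly_Mapping.lookup m i) * M) is (1\<^sub>m ?n)"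
  note pc = pow_carrier_mat[OF matrix_universeE(2)[OF x]]
  have car: "?F is \<in> carrier_mat ?n ?n" for "is"
    by (induction "is") (auto intro!: mult_carrier_mat pc)
  have "i \<in> set is \<Longrightarrow> ?F is = 0\<^sub>m ?n ?n" for "is"
  proof (induction "is")
    case (Cons j js)
    show ?case
    proof (cases "j = i")
      case True
      then show ?thesis using z left_mult_zero_mat[OF car[of js]] by simp
    next
      case False
      then show ?thesis using Cons right_mult_zero_mat[OF pc] by simp
    qed
  qed simp
  then show ?thesis by (simp add: monomial_value_def variables)
qed

lemma pow_mat_zero_mono:
  fixes A :: "complex mat"
  assumes "A \<in> carrier_mat n n" "A ^\<^sub>m k = 0\<^sub>m n n" "k \<le> r"
  shows "A ^\<^sub>m r = 0\<^sub>m n n"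
  using assms(3) by (induction rule: dec_induct) (use assms in auto)

lemma finite_nonzero_monomials:
  fixes x :: "'d::finite \<Rightarrow> complex mat"
  assumes x: "x \<in> matrix_universe" and nil: "\<And>i. x i ^\<^sub>m N = 0\<^sub>m (level x) (level x)"
  shows "finite {m. monomial_value x m \<noteq> 0\<^sub>m (level x) (level x)}"
proof (rule finite_subset)
  show "{m. monomial_value x m \<noteq> 0\<^sub>m (level x) (level x)} \<subseteq> {m. \<forall>i. Poly_Mapping.lookup m i < N}"
  proof (intro subsetI CollectI allI, rule ccontr)
    fix m i
    assume m: "m \<in> {m. monomial_value x m \<noteq> 0\<^sub>m (level x) (level x)}" and "\<not> Poly_Mapping.lookup m i < N"
    then have "N \<le> Poly_Mapping.lookup m i" by simp
    from monomial_value_zeroI[OF x pow_mat_zero_mono[OF matrix_universeE(2)[OF x] nil this]] m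
    show False by simp
  qed
  have "Poly_Mapping.lookup ` {m :: 'd \<Rightarrow>\<^sub>0 nat. \<forall>i. Poly_Mapping.lookup m i < N} \<subseteq> PiE UNIV (\<lambda>_. {..<N})"
    by auto
  then have "finite (Poly_Mapping.lookup ` {m :: 'd \<Rightarrow>\<^sub>0 nat. \<forall>i. Poly_Mapping.lookup m i < N})"
    by (rule finite_subset) (intro finite_PiE; simp)
  then show "finite {m :: 'd \<Rightarrow>\<^sub>0 nat. \<forall>i. Poly_Mapping.lookup m i < N}"
    by (rule finite_imageD) (auto intro!: inj_onI poly_mapping_eqI)
qed

lemma mat_nonzero_column:
  fixes A :: "complex mat"
  assumes "A \<in> carrier_mat n m" "A \<noteq> 0\<^sub>m n m"
  shows "\<exists>b<m. col A b \<noteq> 0\<^sub>v n"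
proof (rule ccontr)
  assume "\<not> ?thesis"
  then have *: "\<And>b. b < m \<Longrightarrow> col A b = 0\<^sub>v n" by auto
  have "A = 0\<^sub>m n m"
  proof (rule eq_matI)
    fix i j assume "i < dim_row (0\<^sub>m n m :: complex mat)" "j < dim_col (0\<^sub>m n m :: complex mat)"
    then have ij: "i < n" "j < m" by auto
    have "vec_index (col A j) i = vec_index (0\<^sub>v n) i" using *[OF ij(2)] by simp
    then show "A $$ (i, j) = (0\<^sub>m n m) $$ (i, j)" using ij assms(1) by auto
  qed (use assms in auto)
  with assms(2) show False ..
qed

text \<open>Any nonzero column of a nonzero monomial of maximal degree is annihilated by all \<open>x i\<close>.\<close>

lemma nilpotent_common_kernel:
  fixes x :: "'d::finite \<Rightarrow> complex mat"
  assumes x: "x \<in> comm_universe" and nil: "\<And>i. x i ^\<^sub>m N = 0\<^sub>m (level x) (level x)"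
  shows "\<exists>v. v \<in> carrier_vec (level x) \<and> v \<noteq> 0\<^sub>v (level x) \<and> (\<forall>i. x i *\<^sub>v v = 0\<^sub>v (level x))"
proof -
  let ?n = "level x"
  note u = comm_universeD(1)[OF x]
  let ?S = "{m. monomial_value x m \<noteq> 0\<^sub>m ?n ?n}"
  have fin: "finite ?S" by (rule finite_nonzero_monomials[OF u nil])
  have "monomial_value x 0 \<noteq> 0\<^sub>m ?n ?n"
  proof
    assume "monomial_value x 0 = 0\<^sub>m ?n ?n"
    then have "(1\<^sub>m ?n :: complex mat) $$ (0, 0) = 0\<^sub>m ?n ?n $$ (0, 0)" using monomial_value_zero[OF u] by simp
    then show False using matrix_universeE(1)[OF u] by simp
  qed
  then have ne: "?S \<noteq> {}" by auto
  have "Max (mdeg ` ?S) \<in> mdeg ` ?S" using fin ne by (intro Max_in) auto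
  then obtain m where m: "m \<in> ?S" "mdeg m = Max (mdeg ` ?S)" by force
  let ?M = "monomial_value x m"
  have Mc: "?M \<in> carrier_mat ?n ?n" by (rule monomial_value_carrier[OF u])
  have z: "x i * ?M = 0\<^sub>m ?n ?n" for i
  proof (rule ccontr)
    assume "x i * ?M \<noteq> 0\<^sub>m ?n ?n"
    then have "Poly_Mapping.single i 1 + m \<in> ?S" using monomial_value_Suc[OF x, of i m] by simp
    then have "mdeg (Poly_Mapping.single i 1 + m) \<le> Max (mdeg ` ?S)" using fin by (intro Max_ge) auto
    then show False using m(2) by (simp add: mdeg_add)
  qed
  obtain b where b: "b < ?n" "col ?M b \<noteq> 0\<^sub>v ?n" using mat_nonzero_column[OF Mc] m(1) by auto
  have "x i *\<^sub>v col ?M b = 0\<^sub>v ?n" for i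
    using col_mult2[OF matrix_universeE(2)[OF u] Mc b(1), of i] b(1) unfolding z by simp
  moreover have "col ?M b \<in> carrier_vec ?n" using Mc b(1) by (metis carrier_matD(1) col_carrier_vec carrier_matD(2))
  ultimately show ?thesis using b(2) by blast
qed

text \<open>A nilpotent shift excludes eigenvalues other than \<open>l $ i\<close>; that
  \<open>l\<close> does occur needs a joint eigenvector, which is a common kernel vector of the
  commuting nilpotents.\<close>

lemma joint_spectrum_nilpotent:
  fixes x :: "'d::finite \<Rightarrow> complex mat"
  assumes x: "x \<in> comm_universe" and nil: "\<And>i. shift_tuple x l i ^\<^sub>m N = 0\<^sub>m (level x) (level x)"
  shows "joint_spectrum x = {l}"
proof -
  let ?n = "level x"
  note u = comm_universeD(1)[OF x]
  note c = matrix_universeE(2)[OF u]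
  note s = shift_tuple_universe[OF u, of l]
  have "z = l" if "z \<in> joint_spectrum x" for z
  proof -
    from that obtain v where "\<forall>i. eigenvector (x i) v (z $ i)" unfolding joint_spectrum_def by blast
    then have v: "\<And>i. eigenvector (x i) v (z $ i)" ..
    have "z $ i = l $ i" for i
    proof (rule ccontr)
      assume ne: "z $ i \<noteq> l $ i"
      have ev: "eigenvector (shift_tuple x l i) v (z $ i - l $ i)"
        unfolding shift_tuple_def by (rule eigenvector_shift_iff[OF c, THEN iffD2, OF v])
      have vc: "v \<in> carrier_vec ?n" "v \<noteq> 0\<^sub>v ?n" 
        using v[of i] carrier_matD(1)[OF c[of i]] unfolding eigenvector_def by simp_all
      have sc: "shift_tuple x l i \<in> carrier_mat ?n ?n" using matrix_universeE(2)[OF s(1), of i] unfolding s(2) .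
      have "0\<^sub>m ?n ?n *\<^sub>v v = (z $ i - l $ i) ^ N \<cdot>\<^sub>v v"
        using eigenvector_pow[OF sc ev, of N] unfolding nil .
      note eq = arg_cong[OF this, of "\<lambda>w. vec_index w k" for k]
      have "vec_index v k = 0" if k: "k < ?n" for k
      proof -
        have "vec_index (0\<^sub>m ?n ?n *\<^sub>v v) k = 0" using k vc(1) by (simp add: scalar_prod_def)
        then show ?thesis using eq[of k] k vc(1) ne by simp
      qed
      then have "v = 0\<^sub>v ?n" using vc(1) by (intro eq_vecI) auto
      with vc(2) show False ..
    qed
    then show ?thesis by (simp add: Finite_Cartesian_Product.vec_eq_iff)
  qed
  moreover have "l \<in> joint_spectrum x"
  proof -
    have "\<exists>v. v \<in> carrier_vec (level (shift_tuple x l)) \<and> v \<noteq> 0\<^sub>v (level (shift_tuple x l)) \<and>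
      (\<forall>i. shift_tuple x l i *\<^sub>v v = 0\<^sub>v (level (shift_tuple x l)))"
      by (rule nilpotent_common_kernel[OF shift_tuple_comm[OF x], where N = N]) (simp only: s nil)
    then obtain v where v: "v \<in> carrier_vec ?n" "v \<noteq> 0\<^sub>v ?n" "\<And>i. shift_tuple x l i *\<^sub>v v = 0\<^sub>v ?n"
      unfolding s(2) by blast
    have "eigenvector (x i) v (l $ i)" for i
    proof -
      have sc: "shift_tuple x l i \<in> carrier_mat ?n ?n" using matrix_universeE(2)[OF s(1), of i] unfolding s(2) .
      have "(l $ i - l $ i) \<cdot>\<^sub>v v = 0\<^sub>v ?n" using v(1) by (intro eq_vecI) auto
      then have "eigenvector (shift_tuple x l i) v (l $ i - l $ i)"
        using v sc unfolding eigenvector_def by simp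
      then show ?thesis unfolding shift_tuple_def by (rule eigenvector_shift_iff[OF c, THEN iffD1])
    qed
    then show ?thesis unfolding joint_spectrum_def by blast
  qed
  ultimately show ?thesis by blast
qed

subsection \<open>Embeddings of the blocks of a block diagonal matrix\<close>

lemma sum_lessThan_add:
  fixes f :: "nat \<Rightarrow> 'a :: comm_monoid_add"
  shows "(\<Sum>s<n + m. f s) = (\<Sum>s<n. f s) + (\<Sum>s<m. f (n + s))"
  by (induction m) (simp_all add: add_ac)

text \<open>The inclusions \<open>J\<close> and projections \<open>L\<close> are chosen before
  \<open>f\<close>, so the same ones work for the coordinates of a tuple and for every function of
  it. The last two clauses say that a matrix is determined by its compositions with all projections,
  or with all inclusions; identities between block matrices can then be checked summand by
  summand.\<close>

lemma block_embedding_exists: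
  fixes xs :: "'a list" and g :: "'a \<Rightarrow> nat"
  defines "N \<equiv> \<lambda>xs. sum_list (map g xs)"
  shows "\<exists>J L. (\<forall>k<length xs. J k \<in> carrier_mat (N xs) (g (xs ! k)) \<and> L k \<in> carrier_mat (g (xs ! k)) (N xs) \<and>
      L k * J k = 1\<^sub>m (g (xs ! k))) \<and>
    (\<forall>f :: 'a \<Rightarrow> complex mat. (\<forall>x\<in>set xs. f x \<in> carrier_mat (g x) (g x)) \<longrightarrow>
      (\<forall>k<length xs. diag_block_mat (map f xs) * J k = J k * f (xs ! k) \<and>
        L k * diag_block_mat (map f xs) = f (xs ! k) * L k)) \<and>
    (\<forall>M A. A \<in> carrier_mat (N xs) M \<and> (\<forall>k<length xs. L k * A = 0\<^sub>m (g (xs ! k)) M) \<longrightarrow> A = 0\<^sub>m (N xs) M) \<and>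
    (\<forall>M A. A \<in> carrier_mat M (N xs) \<and> (\<forall>k<length xs. A * J k = 0\<^sub>m M (g (xs ! k))) \<longrightarrow> A = 0\<^sub>m M (N xs))"
proof (induction xs)
  case Nil
  show ?case by (auto simp: N_def intro!: eq_matI)
next
  case (Cons x xs)
  then obtain J L where
    H1: "\<forall>k<length xs. J k \<in> carrier_mat (N xs) (g (xs ! k)) \<and> L k \<in> carrier_mat (g (xs ! k)) (N xs) \<and>
      L k * J k = 1\<^sub>m (g (xs ! k))"
    and H2: "\<forall>f :: 'a \<Rightarrow> complex mat. (\<forall>x\<in>set xs. f x \<in> carrier_mat (g x) (g x)) \<longrightarrow>
      (\<forall>k<length xs. diag_block_mat (map f xs) * J k = J k * f (xs ! k) \<and>
        L k * diag_block_mat (map f xs) = f (xs ! k) * L k)"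
    and cL: "\<forall>M A. A \<in> carrier_mat (N xs) M \<and> (\<forall>k<length xs. L k * A = 0\<^sub>m (g (xs ! k)) M) \<longrightarrow> A = 0\<^sub>m (N xs) M"
    and cJ: "\<forall>M A. A \<in> carrier_mat M (N xs) \<and> (\<forall>k<length xs. A * J k = 0\<^sub>m M (g (xs ! k))) \<longrightarrow> A = 0\<^sub>m M (N xs)"
    by (elim exE conjE)
  have JL: "\<And>k. k < length xs \<Longrightarrow> J k \<in> carrier_mat (N xs) (g (xs ! k))"
    "\<And>k. k < length xs \<Longrightarrow> L k \<in> carrier_mat (g (xs ! k)) (N xs)"
    "\<And>k. k < length xs \<Longrightarrow> L k * J k = 1\<^sub>m (g (xs ! k))" using H1 by simp_all
  have int: "diag_block_mat (map f xs) * J k = J k * f (xs ! k)" "L k * diag_block_mat (map f xs) = f (xs ! k) * L k"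
    if "\<And>x. x \<in> set xs \<Longrightarrow> f x \<in> carrier_mat (g x) (g x)" "k < length xs" for f :: "'a \<Rightarrow> complex mat" and k
    using H2 that by simp_all
  define n where "n = g x"
  define N' where "N' = N xs"
  have Nx: "N (x # xs) = n + N'" by (simp add: N_def n_def N'_def)
  \<comment> \<open>Index 0 addresses the new first block, and index \<open>Suc k\<close> the old
    block \<open>k\<close> moved down by \<open>n\<close> rows.\<close>
  define J' :: "nat \<Rightarrow> complex mat" where "J' k = (case k of
      0 \<Rightarrow> mat (n + N') n (\<lambda>(a, b). if a = b then 1 else 0)
    | Suc k \<Rightarrow> mat (n + N') (g (xs ! k)) (\<lambda>(a, b). if a < n then 0 else J k $$ (a - n, b)))" for k
  define L' :: "nat \<Rightarrow> complex mat" where "L' k = (case k of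
      0 \<Rightarrow> mat n (n + N') (\<lambda>(a, b). if a = b then 1 else 0)
    | Suc k \<Rightarrow> mat (g (xs ! k)) (n + N') (\<lambda>(a, b). if b < n then 0 else L k $$ (a, b - n)))" for k
  have J0: "J' 0 \<in> carrier_mat (n + N') n" "\<And>a b. a < n + N' \<Longrightarrow> b < n \<Longrightarrow> J' 0 $$ (a, b) = (if a = b then 1 else 0)"
    and L0: "L' 0 \<in> carrier_mat n (n + N')" "\<And>a b. a < n \<Longrightarrow> b < n + N' \<Longrightarrow> L' 0 $$ (a, b) = (if a = b then 1 else 0)"
    by (auto simp: J'_def L'_def)
  have JS: "J' (Suc k) \<in> carrier_mat (n + N') (g (xs ! k))"
      "\<And>a b. a < n + N' \<Longrightarrow> b < g (xs ! k) \<Longrightarrow> J' (Suc k) $$ (a, b) = (if a < n then 0 else J k $$ (a - n, b))"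
    and LS: "L' (Suc k) \<in> carrier_mat (g (xs ! k)) (n + N')"
      "\<And>a b. a < g (xs ! k) \<Longrightarrow> b < n + N' \<Longrightarrow> L' (Suc k) $$ (a, b) = (if b < n then 0 else L k $$ (a, b - n))" for k
    by (auto simp: J'_def L'_def)
  have sumJ0: "(\<Sum>s<n + N'. h s * (if s = b then 1 else 0)) = h b" if "b < n" for h :: "nat \<Rightarrow> complex" and b
    using that by (simp add: mult_delta_right)
  have sumL0: "(\<Sum>s<n + N'. (if a = s then 1 else 0) * h s) = h a" if "a < n" for h :: "nat \<Rightarrow> complex" and a
    using that by (simp add: mult_delta_left)
  have sumS: "(\<Sum>s<n + N'. (if s < n then 0 else p (s - n)) * h s) = (\<Sum>s<N'. p s * h (n + s))"
    "(\<Sum>s<n + N'. h s * (if s < n then 0 else p (s - n))) = (\<Sum>s<N'. h (n + s) * p s)" for p h :: "nat \<Rightarrow> complex"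
    by (simp_all add: sum_lessThan_add)
  have 1: "J' k \<in> carrier_mat (n + N') (g ((x # xs) ! k)) \<and> L' k \<in> carrier_mat (g ((x # xs) ! k)) (n + N') \<and>
      L' k * J' k = 1\<^sub>m (g ((x # xs) ! k))" if "k < length (x # xs)" for k
  proof (cases k)
    case 0
    have "L' 0 * J' 0 = 1\<^sub>m n"
    proof (rule eq_matI)
      fix a b assume "a < dim_row (1\<^sub>m n :: complex mat)" "b < dim_col (1\<^sub>m n :: complex mat)"
      then have ab: "a < n" "b < n" by auto
      have "(L' 0 * J' 0) $$ (a, b) = (\<Sum>s<n + N'. (if a = s then 1 else 0) * J' 0 $$ (s, b))"
        unfolding mat_mult_index[OF L0(1) J0(1) ab] using ab L0(2) by simp
      then show "(L' 0 * J' 0) $$ (a, b) = 1\<^sub>m n $$ (a, b)" unfolding sumL0[OF ab(1)] using J0(2) ab by simp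
    qed (use J0 L0 in auto)
    then show ?thesis using 0 J0 L0 by (simp add: n_def)
  next
    case (Suc k')
    then have k': "k' < length xs" using that by simp
    have "L' (Suc k') * J' (Suc k') = L k' * J k'"
    proof (rule eq_matI)
      fix a b assume "a < dim_row (L k' * J k')" "b < dim_col (L k' * J k')"
      then have ab: "a < g (xs ! k')" "b < g (xs ! k')" using JL[OF k'] by auto
      have "(L' (Suc k') * J' (Suc k')) $$ (a, b) = (\<Sum>s<n + N'. (if s < n then 0 else L k' $$ (a, s - n)) * J' (Suc k') $$ (s, b))"
        unfolding mat_mult_index[OF LS(1) JS(1) ab] using ab LS(2) by simp
      also have "\<dots> = (\<Sum>s<N'. L k' $$ (a, s) * J' (Suc k') $$ (n + s, b))" by (rule sumS)
      also have "\<dots> = (L k' * J k') $$ (a, b)"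
        unfolding mat_mult_index[OF JL(2,1)[OF k'] ab] using JS(2) ab by (simp add: N'_def)
      finally show "(L' (Suc k') * J' (Suc k')) $$ (a, b) = (L k' * J k') $$ (a, b)" .
    qed (use JL(1,2)[OF k'] JS(1)[of k'] LS(1)[of k'] in auto)
    then show ?thesis using Suc JS LS JL(3)[OF k'] by simp
  qed
  have 2: "diag_block_mat (map f (x # xs)) * J' k = J' k * f ((x # xs) ! k) \<and>
      L' k * diag_block_mat (map f (x # xs)) = f ((x # xs) ! k) * L' k"
    if f: "\<And>y. y \<in> set (x # xs) \<Longrightarrow> f y \<in> carrier_mat (g y) (g y)" and k: "k < length (x # xs)" for f :: "'a \<Rightarrow> complex mat" and k
  proof -
    let ?D = "diag_block_mat (map f xs)" and ?D' = "diag_block_mat (map f (x # xs))"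
    have fx: "f x \<in> carrier_mat n n" using f by (simp add: n_def)
    have D: "?D \<in> carrier_mat N' N'" using diag_block_mat_carrier[of xs f g] f by (simp add: N'_def N_def)
    have D': "?D' \<in> carrier_mat (n + N') (n + N')"
      using diag_block_mat_carrier[of "x # xs" f g] f Nx by (simp add: N_def)
    have Di: "?D' $$ (a, b) = (if a < n then if b < n then f x $$ (a, b) else 0
        else if b < n then 0 else ?D $$ (a - n, b - n))" if "a < n + N'" "b < n + N'" for a b
      using that fx D by (auto simp: Let_def)
    show ?thesis
    proof (cases k)
      case 0
      have "?D' * J' 0 = J' 0 * f x"
      proof (rule eq_matI)
        fix a b assume "a < dim_row (J' 0 * f x)" "b < dim_col (J' 0 * f x)"
        then have ab: "a < n + N'" "b < n" using J0(1) fx by auto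
        have "(?D' * J' 0) $$ (a, b) = (\<Sum>s<n + N'. ?D' $$ (a, s) * (if s = b then 1 else 0))"
          unfolding mat_mult_index[OF D' J0(1) ab] using ab J0(2) by simp
        also have "\<dots> = (if a < n then f x $$ (a, b) else 0)" unfolding sumJ0[OF ab(2)] using Di[of a b] ab by simp
        also have "\<dots> = (\<Sum>s<n. J' 0 $$ (a, s) * f x $$ (s, b))"
          using ab J0(2) by (simp add: mult_delta_left)
        finally show "(?D' * J' 0) $$ (a, b) = (J' 0 * f x) $$ (a, b)"
          unfolding mat_mult_index[OF J0(1) fx ab] .
      qed (use D' J0(1) fx in auto)
      moreover have "L' 0 * ?D' = f x * L' 0"
      proof (rule eq_matI)
        fix a b assume "a < dim_row (f x * L' 0)" "b < dim_col (f x * L' 0)"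
        then have ab: "a < n" "b < n + N'" using L0(1) fx by auto
        have "(L' 0 * ?D') $$ (a, b) = (\<Sum>s<n + N'. (if a = s then 1 else 0) * ?D' $$ (s, b))"
          unfolding mat_mult_index[OF L0(1) D' ab] using ab L0(2) by simp
        also have "\<dots> = (if b < n then f x $$ (a, b) else 0)" unfolding sumL0[OF ab(1)] using Di[of a b] ab by simp
        also have "\<dots> = (\<Sum>s<n. f x $$ (a, s) * L' 0 $$ (s, b))"
          using ab L0(2) by (simp add: mult_delta_right)
        finally show "(L' 0 * ?D') $$ (a, b) = (f x * L' 0) $$ (a, b)"
          unfolding mat_mult_index[OF fx L0(1) ab] .
      qed (use D' L0(1) fx in auto)
      ultimately show ?thesis using 0 by simp
    next
      case (Suc k')
      then have k': "k' < length xs" using k by simp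
      have fk: "f (xs ! k') \<in> carrier_mat (g (xs ! k')) (g (xs ! k'))" using f k' by simp
      have "?D' * J' (Suc k') = J' (Suc k') * f (xs ! k')"
      proof (rule eq_matI)
        fix a b assume "a < dim_row (J' (Suc k') * f (xs ! k'))" "b < dim_col (J' (Suc k') * f (xs ! k'))"
        then have ab: "a < n + N'" "b < g (xs ! k')" using JS(1)[of k'] fk by auto
        have "(?D' * J' (Suc k')) $$ (a, b) = (\<Sum>s<n + N'. ?D' $$ (a, s) * (if s < n then 0 else J k' $$ (s - n, b)))"
          unfolding mat_mult_index[OF D' JS(1) ab] using ab JS(2) by simp
        also have "\<dots> = (\<Sum>s<N'. ?D' $$ (a, n + s) * J k' $$ (s, b))" by (rule sumS)
        also have "\<dots> = (if a < n then 0 else \<Sum>s<N'. ?D $$ (a - n, s) * J k' $$ (s, b))"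
          using ab Di by simp
        also have "\<dots> = (if a < n then 0 else (J k' * f (xs ! k')) $$ (a - n, b))"
          using ab mat_mult_index[OF D JL(1)[OF k', folded N'_def], of "a - n" b] int(1)[of f k'] f k' by auto
        also have "\<dots> = (\<Sum>s<g (xs ! k'). J' (Suc k') $$ (a, s) * f (xs ! k') $$ (s, b))"
          using ab JS(2) mat_mult_index[OF JL(1)[OF k'] fk, of "a - n" b] by (auto simp: N'_def)
        finally show "(?D' * J' (Suc k')) $$ (a, b) = (J' (Suc k') * f (xs ! k')) $$ (a, b)"
          unfolding mat_mult_index[OF JS(1) fk ab] .
      qed (use D' JS(1)[of k'] fk in auto)
      moreover have "L' (Suc k') * ?D' = f (xs ! k') * L' (Suc k')"
      proof (rule eq_matI)
        fix a b assume "a < dim_row (f (xs ! k') * L' (Suc k'))" "b < dim_col (f (xs ! k') * L' (Suc k'))"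
        then have ab: "a < g (xs ! k')" "b < n + N'" using LS(1)[of k'] fk by auto
        have "(L' (Suc k') * ?D') $$ (a, b) = (\<Sum>s<n + N'. (if s < n then 0 else L k' $$ (a, s - n)) * ?D' $$ (s, b))"
          unfolding mat_mult_index[OF LS(1) D' ab] using ab LS(2) by simp
        also have "\<dots> = (\<Sum>s<N'. L k' $$ (a, s) * ?D' $$ (n + s, b))" by (rule sumS)
        also have "\<dots> = (if b < n then 0 else \<Sum>s<N'. L k' $$ (a, s) * ?D $$ (s, b - n))"
          using ab Di by simp
        also have "\<dots> = (if b < n then 0 else (f (xs ! k') * L k') $$ (a, b - n))"
          using ab mat_mult_index[OF JL(2)[OF k', folded N'_def] D, of a "b - n"] int(2)[of f k'] f k' by auto
        also have "\<dots> = (\<Sum>s<g (xs ! k'). f (xs ! k') $$ (a, s) * L' (Suc k') $$ (s, b))"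
          using ab LS(2) mat_mult_index[OF fk JL(2)[OF k'], of a "b - n"] by (auto simp: N'_def)
        finally show "(L' (Suc k') * ?D') $$ (a, b) = (f (xs ! k') * L' (Suc k')) $$ (a, b)"
          unfolding mat_mult_index[OF fk LS(1) ab] .
      qed (use D' LS(1)[of k'] fk in auto)
      ultimately show ?thesis using Suc by simp
    qed
  qed
  have 3: "A = 0\<^sub>m (n + N') M" if A: "A \<in> carrier_mat (n + N') M"
    and z: "\<And>k. k < length (x # xs) \<Longrightarrow> L' k * A = 0\<^sub>m (g ((x # xs) ! k)) M" for M and A :: "complex mat"
  proof -
    define A2 where "A2 = mat N' M (\<lambda>(s, b). A $$ (n + s, b))"
    have A2: "A2 \<in> carrier_mat N' M" by (simp add: A2_def)
    have "A2 = 0\<^sub>m N' M" unfolding N'_def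
    proof (rule cL[rule_format], intro conjI allI impI A2[unfolded N'_def])
      fix k assume k: "k < length xs"
      show "L k * A2 = 0\<^sub>m (g (xs ! k)) M"
      proof (rule eq_matI)
        fix a b assume "a < dim_row (0\<^sub>m (g (xs ! k)) M :: complex mat)" "b < dim_col (0\<^sub>m (g (xs ! k)) M :: complex mat)"
        then have ab: "a < g (xs ! k)" "b < M" by auto
        have "(L k * A2) $$ (a, b) = (\<Sum>s<n + N'. (if s < n then 0 else L k $$ (a, s - n)) * A $$ (s, b))"
          unfolding mat_mult_index[OF JL(2)[OF k, folded N'_def] A2 ab]
          using ab sumS(1)[of "\<lambda>s. L k $$ (a, s)" "\<lambda>s. A $$ (s, b)"] by (simp add: A2_def)
        also have "\<dots> = (L' (Suc k) * A) $$ (a, b)"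
          unfolding mat_mult_index[OF LS(1) A ab] using ab LS(2) by simp
        also have "\<dots> = 0" using z[of "Suc k"] k ab by simp
        finally show "(L k * A2) $$ (a, b) = 0\<^sub>m (g (xs ! k)) M $$ (a, b)" using ab by simp
      qed (use JL(2)[OF k] A2 in auto)
    qed
    note z2 = this
    have lo: "A $$ (n + s, b) = 0" if "s < N'" "b < M" for s b
    proof -
      have "A $$ (n + s, b) = A2 $$ (s, b)" using that by (simp add: A2_def)
      then show ?thesis unfolding z2 using that by simp
    qed
    have hi: "A $$ (a, b) = 0" if ab: "a < n" "b < M" for a b
    proof -
      have "A $$ (a, b) = (L' 0 * A) $$ (a, b)"
        unfolding mat_mult_index[OF L0(1) A ab] using ab L0(2) sumL0[OF ab(1), of "\<lambda>s. A $$ (s, b)"] by simp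
      then show ?thesis using z[of 0] ab by (simp add: n_def)
    qed
    show ?thesis
    proof (rule eq_matI)
      fix a b assume "a < dim_row (0\<^sub>m (n + N') M :: complex mat)" "b < dim_col (0\<^sub>m (n + N') M :: complex mat)"
      then show "A $$ (a, b) = 0\<^sub>m (n + N') M $$ (a, b)"
        using hi[of a b] lo[of "a - n" b] by (cases "a < n") auto
    qed (use A in auto)
  qed
  have 4: "A = 0\<^sub>m M (n + N')" if A: "A \<in> carrier_mat M (n + N')"
    and z: "\<And>k. k < length (x # xs) \<Longrightarrow> A * J' k = 0\<^sub>m M (g ((x # xs) ! k))" for M and A :: "complex mat"
  proof -
    define A2 where "A2 = mat M N' (\<lambda>(a, s). A $$ (a, n + s))"
    have A2: "A2 \<in> carrier_mat M N'" by (simp add: A2_def)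
    have "A2 = 0\<^sub>m M N'" unfolding N'_def
    proof (rule cJ[rule_format], intro conjI allI impI A2[unfolded N'_def])
      fix k assume k: "k < length xs"
      show "A2 * J k = 0\<^sub>m M (g (xs ! k))"
      proof (rule eq_matI)
        fix a b assume "a < dim_row (0\<^sub>m M (g (xs ! k)) :: complex mat)" "b < dim_col (0\<^sub>m M (g (xs ! k)) :: complex mat)"
        then have ab: "a < M" "b < g (xs ! k)" by auto
        have "(A2 * J k) $$ (a, b) = (\<Sum>s<n + N'. A $$ (a, s) * (if s < n then 0 else J k $$ (s - n, b)))"
          unfolding mat_mult_index[OF A2 JL(1)[OF k, folded N'_def] ab]
          using ab sumS(2)[of "\<lambda>s. A $$ (a, s)" "\<lambda>s. J k $$ (s, b)"] by (simp add: A2_def)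
        also have "\<dots> = (A * J' (Suc k)) $$ (a, b)"
          unfolding mat_mult_index[OF A JS(1) ab] using ab JS(2) by simp
        also have "\<dots> = 0" using z[of "Suc k"] k ab by simp
        finally show "(A2 * J k) $$ (a, b) = 0\<^sub>m M (g (xs ! k)) $$ (a, b)" using ab by simp
      qed (use JL(1)[OF k] A2 in auto)
    qed
    note z2 = this
    have lo: "A $$ (a, n + s) = 0" if "s < N'" "a < M" for s a
    proof -
      have "A $$ (a, n + s) = A2 $$ (a, s)" using that by (simp add: A2_def)
      then show ?thesis unfolding z2 using that by simp
    qed
    have hi: "A $$ (a, b) = 0" if ab: "a < M" "b < n" for a b
    proof -
      have "A $$ (a, b) = (A * J' 0) $$ (a, b)"
        unfolding mat_mult_index[OF A J0(1) ab] using ab J0(2) sumJ0[OF ab(2), of "\<lambda>s. A $$ (a, s)"] by simp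
      then show ?thesis using z[of 0] ab by (simp add: n_def)
    qed
    show ?thesis
    proof (rule eq_matI)
      fix a b assume "a < dim_row (0\<^sub>m M (n + N') :: complex mat)" "b < dim_col (0\<^sub>m M (n + N') :: complex mat)"
      then show "A $$ (a, b) = 0\<^sub>m M (n + N') $$ (a, b)"
        using hi[of a b] lo[of "b - n" a] by (cases "b < n") auto
    qed (use A in auto)
  qed
  have "\<forall>k<length (x # xs). J' k \<in> carrier_mat (n + N') (g ((x # xs) ! k)) \<and> L' k \<in> carrier_mat (g ((x # xs) ! k)) (n + N') \<and>
      L' k * J' k = 1\<^sub>m (g ((x # xs) ! k))"
    using 1 by blast
  moreover have "\<forall>f :: 'a \<Rightarrow> complex mat. (\<forall>y\<in>set (x # xs). f y \<in> carrier_mat (g y) (g y)) \<longrightarrow>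
      (\<forall>k<length (x # xs). diag_block_mat (map f (x # xs)) * J' k = J' k * f ((x # xs) ! k) \<and>
        L' k * diag_block_mat (map f (x # xs)) = f ((x # xs) ! k) * L' k)"
    using 2 by blast
  moreover have "\<forall>M A. A \<in> carrier_mat (n + N') M \<and> (\<forall>k<length (x # xs). L' k * A = 0\<^sub>m (g ((x # xs) ! k)) M) \<longrightarrow> A = 0\<^sub>m (n + N') M"
    using 3 by blast
  moreover have "\<forall>M A. A \<in> carrier_mat M (n + N') \<and> (\<forall>k<length (x # xs). A * J' k = 0\<^sub>m M (g ((x # xs) ! k))) \<longrightarrow> A = 0\<^sub>m M (n + N')"
    using 4 by blast
  ultimately show ?case unfolding Nx
    by (intro exI[of _ J'] exI[of _ L'] conjI)
qed

subsection \<open>Tuples similar to a direct sum\<close>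

text \<open>The part of \<open>decomposition\<close> on which free evaluation relies: the summands
  may fail to commute and may have any spectrum.\<close>

definition block_similar ::
    "('d::finite \<Rightarrow> complex mat) \<Rightarrow> complex mat \<Rightarrow> complex mat \<Rightarrow> ('d \<Rightarrow> complex mat) list \<Rightarrow> bool" where
  "block_similar y T S xs \<longleftrightarrow> y \<in> matrix_universe \<and> (\<forall>x\<in>set xs. x \<in> matrix_universe) \<and>
     (\<forall>i. similar_mat_wit (y i) (diag_block_mat (map (\<lambda>x. x i) xs)) T S)"

lemma decomposition_block_similar:
  assumes "decomposition y T S xs" "y \<in> matrix_universe"
  shows "block_similar y T S xs"
  using assms comm_universeD(1) by (auto simp: decomposition_def block_similar_def)

lemma block_similar_dims:
  assumes "block_similar y T S xs"
  shows "sum_list (map level xs) = level y" "T \<in> carrier_mat (level y) (level y)"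
    "S \<in> carrier_mat (level y) (level y)" "T * S = 1\<^sub>m (level y)" "S * T = 1\<^sub>m (level y)"
    "y i = T * diag_block_mat (map (\<lambda>x. x i) xs) * S"
proof -
  have y: "y \<in> matrix_universe" and xs: "\<And>x. x \<in> set xs \<Longrightarrow> x \<in> matrix_universe"
    and sim: "\<And>i. similar_mat_wit (y i) (diag_block_mat (map (\<lambda>x. x i) xs)) T S"
    using assms by (auto simp: block_similar_def)
  note w = similar_mat_witE[OF sim matrix_universeE(2)[OF y]]
  show "T \<in> carrier_mat (level y) (level y)" "S \<in> carrier_mat (level y) (level y)" "T * S = 1\<^sub>m (level y)"
    "S * T = 1\<^sub>m (level y)" by (fact w(2-5))+
  show "y i = T * diag_block_mat (map (\<lambda>x. x i) xs) * S" by (fact w(6))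
  have "diag_block_mat (map (\<lambda>x. x i) xs) \<in> carrier_mat (sum_list (map level xs)) (sum_list (map level xs))"
    using matrix_universeE(2)[OF xs] by (intro diag_block_mat_carrier) auto
  with w(1)[of i] show "sum_list (map level xs) = level y" by auto
qed

text \<open>\<open>P k\<close> and \<open>Q k\<close> are the inclusion of and the projection onto the \<open>k\<close>-th summand.\<close>

definition block_projections ::
    "('d::finite \<Rightarrow> complex mat) \<Rightarrow> complex mat \<Rightarrow> complex mat \<Rightarrow> ('d \<Rightarrow> complex mat) list \<Rightarrow>
     (nat \<Rightarrow> complex mat) \<Rightarrow> (nat \<Rightarrow> complex mat) \<Rightarrow> bool" where
  "block_projections y T S xs P Q \<longleftrightarrow>
    (\<forall>k<length xs. P k \<in> carrier_mat (level y) (level (xs ! k)) \<and> Q k \<in> carrier_mat (level (xs ! k)) (level y) \<and>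
       Q k * P k = 1\<^sub>m (level (xs ! k)) \<and> (\<forall>i. y i * P k = P k * (xs ! k) i \<and> Q k * y i = (xs ! k) i * Q k)) \<and>
    (\<forall>f. (\<forall>x\<in>set xs. f x \<in> carrier_mat (level x) (level x)) \<longrightarrow> (\<forall>k<length xs.
       (T * diag_block_mat (map f xs) * S) * P k = P k * f (xs ! k) \<and>
       Q k * (T * diag_block_mat (map f xs) * S) = f (xs ! k) * Q k)) \<and>
    (\<forall>M A. A \<in> carrier_mat (level y) M \<and> (\<forall>k<length xs. Q k * A = 0\<^sub>m (level (xs ! k)) M) \<longrightarrow> A = 0\<^sub>m (level y) M) \<and>
    (\<forall>M A. A \<in> carrier_mat M (level y) \<and> (\<forall>k<length xs. A * P k = 0\<^sub>m M (level (xs ! k))) \<longrightarrow> A = 0\<^sub>m M (level y))"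

lemma block_projectionsD:
  assumes "block_projections y T S xs P Q"
  shows "k < length xs \<Longrightarrow> P k \<in> carrier_mat (level y) (level (xs ! k))"
    "k < length xs \<Longrightarrow> Q k \<in> carrier_mat (level (xs ! k)) (level y)"
    "k < length xs \<Longrightarrow> Q k * P k = 1\<^sub>m (level (xs ! k))"
    "(\<And>x. x \<in> set xs \<Longrightarrow> f x \<in> carrier_mat (level x) (level x)) \<Longrightarrow> k < length xs \<Longrightarrow>
       (T * diag_block_mat (map f xs) * S) * P k = P k * f (xs ! k)"
    "(\<And>x. x \<in> set xs \<Longrightarrow> f x \<in> carrier_mat (level x) (level x)) \<Longrightarrow> k < length xs \<Longrightarrow>
       Q k * (T * diag_block_mat (map f xs) * S) = f (xs ! k) * Q k"
    "k < length xs \<Longrightarrow> y i * P k = P k * (xs ! k) i"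
    "k < length xs \<Longrightarrow> Q k * y i = (xs ! k) i * Q k"
    "A \<in> carrier_mat (level y) M \<Longrightarrow> (\<And>k. k < length xs \<Longrightarrow> Q k * A = 0\<^sub>m (level (xs ! k)) M) \<Longrightarrow> A = 0\<^sub>m (level y) M"
    "A \<in> carrier_mat M (level y) \<Longrightarrow> (\<And>k. k < length xs \<Longrightarrow> A * P k = 0\<^sub>m M (level (xs ! k))) \<Longrightarrow> A = 0\<^sub>m M (level y)"
proof -
  note H = assms[unfolded block_projections_def]
  note H1 = conjunct1[OF H] and H2 = conjunct1[OF conjunct2[OF H]] and H3 = conjunct2[OF conjunct2[OF H]]
  note H1k = H1[rule_format, of k]
  show "k < length xs \<Longrightarrow> P k \<in> carrier_mat (level y) (level (xs ! k))" using H1k by blast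
  show "k < length xs \<Longrightarrow> Q k \<in> carrier_mat (level (xs ! k)) (level y)" using H1k by blast
  show "k < length xs \<Longrightarrow> Q k * P k = 1\<^sub>m (level (xs ! k))" using H1k by blast
  show "k < length xs \<Longrightarrow> y i * P k = P k * (xs ! k) i" using H1k by blast
  show "k < length xs \<Longrightarrow> Q k * y i = (xs ! k) i * Q k" using H1k by blast
  show "(\<And>x. x \<in> set xs \<Longrightarrow> f x \<in> carrier_mat (level x) (level x)) \<Longrightarrow> k < length xs \<Longrightarrow>
    (T * diag_block_mat (map f xs) * S) * P k = P k * f (xs ! k)"
    by (rule H2[rule_format, THEN conjunct1])
  show "(\<And>x. x \<in> set xs \<Longrightarrow> f x \<in> carrier_mat (level x) (level x)) \<Longrightarrow> k < length xs \<Longrightarrow>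
    Q k * (T * diag_block_mat (map f xs) * S) = f (xs ! k) * Q k"
    by (rule H2[rule_format, THEN conjunct2])
  show "A \<in> carrier_mat (level y) M \<Longrightarrow> (\<And>k. k < length xs \<Longrightarrow> Q k * A = 0\<^sub>m (level (xs ! k)) M) \<Longrightarrow> A = 0\<^sub>m (level y) M"
    by (rule conjunct1[OF H3, rule_format]) (intro conjI allI impI)
  show "A \<in> carrier_mat M (level y) \<Longrightarrow> (\<And>k. k < length xs \<Longrightarrow> A * P k = 0\<^sub>m M (level (xs ! k))) \<Longrightarrow> A = 0\<^sub>m M (level y)"
    by (rule conjunct2[OF H3, rule_format]) (intro conjI allI impI)
qed

lemma block_projections_exist:
  assumes bs: "block_similar y T S xs"
  shows "\<exists>P Q. block_projections y T S xs P Q"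
proof -
  let ?n = "level y"
  note d = block_similar_dims[OF bs]
  have xu: "\<And>x. x \<in> set xs \<Longrightarrow> x \<in> matrix_universe" using bs by (auto simp: block_similar_def)
  from block_embedding_exists[of xs level] obtain J L where
    H1: "\<forall>k<length xs. J k \<in> carrier_mat ?n (level (xs ! k)) \<and> L k \<in> carrier_mat (level (xs ! k)) ?n \<and>
      L k * J k = 1\<^sub>m (level (xs ! k))"
    and H2: "\<forall>f :: _ \<Rightarrow> complex mat. (\<forall>x\<in>set xs. f x \<in> carrier_mat (level x) (level x)) \<longrightarrow>
      (\<forall>k<length xs. diag_block_mat (map f xs) * J k = J k * f (xs ! k) \<and>
        L k * diag_block_mat (map f xs) = f (xs ! k) * L k)"
    and cL: "\<forall>M A. A \<in> carrier_mat ?n M \<and> (\<forall>k<length xs. L k * A = 0\<^sub>m (level (xs ! k)) M) \<longrightarrow> A = 0\<^sub>m ?n M"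
    and cJ: "\<forall>M A. A \<in> carrier_mat M ?n \<and> (\<forall>k<length xs. A * J k = 0\<^sub>m M (level (xs ! k))) \<longrightarrow> A = 0\<^sub>m M ?n"
    unfolding d(1) by (elim exE conjE)
  have JL: "J k \<in> carrier_mat ?n (level (xs ! k))" "L k \<in> carrier_mat (level (xs ! k)) ?n"
    "L k * J k = 1\<^sub>m (level (xs ! k))" if "k < length xs" for k using H1 that by simp_all
  have cST: "S * (T * X) = X" "T * (S * X) = X" if X: "X \<in> carrier_mat ?n m" for X m
    using assoc_mult_mat[OF d(3,2) X] assoc_mult_mat[OF d(2,3) X] d(4,5) X by simp_all
  have cST': "X * T * S = X" "X * S * T = X" if X: "X \<in> carrier_mat m ?n" for X m
    using assoc_mult_mat[OF X d(3,2)] assoc_mult_mat[OF X d(2,3)] d(4,5) X by simp_all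
  define P where "P k = T * J k" for k
  define Q where "Q k = L k * S" for k
  have Pc: "P k \<in> carrier_mat ?n (level (xs ! k))" and Qc: "Q k \<in> carrier_mat (level (xs ! k)) ?n"
    if "k < length xs" for k using JL[OF that] d(2,3) by (auto simp: P_def Q_def)
  have QP: "Q k * P k = 1\<^sub>m (level (xs ! k))" if k: "k < length xs" for k
  proof -
    have "Q k * P k = L k * (S * P k)" unfolding Q_def using JL(2)[OF k] d(3) Pc[OF k] by (rule assoc_mult_mat)
    then show ?thesis unfolding P_def cST(1)[OF JL(1)[OF k]] JL(3)[OF k] .
  qed
  have fP: "(T * diag_block_mat (map f xs) * S) * P k = P k * f (xs ! k)"
    and Qf: "Q k * (T * diag_block_mat (map f xs) * S) = f (xs ! k) * Q k"
    if f: "\<And>x. x \<in> set xs \<Longrightarrow> f x \<in> carrier_mat (level x) (level x)" and k: "k < length xs" for f k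
  proof -
    let ?D = "diag_block_mat (map f xs)"
    have D: "?D \<in> carrier_mat ?n ?n" using diag_block_mat_carrier[of xs f level] f unfolding d(1) by simp
    have fk: "f (xs ! k) \<in> carrier_mat (level (xs ! k)) (level (xs ! k))" using f k by simp
    have TD: "T * ?D \<in> carrier_mat ?n ?n" and DS: "?D * S \<in> carrier_mat ?n ?n" using D d(2,3) by auto
    have "(T * ?D * S) * P k = (T * ?D) * (S * P k)" using TD d(3) Pc[OF k] by (rule assoc_mult_mat)
    also have "S * P k = J k" unfolding P_def by (rule cST[OF JL(1)[OF k]])
    also have "(T * ?D) * J k = T * (?D * J k)" using d(2) D JL(1)[OF k] by (rule assoc_mult_mat)
    also have "?D * J k = J k * f (xs ! k)" using H2 f k by simp
    also have "T * (J k * f (xs ! k)) = P k * f (xs ! k)" unfolding P_def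
      using assoc_mult_mat[OF d(2) JL(1)[OF k] fk] by simp
    finally show "(T * ?D * S) * P k = P k * f (xs ! k)" .
    have "Q k * (T * ?D * S) = Q k * (T * (?D * S))" using assoc_mult_mat[OF d(2) D d(3)] by simp
    also have "\<dots> = Q k * T * (?D * S)" using assoc_mult_mat[OF Qc[OF k] d(2) DS] by simp
    also have "Q k * T = L k" unfolding Q_def by (rule cST'[OF JL(2)[OF k]])
    also have "L k * (?D * S) = L k * ?D * S" using assoc_mult_mat[OF JL(2)[OF k] D d(3)] by simp
    also have "L k * ?D = f (xs ! k) * L k" using H2 f k by simp
    also have "f (xs ! k) * L k * S = f (xs ! k) * Q k" unfolding Q_def
      using assoc_mult_mat[OF fk JL(2)[OF k] d(3)] by simp
    finally show "Q k * (T * ?D * S) = f (xs ! k) * Q k" .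
  qed
  have ux: "x i \<in> carrier_mat (level x) (level x)" if "x \<in> set xs" for x i using matrix_universeE(2)[OF xu[OF that]] .
  have yP: "y i * P k = P k * (xs ! k) i" if "k < length xs" for k i
    using fP[of "\<lambda>x. x i" k, OF ux that] unfolding d(6)[of i, symmetric] .
  have Qy: "Q k * y i = (xs ! k) i * Q k" if "k < length xs" for k i
    using Qf[of "\<lambda>x. x i" k, OF ux that] unfolding d(6)[of i, symmetric] .
  have 1: "\<forall>M A. A \<in> carrier_mat ?n M \<and> (\<forall>k<length xs. Q k * A = 0\<^sub>m (level (xs ! k)) M) \<longrightarrow> A = 0\<^sub>m ?n M"
  proof (intro allI impI, elim conjE)
    fix M A assume A: "A \<in> carrier_mat ?n M" and z: "\<forall>k<length xs. Q k * A = 0\<^sub>m (level (xs ! k)) M"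
    have SA: "S * A \<in> carrier_mat ?n M" using d(3) A by (rule mult_carrier_mat)
    have "L k * (S * A) = 0\<^sub>m (level (xs ! k)) M" if k: "k < length xs" for k
      using z[rule_format, OF k] assoc_mult_mat[OF JL(2)[OF k] d(3) A] unfolding Q_def by simp
    then have "S * A = 0\<^sub>m ?n M" using cL SA by blast
    then show "A = 0\<^sub>m ?n M" using cST(2)[OF A] d(2) by simp
  qed
  have 2: "\<forall>M A. A \<in> carrier_mat M ?n \<and> (\<forall>k<length xs. A * P k = 0\<^sub>m M (level (xs ! k))) \<longrightarrow> A = 0\<^sub>m M ?n"
  proof (intro allI impI, elim conjE)
    fix M A assume A: "A \<in> carrier_mat M ?n" and z: "\<forall>k<length xs. A * P k = 0\<^sub>m M (level (xs ! k))"
    have AT: "A * T \<in> carrier_mat M ?n" using A d(2) by (rule mult_carrier_mat)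
    have "A * T * J k = 0\<^sub>m M (level (xs ! k))" if k: "k < length xs" for k
      using z[rule_format, OF k] assoc_mult_mat[OF A d(2) JL(1)[OF k]] unfolding P_def by simp
    then have "A * T = 0\<^sub>m M ?n" using cJ AT by blast
    then show "A = 0\<^sub>m M ?n" using cST'(1)[OF A] d(3) by simp
  qed
  have "block_projections y T S xs P Q"
    unfolding block_projections_def
  proof (intro conjI[OF _ conjI[OF _ conjI[OF 1 2]]])
    show "\<forall>k<length xs. P k \<in> carrier_mat ?n (level (xs ! k)) \<and> Q k \<in> carrier_mat (level (xs ! k)) ?n \<and>
       Q k * P k = 1\<^sub>m (level (xs ! k)) \<and> (\<forall>i. y i * P k = P k * (xs ! k) i \<and> Q k * y i = (xs ! k) i * Q k)"
      by (intro allI impI conjI Pc Qc QP yP Qy)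
    show "\<forall>f. (\<forall>x\<in>set xs. f x \<in> carrier_mat (level x) (level x)) \<longrightarrow> (\<forall>k<length xs.
       (T * diag_block_mat (map f xs) * S) * P k = P k * f (xs ! k) \<and>
       Q k * (T * diag_block_mat (map f xs) * S) = f (xs ! k) * Q k)"
      by (intro allI impI conjI fP Qf) blast+
  qed
  then show ?thesis by blast
qed

text \<open>\<open>Q k\<close> sends a joint eigenvector of \<open>y\<close> to one of the summand
  unless it kills it, and no nonzero vector is killed by all \<open>Q k\<close>. Conversely
  \<open>P k\<close> has the left inverse \<open>Q k\<close>, so it never kills an
  eigenvector.\<close>

lemma block_similar_spectrum:
  assumes bs: "block_similar y T S xs"
  shows "joint_spectrum y = (\<Union>x\<in>set xs. joint_spectrum x)"
proof -
  let ?n = "level y"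
  have y: "y \<in> matrix_universe" and xu: "\<And>x. x \<in> set xs \<Longrightarrow> x \<in> matrix_universe"
    using bs by (auto simp: block_similar_def)
  note yc = matrix_universeE(2)[OF y]
  obtain P Q where PQ: "block_projections y T S xs P Q" using block_projections_exist[OF bs] by blast
  note D = block_projectionsD[OF PQ]
  note Pc = D(1) and Qc = D(2) and QP = D(3) and yP = D(6) and Qy = D(7) and cQ = D(8)
  have ev: "eigenvector B (R *\<^sub>v v) z"
    if A: "A \<in> carrier_mat n n" and B: "B \<in> carrier_mat m m" and R: "R \<in> carrier_mat m n" and BR: "B * R = R * A"
      and v: "eigenvector A v z" and nz: "R *\<^sub>v v \<noteq> 0\<^sub>v m" for A B R :: "complex mat" and n m v z
  proof -
    have vc: "v \<in> carrier_vec n" and Av: "A *\<^sub>v v = z \<cdot>\<^sub>v v" using v A by (auto simp: eigenvector_def)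
    have "B *\<^sub>v (R *\<^sub>v v) = (B * R) *\<^sub>v v" using assoc_mult_mat_vec[OF B R vc] by simp
    also have "\<dots> = R *\<^sub>v (A *\<^sub>v v)" unfolding BR using R A vc by (rule assoc_mult_mat_vec)
    also have "\<dots> = z \<cdot>\<^sub>v (R *\<^sub>v v)" unfolding Av using R vc by (rule mult_mat_vec)
    finally show ?thesis using B R vc nz unfolding eigenvector_def by simp
  qed
  show ?thesis
  proof (intro equalityI subsetI)
    fix z assume "z \<in> joint_spectrum y"
    then obtain v where v: "\<And>i. eigenvector (y i) v (z $ i)" unfolding joint_spectrum_def by blast
    have vc: "v \<in> carrier_vec ?n" "v \<noteq> 0\<^sub>v ?n"
      using v[of undefined] carrier_matD(1)[OF yc[of undefined]] unfolding eigenvector_def by simp_all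
    have "\<exists>k<length xs. Q k *\<^sub>v v \<noteq> 0\<^sub>v (level (xs ! k))"
    proof (rule ccontr)
      assume "\<not> ?thesis"
      then have Qv: "\<And>k. k < length xs \<Longrightarrow> Q k *\<^sub>v v = 0\<^sub>v (level (xs ! k))" by blast
      \<comment> \<open>Joint injectivity of the projections is stated for matrices, so the vector
        is read as a single column.\<close>
      let ?A = "mat ?n 1 (\<lambda>(a, b). vec_index v a)"
      have A: "?A \<in> carrier_mat ?n 1" by simp
      have "?A = 0\<^sub>m ?n 1"
      proof (rule cQ[OF A])
        fix k assume k: "k < length xs"
        show "Q k * ?A = 0\<^sub>m (level (xs ! k)) 1"
        proof (rule eq_matI)
          fix a b assume ab: "a < dim_row (0\<^sub>m (level (xs ! k)) 1 :: complex mat)" "b < dim_col (0\<^sub>m (level (xs ! k)) 1 :: complex mat)"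
          have "(Q k * ?A) $$ (a, b) = vec_index (Q k *\<^sub>v v) a"
            using ab Qc[OF k] vc by (simp add: scalar_prod_def)
          then show "(Q k * ?A) $$ (a, b) = 0\<^sub>m (level (xs ! k)) 1 $$ (a, b)" unfolding Qv[OF k] using ab by simp
        qed (use Qc[OF k] in simp_all)
      qed
      then have Aab: "?A $$ (a, 0) = (0\<^sub>m ?n 1 :: complex mat) $$ (a, 0)" for a by simp
      have "vec_index v a = 0" if "a < ?n" for a using Aab[of a] that by simp
      then have "v = 0\<^sub>v ?n" using vc(1) by (intro eq_vecI) auto
      with vc(2) show False ..
    qed
    then obtain k where k: "k < length xs" "Q k *\<^sub>v v \<noteq> 0\<^sub>v (level (xs ! k))" by blast
    have "eigenvector ((xs ! k) i) (Q k *\<^sub>v v) (z $ i)" for i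
      by (rule ev[OF yc matrix_universeE(2)[OF xu] Qc[OF k(1)] Qy[OF k(1), symmetric] v k(2)]) (use k in simp)
    then show "z \<in> (\<Union>x\<in>set xs. joint_spectrum x)" using k(1) unfolding joint_spectrum_def by fastforce
  next
    fix z assume "z \<in> (\<Union>x\<in>set xs. joint_spectrum x)"
    then obtain k where k: "k < length xs" "z \<in> joint_spectrum (xs ! k)" by (auto simp: in_set_conv_nth)
    then obtain v where v: "\<And>i. eigenvector ((xs ! k) i) v (z $ i)" unfolding joint_spectrum_def by blast
    have xk: "xs ! k \<in> matrix_universe" using xu k by simp
    have vc: "v \<in> carrier_vec (level (xs ! k))" "v \<noteq> 0\<^sub>v (level (xs ! k))"
      using v[of undefined] carrier_matD(1)[OF matrix_universeE(2)[OF xk, of undefined]] unfolding eigenvector_def by simp_all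
    have "P k *\<^sub>v v \<noteq> 0\<^sub>v ?n"
    proof
      assume "P k *\<^sub>v v = 0\<^sub>v ?n"
      then have "(Q k * P k) *\<^sub>v v = Q k *\<^sub>v 0\<^sub>v ?n" using assoc_mult_mat_vec[OF Qc[OF k(1)] Pc[OF k(1)] vc(1)] by simp
      moreover have "Q k *\<^sub>v 0\<^sub>v ?n = 0\<^sub>v (level (xs ! k))" using Qc[OF k(1)] by (intro eq_vecI) (auto simp: scalar_prod_def)
      ultimately show False using vc unfolding QP[OF k(1)] by simp
    qed
    then have "eigenvector (y i) (P k *\<^sub>v v) (z $ i)" for i
      by (rule ev[OF matrix_universeE(2)[OF xk] yc Pc[OF k(1)] yP[OF k(1)] v])
    then show "z \<in> joint_spectrum y" unfolding joint_spectrum_def by blast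
  qed
qed

section \<open>Evaluation along intertwining maps\<close>

lemma word_value_intertwine:
  assumes x: "x \<in> matrix_universe" and x': "x' \<in> matrix_universe" and R: "R \<in> carrier_mat (level x') (level x)"
    and int: "\<And>i. R * x i = x' i * R"
  shows "R * word_value x w = word_value x' w * R"
proof -
  have "R * word_value x (Word u) = word_value x' (Word u) * R" for u
  proof (induction u)
    case Nil
    show ?case using R by simp
  next
    case (Cons i u)
    show ?case unfolding word_value_Cons
      by (rule mat_intertwine_mult[OF matrix_universeE(2)[OF x] word_value_carrier[OF x]
            matrix_universeE(2)[OF x'] word_value_carrier[OF x'] R int Cons])
  qed
  then show ?thesis by (metis free_word.collapse)
qed

text \<open>Lets the intertwining property of monomials be inherited from words.\<close>

lemma word_monomial_surj: "\<exists>w :: 'd::finite free_word. word_monomial w = m"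
proof (induction "mdeg m" arbitrary: m)
  case 0
  then have "m = 0" by (intro poly_mapping_eqI) (simp add: mdeg_def)
  then show ?case by (intro exI[of _ "Word []"]) (simp add: word_monomial_def)
next
  case (Suc k)
  then have "m \<noteq> 0" by (auto simp: mdeg_def)
  then obtain i where i: "Poly_Mapping.lookup m i \<noteq> 0" by (auto simp: poly_mapping_eq_iff fun_eq_iff)
  define m' where "m' = Poly_Mapping.update i (Poly_Mapping.lookup m i - 1) m"
  have m: "m = Poly_Mapping.single i 1 + m'" unfolding m'_def
    using i by (intro poly_mapping_eqI) (auto simp: lookup_add lookup_update lookup_single when_def)
  then have "mdeg m = Suc (mdeg m')" by (simp add: mdeg_add)
  then obtain w :: "'d free_word" where w: "word_monomial w = m'" using Suc.hyps(1)[of m'] Suc.hyps(2) by auto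
  have "word_monomial (Word [i]) = Poly_Mapping.single i 1" by (simp add: word_monomial_def)
  then have "word_monomial (Word [i] + w) = m" unfolding m word_monomial_plus w by simp
  then show ?case by blast
qed

lemma monomial_value_intertwine:
  assumes x: "x \<in> comm_universe" and x': "x' \<in> comm_universe" and R: "R \<in> carrier_mat (level x') (level x)"
    and int: "\<And>i. R * x i = x' i * R"
  shows "R * monomial_value x m = monomial_value x' m * R"
proof -
  obtain w :: "'a free_word" where "word_monomial w = m" using word_monomial_surj by blast
  then show ?thesis
    using word_value_intertwine[OF comm_universeD(1)[OF x] comm_universeD(1)[OF x'] R int, of w]
    by (simp add: word_value_monomial[OF x] word_value_monomial[OF x'])
qed

lemma linear_combination_intertwine:
  assumes R: "R \<in> carrier_mat m n" and X: "\<And>k. k \<in> K \<Longrightarrow> X k \<in> carrier_mat n n" "\<And>k. k \<in> K \<Longrightarrow> Y k \<in> carrier_mat m m"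
    and int: "\<And>k. k \<in> K \<Longrightarrow> R * X k = Y k * R"
  shows "R * linear_combination n c X K = linear_combination m c Y K * R"
proof (rule eq_matI)
  fix a b assume "a < dim_row (linear_combination m c Y K * R)" "b < dim_col (linear_combination m c Y K * R)"
  then have ab: "a < m" "b < n" using R by auto
  have "(R * linear_combination n c X K) $$ (a, b) = (\<Sum>s<n. \<Sum>k\<in>K. c k * (R $$ (a, s) * X k $$ (s, b)))"
    using ab unfolding mat_mult_index[OF R linear_combination_carrier ab]
    by (simp add: linear_combination_index sum_distrib_left mult_ac)
  also have "\<dots> = (\<Sum>k\<in>K. \<Sum>s<n. c k * (R $$ (a, s) * X k $$ (s, b)))" by (rule sum.swap)
  also have "\<dots> = (\<Sum>k\<in>K. c k * (R * X k) $$ (a, b))"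
    by (intro sum.cong refl) (simp add: mat_mult_index[OF R X(1) ab] sum_distrib_left del: index_mult_mat(1))
  also have "\<dots> = (\<Sum>k\<in>K. c k * (Y k * R) $$ (a, b))" using int by (simp del: index_mult_mat(1))
  also have "\<dots> = (\<Sum>k\<in>K. \<Sum>s<m. c k * (Y k $$ (a, s) * R $$ (s, b)))"
    by (intro sum.cong refl) (simp add: mat_mult_index[OF X(2) R ab] sum_distrib_left del: index_mult_mat(1))
  also have "\<dots> = (\<Sum>s<m. \<Sum>k\<in>K. c k * (Y k $$ (a, s) * R $$ (s, b)))" by (rule sum.swap)
  also have "\<dots> = (linear_combination m c Y K * R) $$ (a, b)"
    using ab unfolding mat_mult_index[OF linear_combination_carrier R ab]
    by (simp add: linear_combination_index sum_distrib_left sum_distrib_right mult_ac)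
  finally show "(R * linear_combination n c X K) $$ (a, b) = (linear_combination m c Y K * R) $$ (a, b)" .
qed (use R in auto)

lemma mat_minus_zero_iff:
  fixes A B :: "complex mat"
  assumes "A \<in> carrier_mat n m" "B \<in> carrier_mat n m" "A - B = 0\<^sub>m n m"
  shows "A = B"
proof (rule eq_matI)
  fix i j assume ij: "i < dim_row B" "j < dim_col B"
  have "(A - B) $$ (i, j) = 0\<^sub>m n m $$ (i, j)" unfolding assms(3) ..
  then show "A $$ (i, j) = B $$ (i, j)" using ij assms(1,2) by simp
qed (use assms in auto)

text \<open>Each inclusion \<open>P k\<close> intertwines both sides with the evaluation at summand
  \<open>k\<close>, so their difference is annihilated by all \<open>P k\<close>.\<close>

lemma free_eval_block_similar:
  assumes bs: "block_similar y T S xs"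
  shows "free_eval q y = T * diag_block_mat (map (free_eval q) xs) * S"
proof -
  let ?n = "level y" and ?M = "T * diag_block_mat (map (free_eval q) xs) * S"
  have y: "y \<in> matrix_universe" and xu: "\<And>x. x \<in> set xs \<Longrightarrow> x \<in> matrix_universe"
    using bs by (auto simp: block_similar_def)
  note d = block_similar_dims[OF bs]
  obtain P Q where PQ: "block_projections y T S xs P Q" using block_projections_exist[OF bs] by blast
  note D = block_projectionsD[OF PQ]
  note Pc = D(1) and fP = D(4) and yP = D(6) and cP = D(9)
  have "diag_block_mat (map (free_eval q) xs) \<in> carrier_mat ?n ?n"
    using diag_block_mat_carrier[of xs "free_eval q" level] unfolding d(1) by simp
  then have Mc: "?M \<in> carrier_mat ?n ?n" using d(2,3) by auto
  have "free_eval q y - ?M = 0\<^sub>m ?n ?n"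
  proof (rule cP)
    show "free_eval q y - ?M \<in> carrier_mat ?n ?n" using Mc by (rule minus_carrier_mat)
    fix k assume k: "k < length xs"
    have xk: "xs ! k \<in> matrix_universe" using xu k by simp
    have "P k * free_eval q (xs ! k) = free_eval q y * P k"
      unfolding free_eval_def
      by (rule linear_combination_intertwine[OF Pc[OF k] word_value_carrier[OF xk] word_value_carrier[OF y]
            word_value_intertwine[OF xk y Pc[OF k] yP[OF k, symmetric]]])
    moreover have "?M * P k = P k * free_eval q (xs ! k)" using fP[OF free_eval_carrier k] .
    moreover have "(free_eval q y - ?M) * P k = free_eval q y * P k - ?M * P k"
      using free_eval_carrier Mc Pc[OF k] by (rule minus_mult_distrib_mat)
    ultimately show "(free_eval q y - ?M) * P k = 0\<^sub>m ?n (level (xs ! k))"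
      using minus_r_inv_mat[OF mult_carrier_mat[OF free_eval_carrier Pc[OF k]]] by simp
  qed
  then show ?thesis by (rule mat_minus_zero_iff[OF free_eval_carrier Mc])
qed

text \<open>Converse to \<open>joint_spectrum_nilpotent\<close>. Every summand of a nilpotent
  decomposition has a one-point spectrum contained in that of \<open>x\<close>, so the scalars of
  all summands are the coordinates of \<open>l\<close>. Summands are no larger than
  \<open>x\<close>, so \<open>level x\<close> is a sufficient exponent.\<close>

lemma one_point_spectrum_nilpotent:
  fixes x :: "'d::finite \<Rightarrow> complex mat"
  assumes x: "x \<in> comm_universe" and l: "joint_spectrum x = {l}"
  shows "shift_tuple x l i ^\<^sub>m level x = 0\<^sub>m (level x) (level x)"
proof -
  let ?n = "level x"
  note u = comm_universeD(1)[OF x]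
  note c = matrix_universeE(2)[OF u]
  have n: "?n > 0" using matrix_universeE(1)[OF u] by simp
  obtain T S xs where xs: "\<forall>x\<in>set xs. x \<in> comm_universe \<and> (\<forall>i. \<exists>c. (x i - c \<cdot>\<^sub>m 1\<^sub>m (level x)) ^\<^sub>m level x = 0\<^sub>m (level x) (level x))"
    "\<forall>i. similar_mat_wit (x i) (diag_block_mat (map (\<lambda>x. x i) xs)) T S"
    using nilpotent_decomposition_exists[of x, OF c comm_universeD(2)[OF x] n] by (elim exE conjE)
  have bs: "block_similar x T S xs" using xs u comm_universeD(1) unfolding block_similar_def by blast
  obtain P Q where PQ: "block_projections x T S xs P Q" using block_projections_exist[OF bs] by blast
  note D = block_projectionsD[OF PQ]
  note Pc = D(1) and yP = D(6) and cP = D(9)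
  have sc: "shift_tuple x l i \<in> carrier_mat ?n ?n" using c[of i] by (auto simp: shift_tuple_def)
  show ?thesis
  proof (rule cP)
    show "shift_tuple x l i ^\<^sub>m ?n \<in> carrier_mat ?n ?n" using sc by (rule pow_carrier_mat)
    fix k assume k: "k < length xs"
    let ?z = "xs ! k"
    have z: "?z \<in> comm_universe" using xs k by simp
    note zc = matrix_universeE(2)[OF comm_universeD(1)[OF z]]
    have "\<forall>i. \<exists>c. (?z i - c \<cdot>\<^sub>m 1\<^sub>m (level ?z)) ^\<^sub>m level ?z = 0\<^sub>m (level ?z) (level ?z)" using xs k by simp
    from choice[OF this] obtain c where "\<forall>i. (?z i - c i \<cdot>\<^sub>m 1\<^sub>m (level ?z)) ^\<^sub>m level ?z = 0\<^sub>m (level ?z) (level ?z)" ..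
    then have c': "(?z i - c i \<cdot>\<^sub>m 1\<^sub>m (level ?z)) ^\<^sub>m level ?z = 0\<^sub>m (level ?z) (level ?z)" for i ..
    define l' :: "complex ^ 'd" where "l' = (\<chi> i. c i)"
    have nil: "shift_tuple ?z l' i ^\<^sub>m level ?z = 0\<^sub>m (level ?z) (level ?z)" for i
      using c'[of i] by (simp add: shift_tuple_def l'_def)
    have "joint_spectrum ?z = {l'}" by (rule joint_spectrum_nilpotent[OF z nil])
    moreover have "joint_spectrum ?z \<subseteq> joint_spectrum x" using block_similar_spectrum[OF bs] k by auto
    ultimately have "l' = l" using l by auto
    have zs: "shift_tuple ?z l i \<in> carrier_mat (level ?z) (level ?z)" using zc[of i] by (auto simp: shift_tuple_def)
    have "level ?z \<le> ?n" unfolding block_similar_dims(1)[OF bs, symmetric]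
      using k by (intro member_le_sum_list) auto
    then have "shift_tuple ?z l i ^\<^sub>m ?n = 0\<^sub>m (level ?z) (level ?z)"
      using pow_mat_zero_mono[OF zs] nil unfolding \<open>l' = l\<close> by blast
    moreover have "P k * shift_tuple ?z l i ^\<^sub>m ?n = shift_tuple x l i ^\<^sub>m ?n * P k"
      using mat_intertwine_pow[OF zs sc Pc[OF k]] mat_intertwine_shift[OF zc matrix_universeE(2)[OF u] Pc[OF k] yP[OF k, symmetric]]
      unfolding shift_tuple_def by blast
    ultimately show "shift_tuple x l i ^\<^sub>m ?n * P k = 0\<^sub>m ?n (level ?z)" using Pc[OF k] by simp
  qed
qed

lemma decomposition_exists:
  fixes y :: "'d::finite \<Rightarrow> complex mat"
  assumes y: "y \<in> comm_universe"
  shows "\<exists>T S xs. decomposition y T S xs"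
proof -
  note u = comm_universeD(1)[OF y]
  have n: "level y > 0" using matrix_universeE(1)[OF u] by simp
  obtain T S xs where xs: "\<forall>x\<in>set xs. x \<in> comm_universe \<and> (\<forall>i. \<exists>c. (x i - c \<cdot>\<^sub>m 1\<^sub>m (level x)) ^\<^sub>m level x = 0\<^sub>m (level x) (level x))"
    "\<forall>i. similar_mat_wit (y i) (diag_block_mat (map (\<lambda>x. x i) xs)) T S"
    using nilpotent_decomposition_exists[of y, OF matrix_universeE(2)[OF u] comm_universeD(2)[OF y] n] by (elim exE conjE)
  have "is_singleton (joint_spectrum z)" if z: "z \<in> set xs" for z
  proof -
    have "\<forall>i. \<exists>c. (z i - c \<cdot>\<^sub>m 1\<^sub>m (level z)) ^\<^sub>m level z = 0\<^sub>m (level z) (level z)" using xs z by simp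
    from choice[OF this] obtain c where "\<forall>i. (z i - c i \<cdot>\<^sub>m 1\<^sub>m (level z)) ^\<^sub>m level z = 0\<^sub>m (level z) (level z)" ..
    then have "shift_tuple z (\<chi> i. c i) i ^\<^sub>m level z = 0\<^sub>m (level z) (level z)" for i
      by (simp add: shift_tuple_def)
    moreover have "z \<in> comm_universe" using xs z by blast
    ultimately have "joint_spectrum z = {\<chi> i. c i}" by (intro joint_spectrum_nilpotent)
    then show ?thesis by (simp add: is_singleton_def)
  qed
  then have "decomposition y T S xs" using xs unfolding decomposition_def by blast
  then show ?thesis by blast
qed

section \<open>The functional calculus on commuting tuples\<close>

text \<open>Allowing any finite \<open>K\<close> that contains the support lets two tuples or two
  functions be compared over a common index set.\<close>

lemma local_value_eq:
  fixes x :: "'d::finite \<Rightarrow> complex mat"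
  assumes x: "x \<in> comm_universe" and l: "joint_spectrum x = {l}" and c: "power_series_at g l c"
    and K: "finite K" "{m. monomial_value (shift_tuple x l) m \<noteq> 0\<^sub>m (level x) (level x)} \<subseteq> K"
  shows "local_value g x = linear_combination (level x) c (monomial_value (shift_tuple x l)) K"
proof -
  have "(SOME c. power_series_at g l c) = c"
    using c power_series_at_unique by (intro some_equality)
  then have "local_value g x = linear_combination (level x) c (monomial_value (shift_tuple x l))
      {m. monomial_value (shift_tuple x l) m \<noteq> 0\<^sub>m (level x) (level x)}"
    by (simp add: local_value_def l Let_def shift_tuple_def[abs_def])
  also have "\<dots> = linear_combination (level x) c (monomial_value (shift_tuple x l)) K"
    by (rule linear_combination_mono_neutral[OF K]) blast
  finally show ?thesis .
qed

lemma local_value_carrier [simp]: "local_value g x \<in> carrier_mat (level x) (level x)"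
  by (simp add: local_value_def Let_def)

lemma finite_shift_monomials:
  fixes x :: "'d::finite \<Rightarrow> complex mat"
  assumes x: "x \<in> comm_universe" and l: "joint_spectrum x = {l}"
  shows "finite {m. monomial_value (shift_tuple x l) m \<noteq> 0\<^sub>m (level x) (level x)}"
proof -
  note s = shift_tuple_universe[OF comm_universeD(1)[OF x], of l]
  show ?thesis
    using finite_nonzero_monomials[OF s(1), of "level x"] one_point_spectrum_nilpotent[OF x l] unfolding s(2) by blast
qed

text \<open>For equal spectra, \<open>R\<close> intertwines the shifted tuples and hence all
  monomials in them. For different spectra \<open>R\<close> vanishes: in a coordinate
  \<open>i\<close> where the points differ, shifting by \<open>l $ i\<close> gives a nilpotent on
  one side of \<open>R\<close> and an invertible matrix on the other.\<close>

lemma local_value_intertwine: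
  fixes x x' :: "'d::finite \<Rightarrow> complex mat"
  assumes x: "x \<in> comm_universe" "joint_spectrum x = {l}" and x': "x' \<in> comm_universe" "joint_spectrum x' = {l'}"
    and R: "R \<in> carrier_mat (level x') (level x)" and int: "\<And>i. R * x i = x' i * R"
    and c: "power_series_at g l c"
  shows "R * local_value g x = local_value g x' * R"
proof (cases "l = l'")
  case True
  let ?y = "shift_tuple x l" and ?y' = "shift_tuple x' l"
  note u = comm_universeD(1)[OF x(1)] and u' = comm_universeD(1)[OF x'(1)]
  note s = shift_tuple_universe[OF u, of l] and s' = shift_tuple_universe[OF u', of l]
  let ?K = "{m. monomial_value ?y m \<noteq> 0\<^sub>m (level x) (level x)} \<union> {m. monomial_value ?y' m \<noteq> 0\<^sub>m (level x') (level x')}"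
  have x'l: "joint_spectrum x' = {l}" using x'(2) True by simp
  have K: "finite ?K" using finite_shift_monomials[OF x] finite_shift_monomials[OF x'(1) x'l] by blast
  have ints: "R * ?y i = ?y' i * R" for i
    unfolding shift_tuple_def by (rule mat_intertwine_shift[OF matrix_universeE(2)[OF u] matrix_universeE(2)[OF u'] R int])
  have mono: "R * monomial_value ?y m = monomial_value ?y' m * R" for m
    by (rule monomial_value_intertwine[OF shift_tuple_comm[OF x(1)] shift_tuple_comm[OF x'(1)] _ ints])
      (simp add: s s' R)
  show ?thesis
    unfolding local_value_eq[OF x c K Un_upper1] local_value_eq[OF x'(1) x'l c K Un_upper2]
    by (rule linear_combination_intertwine[OF R _ _ mono])
      (use monomial_value_carrier[OF s(1)] monomial_value_carrier[OF s'(1)] in \<open>simp_all add: s s'\<close>)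
next
  case False
  note u = comm_universeD(1)[OF x(1)] and u' = comm_universeD(1)[OF x'(1)]
  obtain i where i: "l $ i \<noteq> l' $ i" using False by (auto simp: Finite_Cartesian_Product.vec_eq_iff)
  let ?n = "level x" and ?n' = "level x'"
  have xc: "x i \<in> carrier_mat ?n ?n" and xc': "x' i \<in> carrier_mat ?n' ?n'" using matrix_universeE(2)[OF u] matrix_universeE(2)[OF u'] .
  let ?A = "x' i - (l $ i) \<cdot>\<^sub>m 1\<^sub>m ?n'"
  have A: "?A \<in> carrier_mat ?n' ?n'" using xc' by auto
  have "\<not> eigenvalue (x' i) (l $ i)"
  proof
    assume "eigenvalue (x' i) (l $ i)"
    then obtain v where v: "eigenvector (x' i) v (l $ i)" by (auto simp: eigenvalue_def)
    have sc: "shift_tuple x' l' i \<in> carrier_mat ?n' ?n'" using xc' by (auto simp: shift_tuple_def)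
    have ev: "eigenvector (shift_tuple x' l' i) v (l $ i - l' $ i)"
      unfolding shift_tuple_def by (rule eigenvector_shift_iff[OF xc', THEN iffD2, OF v])
    have vc: "v \<in> carrier_vec ?n'" "v \<noteq> 0\<^sub>v ?n'" using v carrier_matD(1)[OF xc'] unfolding eigenvector_def by simp_all
    have "0\<^sub>m ?n' ?n' *\<^sub>v v = (l $ i - l' $ i) ^ ?n' \<cdot>\<^sub>v v"
      using eigenvector_pow[OF sc ev, of ?n'] unfolding one_point_spectrum_nilpotent[OF x'] .
    note eq = arg_cong[OF this, of "\<lambda>w. vec_index w k" for k]
    have "vec_index v k = 0" if k: "k < ?n'" for k
    proof -
      have "vec_index (0\<^sub>m ?n' ?n' *\<^sub>v v) k = 0" using k vc(1) by (simp add: scalar_prod_def)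
      then show ?thesis using eq[of k] k vc(1) i by simp
    qed
    then have "v = 0\<^sub>v ?n'" using vc(1) by (intro eq_vecI) auto
    with vc(2) show False ..
  qed
  from shift_inverse_exists[OF xc' this] obtain B where B: "B \<in> carrier_mat ?n' ?n'" "B * ?A = 1\<^sub>m ?n'" by blast
  have sx: "shift_tuple x l i \<in> carrier_mat ?n ?n" using xc by (auto simp: shift_tuple_def)
  have "R * (shift_tuple x l i) ^\<^sub>m ?n = ?A ^\<^sub>m ?n * R"
    by (rule mat_intertwine_pow[OF sx A R]) (unfold shift_tuple_def, rule mat_intertwine_shift[OF xc xc' R int])
  then have "?A ^\<^sub>m ?n * R = 0\<^sub>m ?n' ?n" unfolding one_point_spectrum_nilpotent[OF x] using R by simp
  then have "R = 0\<^sub>m ?n' ?n" by (rule pow_mult_eq_zero_cancel[OF A B R])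
  then show ?thesis
    using left_mult_zero_mat[OF local_value_carrier[of g x]] right_mult_zero_mat[OF local_value_carrier[of g x']] by simp
qed

lemma decompositionD:
  fixes y :: "'d::finite \<Rightarrow> complex mat"
  assumes "decomposition y T S xs" "x \<in> set xs"
  shows "x \<in> comm_universe" "joint_spectrum x = {the_elem (joint_spectrum x)}"
  using assms by (auto simp: decomposition_def is_singleton_def)

lemma decomposition_spectrum:
  fixes y :: "'d::finite \<Rightarrow> complex mat"
  assumes "decomposition y T S xs" "y \<in> matrix_universe"
  shows "joint_spectrum y = (\<lambda>x. the_elem (joint_spectrum x)) ` set xs"
proof -
  have "(\<Union>x\<in>set xs. joint_spectrum x) = (\<Union>x\<in>set xs. {the_elem (joint_spectrum x)})"
    using decompositionD(2)[OF assms(1)] by (intro SUP_cong refl)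
  then show ?thesis unfolding block_similar_spectrum[OF decomposition_block_similar[OF assms]] by auto
qed

text \<open>The matrix \<open>Q' j * P k\<close> intertwines a summand of one decomposition with a
  summand of the other, so \<open>local_value_intertwine\<close> makes every block of the difference
  vanish. The two lists of summands are never matched up.\<close>

lemma decomposition_independent:
  fixes y :: "'d::finite \<Rightarrow> complex mat"
  assumes y: "y \<in> comm_universe" and d: "decomposition y T S xs" and d': "decomposition y T' S' xs'"
    and g: "\<And>l. l \<in> joint_spectrum y \<Longrightarrow> \<exists>c. power_series_at g l c"
  shows "T * diag_block_mat (map (local_value g) xs) * S = T' * diag_block_mat (map (local_value g) xs') * S'"
proof -
  let ?n = "level y"
  note u = comm_universeD(1)[OF y]
  note bs = decomposition_block_similar[OF d u] and bs' = decomposition_block_similar[OF d' u]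
  let ?M = "T * diag_block_mat (map (local_value g) xs) * S" and ?M' = "T' * diag_block_mat (map (local_value g) xs') * S'"
  note dm = block_similar_dims[OF bs] and dm' = block_similar_dims[OF bs']
  have "diag_block_mat (map (local_value g) xs) \<in> carrier_mat ?n ?n"
    using diag_block_mat_carrier[of xs "local_value g" level] unfolding dm(1) by simp
  then have M: "?M \<in> carrier_mat ?n ?n" using dm(2,3) by auto
  have "diag_block_mat (map (local_value g) xs') \<in> carrier_mat ?n ?n"
    using diag_block_mat_carrier[of xs' "local_value g" level] unfolding dm'(1) by simp
  then have M': "?M' \<in> carrier_mat ?n ?n" using dm'(2,3) by auto
  obtain P Q where PQ: "block_projections y T S xs P Q" using block_projections_exist[OF bs] by blast
  obtain P' Q' where PQ': "block_projections y T' S' xs' P' Q'" using block_projections_exist[OF bs'] by blast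
  note D = block_projectionsD[OF PQ] and D' = block_projectionsD[OF PQ']
  have MM: "?M - ?M' \<in> carrier_mat ?n ?n" using M' by (rule minus_carrier_mat)
  have "?M - ?M' = 0\<^sub>m ?n ?n"
  proof (rule D(9)[OF MM])
    fix k assume k: "k < length xs"
    let ?x = "xs ! k"
    have MP: "(?M - ?M') * P k \<in> carrier_mat ?n (level ?x)" using MM D(1)[OF k] by (rule mult_carrier_mat)
    show "(?M - ?M') * P k = 0\<^sub>m ?n (level ?x)"
    proof (rule D'(8)[OF MP])
      fix j assume j: "j < length xs'"
      let ?x' = "xs' ! j"
      have x: "?x \<in> set xs" and x': "?x' \<in> set xs'" using k j by auto
      define R where "R = Q' j * P k"
      have R: "R \<in> carrier_mat (level ?x') (level ?x)" using D'(2)[OF j] D(1)[OF k] unfolding R_def by (rule mult_carrier_mat)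
      have assoc: "Q' j * Z * P k = Q' j * (Z * P k)" if "Z \<in> carrier_mat ?n ?n" for Z
        using D'(2)[OF j] that D(1)[OF k] by (rule assoc_mult_mat)
      have int: "R * ?x i = ?x' i * R" for i
      proof -
        have xi: "?x i \<in> carrier_mat (level ?x) (level ?x)" "?x' i \<in> carrier_mat (level ?x') (level ?x')"
          using matrix_universeE(2)[OF comm_universeD(1)[OF decompositionD(1)[OF d x]]]
            matrix_universeE(2)[OF comm_universeD(1)[OF decompositionD(1)[OF d' x']]] .
        have "R * ?x i = Q' j * (P k * ?x i)" unfolding R_def using D'(2)[OF j] D(1)[OF k] xi(1) by (rule assoc_mult_mat)
        also have "\<dots> = Q' j * y i * P k" unfolding D(6)[OF k, symmetric] using assoc[OF matrix_universeE(2)[OF u]] by simp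
        also have "\<dots> = ?x' i * R" unfolding D'(7)[OF j] R_def using xi(2) D'(2)[OF j] D(1)[OF k] by (rule assoc_mult_mat)
        finally show ?thesis .
      qed
      have "the_elem (joint_spectrum ?x) \<in> joint_spectrum y" unfolding decomposition_spectrum[OF d u] using x by blast
      then obtain c where c: "power_series_at g (the_elem (joint_spectrum ?x)) c" using g by blast
      have gR: "R * local_value g ?x = local_value g ?x' * R"
        by (rule local_value_intertwine[OF decompositionD[OF d x] decompositionD[OF d' x'] R int c])
      have "Q' j * ((?M - ?M') * P k) = Q' j * (?M * P k) - Q' j * (?M' * P k)"
        unfolding minus_mult_distrib_mat[OF M M' D(1)[OF k]]
        by (rule mult_minus_distrib_mat[OF D'(2)[OF j] mult_carrier_mat[OF M D(1)[OF k]] mult_carrier_mat[OF M' D(1)[OF k]]])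
      also have "Q' j * (?M * P k) = R * local_value g ?x"
        unfolding D(4)[OF local_value_carrier k] R_def
        using D'(2)[OF j] D(1)[OF k] local_value_carrier by (rule assoc_mult_mat[symmetric])
      also have "Q' j * (?M' * P k) = local_value g ?x' * R"
        unfolding assoc[OF M', symmetric] D'(5)[OF local_value_carrier j] R_def
        using local_value_carrier D'(2)[OF j] D(1)[OF k] by (rule assoc_mult_mat)
      also have "R * local_value g ?x - local_value g ?x' * R = 0\<^sub>m (level ?x') (level ?x)"
        unfolding gR using R local_value_carrier by (intro minus_r_inv_mat mult_carrier_mat)
      finally show "Q' j * ((?M - ?M') * P k) = 0\<^sub>m (level ?x') (level ?x)" .
    qed
  qed
  then show ?thesis by (rule mat_minus_zero_iff[OF M M'])
qed

lemma hol_value_eq: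
  fixes y :: "'d::finite \<Rightarrow> complex mat"
  assumes y: "y \<in> comm_universe" and d: "decomposition y T S xs"
    and g: "\<And>l. l \<in> joint_spectrum y \<Longrightarrow> \<exists>c. power_series_at g l c"
  shows "hol_value g y = T * diag_block_mat (map (local_value g) xs) * S"
proof -
  have "\<exists>T S xs. decomposition y T S xs \<and> hol_value g y = T * diag_block_mat (map (local_value g) xs) * S"
    unfolding hol_value_def by (rule someI_ex) (use d in blast)
  then obtain T0 S0 xs0 where 0: "decomposition y T0 S0 xs0"
    "hol_value g y = T0 * diag_block_mat (map (local_value g) xs0) * S0" by blast
  show ?thesis unfolding 0(2) by (rule decomposition_independent[OF y 0(1) d g])
qed

lemma block_diag_zeroD:
  assumes bs: "block_similar y T S xs" and f: "\<And>x. x \<in> set xs \<Longrightarrow> f x \<in> carrier_mat (level x) (level x)"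
    and z: "T * diag_block_mat (map f xs) * S = 0\<^sub>m (level y) (level y)" and k: "k < length xs"
  shows "f (xs ! k) = 0\<^sub>m (level (xs ! k)) (level (xs ! k))"
proof -
  obtain P Q where PQ: "block_projections y T S xs P Q" using block_projections_exist[OF bs] by blast
  note D = block_projectionsD[OF PQ]
  have fk: "f (xs ! k) \<in> carrier_mat (level (xs ! k)) (level (xs ! k))" using f k by simp
  have "P k * f (xs ! k) = 0\<^sub>m (level y) (level (xs ! k))"
    using D(4)[OF f k] D(1)[OF k] unfolding z by simp
  then have "Q k * P k * f (xs ! k) = 0\<^sub>m (level (xs ! k)) (level (xs ! k))"
    using assoc_mult_mat[OF D(2)[OF k] D(1)[OF k] fk] D(2)[OF k] by simp
  then show ?thesis unfolding D(3)[OF k] using fk by simp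
qed

lemma local_value_diff:
  fixes x :: "'d::finite \<Rightarrow> complex mat"
  assumes x: "x \<in> comm_universe" "joint_spectrum x = {l}" and f: "power_series_at f l c" and g: "power_series_at g l c'"
  shows "local_value (\<lambda>z. f z - g z) x = local_value f x - local_value g x"
proof -
  note K = finite_shift_monomials[OF x]
  show ?thesis
    unfolding local_value_eq[OF x power_series_at_diff[OF f g] K order_refl]
      local_value_eq[OF x f K order_refl] local_value_eq[OF x g K order_refl]
    by (rule eq_matI) (auto simp: linear_combination_index left_diff_distrib sum_subtractf)
qed

lemma local_value_cong:
  fixes x :: "'d::finite \<Rightarrow> complex mat"
  assumes "joint_spectrum x = {l}" "0 < e" "\<And>z. z \<in> ball l e \<Longrightarrow> f z = g z"
  shows "local_value f x = local_value g x"
proof -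
  have "power_series_at f l = power_series_at g l"
    by (intro ext power_series_at_cong[OF assms(2,3)])
  then show ?thesis by (simp add: local_value_def assms(1))
qed

section \<open>Gluing and local extensions\<close>

lemma holomorphic_several_subset:
  "holomorphic_several g U \<Longrightarrow> open W \<Longrightarrow> W \<subseteq> U \<Longrightarrow> holomorphic_several g W"
  unfolding holomorphic_several_def by blast

lemma holomorphic_several_cong:
  assumes "holomorphic_several g U" "\<And>z. z \<in> U \<Longrightarrow> f z = g z"
  shows "holomorphic_several f U"
  unfolding holomorphic_several_def
proof (intro conjI ballI)
  show oU: "open U" using assms(1) by (simp add: holomorphic_several_def)
  fix z assume z: "z \<in> U"
  then obtain c :: "complex ^ 'a" where "(g has_derivative (\<lambda>h. \<Sum>i\<in>UNIV. c $ i * h $ i)) (at z)"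
    using assms(1) unfolding holomorphic_several_def by blast
  then have "(f has_derivative (\<lambda>h. \<Sum>i\<in>UNIV. c $ i * h $ i)) (at z)"
    by (rule has_derivative_transform_within_open[OF _ oU z]) (simp add: assms(2))
  then show "\<exists>c :: complex ^ 'a. (f has_derivative (\<lambda>h. \<Sum>i\<in>UNIV. c $ i * h $ i)) (at z)" by blast
qed

text \<open>Subordination is tested with one function near the whole spectrum, whereas local
  extensions are attached to single points. Finitely many points have disjoint balls, so the pieces
  never meet and can be prescribed independently.\<close>

lemma holomorphic_several_glue:
  fixes W :: "complex ^ 'd::finite \<Rightarrow> (complex ^ 'd) set" and g :: "complex ^ 'd \<Rightarrow> complex ^ 'd \<Rightarrow> complex"
  assumes fin: "finite \<Lambda>" and l: "\<And>l. l \<in> \<Lambda> \<Longrightarrow> l \<in> W l" and g: "\<And>l. l \<in> \<Lambda> \<Longrightarrow> holomorphic_several (g l) (W l)"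
  shows "\<exists>U G. \<Lambda> \<subseteq> U \<and> holomorphic_several G U \<and> (\<forall>z\<in>U. \<exists>l\<in>\<Lambda>. z \<in> W l \<and> G z = g l z) \<and>
    (\<forall>l\<in>\<Lambda>. \<exists>e>0. \<forall>z\<in>ball l e. G z = g l z)"
proof -
  have "\<forall>l. \<exists>e>0. \<forall>l'\<in>\<Lambda>. l' \<noteq> l \<longrightarrow> e \<le> dist l l'"
    by (intro allI finite_set_avoid fin)
  from choice[OF this] obtain d where "\<forall>l. d l > 0 \<and> (\<forall>l'\<in>\<Lambda>. l' \<noteq> l \<longrightarrow> d l \<le> dist l l')" ..
  then have d: "\<And>l. d l > 0" "\<And>l l'. l' \<in> \<Lambda> \<Longrightarrow> l' \<noteq> l \<Longrightarrow> d l \<le> dist l l'" by simp_all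
  have "\<forall>l\<in>\<Lambda>. \<exists>e>0. ball l e \<subseteq> W l"
  proof
    fix l' assume l': "l' \<in> \<Lambda>"
    then have "open (W l')" using g[OF l'] unfolding holomorphic_several_def by (elim conjE)
    then show "\<exists>e>0. ball l' e \<subseteq> W l'" using l[OF l'] by (rule openE) blast
  qed
  from bchoice[OF this] obtain e where "\<forall>l\<in>\<Lambda>. e l > 0 \<and> ball l (e l) \<subseteq> W l" ..
  then have e: "\<And>l. l \<in> \<Lambda> \<Longrightarrow> e l > 0" "\<And>l. l \<in> \<Lambda> \<Longrightarrow> ball l (e l) \<subseteq> W l" by simp_all
  \<comment> \<open>At most half the distance to the nearest other point, which separates the balls;
    \<open>e l\<close> keeps them inside \<open>W l\<close>.\<close>
  define r where "r l = min (d l / 2) (e l)" for l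
  have r: "r l > 0" "ball l (r l) \<subseteq> W l" if "l \<in> \<Lambda>" for l
    using d(1)[of l] e(1)[OF that] e(2)[OF that] by (auto simp: r_def)
  have disj: "l = l'" if "l \<in> \<Lambda>" "l' \<in> \<Lambda>" "z \<in> ball l (r l)" "z \<in> ball l' (r l')" for l l' z
  proof (rule ccontr)
    assume "l \<noteq> l'"
    then have "d l \<le> dist l l'" "d l' \<le> dist l' l" using d(2)[OF that(2), of l] d(2)[OF that(1), of l'] by simp_all
    moreover have "dist l l' < r l + r l'" using that(3,4) dist_triangle2[of l l' z] by simp
    ultimately show False unfolding r_def by (simp add: dist_commute[of l' l])
  qed
  define U where "U = (\<Union>l\<in>\<Lambda>. ball l (r l))"
  define G where "G z = g (THE l. l \<in> \<Lambda> \<and> z \<in> ball l (r l)) z" for z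
  have G: "G z = g l z" if "l \<in> \<Lambda>" "z \<in> ball l (r l)" for l z
  proof -
    have "(THE l. l \<in> \<Lambda> \<and> z \<in> ball l (r l)) = l" 
    proof (rule the_equality)
      show "l \<in> \<Lambda> \<and> z \<in> ball l (r l)" using that by (intro conjI)
      fix l' assume "l' \<in> \<Lambda> \<and> z \<in> ball l' (r l')"
      then show "l' = l" using disj[OF _ that(1) _ that(2)] by (elim conjE)
    qed
    then show ?thesis by (simp add: G_def)
  qed
  have "holomorphic_several G U"
    unfolding holomorphic_several_def
  proof (intro conjI ballI)
    show "open U" unfolding U_def by blast
    fix z assume "z \<in> U"
    then obtain l where l: "l \<in> \<Lambda>" "z \<in> ball l (r l)" by (auto simp: U_def)
    have "holomorphic_several (g l) (ball l (r l))" 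
      by (rule holomorphic_several_subset[OF g[OF l(1)] open_ball r(2)[OF l(1)]])
    then have "holomorphic_several G (ball l (r l))" by (rule holomorphic_several_cong) (rule G[OF l(1)])
    then show "\<exists>c :: complex ^ 'd. (G has_derivative (\<lambda>h. \<Sum>i\<in>UNIV. c $ i * h $ i)) (at z)"
      using l(2) unfolding holomorphic_several_def by blast
  qed
  moreover have "\<Lambda> \<subseteq> U"
  proof
    fix l assume "l \<in> \<Lambda>"
    then have "l \<in> ball l (r l)" using r(1) by simp
    with \<open>l \<in> \<Lambda>\<close> show "l \<in> U" unfolding U_def by (rule UN_I)
  qed
  moreover have "\<forall>z\<in>U. \<exists>l\<in>\<Lambda>. z \<in> W l \<and> G z = g l z"
  proof
    fix z assume "z \<in> U"
    then obtain l where l: "l \<in> \<Lambda>" "z \<in> ball l (r l)" unfolding U_def by blast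
    then have "z \<in> W l" "G z = g l z" using r(2)[OF l(1)] G[OF l] by auto
    with l(1) show "\<exists>l\<in>\<Lambda>. z \<in> W l \<and> G z = g l z" by (intro bexI conjI)
  qed
  moreover have "\<forall>l\<in>\<Lambda>. \<exists>e>0. \<forall>z\<in>ball l e. G z = g l z"
  proof
    fix l assume l: "l \<in> \<Lambda>"
    have "\<forall>z\<in>ball l (r l). G z = g l z" by (intro ballI G l)
    with r(1)[OF l] show "\<exists>e>0. \<forall>z\<in>ball l e. G z = g l z" by (intro exI conjI)
  qed
  ultimately show ?thesis by (intro exI conjI)
qed

text \<open>The values of two local extensions of \<open>f\<close> at a point of the spectrum agree since their difference
  vanishes on \<open>V\<close> near that point.\<close>

lemma subordinate_local_extension:
  fixes y :: "'d::finite \<Rightarrow> complex mat"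
  assumes y: "y \<in> comm_universe" and sub: "subordinate V y" and d: "decomposition y T S xs"
    and G: "joint_spectrum y \<subseteq> U" "holomorphic_several G U" "\<And>z. z \<in> U \<inter> V \<Longrightarrow> G z = f z"
    and x: "x \<in> set xs" and g: "local_extension V f (the_elem (joint_spectrum x)) g"
  shows "local_value g x = local_value G x"
proof -
  note u = comm_universeD(1)[OF y]
  define l where "l = the_elem (joint_spectrum x)"
  have xl: "x \<in> comm_universe" "joint_spectrum x = {l}" using decompositionD[OF d x] by (auto simp: l_def)
  have sp: "joint_spectrum y = (\<lambda>x. the_elem (joint_spectrum x)) ` set xs" by (rule decomposition_spectrum[OF d u])
  have ly: "l \<in> joint_spectrum y" unfolding sp l_def using x by blast
  obtain W where W: "l \<in> W" "holomorphic_several g W" "\<And>z. z \<in> W \<inter> V \<Longrightarrow> g z = f z"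
    using g unfolding local_extension_def l_def by blast
  have oW: "open W" "open U" using W(2) G(2) by (simp_all add: holomorphic_several_def)
  have diff: "holomorphic_several (\<lambda>z. g z - G z) (W \<inter> U)"
  proof (rule separately_holomorphic_imp_several)
    show "open (W \<inter> U)" using oW by blast
    fix p assume p: "p \<in> W \<inter> U"
    have hg: "holomorphic_several g (W \<inter> U)" "holomorphic_several G (W \<inter> U)"
      using W(2) G(2) oW by (auto intro: holomorphic_several_subset)
    obtain R M where R: "R > 0" "separately_holomorphic g p R M" using holomorphic_several_separately[OF hg(1) p] by blast
    obtain R' M' where R': "R' > 0" "separately_holomorphic G p R' M'" using holomorphic_several_separately[OF hg(2) p] by blast
    let ?r = "min R R'"
    have s: "separately_holomorphic g p ?r M" "separately_holomorphic G p ?r M'"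
      using R R' by (auto intro: separately_holomorphic_subset)
    have "separately_holomorphic (\<lambda>z. g z - G z) p ?r (M + M')"
    proof (rule separately_holomorphic_diff[OF s])
      fix z assume "z \<in> polydisc p ?r"
      then have "cmod (g z) \<le> M" "cmod (G z) \<le> M'" using s by (auto simp: separately_holomorphic_def)
      then show "cmod (g z - G z) \<le> M + M'" using norm_triangle_ineq4[of "g z" "G z"] by linarith
    qed
    moreover have "?r > 0" using R(1) R'(1) by simp
    ultimately show "\<exists>R>0. \<exists>M. separately_holomorphic (\<lambda>z. g z - G z) p R M" by (intro exI conjI)
  qed
  \<comment> \<open>The difference of the two extensions near \<open>l\<close> and 0 near the other
    points: gluing these gives an admissible test function for subordination that sees only the
    summands at \<open>l\<close>.\<close>
  define k where "k p = (if p = l then (\<lambda>z. g z - G z) else (\<lambda>_. 0))" for p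
  define X where "X p = (if p = l then W \<inter> U else UNIV)" for p
  have zero: "holomorphic_several (\<lambda>_. 0) (UNIV :: (complex ^ 'd) set)"
    unfolding holomorphic_several_def by (auto intro!: exI[of _ 0])
  have "finite (joint_spectrum y)" unfolding sp by simp
  moreover have "p \<in> X p" if "p \<in> joint_spectrum y" for p using that W(1) G(1) by (auto simp: X_def)
  moreover have "holomorphic_several (k p) (X p)" for p using diff zero by (simp add: k_def X_def)
  ultimately obtain U' h where h: "joint_spectrum y \<subseteq> U'" "holomorphic_several h U'"
    "\<And>z. z \<in> U' \<Longrightarrow> \<exists>p\<in>joint_spectrum y. z \<in> X p \<and> h z = k p z"
    "\<And>p. p \<in> joint_spectrum y \<Longrightarrow> \<exists>e>0. \<forall>z\<in>ball p e. h z = k p z"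
    using holomorphic_several_glue[of "joint_spectrum y" X k] by blast
  have "h z = 0" if "z \<in> U' \<inter> V" for z
  proof -
    obtain p where p: "z \<in> X p" "h z = k p z" using h(3) \<open>z \<in> U' \<inter> V\<close> by blast
    show ?thesis using p that W(3)[of z] G(3)[of z] by (cases "p = l") (auto simp: X_def k_def)
  qed
  then have "hol_value h y = 0\<^sub>m (level y) (level y)"
    using sub h(1,2) unfolding subordinate_def by blast
  moreover have "hol_value h y = T * diag_block_mat (map (local_value h) xs) * S"
    by (rule hol_value_eq[OF y d]) (use holomorphic_several_power_series_at[OF h(2)] h(1) in blast)
  ultimately have z: "T * diag_block_mat (map (local_value h) xs) * S = 0\<^sub>m (level y) (level y)" by simp
  obtain j where j: "j < length xs" "x = xs ! j" using x by (auto simp: in_set_conv_nth)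
  have hx: "local_value h x = 0\<^sub>m (level x) (level x)"
    unfolding j(2) by (rule block_diag_zeroD[OF decomposition_block_similar[OF d u] local_value_carrier z j(1)])
  obtain e where "e > 0" "\<forall>z\<in>ball l e. h z = k l z" using h(4)[OF ly] by blast
  then have "local_value h x = local_value (\<lambda>z. g z - G z) x"
    by (intro local_value_cong[OF xl(2)]) (auto simp: k_def)
  also have "\<dots> = local_value g x - local_value G x"
  proof -
    obtain c c' where "power_series_at g l c" "power_series_at G l c'"
      using holomorphic_several_power_series_at[OF W(2,1)] holomorphic_several_power_series_at[OF G(2)] G(1) ly by blast
    then show ?thesis by (rule local_value_diff[OF xl])
  qed
  finally have "local_value g x - local_value G x = 0\<^sub>m (level x) (level x)" using hx by simp
  then show ?thesis by (rule mat_minus_zero_iff[OF local_value_carrier local_value_carrier])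
qed

text \<open>Frees \<open>variety_value\<close> from its choices:
  \<open>decomposition_independent\<close> disposes of the summands and
  \<open>subordinate_local_extension\<close> of the local extensions, so one \<open>G\<close> near
  the spectrum may be used throughout.\<close>

lemma variety_value_eq:
  fixes y :: "'d::finite \<Rightarrow> complex mat"
  assumes y: "y \<in> spectrum_in V" and sub: "subordinate V y" and d: "decomposition y T S xs" and f: "f \<in> Hol V"
    and G: "joint_spectrum y \<subseteq> U" "holomorphic_several G U" "\<And>z. z \<in> U \<inter> V \<Longrightarrow> G z = f z"
  shows "variety_value V f y = T * diag_block_mat (map (local_value G) xs) * S"
proof -
  have yc: "y \<in> comm_universe" and yV: "joint_spectrum y \<subseteq> V" using y by (auto simp: spectrum_in_def)
  have "\<forall>x\<in>set xs. \<exists>g. local_extension V f (the_elem (joint_spectrum x)) g"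
    using f yV unfolding decomposition_spectrum[OF d comm_universeD(1)[OF yc]] Hol_def by blast
  from bchoice[OF this] obtain g where g: "\<forall>x\<in>set xs. local_extension V f (the_elem (joint_spectrum x)) (g x)" ..
  have l2: "list_all2 (\<lambda>g x. local_extension V f (the_elem (joint_spectrum x)) g) (map g xs) xs"
    using g by (simp add: list_all2_conv_all_nth)
  have "\<exists>T S xs gs. decomposition y T S xs \<and>
     list_all2 (\<lambda>g x. local_extension V f (the_elem (joint_spectrum x)) g) gs xs \<and>
     variety_value V f y = T * diag_block_mat (map2 local_value gs xs) * S"
    unfolding variety_value_def by (rule someI_ex) (use d l2 in blast)
  then obtain T' S' xs' gs where v: "decomposition y T' S' xs'"
    "list_all2 (\<lambda>g x. local_extension V f (the_elem (joint_spectrum x)) g) gs xs'"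
    "variety_value V f y = T' * diag_block_mat (map2 local_value gs xs') * S'" by blast
  have "map2 local_value gs xs' = map (local_value G) xs'"
  proof (rule nth_equalityI)
    show "length (map2 local_value gs xs') = length (map (local_value G) xs')" using v(2) by (simp add: list_all2_lengthD)
    fix k assume "k < length (map2 local_value gs xs')"
    then have k: "k < length gs" "k < length xs'" by auto
    have le: "local_extension V f (the_elem (joint_spectrum (xs' ! k))) (gs ! k)"
      using v(2) k by (simp add: list_all2_conv_all_nth)
    have "local_value (gs ! k) (xs' ! k) = local_value G (xs' ! k)"
      by (rule subordinate_local_extension[OF yc sub v(1) G(1,2) _ nth_mem[OF k(2)] le]) (rule G(3))
    then show "map2 local_value gs xs' ! k = map (local_value G) xs' ! k" using k by simp
  qed
  show ?thesis unfolding v(3) \<open>map2 local_value gs xs' = _\<close>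
  proof (rule decomposition_independent[OF yc v(1) d])
    fix l assume "l \<in> joint_spectrum y"
    then have "l \<in> U" using G(1) by blast
    then show "\<exists>c. power_series_at G l c" by (rule holomorphic_several_power_series_at[OF G(2)])
  qed
qed

lemma Hol_extension_near_finite:
  assumes "f \<in> Hol V" "finite \<Lambda>" "\<Lambda> \<subseteq> V"
  shows "\<exists>U G. \<Lambda> \<subseteq> U \<and> holomorphic_several G U \<and> (\<forall>z\<in>U \<inter> V. G z = f z)"
proof -
  have "\<forall>l\<in>\<Lambda>. \<exists>W g. l \<in> W \<and> holomorphic_several g W \<and> (\<forall>z\<in>W \<inter> V. g z = f z)"
    using assms(1,3) unfolding Hol_def local_extension_def by blast
  from bchoice[OF this] obtain W where "\<forall>l\<in>\<Lambda>. \<exists>g. l \<in> W l \<and> holomorphic_several g (W l) \<and> (\<forall>z\<in>W l \<inter> V. g z = f z)" ..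
  from bchoice[OF this] obtain g where H: "\<forall>l\<in>\<Lambda>. l \<in> W l \<and> holomorphic_several (g l) (W l) \<and> (\<forall>z\<in>W l \<inter> V. g l z = f z)" ..
  have W: "\<And>l. l \<in> \<Lambda> \<Longrightarrow> l \<in> W l" "\<And>l. l \<in> \<Lambda> \<Longrightarrow> holomorphic_several (g l) (W l)"
    and 3: "\<And>l z. l \<in> \<Lambda> \<Longrightarrow> z \<in> W l \<inter> V \<Longrightarrow> g l z = f z" using H by blast+
  from holomorphic_several_glue[OF assms(2) W]
  obtain U G where U: "\<Lambda> \<subseteq> U" "holomorphic_several G U" "\<forall>z\<in>U. \<exists>l\<in>\<Lambda>. z \<in> W l \<and> G z = g l z" by blast
  have "\<forall>z\<in>U \<inter> V. G z = f z"
  proof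
    fix z assume z: "z \<in> U \<inter> V"
    then obtain l where "l \<in> \<Lambda>" "z \<in> W l" "G z = g l z" using U(3) by blast
    then show "G z = f z" using 3[of l z] z by simp
  qed
  with U show ?thesis by blast
qed

subsection \<open>Values of polynomials\<close>

definition free_scalar :: "'d::finite free_poly \<Rightarrow> complex ^ 'd \<Rightarrow> complex" where
  "free_scalar q z = scalar_eval (abelianize q) z"

lemma free_eval_scalar_index: "free_eval q (scalar_tuple z) $$ (0, 0) = free_scalar q z"
  by (simp add: free_eval_scalar free_scalar_def)

lemma free_scalar_sum: "free_scalar q z = (\<Sum>w\<in>Poly_Mapping.keys q. Poly_Mapping.lookup q w * scalar_monomial z (word_monomial w))"
  by (simp add: free_scalar_def abelianize_def scalar_eval_sum scalar_eval_single)

text \<open>Induction on the word, writing \<open>z $ i\<close> as \<open>l $ i\<close> plus the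
  coordinate of \<open>z - l\<close>. One and the same \<open>p\<close> serves scalars and commuting
  tuples, so it is at once the Taylor expansion at \<open>l\<close> and a formula for the matrix
  value.\<close>

lemma word_recentered:
  fixes l :: "complex ^ 'd::finite"
  shows "\<exists>p :: 'd comm_poly. (\<forall>z. scalar_monomial z (word_monomial (Word u)) = scalar_eval p (z - l)) \<and>
    (\<forall>x\<in>comm_universe. word_value x (Word u) = comm_eval p (shift_tuple x l))"
proof (induction u)
  case Nil
  have "comm_eval (Poly_Mapping.single 0 1) (shift_tuple x l) = 1\<^sub>m (level x)" if x: "x \<in> comm_universe" for x
  proof (rule eq_matI)
    note s = shift_tuple_universe[OF comm_universeD(1)[OF x], of l]
    show "dim_row (comm_eval (Poly_Mapping.single 0 1) (shift_tuple x l)) = dim_row (1\<^sub>m (level x))"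
      "dim_col (comm_eval (Poly_Mapping.single 0 1) (shift_tuple x l)) = dim_col (1\<^sub>m (level x))"
      using s(2) by simp_all
    fix a b assume "a < dim_row (1\<^sub>m (level x) :: complex mat)" "b < dim_col (1\<^sub>m (level x) :: complex mat)"
    then have ab: "a < level (shift_tuple x l)" "b < level (shift_tuple x l)" using s(2) by simp_all
    then show "comm_eval (Poly_Mapping.single 0 1) (shift_tuple x l) $$ (a, b) = 1\<^sub>m (level x) $$ (a, b)"
      unfolding comm_eval_single_index[OF ab] monomial_value_zero[OF s(1)] s(2) by simp
  qed
  then show ?case
    by (intro exI[of _ "Poly_Mapping.single 0 1"]) (simp add: scalar_eval_single word_monomial_def del: single_one)
next
  case (Cons i u)
  then obtain p :: "'d comm_poly" where p: "\<And>z. scalar_monomial z (word_monomial (Word u)) = scalar_eval p (z - l)"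
    "\<And>x. x \<in> comm_universe \<Longrightarrow> word_value x (Word u) = comm_eval p (shift_tuple x l)" by blast
  let ?e = "Poly_Mapping.single i 1 :: 'd \<Rightarrow>\<^sub>0 nat"
  define p' where "p' = (\<Sum>m\<in>Poly_Mapping.keys p. Poly_Mapping.single m (l $ i * Poly_Mapping.lookup p m)
    + Poly_Mapping.single (?e + m) (Poly_Mapping.lookup p m))"
  have 1: "scalar_monomial z (word_monomial (Word (i # u))) = scalar_eval p' (z - l)" for z
  proof -
    have "scalar_eval p' (z - l) = (\<Sum>m\<in>Poly_Mapping.keys p. z $ i * (Poly_Mapping.lookup p m * scalar_monomial (z - l) m))"
      unfolding p'_def scalar_eval_sum scalar_eval_add scalar_eval_single scalar_monomial_Suc
      by (intro sum.cong refl) (simp add: algebra_simps)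
    also have "\<dots> = z $ i * scalar_monomial z (word_monomial (Word u))"
      unfolding p(1) scalar_eval_def sum_distrib_left ..
    also have "\<dots> = scalar_monomial z (word_monomial (Word (i # u)))"
      using scalar_monomial_Suc[of z i "word_monomial (Word u)"] by (simp add: word_monomial_def)
    finally show ?thesis ..
  qed
  have 2: "word_value x (Word (i # u)) = comm_eval p' (shift_tuple x l)" if x: "x \<in> comm_universe" for x
  proof (rule eq_matI)
    let ?y = "shift_tuple x l" and ?n = "level x"
    note u = comm_universeD(1)[OF x]
    note s = shift_tuple_universe[OF u, of l]
    note sc = shift_tuple_comm[OF x, of l]
    have xc: "x i \<in> carrier_mat ?n ?n" using matrix_universeE(2)[OF u] .
    have yc: "?y i \<in> carrier_mat ?n ?n" using matrix_universeE(2)[OF s(1)] unfolding s(2) .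
    have mc: "monomial_value ?y m \<in> carrier_mat ?n ?n" for m using monomial_value_carrier[OF s(1)] unfolding s(2) .
    have ec: "comm_eval p ?y \<in> carrier_mat ?n ?n" using comm_eval_carrier[of p ?y] unfolding s(2) .
    show "dim_row (word_value x (Word (i # u))) = dim_row (comm_eval p' ?y)"
      "dim_col (word_value x (Word (i # u))) = dim_col (comm_eval p' ?y)"
      using word_value_carrier[OF u] s(2) by auto
    fix a b assume "a < dim_row (comm_eval p' ?y)" "b < dim_col (comm_eval p' ?y)"
    then have ab: "a < ?n" "b < ?n" using s(2) by simp_all
    then have ab': "a < level ?y" "b < level ?y" using s(2) by simp_all
    have ev: "comm_eval p ?y $$ (c, b) = (\<Sum>m\<in>Poly_Mapping.keys p. Poly_Mapping.lookup p m * monomial_value ?y m $$ (c, b))"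
      if "c < ?n" for c using that ab s(2) by (simp add: comm_eval_def linear_combination_index)
    have idx: "comm_eval (q + r) ?y $$ (a, b) = comm_eval q ?y $$ (a, b) + comm_eval r ?y $$ (a, b)" for q r
      using ab' by (simp add: comm_eval_add)
    have "comm_eval p' ?y $$ (a, b) = (\<Sum>m\<in>Poly_Mapping.keys p. l $ i * (Poly_Mapping.lookup p m * monomial_value ?y m $$ (a, b))
      + Poly_Mapping.lookup p m * (?y i * monomial_value ?y m) $$ (a, b))"
      unfolding p'_def comm_eval_sum_index[OF ab'] idx comm_eval_single_index[OF ab'] monomial_value_Suc[OF sc]
      by (simp add: mult_ac del: index_mult_mat(1))
    also have "\<dots> = l $ i * comm_eval p ?y $$ (a, b) +
      (\<Sum>m\<in>Poly_Mapping.keys p. Poly_Mapping.lookup p m * (?y i * monomial_value ?y m) $$ (a, b))"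
      unfolding ev[OF ab(1)] by (simp add: sum.distrib sum_distrib_left del: index_mult_mat(1))
    also have "(\<Sum>m\<in>Poly_Mapping.keys p. Poly_Mapping.lookup p m * (?y i * monomial_value ?y m) $$ (a, b))
      = (\<Sum>m\<in>Poly_Mapping.keys p. \<Sum>c<?n. ?y i $$ (a, c) * (Poly_Mapping.lookup p m * monomial_value ?y m $$ (c, b)))"
      unfolding mat_mult_index[OF yc mc ab] by (simp add: sum_distrib_left mult_ac)
    also have "\<dots> = (\<Sum>c<?n. \<Sum>m\<in>Poly_Mapping.keys p. ?y i $$ (a, c) * (Poly_Mapping.lookup p m * monomial_value ?y m $$ (c, b)))"
      by (rule sum.swap)
    also have "\<dots> = (\<Sum>c<?n. ?y i $$ (a, c) * comm_eval p ?y $$ (c, b))"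
      by (intro sum.cong refl) (simp add: ev sum_distrib_left)
    also have "l $ i * comm_eval p ?y $$ (a, b) = (\<Sum>c<?n. (if a = c then l $ i else 0) * comm_eval p ?y $$ (c, b))"
      using ab by (simp add: mult_delta_left)
    also have "\<dots> + (\<Sum>c<?n. ?y i $$ (a, c) * comm_eval p ?y $$ (c, b))
      = (\<Sum>c<?n. x i $$ (a, c) * comm_eval p ?y $$ (c, b))"
      unfolding sum.distrib[symmetric] distrib_right[symmetric]
      using ab xc by (intro sum.cong refl) (simp add: shift_tuple_def)
    also have "\<dots> = (x i * word_value x (Word u)) $$ (a, b)" unfolding p(2)[OF x] mat_mult_index[OF xc ec ab] ..
    finally show "word_value x (Word (i # u)) $$ (a, b) = comm_eval p' ?y $$ (a, b)" by (simp add: word_value_Cons)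
  qed
  from 1 2 show ?case by blast
qed

lemma free_poly_recentered:
  fixes l :: "complex ^ 'd::finite" and q :: "'d free_poly"
  shows "\<exists>p :: 'd comm_poly. (\<forall>z. free_scalar q z = scalar_eval p (z - l)) \<and>
    (\<forall>x\<in>comm_universe. free_eval q x = comm_eval p (shift_tuple x l))"
proof -
  have "\<forall>w. \<exists>p :: 'd comm_poly. (\<forall>z. scalar_monomial z (word_monomial w) = scalar_eval p (z - l)) \<and>
    (\<forall>x\<in>comm_universe. word_value x w = comm_eval p (shift_tuple x l))"
    using word_recentered[of "letters _" l] by simp
  from choice[OF this] obtain P :: "'d free_word \<Rightarrow> 'd comm_poly" where
    P: "\<forall>w. (\<forall>z. scalar_monomial z (word_monomial w) = scalar_eval (P w) (z - l)) \<and>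
    (\<forall>x\<in>comm_universe. word_value x w = comm_eval (P w) (shift_tuple x l))" ..
  then have P1: "scalar_monomial z (word_monomial w) = scalar_eval (P w) (z - l)"
    and P2: "x \<in> comm_universe \<Longrightarrow> word_value x w = comm_eval (P w) (shift_tuple x l)" for z w x by simp_all
  define p where "p = (\<Sum>w\<in>Poly_Mapping.keys q. \<Sum>m\<in>Poly_Mapping.keys (P w).
    Poly_Mapping.single m (Poly_Mapping.lookup q w * Poly_Mapping.lookup (P w) m))"
  have "free_scalar q z = scalar_eval p (z - l)" for z
    unfolding free_scalar_sum P1 p_def scalar_eval_sum scalar_eval_single
    by (simp add: scalar_eval_def sum_distrib_left mult_ac)
  moreover have "free_eval q x = comm_eval p (shift_tuple x l)" if x: "x \<in> comm_universe" for x
  proof (rule eq_matI)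
    note s = shift_tuple_universe[OF comm_universeD(1)[OF x], of l]
    show "dim_row (free_eval q x) = dim_row (comm_eval p (shift_tuple x l))"
      "dim_col (free_eval q x) = dim_col (comm_eval p (shift_tuple x l))" using s(2) by simp_all
    fix a b assume "a < dim_row (comm_eval p (shift_tuple x l))" "b < dim_col (comm_eval p (shift_tuple x l))"
    then have ab: "a < level (shift_tuple x l)" "b < level (shift_tuple x l)" and ab': "a < level x" "b < level x"
      using s(2) by simp_all
    show "free_eval q x $$ (a, b) = comm_eval p (shift_tuple x l) $$ (a, b)"
      unfolding p_def comm_eval_sum_index[OF ab] comm_eval_single_index[OF ab] free_eval_index[OF ab'] P2[OF x]
      using ab by (simp add: comm_eval_def linear_combination_index sum_distrib_left mult_ac)
  qed
  ultimately show ?thesis by blast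
qed

text \<open>The recentred polynomial is a terminating power series at \<open>l\<close>, so inserting
  the nilpotent shift into it is ordinary evaluation.\<close>

lemma local_value_free_scalar:
  fixes x :: "'d::finite \<Rightarrow> complex mat"
  assumes x: "x \<in> comm_universe" "joint_spectrum x = {l}"
  shows "local_value (free_scalar q) x = free_eval q x"
    and "\<exists>c. power_series_at (free_scalar q) l c"
proof -
  obtain p :: "'d comm_poly" where p: "\<And>z. free_scalar q z = scalar_eval p (z - l)"
    "free_eval q x = comm_eval p (shift_tuple x l)" using free_poly_recentered[of q l] x(1) by blast
  note s = shift_tuple_universe[OF comm_universeD(1)[OF x(1)], of l]
  have ps: "power_series_at (free_scalar q) l (Poly_Mapping.lookup p)"
    unfolding power_series_at_def
  proof (intro exI[of _ 1] conjI ballI)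
    fix z :: "complex ^ 'd"
    show "((\<lambda>m. Poly_Mapping.lookup p m * scalar_monomial (z - l) m) has_sum free_scalar q z) UNIV"
      unfolding p(1) scalar_eval_def by (rule has_sum_finite_neutralI[of "Poly_Mapping.keys p"]) (auto simp: in_keys_iff)
  qed simp
  then show "\<exists>c. power_series_at (free_scalar q) l c" by blast
  let ?K = "Poly_Mapping.keys p \<union> {m. monomial_value (shift_tuple x l) m \<noteq> 0\<^sub>m (level x) (level x)}"
  have K: "finite ?K" using finite_shift_monomials[OF x] by simp
  show "local_value (free_scalar q) x = free_eval q x"
    unfolding p(2) comm_eval_superset[OF K Un_upper1] s(2) by (rule local_value_eq[OF x ps K Un_upper2])
qed

lemma free_scalar_separately_holomorphic:
  fixes l :: "complex ^ 'd::finite"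
  shows "\<exists>M. separately_holomorphic (free_scalar q) l R M"
proof -
  define \<rho> where "\<rho> = norm l + \<bar>R\<bar>"
  have le: "cmod (z $ i) \<le> \<rho>" if "z \<in> polydisc l R" for z i
  proof -
    have "cmod (z $ i) \<le> cmod (l $ i) + cmod (z $ i - l $ i)" using norm_triangle_sub[of "z $ i" "l $ i"] by simp
    moreover have "cmod (l $ i) \<le> norm l" by (rule Finite_Cartesian_Product.norm_nth_le)
    moreover have "cmod (z $ i - l $ i) < R" using that by (simp add: polydisc_def)
    ultimately show ?thesis by (simp add: \<rho>_def)
  qed
  have "separately_holomorphic (free_scalar q) l R
    (\<Sum>w\<in>Poly_Mapping.keys q. cmod (Poly_Mapping.lookup q w) * \<rho> ^ mdeg (word_monomial w))"
    unfolding separately_holomorphic_def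
  proof (intro ballI conjI allI)
    fix z assume z: "z \<in> polydisc l R"
    show "cmod (free_scalar q z) \<le> (\<Sum>w\<in>Poly_Mapping.keys q. cmod (Poly_Mapping.lookup q w) * \<rho> ^ mdeg (word_monomial w))"
      unfolding free_scalar_sum
      by (rule sum_norm_le) (auto simp: norm_mult intro!: mult_left_mono norm_scalar_monomial_le le[OF z])
    fix i
    have "(\<lambda>w. if j = i then w else z $ j) holomorphic_on S" for j S
      by (cases "j = i") (auto intro!: holomorphic_intros)
    then show "(\<lambda>w. free_scalar q (coord_update z i w)) holomorphic_on ball (l $ i) R"
      unfolding free_scalar_sum scalar_monomial_def coord_update_nth
      by (intro holomorphic_intros)
  qed
  then show ?thesis by blast
qed

text \<open>A local value involves only finitely many coefficients, and each converges: Cauchy's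
  estimate bounds a coefficient of the difference of \<open>free_scalar (q n)\<close> and
  \<open>g\<close> by the uniform distance on the polydisc.\<close>

lemma local_value_tendsto:
  fixes x :: "'d::finite \<Rightarrow> complex mat"
  assumes x: "x \<in> comm_universe" "joint_spectrum x = {l}" and R: "R > 0"
    and lim: "uniform_limit (polydisc l R) (\<lambda>n. free_scalar (q n)) g sequentially"
    and ab: "a < level x" "b < level x"
  shows "(\<lambda>n. free_eval (q n) x $$ (a, b)) \<longlonglongrightarrow> local_value g x $$ (a, b)"
proof -
  obtain M where M: "separately_holomorphic g l R M"
    using separately_holomorphic_uniform_limit[OF free_scalar_separately_holomorphic lim] by blast
  obtain c where c: "power_series_at g l c" using separately_holomorphic_power_series_at[OF R M] by blast
  have "\<forall>n. \<exists>c. power_series_at (free_scalar (q n)) l c" using local_value_free_scalar(2)[OF x] by blast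
  from choice[OF this] obtain d where d: "\<forall>n. power_series_at (free_scalar (q n)) l (d n)" ..
  let ?K = "{m. monomial_value (shift_tuple x l) m \<noteq> 0\<^sub>m (level x) (level x)}"
  note K = finite_shift_monomials[OF x]
  have dm: "(\<lambda>n. d n m) \<longlonglongrightarrow> c m" for m
  proof (rule LIMSEQ_I)
    fix e :: real assume e: "e > 0"
    \<comment> \<open>Cauchy's estimate divides by \<open>R ^ mdeg m\<close>; the factor 1/2
      restores the strict inequality.\<close>
    define e' where "e' = e * R ^ mdeg m / 2"
    have e': "e' > 0" using e R by (simp add: e'_def)
    have "\<forall>\<^sub>F n in sequentially. \<forall>z\<in>polydisc l R. dist (free_scalar (q n) z) (g z) < e'"
      using lim e' by (rule uniform_limitD)
    then obtain N where N: "\<And>n z. n \<ge> N \<Longrightarrow> z \<in> polydisc l R \<Longrightarrow> dist (free_scalar (q n) z) (g z) < e'"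
      unfolding eventually_sequentially by blast
    have "norm (d n m - c m) < e" if n: "n \<ge> N" for n
    proof -
      obtain M' where M': "separately_holomorphic (free_scalar (q n)) l R M'" using free_scalar_separately_holomorphic by blast
      have "separately_holomorphic (\<lambda>z. free_scalar (q n) z - g z) l R e'"
        by (rule separately_holomorphic_diff[OF M' M]) (use N[OF n] in \<open>simp add: dist_norm less_imp_le\<close>)
      from separately_holomorphic_power_series_at[OF R this] obtain h where
        h: "power_series_at (\<lambda>z. free_scalar (q n) z - g z) l h" "cmod (h m) \<le> e' / R ^ mdeg m" by blast
      have "h = (\<lambda>m. d n m - c m)"
        by (rule power_series_at_unique[OF h(1) power_series_at_diff[OF d[rule_format] c]])
      then have "norm (d n m - c m) \<le> e' / R ^ mdeg m" using h(2) by simp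
      also have "\<dots> = e / 2" using R by (simp add: e'_def)
      finally show ?thesis using e by simp
    qed
    then show "\<exists>N. \<forall>n\<ge>N. norm (d n m - c m) < e" by blast
  qed
  have "free_eval (q n) x $$ (a, b) = (\<Sum>m\<in>?K. d n m * monomial_value (shift_tuple x l) m $$ (a, b))" for n
    unfolding local_value_free_scalar(1)[OF x, symmetric] local_value_eq[OF x d[rule_format] K order_refl]
    using ab by (simp add: linear_combination_index)
  moreover have "local_value g x $$ (a, b) = (\<Sum>m\<in>?K. c m * monomial_value (shift_tuple x l) m $$ (a, b))"
    unfolding local_value_eq[OF x c K order_refl] using ab by (simp add: linear_combination_index)
  moreover have "(\<lambda>n. \<Sum>m\<in>?K. d n m * monomial_value (shift_tuple x l) m $$ (a, b))
    \<longlonglongrightarrow> (\<Sum>m\<in>?K. c m * monomial_value (shift_tuple x l) m $$ (a, b))"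
    by (intro tendsto_sum tendsto_mult dm tendsto_const)
  ultimately show ?thesis by simp
qed

section \<open>Restriction of free holomorphic functions\<close>

text \<open>Testing the block matrix on vectors whose block \<open>j\<close> is a multiple of a
  common eigenvector \<open>v\<close> multiplies both sides by the squared norm of \<open>v\<close>,
  which cancels.\<close>

lemma block_bounded_eigen:
  assumes bb: "block_bounded r n I J (\<lambda>i j. U i j)"
    and ev: "\<And>i j a. i < I \<Longrightarrow> j < J \<Longrightarrow> a < n \<Longrightarrow> (\<Sum>b<n. U i j $$ (a, b) * v b) = c i j * v a"
    and v: "a0 < n" "v a0 \<noteq> 0"
  shows "block_bounded r 1 I J (\<lambda>i j. mat 1 1 (\<lambda>_. c i j))"
  unfolding block_bounded_def
proof
  fix \<zeta> :: "nat \<Rightarrow> nat \<Rightarrow> complex"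
  let ?V = "\<Sum>a<n. (cmod (v a))\<^sup>2"
  have "(cmod (v a0))\<^sup>2 \<le> ?V" using v by (intro member_le_sum) auto
  moreover have "0 < (cmod (v a0))\<^sup>2" using v by simp
  ultimately have V: "?V > 0" by linarith
  have "(\<Sum>i<I. \<Sum>a<n. (cmod (\<Sum>j<J. \<Sum>b<n. U i j $$ (a, b) * (\<zeta> j 0 * v b)))\<^sup>2)
    = (\<Sum>i<I. \<Sum>a<n. (cmod (\<Sum>j<J. c i j * \<zeta> j 0))\<^sup>2 * (cmod (v a))\<^sup>2)"
  proof (intro sum.cong refl)
    fix i a assume ia: "i \<in> {..<I}" "a \<in> {..<n}"
    have "(\<Sum>j<J. \<Sum>b<n. U i j $$ (a, b) * (\<zeta> j 0 * v b)) = (\<Sum>j<J. \<zeta> j 0 * (\<Sum>b<n. U i j $$ (a, b) * v b))"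
      by (simp add: sum_distrib_left mult_ac)
    also have "\<dots> = (\<Sum>j<J. c i j * \<zeta> j 0) * v a"
      using ia ev by (simp add: sum_distrib_left sum_distrib_right mult_ac)
    finally show "(cmod (\<Sum>j<J. \<Sum>b<n. U i j $$ (a, b) * (\<zeta> j 0 * v b)))\<^sup>2
      = (cmod (\<Sum>j<J. c i j * \<zeta> j 0))\<^sup>2 * (cmod (v a))\<^sup>2" by (simp add: norm_mult power_mult_distrib)
  qed
  also have "\<dots> = (\<Sum>i<I. (cmod (\<Sum>j<J. c i j * \<zeta> j 0))\<^sup>2) * ?V"
    by (simp add: sum_product)
  finally have "(\<Sum>i<I. (cmod (\<Sum>j<J. c i j * \<zeta> j 0))\<^sup>2) * ?V
    \<le> r\<^sup>2 * (\<Sum>j<J. \<Sum>b<n. (cmod (\<zeta> j 0 * v b))\<^sup>2)"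
    using bb[unfolded block_bounded_def, rule_format, of "\<lambda>j b. \<zeta> j 0 * v b"] by simp
  also have "\<dots> = (r\<^sup>2 * (\<Sum>j<J. (cmod (\<zeta> j 0))\<^sup>2)) * ?V"
    by (simp add: norm_mult power_mult_distrib sum_product)
  finally have "(\<Sum>i<I. (cmod (\<Sum>j<J. c i j * \<zeta> j 0))\<^sup>2) \<le> r\<^sup>2 * (\<Sum>j<J. (cmod (\<zeta> j 0))\<^sup>2)"
    using V by simp
  then show "(\<Sum>i<I. \<Sum>a<1. (cmod (\<Sum>j<J. \<Sum>b<1. mat 1 1 (\<lambda>_. c i j) $$ (a, b) * \<zeta> j b))\<^sup>2)
    \<le> r\<^sup>2 * (\<Sum>j<J. \<Sum>b<1. (cmod (\<zeta> j b))\<^sup>2)" by simp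
qed

lemma free_eval_eigenvector:
  assumes y: "y \<in> matrix_universe" and v: "\<And>i. eigenvector (y i) v (z $ i)" and a: "a < level y"
  shows "(\<Sum>b<level y. free_eval q y $$ (a, b) * vec_index v b) = free_scalar q z * vec_index v a"
proof -
  let ?n = "level y"
  have vc: "v \<in> carrier_vec ?n"
    using v[of undefined] carrier_matD(1)[OF matrix_universeE(2)[OF y, of undefined]] unfolding eigenvector_def by simp
  have w: "word_value y (Word u) *\<^sub>v v = scalar_monomial z (word_monomial (Word u)) \<cdot>\<^sub>v v" for u
  proof (induction u)
    case Nil
    show ?case using vc by (simp add: word_monomial_def)
  next
    case (Cons i u)
    have "word_value y (Word (i # u)) *\<^sub>v v = y i *\<^sub>v (word_value y (Word u) *\<^sub>v v)"
      unfolding word_value_Cons using matrix_universeE(2)[OF y] word_value_carrier[OF y] vc by (rule assoc_mult_mat_vec)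
    also have "\<dots> = scalar_monomial z (word_monomial (Word u)) \<cdot>\<^sub>v (y i *\<^sub>v v)"
      unfolding Cons using matrix_universeE(2)[OF y] vc by (rule mult_mat_vec)
    also have "y i *\<^sub>v v = z $ i \<cdot>\<^sub>v v" using v[of i] unfolding eigenvector_def by blast
    finally show ?case using scalar_monomial_Suc[of z i "word_monomial (Word u)"]
      by (simp add: word_monomial_def smult_smult_assoc mult.commute)
  qed
  have wi: "(\<Sum>b<?n. word_value y w $$ (a, b) * vec_index v b) = scalar_monomial z (word_monomial w) * vec_index v a" for w
  proof -
    obtain u where u: "w = Word u" by (cases w)
    have "(\<Sum>b<?n. word_value y w $$ (a, b) * vec_index v b) = vec_index (word_value y w *\<^sub>v v) a"
      using a vc carrier_matD[OF word_value_carrier[OF y, of w]] by (simp add: scalar_prod_def atLeast0LessThan)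
    then show ?thesis unfolding u w using a vc by simp
  qed
  have "(\<Sum>b<?n. free_eval q y $$ (a, b) * vec_index v b)
    = (\<Sum>b<?n. \<Sum>w\<in>Poly_Mapping.keys q. Poly_Mapping.lookup q w * (word_value y w $$ (a, b) * vec_index v b))"
    using a by (simp add: free_eval_index sum_distrib_left sum_distrib_right mult_ac)
  also have "\<dots> = (\<Sum>w\<in>Poly_Mapping.keys q. Poly_Mapping.lookup q w * (\<Sum>b<?n. word_value y w $$ (a, b) * vec_index v b))"
    by (subst sum.swap) (simp add: sum_distrib_left)
  finally show ?thesis unfolding wi free_scalar_sum by (simp add: sum_distrib_left sum_distrib_right mult_ac)
qed

text \<open>Places the spectrum inside the same basic set, so polynomials that approximate on this
  set also approximate near the spectrum.\<close>

lemma basic_set_spectrum: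
  fixes y :: "'d::finite \<Rightarrow> complex mat"
  assumes y: "y \<in> basic_set E" and l: "l \<in> joint_spectrum y"
  shows "scalar_tuple l \<in> basic_set E"
proof -
  obtain r where u: "y \<in> matrix_universe" and r: "0 \<le> r" "r < 1"
    "block_bounded r (level y) (dim_row E) (dim_col E) (\<lambda>i j. free_eval (E $$ (i, j)) y)"
    using y unfolding basic_set_iff by blast
  obtain v where v: "\<And>i. eigenvector (y i) v (l $ i)" using l unfolding joint_spectrum_def by blast
  have vc: "v \<in> carrier_vec (level y)" "v \<noteq> 0\<^sub>v (level y)"
    using v[of undefined] carrier_matD(1)[OF matrix_universeE(2)[OF u, of undefined]] unfolding eigenvector_def by simp_all
  obtain a0 where a0: "a0 < level y" "vec_index v a0 \<noteq> 0"
  proof (rule ccontr)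
    assume "\<not> thesis"
    then have "v = 0\<^sub>v (level y)" using that vc(1) by (intro eq_vecI) auto
    with vc(2) show False ..
  qed
  have "block_bounded r 1 (dim_row E) (dim_col E) (\<lambda>i j. mat 1 1 (\<lambda>_. free_scalar (E $$ (i, j)) l))"
    by (rule block_bounded_eigen[OF r(3) free_eval_eigenvector[OF u v] a0])
  then show ?thesis unfolding basic_set_iff using r(1,2)
    by (auto simp: free_eval_scalar free_scalar_def)
qed

text \<open>The norm at \<open>z'\<close> exceeds that at \<open>z\<close> by at most the sum of the
  moduli of the differences of the entries, which tends to 0.\<close>

lemma open_scalar_basic_set: "open {z :: complex ^ 'd::finite. scalar_tuple z \<in> basic_set E}"
proof -
  have "\<exists>e>0. \<forall>z'\<in>ball z e. scalar_tuple z' \<in> basic_set E" if z: "scalar_tuple z \<in> basic_set E" for z :: "complex ^ 'd"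
  proof -
    let ?B = "\<lambda>z. block_eval 1 (\<lambda>q. free_eval q (scalar_tuple z)) E"
    let ?I = "dim_row E" and ?J = "dim_col E"
    have n: "op_norm (?B z) < 1" using z by (simp add: basic_set_def)
    have cont: "continuous (at z) (\<lambda>z. free_scalar q z)" for q :: "'d free_poly"
      unfolding free_scalar_sum scalar_monomial_def by (intro continuous_intros)
    have "((\<lambda>z'. \<Sum>i<?I. \<Sum>j<?J. cmod (free_scalar (E $$ (i, j)) z' - free_scalar (E $$ (i, j)) z)) \<longlongrightarrow>
      (\<Sum>i<?I. \<Sum>j<?J. cmod (free_scalar (E $$ (i, j)) z - free_scalar (E $$ (i, j)) z))) (at z)"
      using cont unfolding continuous_within by (intro tendsto_intros)
    then have "\<forall>\<^sub>F z' in at z. (\<Sum>i<?I. \<Sum>j<?J. cmod (free_scalar (E $$ (i, j)) z' - free_scalar (E $$ (i, j)) z)) < 1 - op_norm (?B z)"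
      by (rule order_tendstoD) (use n in simp)
    then obtain e where e: "e > 0" "\<And>z'. z' \<noteq> z \<Longrightarrow> dist z' z < e \<Longrightarrow>
      (\<Sum>i<?I. \<Sum>j<?J. cmod (free_scalar (E $$ (i, j)) z' - free_scalar (E $$ (i, j)) z)) < 1 - op_norm (?B z)"
      unfolding eventually_at by blast
    have "scalar_tuple z' \<in> basic_set E" if z': "z' \<in> ball z e" for z'
    proof (cases "z' = z")
      case False
      then have s: "(\<Sum>i<?I. \<Sum>j<?J. cmod (free_scalar (E $$ (i, j)) z' - free_scalar (E $$ (i, j)) z)) < 1 - op_norm (?B z)"
        using e(2)[of z'] z' by (simp add: dist_commute)
      have "op_norm (?B z') \<le> op_norm (?B z) + (\<Sum>i<?I. \<Sum>j<?J. cmod (free_scalar (E $$ (i, j)) z' - free_scalar (E $$ (i, j)) z))"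
      proof (rule op_norm_le)
        show "0 \<le> op_norm (?B z) + (\<Sum>i<?I. \<Sum>j<?J. cmod (free_scalar (E $$ (i, j)) z' - free_scalar (E $$ (i, j)) z))"
          by (intro add_nonneg_nonneg sum_nonneg) auto
        fix v :: "complex vec" assume "v \<in> carrier_vec (dim_col (?B z'))"
        then have v: "v \<in> carrier_vec (dim_col (?B z))" "v \<in> carrier_vec (dim_col (?B z' - ?B z))" by (simp_all add: block_eval_def)
        have c: "?B z \<in> carrier_mat ?I ?J" "?B z' \<in> carrier_mat ?I ?J" for z by (auto simp: block_eval_def)
        have vJ: "v \<in> carrier_vec ?J" using v by (simp add: block_eval_def)
        have "?B z' = ?B z + (?B z' - ?B z)" by (rule eq_matI) (auto simp: block_eval_def)
        then have "?B z' *\<^sub>v v = (?B z + (?B z' - ?B z)) *\<^sub>v v" by (rule arg_cong)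
        also have "\<dots> = ?B z *\<^sub>v v + (?B z' - ?B z) *\<^sub>v v"
          by (rule add_mult_distrib_mat_vec[OF c(1) minus_carrier_mat[OF c(1)] vJ])
        finally have "euclid_norm (?B z' *\<^sub>v v) \<le> euclid_norm (?B z *\<^sub>v v) + euclid_norm ((?B z' - ?B z) *\<^sub>v v)"
          by (simp add: euclid_norm_add_le)
        also have "\<dots> \<le> op_norm (?B z) * euclid_norm v +
          (\<Sum>i<dim_row (?B z' - ?B z). \<Sum>j<dim_col (?B z' - ?B z). cmod ((?B z' - ?B z) $$ (i, j))) * euclid_norm v"
          by (intro add_mono op_norm_bound euclid_norm_mult_mat_le v)
        also have "(\<Sum>i<dim_row (?B z' - ?B z). \<Sum>j<dim_col (?B z' - ?B z). cmod ((?B z' - ?B z) $$ (i, j)))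
          = (\<Sum>i<?I. \<Sum>j<?J. cmod (free_scalar (E $$ (i, j)) z' - free_scalar (E $$ (i, j)) z))"
          by (auto simp: block_eval_def free_eval_scalar_index intro!: sum.cong)
        finally show "euclid_norm (?B z' *\<^sub>v v) \<le> (op_norm (?B z) + (\<Sum>i<?I. \<Sum>j<?J. cmod (free_scalar (E $$ (i, j)) z' - free_scalar (E $$ (i, j)) z))) * euclid_norm v"
          by (simp add: distrib_right)
      qed
      then show ?thesis using s by (simp add: basic_set_def)
    qed (use z in simp)
    with e(1) show ?thesis by blast
  qed
  then show ?thesis unfolding open_contains_ball subset_iff mem_Collect_eq by blast
qed

text \<open>A single sequence of free polynomials approximates \<open>F\<close> at \<open>y\<close>
  and its restriction near the whole spectrum of \<open>y\<close>. Evaluation at \<open>y\<close>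
  and at the summands is intertwined by \<open>P k\<close> for each polynomial, and this relation
  survives both limits.\<close>

lemma free_holomorphic_restriction:
  fixes F :: "('d::finite \<Rightarrow> complex mat) \<Rightarrow> complex mat" and V :: "(complex ^ 'd) set"
  assumes F: "free_holomorphic (basic_set D) F" and V: "V \<subseteq> {z. scalar_tuple z \<in> basic_set D}"
    and f: "\<And>z. z \<in> V \<Longrightarrow> mat 1 1 (\<lambda>_. f z) = F (scalar_tuple z)"
  shows "f \<in> Hol V"
    and "y \<in> spectrum_in V \<Longrightarrow> subordinate V y \<Longrightarrow> y \<in> basic_set D \<Longrightarrow> variety_value V f y = F y"
proof -
  define g where "g z = F (scalar_tuple z) $$ (0, 0)" for z
  have gf: "g z = f z" if "z \<in> V" for z using f[OF that, symmetric] by (simp add: g_def)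
  have loc: "\<exists>E q. x \<in> basic_set E \<and> basic_set E \<subseteq> basic_set D \<and>
      (\<forall>a b w. w \<in> basic_set E \<longrightarrow> a < level w \<longrightarrow> b < level w \<longrightarrow> (\<lambda>n. free_eval (q n) w $$ (a, b)) \<longlonglongrightarrow> F w $$ (a, b)) \<and>
      holomorphic_several g {z. scalar_tuple z \<in> basic_set E} \<and>
      uniform_limit {z. scalar_tuple z \<in> basic_set E} (\<lambda>n. free_scalar (q n)) g sequentially"
    if x: "x \<in> basic_set D" for x
  proof -
    obtain E where E: "x \<in> basic_set E" "basic_set E \<subseteq> basic_set D"
      "\<forall>\<epsilon>>0. \<exists>q. \<forall>x\<in>basic_set E. op_norm (F x - free_eval q x) < \<epsilon>"
      using F x unfolding free_holomorphic_def by blast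
    have "\<forall>n. \<exists>q. \<forall>x\<in>basic_set E. op_norm (F x - free_eval q x) < 1 / real (Suc n)"
      using E(3) by simp
    from choice[OF this] obtain q where q: "\<forall>n. \<forall>x\<in>basic_set E. op_norm (F x - free_eval (q n) x) < 1 / real (Suc n)" ..
    have Fc: "F w \<in> carrier_mat (level w) (level w)" if "w \<in> basic_set E" for w
      using F E(2) that unfolding free_holomorphic_def by blast
    have ent: "cmod (free_eval (q n) w $$ (a, b) - F w $$ (a, b)) < 1 / real (Suc n)"
      if w: "w \<in> basic_set E" and ab: "a < level w" "b < level w" for a b w n
    proof -
      have "cmod ((F w - free_eval (q n) w) $$ (a, b)) \<le> op_norm (F w - free_eval (q n) w)"
        using ab by (intro norm_index_le_op_norm) simp_all
      also have "\<dots> < 1 / real (Suc n)" using q w by blast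
      finally show ?thesis using ab Fc[OF w] by (simp add: norm_minus_commute)
    qed
    have l0: "(\<lambda>n. 1 / real (Suc n)) \<longlonglongrightarrow> 0" using LIMSEQ_inverse_real_of_nat by (simp add: inverse_eq_divide)
    have 1: "(\<lambda>n. free_eval (q n) w $$ (a, b)) \<longlonglongrightarrow> F w $$ (a, b)"
      if "w \<in> basic_set E" "a < level w" "b < level w" for a b w
    proof (rule LIM_zero_cancel, rule tendsto_norm_zero_cancel, rule tendsto_sandwich[OF _ _ tendsto_const l0])
      show "\<forall>\<^sub>F n in sequentially. 0 \<le> norm (free_eval (q n) w $$ (a, b) - F w $$ (a, b))" by simp
      show "\<forall>\<^sub>F n in sequentially. norm (free_eval (q n) w $$ (a, b) - F w $$ (a, b)) \<le> 1 / real (Suc n)"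
        by (intro always_eventually allI less_imp_le ent that)
    qed
    let ?U = "{z. scalar_tuple z \<in> basic_set E}"
    have ul: "uniform_limit ?U (\<lambda>n. free_scalar (q n)) g sequentially"
    proof (rule uniform_limitI)
      fix e :: real assume "0 < e"
      with l0 have "\<forall>\<^sub>F n in sequentially. 1 / real (Suc n) < e" by (intro order_tendstoD(2))
      then show "\<forall>\<^sub>F n in sequentially. \<forall>z\<in>?U. dist (free_scalar (q n) z) (g z) < e"
      proof (eventually_elim, intro ballI)
        fix n z assume n: "1 / real (Suc n) < e" and z: "z \<in> ?U"
        have "cmod (free_eval (q n) (scalar_tuple z) $$ (0, 0) - F (scalar_tuple z) $$ (0, 0)) < 1 / real (Suc n)"
          using z by (intro ent) simp_all
        with n show "dist (free_scalar (q n) z) (g z) < e"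
          unfolding free_eval_scalar_index g_def[symmetric] dist_norm by linarith
      qed
    qed
    have "holomorphic_several g ?U"
    proof (rule separately_holomorphic_imp_several[OF open_scalar_basic_set])
      fix l assume l: "l \<in> ?U"
      obtain r where r: "r > 0" "ball l r \<subseteq> ?U" using openE[OF open_scalar_basic_set l] by blast
      obtain R where R: "R > 0" "polydisc l R \<subseteq> ball l r" using polydisc_subset_ball[OF r(1)] by blast
      have "uniform_limit (polydisc l R) (\<lambda>n. free_scalar (q n)) g sequentially"
        by (rule uniform_limit_on_subset[OF ul]) (use R r in blast)
      from separately_holomorphic_uniform_limit[OF free_scalar_separately_holomorphic this] R(1)
      show "\<exists>R>0. \<exists>M. separately_holomorphic g l R M" by blast
    qed
    with E 1 ul show ?thesis by blast
  qed
  show fH: "f \<in> Hol V"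
    unfolding Hol_def
  proof (intro CollectI ballI)
    fix l assume l: "l \<in> V"
    with V have "scalar_tuple l \<in> basic_set D" by blast
    from loc[OF this] obtain E where E: "scalar_tuple l \<in> basic_set E" "holomorphic_several g {z. scalar_tuple z \<in> basic_set E}" by blast
    have "local_extension V f l g"
      unfolding local_extension_def
      by (rule exI[of _ "{z. scalar_tuple z \<in> basic_set E}"]) (use E gf in auto)
    then show "\<exists>g. local_extension V f l g" by blast
  qed
  assume y: "y \<in> spectrum_in V" and sub: "subordinate V y" and yD: "y \<in> basic_set D"
  have yc: "y \<in> comm_universe" using y by (simp add: spectrum_in_def)
  note u = comm_universeD(1)[OF yc]
  from loc[OF yD] obtain E q where E: "y \<in> basic_set E" "basic_set E \<subseteq> basic_set D"
    "\<And>a b w. w \<in> basic_set E \<Longrightarrow> a < level w \<Longrightarrow> b < level w \<Longrightarrow> (\<lambda>n. free_eval (q n) w $$ (a, b)) \<longlonglongrightarrow> F w $$ (a, b)"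
    "holomorphic_several g {z. scalar_tuple z \<in> basic_set E}"
    "uniform_limit {z. scalar_tuple z \<in> basic_set E} (\<lambda>n. free_scalar (q n)) g sequentially" by blast
  let ?U = "{z. scalar_tuple z \<in> basic_set E}" and ?n = "level y"
  have sU: "joint_spectrum y \<subseteq> ?U" using basic_set_spectrum[OF E(1)] by blast
  obtain T S xs where d: "decomposition y T S xs" using decomposition_exists[OF yc] by blast
  note bs = decomposition_block_similar[OF d u]
  note dm = block_similar_dims[OF bs]
  have vv: "variety_value V f y = T * diag_block_mat (map (local_value g) xs) * S"
    by (rule variety_value_eq[OF y sub d fH sU E(4)]) (use gf in blast)
  have lim: "(\<lambda>n. free_eval (q n) (xs ! k) $$ (a, b)) \<longlonglongrightarrow> local_value g (xs ! k) $$ (a, b)"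
    if k: "k < length xs" and ab: "a < level (xs ! k)" "b < level (xs ! k)" for k a b
  proof -
    have x: "xs ! k \<in> set xs" using k by simp
    let ?l = "the_elem (joint_spectrum (xs ! k))"
    have "?l \<in> ?U" using sU x unfolding decomposition_spectrum[OF d u] by blast
    then obtain r where r: "r > 0" "ball ?l r \<subseteq> ?U" using openE[OF open_scalar_basic_set] by blast
    obtain R where R: "R > 0" "polydisc ?l R \<subseteq> ball ?l r" using polydisc_subset_ball[OF r(1)] by blast
    have "uniform_limit (polydisc ?l R) (\<lambda>n. free_scalar (q n)) g sequentially"
      by (rule uniform_limit_on_subset[OF E(5)]) (use R r in blast)
    then show ?thesis by (rule local_value_tendsto[OF decompositionD[OF d x] R(1) _ ab])
  qed
  obtain P Q where PQ: "block_projections y T S xs P Q" using block_projections_exist[OF bs] by blast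
  note B = block_projectionsD[OF PQ]
  let ?M = "T * diag_block_mat (map (local_value g) xs) * S"
  have Fy: "F y \<in> carrier_mat ?n ?n" using F yD unfolding free_holomorphic_def by blast
  have "diag_block_mat (map (local_value g) xs) \<in> carrier_mat ?n ?n"
    using diag_block_mat_carrier[of xs "local_value g" level] unfolding dm(1) by simp
  then have M: "?M \<in> carrier_mat ?n ?n" using dm(2,3) by auto
  have "F y - ?M = 0\<^sub>m ?n ?n"
  proof (rule B(9))
    show "F y - ?M \<in> carrier_mat ?n ?n" using M by (rule minus_carrier_mat)
    fix k assume k: "k < length xs"
    let ?x = "xs ! k"
    have eq: "F y * P k = P k * local_value g ?x"
    proof (rule eq_matI)
      fix a b assume "a < dim_row (P k * local_value g ?x)" "b < dim_col (P k * local_value g ?x)"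
      then have ab: "a < ?n" "b < level ?x" using B(1)[OF k] carrier_matD[OF local_value_carrier[of g ?x]] by auto
      have "(\<lambda>m. (free_eval (q m) y * P k) $$ (a, b)) \<longlonglongrightarrow> (F y * P k) $$ (a, b)"
        unfolding mat_mult_index[OF free_eval_carrier B(1)[OF k] ab] mat_mult_index[OF Fy B(1)[OF k] ab]
        using ab by (intro tendsto_sum tendsto_mult tendsto_const E(3)[OF E(1)]) auto
      moreover have "(\<lambda>m. (P k * free_eval (q m) ?x) $$ (a, b)) \<longlonglongrightarrow> (P k * local_value g ?x) $$ (a, b)"
        unfolding mat_mult_index[OF B(1)[OF k] free_eval_carrier ab] mat_mult_index[OF B(1)[OF k] local_value_carrier ab]
        using ab by (intro tendsto_sum tendsto_mult tendsto_const lim[OF k]) auto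
      moreover have "free_eval (q m) y * P k = P k * free_eval (q m) ?x" for m
        unfolding free_eval_block_similar[OF bs] by (rule B(4)[OF free_eval_carrier k])
      ultimately show "(F y * P k) $$ (a, b) = (P k * local_value g ?x) $$ (a, b)"
        using LIMSEQ_unique by simp
    qed (use B(1)[OF k] Fy carrier_matD[OF local_value_carrier[of g ?x]] in simp_all)
    have "(F y - ?M) * P k = F y * P k - ?M * P k" using Fy M B(1)[OF k] by (rule minus_mult_distrib_mat)
    then show "(F y - ?M) * P k = 0\<^sub>m ?n (level ?x)"
      unfolding eq B(4)[OF local_value_carrier k]
      using minus_r_inv_mat[OF mult_carrier_mat[OF B(1)[OF k] local_value_carrier]] by simp
  qed
  then have "F y = ?M" by (rule mat_minus_zero_iff[OF Fy M])
  then show "variety_value V f y = F y" using vv by simp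
qed

section \<open>Contractions with prescribed values\<close>

lemma sum_mult_cnj: "(\<Sum>x\<in>X. f x * cnj (f x)) = of_real (\<Sum>x\<in>X. (cmod (f x))\<^sup>2)"
  by (simp add: complex_norm_square del: of_real_power)

text \<open>Gram-Schmidt without normalization: \<open>\<gamma>\<close> gives the orthogonal
  projection of \<open>\<xi>\<close> onto the span of the \<open>u b\<close>, which may be linearly
  dependent. The inductive step projects onto the residual \<open>w\<close> of the new
  vector.\<close>

lemma projection_coefficients:
  fixes u :: "nat \<Rightarrow> 'x \<Rightarrow> complex"
  assumes X: "finite X"
  shows "\<exists>\<gamma>. \<forall>b<N. (\<Sum>x\<in>X. (\<xi> x - (\<Sum>a<N. \<gamma> a * u a x)) * cnj (u b x)) = 0"
proof (induction N arbitrary: \<xi>)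
  case 0
  then show ?case by simp
next
  case (Suc N)
  obtain \<alpha> where \<alpha>: "\<forall>b<N. (\<Sum>x\<in>X. (\<xi> x - (\<Sum>a<N. \<alpha> a * u a x)) * cnj (u b x)) = 0" using Suc by blast
  obtain \<beta> where \<beta>: "\<forall>b<N. (\<Sum>x\<in>X. (u N x - (\<Sum>a<N. \<beta> a * u a x)) * cnj (u b x)) = 0" using Suc by blast
  define w where "w x = u N x - (\<Sum>a<N. \<beta> a * u a x)" for x
  define \<eta> where "\<eta> x = \<xi> x - (\<Sum>a<N. \<alpha> a * u a x)" for x
  define W where "W = (\<Sum>x\<in>X. w x * cnj (w x))"
  \<comment> \<open>If \<open>W\<close> is 0 then \<open>w\<close> vanishes on \<open>X\<close>, and
    the value of the quotient, which is then 0, does not matter.\<close>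
  define t where "t = (\<Sum>x\<in>X. \<eta> x * cnj (w x)) / W"
  define \<gamma> where "\<gamma> a = (if a = N then t else \<alpha> a - t * \<beta> a)" for a
  have res: "\<xi> x - (\<Sum>a<Suc N. \<gamma> a * u a x) = \<eta> x - t * w x" for x
  proof -
    have "(\<Sum>a<N. \<gamma> a * u a x) = (\<Sum>a<N. \<alpha> a * u a x) - t * (\<Sum>a<N. \<beta> a * u a x)"
      unfolding sum_distrib_left sum_subtractf[symmetric]
      by (intro sum.cong refl) (simp add: \<gamma>_def algebra_simps)
    then show ?thesis by (simp add: \<gamma>_def \<eta>_def w_def algebra_simps)
  qed
  have split: "(\<Sum>x\<in>X. (\<eta> x - t * w x) * cnj (z x)) = (\<Sum>x\<in>X. \<eta> x * cnj (z x)) - t * (\<Sum>x\<in>X. w x * cnj (z x))" for z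
    by (simp add: left_diff_distrib sum_subtractf sum_distrib_left mult.assoc)
  have o1: "(\<Sum>x\<in>X. (\<eta> x - t * w x) * cnj (u b x)) = 0" if "b < N" for b
    using \<alpha> \<beta> that unfolding split by (simp add: \<eta>_def w_def)
  have o2: "(\<Sum>x\<in>X. (\<eta> x - t * w x) * cnj (w x)) = 0"
  proof (cases "W = 0")
    case True
    then have "(\<Sum>x\<in>X. (cmod (w x))\<^sup>2) = 0" unfolding W_def sum_mult_cnj of_real_eq_0_iff .
    then have "\<forall>x\<in>X. (cmod (w x))\<^sup>2 = 0" using sum_nonneg_eq_0_iff[OF X, of "\<lambda>x. (cmod (w x))\<^sup>2"] by simp
    then show ?thesis by simp
  next
    case False
    then show ?thesis unfolding split W_def[symmetric] by (simp add: t_def)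
  qed
  have "(\<Sum>x\<in>X. (\<eta> x - t * w x) * cnj (u N x))
    = (\<Sum>x\<in>X. (\<eta> x - t * w x) * cnj (w x)) + (\<Sum>x\<in>X. \<Sum>a<N. cnj (\<beta> a) * ((\<eta> x - t * w x) * cnj (u a x)))"
    unfolding sum.distrib[symmetric]
  proof (intro sum.cong refl)
    fix x
    have "cnj (u N x) = cnj (w x) + (\<Sum>a<N. cnj (\<beta> a) * cnj (u a x))" by (simp add: w_def cnj_sum)
    then show "(\<eta> x - t * w x) * cnj (u N x) = (\<eta> x - t * w x) * cnj (w x)
      + (\<Sum>a<N. cnj (\<beta> a) * ((\<eta> x - t * w x) * cnj (u a x)))"
      by (simp add: distrib_left sum_distrib_left mult_ac)
  qed
  also have "(\<Sum>x\<in>X. \<Sum>a<N. cnj (\<beta> a) * ((\<eta> x - t * w x) * cnj (u a x)))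
    = (\<Sum>a<N. cnj (\<beta> a) * (\<Sum>x\<in>X. (\<eta> x - t * w x) * cnj (u a x)))"
    unfolding sum_distrib_left by (rule sum.swap)
  finally have o3: "(\<Sum>x\<in>X. (\<eta> x - t * w x) * cnj (u N x)) = 0" using o1 o2 by simp
  show ?case
    by (rule exI[of _ \<gamma>]) (use o1 o3 in \<open>simp only: res, auto simp: less_Suc_eq\<close>)
qed

lemma norm_sq_le_of_orthogonal:
  assumes "(\<Sum>x\<in>X. q x * cnj (p x)) = 0"
  shows "(\<Sum>x\<in>X. (cmod (p x))\<^sup>2) \<le> (\<Sum>x\<in>X. (cmod (p x + q x))\<^sup>2)"
proof -
  have "(cmod (p x + q x))\<^sup>2 = (cmod (p x))\<^sup>2 + (cmod (q x))\<^sup>2 + 2 * Re (q x * cnj (p x))" for x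
    unfolding cmod_power2 by (simp add: power2_eq_square algebra_simps)
  then have "(\<Sum>x\<in>X. (cmod (p x + q x))\<^sup>2) = (\<Sum>x\<in>X. (cmod (p x))\<^sup>2) + (\<Sum>x\<in>X. (cmod (q x))\<^sup>2)
    + 2 * Re (\<Sum>x\<in>X. q x * cnj (p x))" by (simp add: sum.distrib sum_distrib_left)
  then show ?thesis using assms sum_nonneg[of X "\<lambda>x. (cmod (q x))\<^sup>2"] by simp
qed

text \<open>The lurking isometry argument in contractive form: by \<open>dom\<close>, the map
  sending combinations of the \<open>u a\<close> to those of the \<open>v a\<close> is well defined
  and contractive on the span, and composing it with the orthogonal projection extends it to the
  whole space.\<close>

lemma contraction_extension:
  fixes u :: "nat \<Rightarrow> 'x \<Rightarrow> complex" and v :: "nat \<Rightarrow> 'y \<Rightarrow> complex"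
  assumes X: "finite X" and Y: "finite Y"
    and dom: "\<And>\<gamma>. (\<Sum>y\<in>Y. (cmod (\<Sum>a<N. \<gamma> a * v a y))\<^sup>2) \<le> (\<Sum>x\<in>X. (cmod (\<Sum>a<N. \<gamma> a * u a x))\<^sup>2)"
  shows "\<exists>W. (\<forall>\<xi>. (\<Sum>y\<in>Y. (cmod (\<Sum>x\<in>X. W y x * \<xi> x))\<^sup>2) \<le> (\<Sum>x\<in>X. (cmod (\<xi> x))\<^sup>2)) \<and>
    (\<forall>a<N. \<forall>y\<in>Y. (\<Sum>x\<in>X. W y x * u a x) = v a y)"
proof -
  \<comment> \<open>The columns of \<open>W\<close> come from the projections of the standard basis
    vectors.\<close>
  have "\<forall>z. \<exists>\<gamma>. \<forall>b<N. (\<Sum>x\<in>X. ((if x = z then 1 else 0) - (\<Sum>a<N. \<gamma> a * u a x)) * cnj (u b x)) = 0"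
    by (intro allI projection_coefficients[OF X])
  from choice[OF this] obtain \<alpha> where
    \<alpha>: "\<forall>z. \<forall>b<N. (\<Sum>x\<in>X. ((if x = z then 1 else 0) - (\<Sum>a<N. \<alpha> z a * u a x)) * cnj (u b x)) = 0" ..
  define W where "W y x = (\<Sum>a<N. \<alpha> x a * v a y)" for y x
  define \<gamma> where "\<gamma> \<xi> a = (\<Sum>z\<in>X. \<xi> z * \<alpha> z a)" for \<xi> a
  define p where "p \<xi> x = (\<Sum>a<N. \<gamma> \<xi> a * u a x)" for \<xi> x
  have W: "(\<Sum>x\<in>X. W y x * \<xi> x) = (\<Sum>a<N. \<gamma> \<xi> a * v a y)" for \<xi> y
    unfolding W_def \<gamma>_def sum_distrib_right by (subst sum.swap) (simp add: mult_ac)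
  have orth: "(\<Sum>x\<in>X. (\<xi> x - p \<xi> x) * cnj (u b x)) = 0" if b: "b < N" for \<xi> b
  proof -
    have "\<xi> x - p \<xi> x = (\<Sum>z\<in>X. \<xi> z * ((if x = z then 1 else 0) - (\<Sum>a<N. \<alpha> z a * u a x)))" if "x \<in> X" for x
    proof -
      have "p \<xi> x = (\<Sum>z\<in>X. \<xi> z * (\<Sum>a<N. \<alpha> z a * u a x))"
        unfolding p_def \<gamma>_def sum_distrib_right sum_distrib_left by (subst sum.swap) (simp add: mult_ac)
      moreover have "(\<Sum>z\<in>X. \<xi> z * (if x = z then 1 else 0)) = \<xi> x" using that X by (simp add: mult_delta_right)
      ultimately show ?thesis unfolding right_diff_distrib sum_subtractf by (simp only:)
    qed
    then have "(\<Sum>x\<in>X. (\<xi> x - p \<xi> x) * cnj (u b x))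
      = (\<Sum>x\<in>X. \<Sum>z\<in>X. \<xi> z * (((if x = z then 1 else 0) - (\<Sum>a<N. \<alpha> z a * u a x)) * cnj (u b x)))"
      by (intro sum.cong refl) (simp add: sum_distrib_right mult.assoc)
    also have "\<dots> = (\<Sum>z\<in>X. \<xi> z * (\<Sum>x\<in>X. ((if x = z then 1 else 0) - (\<Sum>a<N. \<alpha> z a * u a x)) * cnj (u b x)))"
      unfolding sum_distrib_left by (rule sum.swap)
    also have "\<dots> = 0" using \<alpha> b by simp
    finally show ?thesis .
  qed
  have orth': "(\<Sum>x\<in>X. (\<xi> x - p \<xi> x) * cnj (\<Sum>a<N. \<kappa> a * u a x)) = 0" for \<xi> \<kappa>
  proof -
    have "(\<Sum>x\<in>X. (\<xi> x - p \<xi> x) * cnj (\<Sum>a<N. \<kappa> a * u a x))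
      = (\<Sum>x\<in>X. \<Sum>a<N. cnj (\<kappa> a) * ((\<xi> x - p \<xi> x) * cnj (u a x)))"
      by (simp add: cnj_sum sum_distrib_left mult_ac)
    also have "\<dots> = (\<Sum>a<N. cnj (\<kappa> a) * (\<Sum>x\<in>X. (\<xi> x - p \<xi> x) * cnj (u a x)))"
      unfolding sum_distrib_left by (rule sum.swap)
    also have "\<dots> = 0" using orth by simp
    finally show ?thesis .
  qed
  have "(\<Sum>y\<in>Y. (cmod (\<Sum>x\<in>X. W y x * \<xi> x))\<^sup>2) \<le> (\<Sum>x\<in>X. (cmod (\<xi> x))\<^sup>2)" for \<xi>
  proof -
    have "(\<Sum>y\<in>Y. (cmod (\<Sum>x\<in>X. W y x * \<xi> x))\<^sup>2) \<le> (\<Sum>x\<in>X. (cmod (p \<xi> x))\<^sup>2)"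
      unfolding W p_def by (rule dom)
    also have "\<dots> \<le> (\<Sum>x\<in>X. (cmod (p \<xi> x + (\<xi> x - p \<xi> x)))\<^sup>2)"
      by (rule norm_sq_le_of_orthogonal) (use orth'[of \<xi> "\<gamma> \<xi>"] in \<open>simp add: p_def\<close>)
    finally show ?thesis by simp
  qed
  moreover have "(\<Sum>x\<in>X. W y x * u b x) = v b y" if b: "b < N" and y: "y \<in> Y" for b y
  proof -
    \<comment> \<open>Coefficients of \<open>u b\<close> minus its projection. That vector lies in
      the span and is orthogonal to it, hence 0, and \<open>dom\<close> carries this over to the
      \<open>v a\<close>.\<close>
    define \<kappa> where "\<kappa> a = (if a = b then 1 else 0) - \<gamma> (u b) a" for a
    have \<kappa>: "(\<Sum>a<N. \<kappa> a * z a) = z b - (\<Sum>a<N. \<gamma> (u b) a * z a)" for z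
      using b by (simp add: \<kappa>_def left_diff_distrib sum_subtractf mult_delta_left)
    have "(\<Sum>x\<in>X. (u b x - p (u b) x) * cnj (u b x - p (u b) x)) = 0"
      using orth'[of "u b" \<kappa>] unfolding \<kappa> p_def .
    then have "(\<Sum>x\<in>X. (cmod (\<Sum>a<N. \<kappa> a * u a x))\<^sup>2) = 0"
      unfolding sum_mult_cnj of_real_eq_0_iff \<kappa> p_def .
    with dom[of \<kappa>] have "(\<Sum>y\<in>Y. (cmod (\<Sum>a<N. \<kappa> a * v a y))\<^sup>2) = 0"
      using sum_nonneg[of Y "\<lambda>y. (cmod (\<Sum>a<N. \<kappa> a * v a y))\<^sup>2"] by simp
    then have "(cmod (\<Sum>a<N. \<kappa> a * v a y))\<^sup>2 = 0" using sum_nonneg_eq_0_iff[OF Y, of "\<lambda>y. (cmod (\<Sum>a<N. \<kappa> a * v a y))\<^sup>2"] y by simp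
    then show ?thesis unfolding \<kappa> W by simp
  qed
  ultimately show ?thesis by blast
qed

section \<open>Power series in non-commuting blocks\<close>

text \<open>Letters are index pairs, standing for the entries of \<delta>. The length is strictly
  below \<open>k\<close>, so the partial sums start from the empty set of words.\<close>

definition words :: "nat \<Rightarrow> nat \<Rightarrow> nat \<Rightarrow> (nat \<times> nat) list set" where
  "words I J k = {w. set w \<subseteq> {..<I} \<times> {..<J} \<and> length w < k}"

lemma finite_words: "finite (words I J k)"
  by (rule finite_subset[OF _ finite_lists_length_le[of "{..<I} \<times> {..<J}" k]]) (auto simp: words_def)

lemma words_0 [simp]: "words I J 0 = {}"
  by (simp add: words_def)

lemma sum_words_Suc:
  "(\<Sum>w\<in>words I J (Suc k). \<phi> w) = \<phi> [] + (\<Sum>i<I. \<Sum>j<J. \<Sum>w\<in>words I J k. \<phi> ((i, j) # w))"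
proof -
  let ?c = "\<lambda>(q, w). q # w" and ?P = "({..<I} \<times> {..<J}) \<times> words I J k"
  have eq: "words I J (Suc k) = insert [] (?c ` ?P)"
  proof (rule Set.set_eqI)
    fix w show "w \<in> words I J (Suc k) \<longleftrightarrow> w \<in> insert [] (?c ` ?P)"
      by (cases w) (auto simp: words_def image_iff)
  qed
  have "(\<Sum>w\<in>words I J (Suc k). \<phi> w) = \<phi> [] + (\<Sum>w\<in>?c ` ?P. \<phi> w)"
    unfolding eq by (rule sum.insert) (auto simp: finite_words)
  also have "(\<Sum>w\<in>?c ` ?P. \<phi> w) = (\<Sum>qw\<in>?P. \<phi> (?c qw))"
    by (rule sum.reindex_cong[of ?c]) (auto simp: inj_on_def)
  also have "\<dots> = (\<Sum>q\<in>{..<I} \<times> {..<J}. \<Sum>w\<in>words I J k. \<phi> (q # w))"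
    using sum.cartesian_product[of "\<lambda>q w. \<phi> (q # w)" "words I J k" "{..<I} \<times> {..<J}"] by (simp add: case_prod_beta)
  also have "\<dots> = (\<Sum>i<I. \<Sum>j<J. \<Sum>w\<in>words I J k. \<phi> ((i, j) # w))"
    using sum.cartesian_product[of "\<lambda>i j. \<Sum>w\<in>words I J k. \<phi> ((i, j) # w)" "{..<J}" "{..<I}"] by (simp add: case_prod_beta)
  finally show ?thesis .
qed

text \<open>The product of the blocks named by the word, applied to \<open>v\<close>; functions on
  indices instead of vectors leave only finite sums and no carrier conditions.\<close>

primrec word_action :: "(nat \<Rightarrow> nat \<Rightarrow> complex mat) \<Rightarrow> nat \<Rightarrow> (nat \<Rightarrow> complex) \<Rightarrow> (nat \<times> nat) list \<Rightarrow> nat \<Rightarrow> complex" where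
  "word_action U n v [] = v"
| "word_action U n v (q # w) = (\<lambda>a. \<Sum>b<n. U (fst q) (snd q) $$ (a, b) * word_action U n v w b)"

definition word_series :: "((nat \<times> nat) list \<Rightarrow> complex) \<Rightarrow> nat \<Rightarrow> nat \<Rightarrow> (nat \<Rightarrow> nat \<Rightarrow> complex mat) \<Rightarrow>
    nat \<Rightarrow> (nat \<Rightarrow> complex) \<Rightarrow> nat \<Rightarrow> nat \<Rightarrow> complex" where
  "word_series cf I J U n v k a = (\<Sum>w\<in>words I J k. cf w * word_action U n v w a)"

text \<open>Both bounds survive pointwise limits of the coefficients, and together they make the limit of the
  partial sums contractive.\<close>

definition schur_series :: "nat \<Rightarrow> nat \<Rightarrow> ((nat \<times> nat) list \<Rightarrow> complex) \<Rightarrow> bool" where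
  "schur_series I J cf \<longleftrightarrow> (\<forall>n U v r. 0 \<le> r \<and> r \<le> 1 \<and> block_bounded r n I J U \<longrightarrow>
     (\<forall>k. (\<Sum>a<n. (cmod (word_series cf I J U n v (Suc k) a - word_series cf I J U n v k a))\<^sup>2)
        \<le> (r\<^sup>2) ^ k * (\<Sum>a<n. (cmod (v a))\<^sup>2)) \<and>
     (\<forall>k. (\<Sum>m<k. \<Sum>a<n. (cmod (word_series cf I J U n v (Suc m) a))\<^sup>2) \<le> real k * (\<Sum>a<n. (cmod (v a))\<^sup>2)))"

text \<open>Each single inequality involves finitely many words, so it is closed under pointwise
  convergence of the coefficients.\<close>

lemma schur_series_limit:
  assumes s: "\<And>n. schur_series I J (cf n)"
    and lim: "\<And>w. set w \<subseteq> {..<I} \<times> {..<J} \<Longrightarrow> (\<lambda>n. cf n w) \<longlonglongrightarrow> c w"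
  shows "schur_series I J c"
  unfolding schur_series_def
proof (intro allI impI conjI; elim conjE)
  fix n U v r k assume r: "(0::real) \<le> r" "r \<le> 1" "block_bounded r n I J U"
  have l: "(\<lambda>N. word_series (cf N) I J U n v k a) \<longlonglongrightarrow> word_series c I J U n v k a" for k a
    unfolding word_series_def by (intro tendsto_intros lim) (simp add: words_def)
  have "(\<lambda>N. \<Sum>a<n. (cmod (word_series (cf N) I J U n v (Suc k) a - word_series (cf N) I J U n v k a))\<^sup>2)
    \<longlonglongrightarrow> (\<Sum>a<n. (cmod (word_series c I J U n v (Suc k) a - word_series c I J U n v k a))\<^sup>2)"
    by (intro tendsto_intros l)
  then show "(\<Sum>a<n. (cmod (word_series c I J U n v (Suc k) a - word_series c I J U n v k a))\<^sup>2)
        \<le> (r\<^sup>2) ^ k * (\<Sum>a<n. (cmod (v a))\<^sup>2)"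
    by (rule LIMSEQ_le_const2) (use s r in \<open>auto simp: schur_series_def\<close>)
  have "(\<lambda>N. \<Sum>m<k. \<Sum>a<n. (cmod (word_series (cf N) I J U n v (Suc m) a))\<^sup>2)
    \<longlonglongrightarrow> (\<Sum>m<k. \<Sum>a<n. (cmod (word_series c I J U n v (Suc m) a))\<^sup>2)"
    by (intro tendsto_intros l)
  then show "(\<Sum>m<k. \<Sum>a<n. (cmod (word_series c I J U n v (Suc m) a))\<^sup>2) \<le> real k * (\<Sum>a<n. (cmod (v a))\<^sup>2)"
    by (rule LIMSEQ_le_const2) (use s r in \<open>auto simp: schur_series_def\<close>)
qed

lemma sum_rearrange:
  fixes e :: "'s \<Rightarrow> complex"
  shows "(\<Sum>j\<in>P. \<Sum>w\<in>W. (\<Sum>s\<in>S. e s * c w j s) * (\<Sum>b\<in>T. u j b * x w b))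
    = (\<Sum>s\<in>S. e s * (\<Sum>j\<in>P. \<Sum>b\<in>T. u j b * (\<Sum>w\<in>W. c w j s * x w b)))"
proof -
  have "(\<Sum>j\<in>P. \<Sum>w\<in>W. (\<Sum>s\<in>S. e s * c w j s) * (\<Sum>b\<in>T. u j b * x w b))
    = (\<Sum>j\<in>P. \<Sum>w\<in>W. \<Sum>s\<in>S. \<Sum>b\<in>T. e s * (u j b * (c w j s * x w b)))"
    unfolding sum_product by (intro sum.cong refl) (simp add: mult_ac)
  also have "\<dots> = (\<Sum>j\<in>P. \<Sum>s\<in>S. \<Sum>w\<in>W. \<Sum>b\<in>T. e s * (u j b * (c w j s * x w b)))"
    by (intro sum.cong refl sum.swap)
  also have "\<dots> = (\<Sum>s\<in>S. \<Sum>j\<in>P. \<Sum>w\<in>W. \<Sum>b\<in>T. e s * (u j b * (c w j s * x w b)))"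
    by (rule sum.swap)
  also have "\<dots> = (\<Sum>s\<in>S. \<Sum>j\<in>P. \<Sum>b\<in>T. \<Sum>w\<in>W. e s * (u j b * (c w j s * x w b)))"
    by (intro sum.cong refl sum.swap)
  finally show ?thesis by (simp add: sum_distrib_left)
qed

text \<open>The block matrix [A, B; C, E] is a contraction whose second input is indexed by
  \<open>I\<close> and \<open>M\<close> and whose second output by \<open>J\<close> and
  \<open>M\<close>. An \<open>I\<close> by \<open>J\<close> block matrix, tensored with the identity
  of size \<open>M\<close>, feeds this output back into this input.\<close>

locale colligation =
  fixes I J M :: nat and A :: complex and B C :: "nat \<Rightarrow> nat \<Rightarrow> complex"
    and E :: "nat \<Rightarrow> nat \<Rightarrow> nat \<Rightarrow> nat \<Rightarrow> complex"
  assumes contractive: "(cmod (A * \<alpha> + (\<Sum>i<I. \<Sum>s<M. B i s * \<beta> i s)))\<^sup>2 +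
      (\<Sum>j<J. \<Sum>t<M. (cmod (C j t * \<alpha> + (\<Sum>i<I. \<Sum>s<M. E j t i s * \<beta> i s)))\<^sup>2)
    \<le> (cmod \<alpha>)\<^sup>2 + (\<Sum>i<I. \<Sum>s<M. (cmod (\<beta> i s))\<^sup>2)"
begin

definition out_map :: "complex \<Rightarrow> (nat \<Rightarrow> nat \<Rightarrow> complex) \<Rightarrow> complex" where
  "out_map \<alpha> \<beta> = A * \<alpha> + (\<Sum>i<I. \<Sum>s<M. B i s * \<beta> i s)"

definition state_map :: "complex \<Rightarrow> (nat \<Rightarrow> nat \<Rightarrow> complex) \<Rightarrow> nat \<Rightarrow> nat \<Rightarrow> complex" where
  "state_map \<alpha> \<beta> j t = C j t * \<alpha> + (\<Sum>i<I. \<Sum>s<M. E j t i s * \<beta> i s)"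

definition feedback :: "(nat \<Rightarrow> nat \<Rightarrow> complex mat) \<Rightarrow> nat \<Rightarrow> (nat \<Rightarrow> nat \<Rightarrow> nat \<Rightarrow> complex) \<Rightarrow> nat \<Rightarrow> nat \<Rightarrow> nat \<Rightarrow> complex" where
  "feedback U n h a i s = (\<Sum>j<J. \<Sum>b<n. U i j $$ (a, b) * h j s b)"

text \<open>Coefficients of the words in the Neumann series of (1 - E U)^-1 C, where U stands for
  the noncommuting blocks; accordingly \<open>transfer_coef\<close> expands A + B U (1 - E U)^-1
  C.\<close>

primrec state_coef :: "(nat \<times> nat) list \<Rightarrow> nat \<Rightarrow> nat \<Rightarrow> complex" where
  "state_coef [] = C"
| "state_coef (q # w) = (\<lambda>j t. \<Sum>s<M. E j t (fst q) s * state_coef w (snd q) s)"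

primrec transfer_coef :: "(nat \<times> nat) list \<Rightarrow> complex" where
  "transfer_coef [] = A"
| "transfer_coef (q # w) = (\<Sum>s<M. B (fst q) s * state_coef w (snd q) s)"

definition state :: "(nat \<Rightarrow> nat \<Rightarrow> complex mat) \<Rightarrow> nat \<Rightarrow> (nat \<Rightarrow> complex) \<Rightarrow> nat \<Rightarrow> nat \<Rightarrow> nat \<Rightarrow> nat \<Rightarrow> complex" where
  "state U n v k j t a = (\<Sum>w\<in>words I J k. state_coef w j t * word_action U n v w a)"

abbreviation response :: "(nat \<Rightarrow> nat \<Rightarrow> complex mat) \<Rightarrow> nat \<Rightarrow> (nat \<Rightarrow> complex) \<Rightarrow> nat \<Rightarrow> nat \<Rightarrow> complex" where
  "response U n v \<equiv> word_series transfer_coef I J U n v"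

lemma state_0 [simp]: "state U n v 0 j t a = 0" and response_0 [simp]: "response U n v 0 a = 0"
  by (simp_all add: state_def word_series_def)

text \<open>Prepending a letter to all words is one turn of the feedback loop, so the partial sums
  are the orbit of a discrete linear system started in state 0 with constant input
  \<open>v\<close>.\<close>

lemma state_Suc: "state U n v (Suc k) j t a = state_map (v a) (feedback U n (state U n v k) a) j t"
  unfolding state_def[of _ _ _ "Suc k"] sum_words_Suc state_map_def feedback_def
  by (simp add: sum_rearrange) (simp add: state_def)

lemma response_Suc: "response U n v (Suc k) a = out_map (v a) (feedback U n (state U n v k) a)"
  unfolding word_series_def sum_words_Suc out_map_def feedback_def
  by (simp add: sum_rearrange) (simp add: state_def)

lemma map_diff:
  "out_map \<alpha> \<beta> - out_map \<alpha>' \<beta>' = out_map (\<alpha> - \<alpha>') (\<lambda>i s. \<beta> i s - \<beta>' i s)"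
  "state_map \<alpha> \<beta> j t - state_map \<alpha>' \<beta>' j t = state_map (\<alpha> - \<alpha>') (\<lambda>i s. \<beta> i s - \<beta>' i s) j t"
  "feedback U n h a i s - feedback U n h' a i s = feedback U n (\<lambda>j s b. h j s b - h' j s b) a i s"
  by (simp_all add: out_map_def state_map_def feedback_def right_diff_distrib sum_subtractf)

text \<open>Energy balance of one step: contractivity is applied for each index \<open>a\<close> of
  the matrix space, and \<open>block_bounded\<close> for each state index \<open>s\<close>.\<close>

lemma step_bound:
  assumes U: "block_bounded r n I J U"
  shows "(\<Sum>a<n. (cmod (out_map (v a) (feedback U n h a)))\<^sup>2)
      + (\<Sum>a<n. \<Sum>j<J. \<Sum>t<M. (cmod (state_map (v a) (feedback U n h a) j t))\<^sup>2)
    \<le> (\<Sum>a<n. (cmod (v a))\<^sup>2) + r\<^sup>2 * (\<Sum>a<n. \<Sum>j<J. \<Sum>t<M. (cmod (h j t a))\<^sup>2)"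
proof -
  have "(\<Sum>a<n. (cmod (out_map (v a) (feedback U n h a)))\<^sup>2)
      + (\<Sum>a<n. \<Sum>j<J. \<Sum>t<M. (cmod (state_map (v a) (feedback U n h a) j t))\<^sup>2)
    \<le> (\<Sum>a<n. (cmod (v a))\<^sup>2 + (\<Sum>i<I. \<Sum>s<M. (cmod (feedback U n h a i s))\<^sup>2))"
    unfolding sum.distrib[symmetric] out_map_def state_map_def by (intro sum_mono contractive)
  also have "\<dots> = (\<Sum>a<n. (cmod (v a))\<^sup>2) + (\<Sum>a<n. \<Sum>i<I. \<Sum>s<M. (cmod (feedback U n h a i s))\<^sup>2)"
    by (rule sum.distrib)
  also have "(\<Sum>a<n. \<Sum>i<I. \<Sum>s<M. (cmod (feedback U n h a i s))\<^sup>2)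
    = (\<Sum>a<n. \<Sum>s<M. \<Sum>i<I. (cmod (feedback U n h a i s))\<^sup>2)" by (intro sum.cong refl sum.swap)
  also have "\<dots> = (\<Sum>s<M. \<Sum>a<n. \<Sum>i<I. (cmod (feedback U n h a i s))\<^sup>2)" by (rule sum.swap)
  also have "\<dots> = (\<Sum>s<M. \<Sum>i<I. \<Sum>a<n. (cmod (feedback U n h a i s))\<^sup>2)" by (intro sum.cong refl sum.swap)
  also have "\<dots> \<le> (\<Sum>s<M. r\<^sup>2 * (\<Sum>j<J. \<Sum>b<n. (cmod (h j s b))\<^sup>2))"
    unfolding feedback_def
    by (intro sum_mono) (use U[unfolded block_bounded_def, rule_format, of "\<lambda>j b. h j _ b"] in simp)
  also have "\<dots> = r\<^sup>2 * (\<Sum>a<n. \<Sum>j<J. \<Sum>t<M. (cmod (h j t a))\<^sup>2)"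
  proof -
    have "(\<Sum>s<M. \<Sum>j<J. \<Sum>b<n. (cmod (h j s b))\<^sup>2) = (\<Sum>s<M. \<Sum>b<n. \<Sum>j<J. (cmod (h j s b))\<^sup>2)"
      by (intro sum.cong refl sum.swap)
    also have "\<dots> = (\<Sum>b<n. \<Sum>s<M. \<Sum>j<J. (cmod (h j s b))\<^sup>2)" by (rule sum.swap)
    also have "\<dots> = (\<Sum>b<n. \<Sum>j<J. \<Sum>s<M. (cmod (h j s b))\<^sup>2)" by (intro sum.cong refl sum.swap)
    finally show ?thesis unfolding sum_distrib_left[symmetric] by (rule arg_cong)
  qed
  finally show ?thesis by simp
qed

text \<open>Increments obey the same system with input 0, so each further step gains a factor of
  \<open>r\<^sup>2\<close>; the input \<open>v\<close> enters only through the first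
  increment.\<close>

lemma increment_bound:
  assumes U: "block_bounded r n I J U"
  shows "(\<Sum>a<n. (cmod (response U n v (Suc k) a - response U n v k a))\<^sup>2)
      + (\<Sum>a<n. \<Sum>j<J. \<Sum>t<M. (cmod (state U n v (Suc k) j t a - state U n v k j t a))\<^sup>2)
    \<le> (r\<^sup>2) ^ k * (\<Sum>a<n. (cmod (v a))\<^sup>2)"
proof (induction k)
  case 0
  then show ?case using step_bound[OF U, of v "state U n v 0"] by (simp add: state_Suc response_Suc)
next
  case (Suc k)
  let ?h = "\<lambda>j t a. state U n v (Suc k) j t a - state U n v k j t a"
  have o: "response U n v (Suc (Suc k)) a - response U n v (Suc k) a = out_map 0 (feedback U n ?h a)" for a
    unfolding response_Suc map_diff by simp
  have x: "state U n v (Suc (Suc k)) j t a - state U n v (Suc k) j t a = state_map 0 (feedback U n ?h a) j t" for j t a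
    unfolding state_Suc[of U n v "Suc k" j t a] state_Suc[of U n v k j t a] map_diff by simp
  have "(\<Sum>a<n. (cmod (response U n v (Suc (Suc k)) a - response U n v (Suc k) a))\<^sup>2)
      + (\<Sum>a<n. \<Sum>j<J. \<Sum>t<M. (cmod (state U n v (Suc (Suc k)) j t a - state U n v (Suc k) j t a))\<^sup>2)
    \<le> r\<^sup>2 * (\<Sum>a<n. \<Sum>j<J. \<Sum>t<M. (cmod (?h j t a))\<^sup>2)"
    using step_bound[OF U, of "\<lambda>_. 0" ?h] unfolding o x by simp
  also have "\<dots> \<le> r\<^sup>2 * ((r\<^sup>2) ^ k * (\<Sum>a<n. (cmod (v a))\<^sup>2))"
  proof (rule mult_left_mono)
    have "0 \<le> (\<Sum>a<n. (cmod (response U n v (Suc k) a - response U n v k a))\<^sup>2)" by (simp add: sum_nonneg)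
    with Suc show "(\<Sum>a<n. \<Sum>j<J. \<Sum>t<M. (cmod (?h j t a))\<^sup>2) \<le> (r\<^sup>2) ^ k * (\<Sum>a<n. (cmod (v a))\<^sup>2)" by linarith
  qed simp
  finally show ?case by (simp add: mult.assoc)
qed

text \<open>Summing the energy balance: total output plus stored energy never exceeds the total
  input. The balance does not bound a single response by \<open>v\<close>, because it can draw on
  stored energy.\<close>

lemma average_bound:
  assumes U: "block_bounded r n I J U" and r: "0 \<le> r" "r \<le> 1"
  shows "(\<Sum>m<k. \<Sum>a<n. (cmod (response U n v (Suc m) a))\<^sup>2)
      + (\<Sum>a<n. \<Sum>j<J. \<Sum>t<M. (cmod (state U n v k j t a))\<^sup>2)
    \<le> real k * (\<Sum>a<n. (cmod (v a))\<^sup>2)"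
proof (induction k)
  case (Suc k)
  let ?s = "\<lambda>k. \<Sum>a<n. \<Sum>j<J. \<Sum>t<M. (cmod (state U n v k j t a))\<^sup>2"
  have "(\<Sum>a<n. (cmod (response U n v (Suc k) a))\<^sup>2) + ?s (Suc k) \<le> (\<Sum>a<n. (cmod (v a))\<^sup>2) + r\<^sup>2 * ?s k"
    unfolding response_Suc state_Suc by (rule step_bound[OF U])
  moreover have "r\<^sup>2 * ?s k \<le> 1 * ?s k"
    by (intro mult_right_mono sum_nonneg) (use r in \<open>auto simp: power_le_one\<close>)
  ultimately show ?case using Suc by (simp add: algebra_simps)
qed simp

lemma schur_series_transfer: "schur_series I J transfer_coef"
  unfolding schur_series_def
proof (intro allI impI conjI; elim conjE)
  fix n U v r k assume r: "(0::real) \<le> r" "r \<le> 1" "block_bounded r n I J U"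
  have "0 \<le> (\<Sum>a<n. \<Sum>j<J. \<Sum>t<M. (cmod (state U n v (Suc k) j t a - state U n v k j t a))\<^sup>2)"
    by (intro sum_nonneg) simp
  with increment_bound[OF r(3), of v k]
  show "(\<Sum>a<n. (cmod (response U n v (Suc k) a - response U n v k a))\<^sup>2) \<le> (r\<^sup>2) ^ k * (\<Sum>a<n. (cmod (v a))\<^sup>2)"
    by linarith
  have "0 \<le> (\<Sum>a<n. \<Sum>j<J. \<Sum>t<M. (cmod (state U n v k j t a))\<^sup>2)" by (intro sum_nonneg) simp
  with average_bound[OF r(3,1,2), of v k]
  show "(\<Sum>m<k. \<Sum>a<n. (cmod (response U n v (Suc m) a))\<^sup>2) \<le> real k * (\<Sum>a<n. (cmod (v a))\<^sup>2)" by linarith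
qed

text \<open>A word is followed letter by letter: input 0 together with \<open>state_coef w j\<close>
  in slot \<open>i\<close> produces the coefficients of the longer word. The resulting uniform bound
  makes convergent subsequences of coefficients available.\<close>

lemma coef_bound:
  assumes "set w \<subseteq> {..<I} \<times> {..<J}"
  shows "(cmod (transfer_coef w))\<^sup>2 + (\<Sum>j<J. \<Sum>t<M. (cmod (state_coef w j t))\<^sup>2) \<le> 1"
  using assms
proof (induction w)
  case Nil
  then show ?case using contractive[of 1 "\<lambda>_ _. 0"] by simp
next
  case (Cons q w)
  obtain i j where q: "q = (i, j)" by (cases q)
  then have ij: "i < I" "j < J" using Cons.prems by auto
  let ?\<beta> = "\<lambda>k s. if k = i then state_coef w j s else 0"
  have d: "(\<Sum>k<I. \<Sum>s<M. z k s * ?\<beta> k s) = (\<Sum>s<M. z i s * state_coef w j s)" for z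
    using ij(1) by (subst sum.swap) (simp add: mult_delta_right)
  have "(\<Sum>k<I. \<Sum>s<M. (cmod (?\<beta> k s))\<^sup>2) = (\<Sum>s<M. \<Sum>k<I. if k = i then (cmod (state_coef w j s))\<^sup>2 else 0)"
    by (subst sum.swap) (intro sum.cong, auto)
  then have n: "(\<Sum>k<I. \<Sum>s<M. (cmod (?\<beta> k s))\<^sup>2) = (\<Sum>s<M. (cmod (state_coef w j s))\<^sup>2)" using ij(1) by simp
  have "(\<Sum>s<M. (cmod (state_coef w j s))\<^sup>2) \<le> (\<Sum>j<J. \<Sum>s<M. (cmod (state_coef w j s))\<^sup>2)"
    by (rule member_le_sum[of j "{..<J}" "\<lambda>j. \<Sum>s<M. (cmod (state_coef w j s))\<^sup>2"]) (use ij in \<open>auto intro: sum_nonneg\<close>)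
  moreover have "(\<Sum>j<J. \<Sum>t<M. (cmod (state_coef w j t))\<^sup>2) \<le> 1"
  proof -
    have "(cmod (transfer_coef w))\<^sup>2 + (\<Sum>j<J. \<Sum>t<M. (cmod (state_coef w j t))\<^sup>2) \<le> 1" using Cons by simp
    then show ?thesis using zero_le_power2[of "cmod (transfer_coef w)"] by linarith
  qed
  ultimately show ?case using contractive[of 0 ?\<beta>] unfolding d n by (simp add: q)
qed

text \<open>By \<open>near\<close>, the colligation sends (c, \<delta> g) to (f, g) up to
  \<epsilon>, so \<open>g\<close> is almost a fixed state. The orbit \<open>h k\<close> with input
  \<open>c\<close> approaches it: the error \<open>e\<close> shrinks by \<open>r\<^sup>2\<close> in
  each step up to an additive \<epsilon>, and the output error is part of the same balance.\<close>

lemma interpolation_error: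
  fixes c \<epsilon> r :: real and g :: "nat \<Rightarrow> nat \<Rightarrow> complex"
  assumes U: "block_bounded r 1 I J (\<lambda>i j. mat 1 1 (\<lambda>_. \<delta> i j))" and r: "0 \<le> r" "r < 1" and \<epsilon>: "0 \<le> \<epsilon>"
    and near: "\<And>\<alpha> h. (cmod (f - out_map \<alpha> (\<lambda>i s. \<Sum>j<J. \<delta> i j * h j s)))\<^sup>2
      + (\<Sum>j<J. \<Sum>t<M. (cmod (g j t - state_map \<alpha> (\<lambda>i s. \<Sum>j<J. \<delta> i j * h j s) j t))\<^sup>2)
      \<le> (cmod (complex_of_real c - \<alpha>))\<^sup>2 + \<epsilon> + (\<Sum>i<I. \<Sum>s<M. (cmod (\<Sum>j<J. \<delta> i j * (g j s - h j s)))\<^sup>2)"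
  shows "(cmod (f - response (\<lambda>i j. mat 1 1 (\<lambda>_. \<delta> i j)) 1 (\<lambda>_. of_real c) (Suc k) 0))\<^sup>2
    \<le> (r\<^sup>2) ^ k * ((c\<^sup>2 + \<epsilon>) / (1 - r\<^sup>2)) + 2 * (\<epsilon> / (1 - r\<^sup>2))"
proof -
  let ?U = "\<lambda>i j. mat 1 1 (\<lambda>_. \<delta> i j)"
  define h where "h k j t = state ?U 1 (\<lambda>_. of_real c) k j t 0" for k j t
  define e where "e k = (\<Sum>j<J. \<Sum>t<M. (cmod (g j t - h k j t))\<^sup>2)" for k
  have e0: "e k \<ge> 0" for k by (simp add: e_def sum_nonneg)
  have fb: "feedback ?U 1 (state ?U 1 (\<lambda>_. of_real c) k) 0 = (\<lambda>i s. \<Sum>j<J. \<delta> i j * h k j s)" for k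
    by (intro ext) (simp add: feedback_def h_def)
  have r2: "r\<^sup>2 < 1" "0 \<le> r\<^sup>2" using r by (auto simp: power_less_one_iff)
  have bb: "(\<Sum>i<I. \<Sum>s<M. (cmod (\<Sum>j<J. \<delta> i j * z j s))\<^sup>2) \<le> r\<^sup>2 * (\<Sum>j<J. \<Sum>s<M. (cmod (z j s))\<^sup>2)" for z
  proof -
    have "(\<Sum>i<I. \<Sum>s<M. (cmod (\<Sum>j<J. \<delta> i j * z j s))\<^sup>2) = (\<Sum>s<M. \<Sum>i<I. (cmod (\<Sum>j<J. \<delta> i j * z j s))\<^sup>2)"
      by (rule sum.swap)
    also have "\<dots> \<le> (\<Sum>s<M. r\<^sup>2 * (\<Sum>j<J. (cmod (z j s))\<^sup>2))"
      by (intro sum_mono) (use U[unfolded block_bounded_def, rule_format, of "\<lambda>j _. z j _"] in simp)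
    also have "\<dots> = r\<^sup>2 * (\<Sum>j<J. \<Sum>s<M. (cmod (z j s))\<^sup>2)"
      unfolding sum_distrib_left by (rule sum.swap)
    finally show ?thesis .
  qed
  have step: "(cmod (f - response ?U 1 (\<lambda>_. of_real c) (Suc k) 0))\<^sup>2 + e (Suc k) \<le> \<epsilon> + r\<^sup>2 * e k" for k
    using near[of "of_real c" "h k"] bb[of "\<lambda>j s. g j s - h k j s"]
    unfolding e_def h_def[of "Suc k"] response_Suc state_Suc fb by simp
  \<comment> \<open>The size of \<open>g\<close> is not given, but comparing it with input and state
    0 bounds \<open>e 0\<close> by c^2 + \<epsilon> plus a proper fraction of itself.\<close>
  have "e 0 \<le> c\<^sup>2 + \<epsilon> + r\<^sup>2 * e 0"
  proof -
    have "(cmod f)\<^sup>2 + (\<Sum>j<J. \<Sum>t<M. (cmod (g j t))\<^sup>2) \<le> c\<^sup>2 + \<epsilon> + r\<^sup>2 * (\<Sum>j<J. \<Sum>s<M. (cmod (g j s))\<^sup>2)"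
      using near[of 0 "\<lambda>_ _. 0"] bb[of g] by (simp add: out_map_def state_map_def)
    then show ?thesis using zero_le_power2[of "cmod f"] unfolding e_def h_def state_0 diff_zero by linarith
  qed
  then have G: "e 0 \<le> (c\<^sup>2 + \<epsilon>) / (1 - r\<^sup>2)" using r2 by (simp add: field_simps)
  have ek: "e k \<le> (r\<^sup>2) ^ k * e 0 + \<epsilon> / (1 - r\<^sup>2)" for k
  proof (induction k)
    case 0
    show ?case using r2 \<epsilon> by simp
  next
    case (Suc k)
    have "e (Suc k) \<le> \<epsilon> + r\<^sup>2 * e k" using step[of k] zero_le_power2[of "cmod (f - response ?U 1 (\<lambda>_. of_real c) (Suc k) 0)"] by linarith
    also have "\<dots> \<le> \<epsilon> + r\<^sup>2 * ((r\<^sup>2) ^ k * e 0 + \<epsilon> / (1 - r\<^sup>2))"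
      by (intro add_left_mono mult_left_mono Suc r2)
    also have "\<dots> = (r\<^sup>2) ^ Suc k * e 0 + \<epsilon> / (1 - r\<^sup>2)" using r2 by (simp add: field_simps)
    finally show ?case .
  qed
  have "(cmod (f - response ?U 1 (\<lambda>_. of_real c) (Suc k) 0))\<^sup>2 \<le> \<epsilon> + r\<^sup>2 * e k" using step[of k] e0[of "Suc k"] by linarith
  also have "\<dots> \<le> \<epsilon> / (1 - r\<^sup>2) + 1 * e k"
    by (intro add_mono mult_right_mono e0) (use r2 \<epsilon> in \<open>auto simp: field_simps\<close>)
  also have "\<dots> \<le> \<epsilon> / (1 - r\<^sup>2) + ((r\<^sup>2) ^ k * e 0 + \<epsilon> / (1 - r\<^sup>2))" using ek[of k] by simp
  also have "(r\<^sup>2) ^ k * e 0 \<le> (r\<^sup>2) ^ k * ((c\<^sup>2 + \<epsilon>) / (1 - r\<^sup>2))" by (intro mult_left_mono G) simp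
  finally show ?thesis by simp
qed

end

text \<open>This is \<open>contraction_extension\<close> for the vectors (slack, c, \<delta> g) and
  (f, g) attached to the points. The error term \<epsilon> of \<open>dom\<close> is absorbed by
  \<open>N\<close> slack coordinates, the one of index \<open>a\<close> carrying the square root of
  \<epsilon>; discarding them from \<open>W\<close> leaves a contraction that interpolates up to
  \<epsilon>.\<close>

lemma realization:
  fixes f :: "nat \<Rightarrow> complex" and \<delta> g :: "nat \<Rightarrow> nat \<Rightarrow> nat \<Rightarrow> complex" and c \<epsilon> :: real
  assumes \<epsilon>: "0 \<le> \<epsilon>" and dom: "\<And>\<gamma>. (cmod (\<Sum>a<N. \<gamma> a * f a))\<^sup>2 + (\<Sum>j<J. \<Sum>s<M. (cmod (\<Sum>a<N. \<gamma> a * g a j s))\<^sup>2)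
    \<le> c\<^sup>2 * (cmod (\<Sum>a<N. \<gamma> a))\<^sup>2 + (\<Sum>i<I. \<Sum>s<M. (cmod (\<Sum>a<N. \<gamma> a * (\<Sum>j<J. \<delta> a i j * g a j s)))\<^sup>2)
      + \<epsilon> * (\<Sum>a<N. (cmod (\<gamma> a))\<^sup>2)"
  shows "\<exists>A B C E. colligation I J M A B C E \<and> (\<forall>a<N. \<forall>\<alpha> h.
    (cmod (f a - colligation.out_map I M A B \<alpha> (\<lambda>i s. \<Sum>j<J. \<delta> a i j * h j s)))\<^sup>2
      + (\<Sum>j<J. \<Sum>t<M. (cmod (g a j t - colligation.state_map I M C E \<alpha> (\<lambda>i s. \<Sum>j<J. \<delta> a i j * h j s) j t))\<^sup>2)
      \<le> (cmod (complex_of_real c - \<alpha>))\<^sup>2 + \<epsilon> + (\<Sum>i<I. \<Sum>s<M. (cmod (\<Sum>j<J. \<delta> a i j * (g a j s - h j s)))\<^sup>2))"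
proof -
  \<comment> \<open>Among the left summands of \<open>?X\<close>, the indices below \<open>N\<close>
    are the slack coordinates and \<open>N\<close> is the constant coordinate.\<close>
  let ?X = "{..<Suc N} <+> ({..<I} \<times> {..<M})" and ?Y = "{..<1::nat} <+> ({..<J} \<times> {..<M})"
  define u :: "nat \<Rightarrow> nat + nat \<times> nat \<Rightarrow> complex" where
    "u a x = (case x of Inl b \<Rightarrow> if b = N then of_real c else if b = a then of_real (sqrt \<epsilon>) else 0
      | Inr (i, s) \<Rightarrow> \<Sum>j<J. \<delta> a i j * g a j s)" for a x
  define v :: "nat \<Rightarrow> nat + nat \<times> nat \<Rightarrow> complex" where
    "v a y = (case y of Inl b \<Rightarrow> f a | Inr (j, s) \<Rightarrow> g a j s)" for a y
  have X: "(\<Sum>x\<in>?X. z x) = (\<Sum>b<N. z (Inl b)) + z (Inl N) + (\<Sum>i<I. \<Sum>s<M. z (Inr (i, s)))"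
    for z :: "nat + nat \<times> nat \<Rightarrow> 'a :: comm_monoid_add"
    by (subst sum.Plus) (simp_all add: sum.cartesian_product case_prod_beta)
  have Y: "(\<Sum>y\<in>?Y. z y) = z (Inl 0) + (\<Sum>j<J. \<Sum>s<M. z (Inr (j, s)))"
    for z :: "nat + nat \<times> nat \<Rightarrow> 'a :: comm_monoid_add"
    by (subst sum.Plus) (simp_all add: sum.cartesian_product case_prod_beta)
  have d: "(\<Sum>y\<in>?Y. (cmod (\<Sum>a<N. \<gamma> a * v a y))\<^sup>2) \<le> (\<Sum>x\<in>?X. (cmod (\<Sum>a<N. \<gamma> a * u a x))\<^sup>2)" for \<gamma>
  proof -
    have m1: "(\<Sum>b<N. (cmod (\<Sum>a<N. \<gamma> a * u a (Inl b)))\<^sup>2) = (\<Sum>b<N. \<epsilon> * (cmod (\<gamma> b))\<^sup>2)"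
    proof (intro sum.cong refl)
      fix b assume b: "b \<in> {..<N}"
      then have "(\<Sum>a<N. \<gamma> a * u a (Inl b)) = (\<Sum>a<N. if b = a then \<gamma> a * of_real (sqrt \<epsilon>) else 0)"
        by (intro sum.cong refl) (simp add: u_def)
      then show "(cmod (\<Sum>a<N. \<gamma> a * u a (Inl b)))\<^sup>2 = \<epsilon> * (cmod (\<gamma> b))\<^sup>2"
        using b \<epsilon> by (simp add: norm_mult power_mult_distrib)
    qed
    have "(\<Sum>a<N. \<gamma> a * u a (Inl N)) = of_real c * (\<Sum>a<N. \<gamma> a)"
      by (simp add: u_def sum_distrib_left mult.commute)
    then have m2: "(cmod (\<Sum>a<N. \<gamma> a * u a (Inl N)))\<^sup>2 = c\<^sup>2 * (cmod (\<Sum>a<N. \<gamma> a))\<^sup>2"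
      by (simp add: norm_mult power_mult_distrib)
    have "u a (Inr (i, s)) = (\<Sum>j<J. \<delta> a i j * g a j s)" "v a (Inl 0) = f a" "v a (Inr (i, s)) = g a i s" for a i s
      by (simp_all add: u_def v_def)
    then show ?thesis using dom[of \<gamma>] unfolding X Y m1 m2 sum_distrib_left[symmetric] by simp
  qed
  have "finite ?X" "finite ?Y" by simp_all
  from contraction_extension[OF this d] obtain W where
    W': "(\<forall>\<xi>. (\<Sum>y\<in>?Y. (cmod (\<Sum>x\<in>?X. W y x * \<xi> x))\<^sup>2) \<le> (\<Sum>x\<in>?X. (cmod (\<xi> x))\<^sup>2)) \<and>
      (\<forall>a<N. \<forall>y\<in>?Y. (\<Sum>x\<in>?X. W y x * u a x) = v a y)" ..
  note W = W'[THEN conjunct1, rule_format] W'[THEN conjunct2, rule_format]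
  let ?A = "W (Inl 0) (Inl N)" and ?B = "\<lambda>i s. W (Inl 0) (Inr (i, s))"
    and ?C = "\<lambda>j t. W (Inr (j, t)) (Inl N)" and ?E = "\<lambda>j t i s. W (Inr (j, t)) (Inr (i, s))"
  have col: "colligation I J M ?A ?B ?C ?E"
  proof
    fix \<alpha> and \<beta> :: "nat \<Rightarrow> nat \<Rightarrow> complex"
    let ?\<xi> = "\<lambda>x. case x of Inl b \<Rightarrow> if b = N then \<alpha> else 0 | Inr (i, s) \<Rightarrow> \<beta> i s"
    show "(cmod (?A * \<alpha> + (\<Sum>i<I. \<Sum>s<M. ?B i s * \<beta> i s)))\<^sup>2 +
      (\<Sum>j<J. \<Sum>t<M. (cmod (?C j t * \<alpha> + (\<Sum>i<I. \<Sum>s<M. ?E j t i s * \<beta> i s)))\<^sup>2)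
      \<le> (cmod \<alpha>)\<^sup>2 + (\<Sum>i<I. \<Sum>s<M. (cmod (\<beta> i s))\<^sup>2)"
      using W(1)[of ?\<xi>] unfolding X Y by simp
  qed
  have "(cmod (f a - colligation.out_map I M ?A ?B \<alpha> (\<lambda>i s. \<Sum>j<J. \<delta> a i j * h j s)))\<^sup>2
      + (\<Sum>j<J. \<Sum>t<M. (cmod (g a j t - colligation.state_map I M ?C ?E \<alpha> (\<lambda>i s. \<Sum>j<J. \<delta> a i j * h j s) j t))\<^sup>2)
      \<le> (cmod (complex_of_real c - \<alpha>))\<^sup>2 + \<epsilon> + (\<Sum>i<I. \<Sum>s<M. (cmod (\<Sum>j<J. \<delta> a i j * (g a j s - h j s)))\<^sup>2)"
    if a: "a < N" for a \<alpha> h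
  proof -
    let ?\<beta> = "\<lambda>i s. \<Sum>j<J. \<delta> a i j * h j s"
    \<comment> \<open>The input actually fed in, with slack 0. It differs from \<open>u a\<close> by
      \<open>c - \<alpha>\<close>, the square root of \<epsilon>, and \<delta> applied to the
      difference of \<open>g\<close> and \<open>h\<close>; their squared norms make up the
      right-hand side.\<close>
    let ?\<zeta> = "\<lambda>x. case x of Inl b \<Rightarrow> if b = N then \<alpha> else 0 | Inr (i, s) \<Rightarrow> ?\<beta> i s"
    let ?\<xi> = "\<lambda>x. u a x - ?\<zeta> x"
    have 1: "(\<Sum>x\<in>?X. W y x * ?\<xi> x) = v a y - (W y (Inl N) * \<alpha> + (\<Sum>i<I. \<Sum>s<M. W y (Inr (i, s)) * ?\<beta> i s))"
      if "y \<in> ?Y" for y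
      unfolding right_diff_distrib sum_subtractf W(2)[OF a that] by (subst X) simp
    have 2: "(\<Sum>x\<in>?X. (cmod (?\<xi> x))\<^sup>2)
      = (cmod (complex_of_real c - \<alpha>))\<^sup>2 + \<epsilon> + (\<Sum>i<I. \<Sum>s<M. (cmod (\<Sum>j<J. \<delta> a i j * (g a j s - h j s)))\<^sup>2)"
    proof -
      have "(\<Sum>b<N. (cmod (?\<xi> (Inl b)))\<^sup>2) = (\<Sum>b<N. if b = a then \<epsilon> else 0)"
        using \<epsilon> by (intro sum.cong refl) (auto simp: u_def)
      then show ?thesis unfolding X using a by (simp add: u_def right_diff_distrib sum_subtractf)
    qed
    have "(\<Sum>y\<in>?Y. (cmod (v a y - (W y (Inl N) * \<alpha> + (\<Sum>i<I. \<Sum>s<M. W y (Inr (i, s)) * ?\<beta> i s))))\<^sup>2)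
      \<le> (cmod (complex_of_real c - \<alpha>))\<^sup>2 + \<epsilon> + (\<Sum>i<I. \<Sum>s<M. (cmod (\<Sum>j<J. \<delta> a i j * (g a j s - h j s)))\<^sup>2)"
      using W(1)[of ?\<xi>] unfolding 2 by (simp add: 1 cong: sum.cong)
    then show ?thesis unfolding Y colligation.out_map_def[OF col] colligation.state_map_def[OF col]
      by (simp add: v_def)
  qed
  with col show ?thesis by blast
qed

section \<open>Approximation by elements of a convex cone\<close>

definition re_ip :: "'x set \<Rightarrow> ('x \<Rightarrow> complex) \<Rightarrow> ('x \<Rightarrow> complex) \<Rightarrow> real" where
  "re_ip X x y = Re (\<Sum>k\<in>X. x k * cnj (y k))"

definition norm_sq :: "'x set \<Rightarrow> ('x \<Rightarrow> complex) \<Rightarrow> real" where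
  "norm_sq X x = (\<Sum>k\<in>X. (cmod (x k))\<^sup>2)"

lemma norm_sq_nonneg [simp]: "0 \<le> norm_sq X x"
  by (simp add: norm_sq_def sum_nonneg)

lemma norm_sq_diff_scale:
  "norm_sq X (\<lambda>k. x k - of_real s * y k) = norm_sq X x - 2 * s * re_ip X x y + s\<^sup>2 * norm_sq X y"
proof -
  have "(cmod (x k - of_real s * y k))\<^sup>2 = (cmod (x k))\<^sup>2 - 2 * s * Re (x k * cnj (y k)) + s\<^sup>2 * (cmod (y k))\<^sup>2" for k
    unfolding cmod_power2 by (simp add: power2_eq_square algebra_simps)
  then show ?thesis
    unfolding norm_sq_def re_ip_def Re_sum sum_distrib_left sum_subtractf[symmetric] sum.distrib[symmetric]
    by (intro sum.cong refl)
qed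

lemma re_ip_commute: "re_ip X x y = re_ip X y x"
  by (simp add: re_ip_def mult.commute)

lemma re_ip_add: "re_ip X x (\<lambda>k. y k + z k) = re_ip X x y + re_ip X x z"
  and re_ip_diff: "re_ip X x (\<lambda>k. y k - z k) = re_ip X x y - re_ip X x z"
  and re_ip_scale: "re_ip X x (\<lambda>k. of_real s * y k) = s * re_ip X x y"
  by (simp_all add: re_ip_def sum.distrib sum_subtractf distrib_left right_diff_distrib sum_distrib_left algebra_simps)

lemma re_ip_sum: "re_ip X x (\<lambda>k. \<Sum>s\<in>S. y s k) = (\<Sum>s\<in>S. re_ip X x (y s))"
proof -
  have "(\<Sum>k\<in>X. x k * cnj (\<Sum>s\<in>S. y s k)) = (\<Sum>s\<in>S. \<Sum>k\<in>X. x k * cnj (y s k))"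
    unfolding cnj_sum sum_distrib_left by (rule sum.swap)
  then show ?thesis by (simp add: re_ip_def)
qed

lemma re_ip_self: "re_ip X x x = norm_sq X x"
  by (simp add: re_ip_def norm_sq_def sum_mult_cnj)

lemma norm_sum_mult_le:
  fixes x y :: "'x \<Rightarrow> complex"
  shows "cmod (\<Sum>k\<in>X. x k * cnj (y k)) \<le> sqrt (norm_sq X x) * sqrt (norm_sq X y)"
proof -
  have "cmod (\<Sum>k\<in>X. x k * cnj (y k)) \<le> (\<Sum>k\<in>X. \<bar>cmod (x k)\<bar> * \<bar>cmod (y k)\<bar>)"
    by (rule sum_norm_le) (simp add: norm_mult)
  also have "\<dots> \<le> L2_set (\<lambda>k. cmod (x k)) X * L2_set (\<lambda>k. cmod (y k)) X" by (rule L2_set_mult_ineq)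
  finally show ?thesis by (simp add: L2_set_def norm_sq_def)
qed

lemma re_ip_bound:
  assumes "norm_sq X x \<le> p\<^sup>2" "norm_sq X y \<le> q\<^sup>2" "0 \<le> p" "0 \<le> q"
  shows "\<bar>re_ip X x y\<bar> \<le> p * q"
proof -
  have "\<bar>re_ip X x y\<bar> \<le> cmod (\<Sum>k\<in>X. x k * cnj (y k))" unfolding re_ip_def by (rule abs_Re_le_cmod)
  also have "\<dots> \<le> sqrt (norm_sq X x) * sqrt (norm_sq X y)" by (rule norm_sum_mult_le)
  also have "\<dots> \<le> p * q" using assms by (intro mult_mono real_le_lsqrt) auto
  finally show ?thesis .
qed

text \<open>A point \<open>h\<close> of the cone whose distance to \<open>t\<close> is almost minimal yields the separating functional
  \<open>e = t - h\<close>; no closedness of the cone is needed, at the price of errors of size \<open>\<eta>\<close>.\<close>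

lemma cone_separation:
  fixes t :: "'x \<Rightarrow> complex"
  assumes add: "\<And>h h'. h \<in> \<C> \<Longrightarrow> h' \<in> \<C> \<Longrightarrow> (\<lambda>k. h k + h' k) \<in> \<C>"
    and scale: "\<And>h s. h \<in> \<C> \<Longrightarrow> 0 \<le> s \<Longrightarrow> (\<lambda>k. of_real s * h k) \<in> \<C>" and ne: "\<C> \<noteq> {}"
    and d: "\<And>h. h \<in> \<C> \<Longrightarrow> d \<le> norm_sq X (\<lambda>k. t k - h k)"
  shows "\<exists>H>0. \<forall>\<eta>. 0 < \<eta> \<and> \<eta> \<le> 1 \<longrightarrow> (\<exists>e. norm_sq X e \<le> H \<and>
    (\<forall>h\<in>\<C>. \<forall>q\<ge>0. norm_sq X h \<le> q\<^sup>2 \<longrightarrow> re_ip X e h \<le> \<eta> * q) \<and> d - \<eta> * H \<le> re_ip X e t)"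
proof -
  \<comment> \<open>Bounds the squared norm of a nearly optimal \<open>h\<close>: it is at most
    2|t|^2 + 2|e|^2, and |e|^2 is at most m + 1, hence at most |t|^2 + 1.\<close>
  define Q where "Q = 4 * norm_sq X t + 2"
  have Q: "Q \<ge> 2" by (simp add: Q_def)
  define \<N> where "\<N> = (\<lambda>h. norm_sq X (\<lambda>k. t k - h k)) ` \<C>"
  define m where "m = Inf \<N>"
  have N0: "\<N> \<noteq> {}" using ne by (simp add: \<N>_def)
  have m_le: "m \<le> norm_sq X (\<lambda>k. t k - h k)" if "h \<in> \<C>" for h
    unfolding m_def by (rule cInf_lower) (use that in \<open>auto simp: \<N>_def intro: bdd_belowI[of _ 0]\<close>)
  have dm: "d \<le> m" unfolding m_def by (rule cInf_greatest[OF N0]) (use d in \<open>auto simp: \<N>_def\<close>)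
  obtain h0 where "h0 \<in> \<C>" using ne by blast
  from scale[OF this, of 0] have "(\<lambda>k. 0) \<in> \<C>" by simp
  from m_le[OF this] have mt: "m \<le> norm_sq X t" by simp
  have "\<exists>e. norm_sq X e \<le> Q + 1 \<and>
    (\<forall>h\<in>\<C>. \<forall>q\<ge>0. norm_sq X h \<le> q\<^sup>2 \<longrightarrow> re_ip X e h \<le> \<eta> * q) \<and> d - \<eta> * (Q + 1) \<le> re_ip X e t"
    if \<eta>: "0 < \<eta>" "\<eta> \<le> 1" for \<eta>
  proof -
    have "m < m + \<eta>\<^sup>2" using \<eta> by simp
    then obtain n where "n \<in> \<N>" "n < m + \<eta>\<^sup>2" using cInf_lessD[OF N0] unfolding m_def by blast
    then obtain h where h: "h \<in> \<C>" "norm_sq X (\<lambda>k. t k - h k) < m + \<eta>\<^sup>2" by (auto simp: \<N>_def)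
    define e where "e k = t k - h k" for k
    have e: "norm_sq X e < m + \<eta>\<^sup>2" using h(2) by (simp add: e_def[abs_def])
    have \<eta>2: "\<eta>\<^sup>2 \<le> 1" using \<eta> by (simp add: power_le_one)
    \<comment> \<open>Moving from \<open>h\<close> in the direction of a cone element cannot lower
      the squared distance by more than \<eta>^2; expanded in \<open>s\<close>, this bounds the
      pairing with that element from above.\<close>
    have A: "2 * s * re_ip X e g \<le> \<eta>\<^sup>2 + s\<^sup>2 * norm_sq X g" if g: "g \<in> \<C>" and s: "0 \<le> s" for g s
    proof -
      have "m \<le> norm_sq X (\<lambda>k. t k - (h k + of_real s * g k))" by (intro m_le add h(1) scale g s)
      also have "\<dots> = norm_sq X (\<lambda>k. e k - of_real s * g k)" by (simp add: e_def diff_diff_eq)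
      finally show ?thesis using e unfolding norm_sq_diff_scale by linarith
    qed
    \<comment> \<open>Shrinking \<open>h\<close> towards the apex stays in the cone as well; this
      bounds the pairing with \<open>h\<close> itself from below.\<close>
    have B: "- 2 * s * re_ip X e h \<le> \<eta>\<^sup>2 + s\<^sup>2 * norm_sq X h" if s: "0 \<le> s" "s \<le> 1" for s
    proof -
      have "m \<le> norm_sq X (\<lambda>k. t k - of_real (1 - s) * h k)" by (intro m_le scale h(1)) (use s in simp)
      also have "\<dots> = norm_sq X (\<lambda>k. e k - of_real (- s) * h k)" by (simp add: e_def algebra_simps)
      finally show ?thesis using e unfolding norm_sq_diff_scale by simp
    qed
    have hQ: "norm_sq X h \<le> Q"
    proof -
      have "norm_sq X h = norm_sq X (\<lambda>k. t k - of_real 1 * e k)" by (simp add: e_def)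
      also have "\<dots> = norm_sq X t - 2 * re_ip X t e + norm_sq X e" unfolding norm_sq_diff_scale by simp
      finally have 1: "norm_sq X h = norm_sq X t - 2 * re_ip X t e + norm_sq X e" .
      have "0 \<le> norm_sq X (\<lambda>k. t k - of_real (- 1) * e k)" by simp
      then have "- 2 * re_ip X t e \<le> norm_sq X t + norm_sq X e" unfolding norm_sq_diff_scale by simp
      with 1 e mt \<eta>2 show ?thesis unfolding Q_def by linarith
    qed
    have 1: "norm_sq X e \<le> Q + 1" using e mt \<eta>2 norm_sq_nonneg[of X t] unfolding Q_def by linarith
    have 2: "re_ip X e g \<le> \<eta> * q" if g: "g \<in> \<C>" and q: "0 \<le> q" "norm_sq X g \<le> q\<^sup>2" for g q
    proof (cases "q = 0")
      case True
      then have "\<bar>re_ip X e g\<bar> \<le> sqrt (norm_sq X e) * 0" using q by (intro re_ip_bound) auto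
      then show ?thesis using True by simp
    next
      case False
      then have q0: "q > 0" using q by simp
      \<comment> \<open>The choice s = \<eta> / q balances the two error terms.\<close>
      have "2 * (\<eta> / q) * re_ip X e g \<le> \<eta>\<^sup>2 + (\<eta> / q)\<^sup>2 * norm_sq X g" by (rule A[OF g]) (use \<eta> q0 in simp)
      also have "\<dots> \<le> \<eta>\<^sup>2 + (\<eta> / q)\<^sup>2 * q\<^sup>2" by (intro add_left_mono mult_left_mono q) simp
      also have "\<dots> = 2 * \<eta>\<^sup>2" using q0 by (simp add: power_divide)
      finally have "(2 * \<eta> / q) * re_ip X e g \<le> (2 * \<eta> / q) * (\<eta> * q)" using q0 by (simp add: power2_eq_square)
      then show ?thesis by (rule mult_left_le_imp_le) (use \<eta> q0 in simp)
    qed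
    have 3: "d - \<eta> * (Q + 1) \<le> re_ip X e t"
    proof -
      let ?s = "\<eta> / (Q + 1)"
      have s: "0 \<le> ?s" "?s \<le> 1" using \<eta> Q by auto
      have "- 2 * ?s * re_ip X e h \<le> \<eta>\<^sup>2 + ?s\<^sup>2 * norm_sq X h" by (rule B[OF s])
      also have "\<dots> \<le> \<eta>\<^sup>2 + ?s\<^sup>2 * (Q + 1)\<^sup>2"
      proof (intro add_left_mono mult_left_mono)
        have "Q + 1 \<le> (Q + 1)\<^sup>2" using Q by (simp add: power2_eq_square)
        with hQ show "norm_sq X h \<le> (Q + 1)\<^sup>2" by linarith
      qed simp
      also have "\<dots> = 2 * \<eta>\<^sup>2" using Q by (simp add: power_divide)
      finally have "(2 * ?s) * - re_ip X e h \<le> (2 * ?s) * (\<eta> * (Q + 1))" using Q by (simp add: power2_eq_square)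
      then have "- re_ip X e h \<le> \<eta> * (Q + 1)" by (rule mult_left_le_imp_le) (use \<eta> Q in simp)
      moreover have "re_ip X e t = norm_sq X e + re_ip X e h"
        using re_ip_add[of X e e h] by (simp add: re_ip_self e_def)
      moreover have "m \<le> norm_sq X e" using m_le[OF h(1)] by (simp add: e_def[abs_def])
      ultimately show ?thesis using dm by linarith
    qed
    from 1 2 3 show ?thesis by (intro exI[of _ e]) simp
  qed
  then show ?thesis using Q by (intro exI[of _ "Q + 1"]) simp
qed

section \<open>Positive kernels\<close>

definition qform :: "nat \<Rightarrow> (nat \<Rightarrow> nat \<Rightarrow> complex) \<Rightarrow> (nat \<Rightarrow> complex) \<Rightarrow> real" where
  "qform N K \<gamma> = Re (\<Sum>a<N. \<Sum>b<N. K a b * \<gamma> a * cnj (\<gamma> b))"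

definition rank_one :: "(nat \<Rightarrow> complex) \<Rightarrow> nat \<times> nat \<Rightarrow> complex" where
  "rank_one \<gamma> = (\<lambda>(a, b). \<gamma> a * cnj (\<gamma> b))"

lemma re_ip_rank_one:
  "re_ip ({..<N} \<times> {..<N}) (rank_one x) (rank_one (\<lambda>a. cnj (\<gamma> a))) = (cmod (\<Sum>a<N. \<gamma> a * x a))\<^sup>2"
proof -
  let ?z = "\<Sum>a<N. \<gamma> a * x a"
  have "(\<Sum>k\<in>{..<N} \<times> {..<N}. rank_one x k * cnj (rank_one (\<lambda>a. cnj (\<gamma> a)) k)) = (\<Sum>a<N. \<Sum>b<N. (\<gamma> a * x a) * cnj (\<gamma> b * x b))"
    unfolding sum.cartesian_product by (intro sum.cong refl) (auto simp: rank_one_def)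
  also have "\<dots> = ?z * cnj ?z" unfolding cnj_sum sum_product ..
  also have "\<dots> = of_real ((cmod ?z)\<^sup>2)" by (rule complex_norm_square[symmetric])
  finally show ?thesis unfolding re_ip_def by simp
qed

lemma norm_sq_rank_one: "norm_sq ({..<N} \<times> {..<N}) (rank_one x) = (norm_sq {..<N} x)\<^sup>2"
proof -
  have "norm_sq ({..<N} \<times> {..<N}) (rank_one x) = (\<Sum>a<N. \<Sum>b<N. (cmod (x a))\<^sup>2 * (cmod (x b))\<^sup>2)"
    unfolding norm_sq_def sum.cartesian_product
    by (intro sum.cong refl) (auto simp: rank_one_def norm_mult power_mult_distrib)
  then show ?thesis by (simp add: norm_sq_def sum_product power2_eq_square)
qed

text \<open>The kernel \<open>K\<close> is minus the Hermitian part of the functional \<open>e\<close>, shifted by \<open>\<kappa>\<close> to become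
  positive definite.\<close>

lemma qform_functional:
  fixes \<kappa> :: real
  shows "qform N (\<lambda>a b. (if a = b then of_real \<kappa> else 0) - (cnj (e (a, b)) + e (b, a)) / 2) \<gamma>
    = \<kappa> * norm_sq {..<N} \<gamma> - re_ip ({..<N} \<times> {..<N}) e (rank_one \<gamma>)"
proof -
  let ?S = "\<Sum>a<N. \<Sum>b<N. e (a, b) * cnj (\<gamma> a) * \<gamma> b"
  have S: "re_ip ({..<N} \<times> {..<N}) e (rank_one \<gamma>) = Re ?S"
    unfolding re_ip_def sum.cartesian_product
    by (intro arg_cong[of _ _ Re] sum.cong refl) (auto simp: rank_one_def)
  have 1: "(\<Sum>a<N. \<Sum>b<N. cnj (e (a, b)) * \<gamma> a * cnj (\<gamma> b)) = cnj ?S" by (simp add: cnj_sum)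
  have 2: "(\<Sum>a<N. \<Sum>b<N. e (b, a) * \<gamma> a * cnj (\<gamma> b)) = ?S"
    by (subst sum.swap) (simp add: mult_ac)
  have 3: "(\<Sum>a<N. \<Sum>b<N. (if a = b then of_real \<kappa> else 0) * \<gamma> a * cnj (\<gamma> b)) = of_real (\<kappa> * norm_sq {..<N} \<gamma>)"
  proof -
    have "(\<Sum>a<N. \<Sum>b<N. (if a = b then of_real \<kappa> else 0) * \<gamma> a * cnj (\<gamma> b)) = (\<Sum>a<N. of_real \<kappa> * (\<gamma> a * cnj (\<gamma> a)))"
      by (intro sum.cong refl) (simp add: mult_delta_left mult.assoc)
    then show ?thesis unfolding sum_distrib_left[symmetric] sum_mult_cnj norm_sq_def by simp
  qed
  have 4: "(\<Sum>a<N. \<Sum>b<N. ((if a = b then of_real \<kappa> else 0) - (cnj (e (a, b)) + e (b, a)) / 2) * \<gamma> a * cnj (\<gamma> b))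
    = (\<Sum>a<N. \<Sum>b<N. (if a = b then of_real \<kappa> else 0) * \<gamma> a * cnj (\<gamma> b))
      - ((\<Sum>a<N. \<Sum>b<N. cnj (e (a, b)) * \<gamma> a * cnj (\<gamma> b)) + (\<Sum>a<N. \<Sum>b<N. e (b, a) * \<gamma> a * cnj (\<gamma> b))) / 2"
    unfolding sum.distrib[symmetric] sum_divide_distrib sum_subtractf[symmetric]
    by (intro sum.cong refl) (simp add: field_simps)
  have "Re (of_real u - (cnj z + z) / 2) = u - Re z" for u z by simp
  then show ?thesis unfolding qform_def S 4 1 2 3 .
qed

text \<open>Sums of the kernels \<open>gen p g\<close> form a convex cone. If it stayed at distance
  \<epsilon> from \<open>t\<close>, a separating functional would turn into a positive definite
  \<open>K\<close> for which \<delta> is strictly contractive, and \<open>pos\<close> would bound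
  the pairing of the functional with \<open>t\<close> by a quantity too small for
  separation.\<close>

lemma schur_kernel_approximation:
  fixes f :: "nat \<Rightarrow> complex" and \<delta> :: "nat \<Rightarrow> nat \<Rightarrow> nat \<Rightarrow> complex" and c \<epsilon> \<rho> :: real
  assumes \<rho>: "0 \<le> \<rho>" "\<rho> < 1" and \<epsilon>: "0 < \<epsilon>"
    and bb: "\<And>a \<zeta>. a < N \<Longrightarrow> (\<Sum>i<I. (cmod (\<Sum>j<J. \<delta> a i j * \<zeta> j))\<^sup>2) \<le> \<rho>\<^sup>2 * (\<Sum>j<J. (cmod (\<zeta> j))\<^sup>2)"
    and pos: "\<And>K r. (\<And>a b. K b a = cnj (K a b)) \<Longrightarrow> (\<And>\<gamma> a. a < N \<Longrightarrow> \<gamma> a \<noteq> 0 \<Longrightarrow> 0 < qform N K \<gamma>) \<Longrightarrow>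
      0 \<le> r \<Longrightarrow> r < 1 \<Longrightarrow>
      (\<And>\<xi>. (\<Sum>i<I. qform N K (\<lambda>a. \<Sum>j<J. \<delta> a i j * \<xi> j a)) \<le> r\<^sup>2 * (\<Sum>j<J. qform N K (\<xi> j))) \<Longrightarrow>
      qform N K f \<le> c\<^sup>2 * qform N K (\<lambda>_. 1)"
  shows "\<exists>(M :: nat) g. \<forall>\<gamma>. (cmod (\<Sum>a<N. \<gamma> a * f a))\<^sup>2 + (\<Sum>j<J. \<Sum>s<M. (cmod (\<Sum>a<N. \<gamma> a * g a j s))\<^sup>2)
    \<le> c\<^sup>2 * (cmod (\<Sum>a<N. \<gamma> a))\<^sup>2 + (\<Sum>i<I. \<Sum>s<M. (cmod (\<Sum>a<N. \<gamma> a * (\<Sum>j<J. \<delta> a i j * g a j s)))\<^sup>2)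
      + \<epsilon> * (\<Sum>a<N. (cmod (\<gamma> a))\<^sup>2)"
proof -
  let ?P = "{..<N} \<times> {..<N}" and ?Y = "norm_sq {..<N}"
  define dg where "dg g i a = (\<Sum>j<J. \<delta> a i j * g j a)" for g :: "nat \<Rightarrow> nat \<Rightarrow> complex" and i a
  define gen where "gen p g k = rank_one p k + (\<Sum>j<J. rank_one (g j) k) - (\<Sum>i<I. rank_one (dg g i) k)"
    for p :: "nat \<Rightarrow> complex" and g k
  define \<C> where "\<C> = {h. \<exists>M p g. h = (\<lambda>k. \<Sum>s<(M::nat). gen (p s) (g s) k)}"
  have CM: "h \<in> \<C>" if "h = (\<lambda>k. \<Sum>s<M. gen (p s) (g s) k)" for h p g and M :: nat
    unfolding \<C>_def mem_Collect_eq by (intro exI) (rule that)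
  define t where "t k = of_real (c\<^sup>2) * rank_one (\<lambda>_. 1) k - rank_one f k" for k
  have ip_gen: "re_ip ?P x (gen p g) = re_ip ?P x (rank_one p) + (\<Sum>j<J. re_ip ?P x (rank_one (g j)))
    - (\<Sum>i<I. re_ip ?P x (rank_one (dg g i)))" for x p g
    unfolding gen_def[abs_def] re_ip_diff re_ip_add re_ip_sum ..
  have ip_t: "re_ip ?P x t = c\<^sup>2 * re_ip ?P x (rank_one (\<lambda>_. 1)) - re_ip ?P x (rank_one f)" for x
    unfolding t_def[abs_def] re_ip_diff re_ip_scale ..
  have CI: "gen p g \<in> \<C>" for p g
    by (rule CM[where M = 1 and p = "\<lambda>_. p" and g = "\<lambda>_. g"]) simp
  have C_add: "(\<lambda>k. h k + h' k) \<in> \<C>" if hh: "h \<in> \<C>" "h' \<in> \<C>" for h h'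
  proof -
    from hh(1)[unfolded \<C>_def mem_Collect_eq] obtain M :: nat and p g where h: "h = (\<lambda>k. \<Sum>s<M. gen (p s) (g s) k)" by (elim exE)
    from hh(2)[unfolded \<C>_def mem_Collect_eq] obtain M' :: nat and p' g' where h': "h' = (\<lambda>k. \<Sum>s<M'. gen (p' s) (g' s) k)" by (elim exE)
    have "(\<lambda>k. h k + h' k) = (\<lambda>k. \<Sum>s<M + M'. gen (if s < M then p s else p' (s - M)) (if s < M then g s else g' (s - M)) k)"
      unfolding h h' sum_lessThan_add by simp
    then show ?thesis by (rule CM)
  qed
  have C_scale: "(\<lambda>k. of_real s * h k) \<in> \<C>" if hh: "h \<in> \<C>" and s: "0 \<le> s" for h s
  proof -
    from hh[unfolded \<C>_def mem_Collect_eq] obtain M :: nat and p g where h: "h = (\<lambda>k. \<Sum>m<M. gen (p m) (g m) k)" by (elim exE)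
    \<comment> \<open>Generators are quadratic in \<open>p\<close> and \<open>g\<close>, so scaling
      by \<open>s\<close> means scaling these data by its square root.\<close>
    let ?q = "complex_of_real (sqrt s)"
    have q: "?q * cnj ?q = of_real s" using s by (simp flip: of_real_mult)
    have r: "rank_one (\<lambda>a. ?q * x a) k = of_real s * rank_one x k" for x k
      unfolding q[symmetric] by (simp add: rank_one_def case_prod_beta mult_ac)
    have "dg (\<lambda>j a. ?q * g j a) i = (\<lambda>a. ?q * dg g i a)" for g i
      by (intro ext) (simp add: dg_def sum_distrib_left mult_ac)
    then have "gen (\<lambda>a. ?q * p m a) (\<lambda>j a. ?q * g m j a) k = of_real s * gen (p m) (g m) k" for m k
      unfolding gen_def by (simp only: r sum_distrib_left right_diff_distrib distrib_left)
    then have "(\<lambda>k. of_real s * h k) = (\<lambda>k. \<Sum>m<M. gen (\<lambda>a. ?q * p m a) (\<lambda>j a. ?q * g m j a) k)"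
      unfolding h by (simp only: sum_distrib_left)
    then show ?thesis by (rule CM)
  qed
  have "\<exists>h\<in>\<C>. norm_sq ?P (\<lambda>k. t k - h k) < \<epsilon>\<^sup>2"
  proof (rule ccontr)
    assume "\<not> (\<exists>h\<in>\<C>. norm_sq ?P (\<lambda>k. t k - h k) < \<epsilon>\<^sup>2)"
    then have d: "\<epsilon>\<^sup>2 \<le> norm_sq ?P (\<lambda>k. t k - h k)" if "h \<in> \<C>" for h
      using that by (intro leI notI) blast
    have ne: "\<C> \<noteq> {}" using CI by blast
    have "\<exists>H>0. \<forall>\<eta>. 0 < \<eta> \<and> \<eta> \<le> 1 \<longrightarrow> (\<exists>e. norm_sq ?P e \<le> H \<and>
        (\<forall>h\<in>\<C>. \<forall>q\<ge>0. norm_sq ?P h \<le> q\<^sup>2 \<longrightarrow> re_ip ?P e h \<le> \<eta> * q) \<and> \<epsilon>\<^sup>2 - \<eta> * H \<le> re_ip ?P e t)"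
      by (rule cone_separation[OF _ _ ne]) (erule (1) C_add, erule (1) C_scale, erule d)
    then obtain H where H: "H > 0" and
      H2: "\<forall>\<eta>. 0 < \<eta> \<and> \<eta> \<le> 1 \<longrightarrow> (\<exists>e. norm_sq ?P e \<le> H \<and>
        (\<forall>h\<in>\<C>. \<forall>q\<ge>0. norm_sq ?P h \<le> q\<^sup>2 \<longrightarrow> re_ip ?P e h \<le> \<eta> * q) \<and> \<epsilon>\<^sup>2 - \<eta> * H \<le> re_ip ?P e t)"
      by (elim exE conjE)
    have \<rho>2: "0 < 1 - \<rho>\<^sup>2" "\<rho>\<^sup>2 \<le> 1" using \<rho> by (auto simp: abs_square_less_1 power_le_one)
    \<comment> \<open>Every error in the final estimate is a multiple of \<eta>: \<open>H\<close>
      comes from the separation and the second summand from the shift \<kappa>. Then \<eta> is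
      chosen to make the total smaller than \<epsilon>^2.\<close>
    define Z where "Z = H + 4 * c\<^sup>2 * real N / (1 - \<rho>\<^sup>2)"
    have Z: "Z > 0" unfolding Z_def using H \<rho>2 by (intro add_pos_nonneg) auto
    define \<eta> where "\<eta> = min 1 (\<epsilon>\<^sup>2 / (2 * (Z + 1)))"
    have \<eta>: "0 < \<eta>" "\<eta> \<le> 1" "\<eta> * Z < \<epsilon>\<^sup>2"
    proof -
      show "0 < \<eta>" "\<eta> \<le> 1" using \<epsilon> Z by (auto simp: \<eta>_def)
      have "\<eta> * Z \<le> \<epsilon>\<^sup>2 / (2 * (Z + 1)) * Z" using Z by (intro mult_right_mono) (auto simp: \<eta>_def)
      also have "\<dots> < \<epsilon>\<^sup>2" using Z \<epsilon> by (simp add: field_simps) (use Z \<epsilon> in \<open>auto intro: add_pos_pos mult_pos_pos\<close>)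
      finally show "\<eta> * Z < \<epsilon>\<^sup>2" .
    qed
    from H2[rule_format, OF conjI[OF \<eta>(1,2)]] obtain e where e1: "norm_sq ?P e \<le> H"
      and e2: "\<forall>h\<in>\<C>. \<forall>q\<ge>0. norm_sq ?P h \<le> q\<^sup>2 \<longrightarrow> re_ip ?P e h \<le> \<eta> * q"
      and e3: "\<epsilon>\<^sup>2 - \<eta> * H \<le> re_ip ?P e t" by (elim exE conjE)
    note e = e1 e2[rule_format] e3
    let ?E = "\<lambda>\<gamma>. re_ip ?P e (rank_one \<gamma>)"
    \<comment> \<open>The strict contraction by \<rho> turns the shift into a gain of \<kappa> (1 -
      \<rho>^2) = 4 \<eta>. Half of it pays for the error in \<open>E3\<close>, and the remaining 2
      \<eta> leaves room for a radius \<open>r < 1\<close>. Being at least 4 \<eta>, the shift also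
      outweighs the loss in \<open>E1\<close>.\<close>
    define \<kappa> where "\<kappa> = 4 * \<eta> / (1 - \<rho>\<^sup>2)"
    have \<kappa>: "\<kappa> * (1 - \<rho>\<^sup>2) = 4 * \<eta>" "4 * \<eta> \<le> \<kappa>"
      using \<rho>2 \<eta> by (auto simp: \<kappa>_def field_simps)
    define K where "K a b = (if a = b then of_real \<kappa> else 0) - (cnj (e (a, b)) + e (b, a)) / 2" for a b
    have qK: "qform N K \<gamma> = \<kappa> * ?Y \<gamma> - ?E \<gamma>" for \<gamma>
      unfolding K_def[abs_def] by (rule qform_functional)
    have E1: "?E \<gamma> \<le> \<eta> * ?Y \<gamma>" for \<gamma>
    proof (rule e(2))
      have "gen \<gamma> (\<lambda>_ _. 0) = rank_one \<gamma>" by (rule ext) (simp add: gen_def dg_def rank_one_def case_prod_beta)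
      then show "rank_one \<gamma> \<in> \<C>" using CI[of \<gamma> "\<lambda>_ _. 0"] by simp
    qed (simp_all add: norm_sq_rank_one)
    have E2: "- ?E \<gamma> \<le> (1 + H) * ?Y \<gamma>" for \<gamma>
    proof -
      have "H \<le> (1 + H)\<^sup>2" using H by (simp add: power2_eq_square algebra_simps)
      then have "\<bar>?E \<gamma>\<bar> \<le> (1 + H) * ?Y \<gamma>" using e(1) H
        by (intro re_ip_bound) (simp_all add: norm_sq_rank_one)
      then show ?thesis by linarith
    qed
    have dgY: "(\<Sum>i<I. ?Y (dg \<xi> i)) \<le> \<rho>\<^sup>2 * (\<Sum>j<J. ?Y (\<xi> j))" for \<xi>
    proof -
      have "(\<Sum>i<I. ?Y (dg \<xi> i)) = (\<Sum>a<N. \<Sum>i<I. (cmod (\<Sum>j<J. \<delta> a i j * \<xi> j a))\<^sup>2)"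
        unfolding norm_sq_def dg_def by (rule sum.swap)
      also have "\<dots> \<le> (\<Sum>a<N. \<rho>\<^sup>2 * (\<Sum>j<J. (cmod (\<xi> j a))\<^sup>2))" by (intro sum_mono bb) simp
      also have "\<dots> = \<rho>\<^sup>2 * (\<Sum>j<J. ?Y (\<xi> j))"
        unfolding norm_sq_def sum_distrib_left by (rule sum.swap)
      finally show ?thesis .
    qed
    have E3: "(\<Sum>j<J. ?E (\<xi> j)) - (\<Sum>i<I. ?E (dg \<xi> i)) \<le> 2 * \<eta> * (\<Sum>j<J. ?Y (\<xi> j))" for \<xi>
    proof -
      define n where "n a = norm_sq {..<J} (\<lambda>j. \<xi> j a)" for a
      have n: "0 \<le> n a" for a by (simp add: n_def)
      have sn: "(\<Sum>a<N. n a) = (\<Sum>j<J. ?Y (\<xi> j))" unfolding n_def norm_sq_def by (rule sum.swap)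
      have dn: "norm_sq {..<I} (\<lambda>i. dg \<xi> i a) \<le> n a" if "a < N" for a
      proof -
        have "norm_sq {..<I} (\<lambda>i. dg \<xi> i a) \<le> \<rho>\<^sup>2 * n a" unfolding norm_sq_def dg_def n_def by (rule bb[OF that])
        also have "\<dots> \<le> 1 * n a" by (intro mult_right_mono n \<rho>2)
        finally show ?thesis by simp
      qed
      have z: "rank_one (\<lambda>_. 0) k = 0" for k by (simp add: rank_one_def case_prod_beta)
      \<comment> \<open>Cauchy-Schwarz for the two inner products; the bound for the second is no
        larger because \<delta> is contractive at each point.\<close>
      have gb: "cmod (gen (\<lambda>_. 0) \<xi> (a, b)) \<le> 2 * (sqrt (n a) * sqrt (n b))" if ab: "a < N" "b < N" for a b
      proof -
        have "cmod (\<Sum>j<J. \<xi> j a * cnj (\<xi> j b)) \<le> sqrt (n a) * sqrt (n b)"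
          unfolding n_def by (rule norm_sum_mult_le)
        moreover have "cmod (\<Sum>i<I. dg \<xi> i a * cnj (dg \<xi> i b)) \<le> sqrt (n a) * sqrt (n b)"
          by (rule order_trans[OF norm_sum_mult_le]) (use dn ab n in \<open>intro mult_mono real_sqrt_le_mono; simp\<close>)
        moreover have "gen (\<lambda>_. 0) \<xi> (a, b) = (\<Sum>j<J. \<xi> j a * cnj (\<xi> j b)) - (\<Sum>i<I. dg \<xi> i a * cnj (dg \<xi> i b))"
          by (simp add: gen_def z) (simp add: rank_one_def)
        ultimately show ?thesis
          using norm_triangle_ineq4[of "\<Sum>j<J. \<xi> j a * cnj (\<xi> j b)" "\<Sum>i<I. dg \<xi> i a * cnj (dg \<xi> i b)"] by simp
      qed
      have "norm_sq ?P (gen (\<lambda>_. 0) \<xi>) \<le> (\<Sum>(a, b)\<in>?P. 4 * (n a * n b))"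
        unfolding norm_sq_def
      proof (rule sum_mono)
        fix k assume k: "k \<in> ?P"
        obtain a b where ab: "k = (a, b)" by (cases k)
        have "(cmod (gen (\<lambda>_. 0) \<xi> (a, b)))\<^sup>2 \<le> (2 * (sqrt (n a) * sqrt (n b)))\<^sup>2"
          by (intro power_mono gb) (use k ab in auto)
        also have "\<dots> = 4 * (n a * n b)" using n by (simp add: power_mult_distrib)
        finally show "(cmod (gen (\<lambda>_. 0) \<xi> k))\<^sup>2 \<le> (case k of (a, b) \<Rightarrow> 4 * (n a * n b))" by (simp add: ab)
      qed
      also have "\<dots> = (2 * (\<Sum>j<J. ?Y (\<xi> j)))\<^sup>2"
        unfolding sum.cartesian_product[symmetric] sn[symmetric]
        by (simp add: sum_distrib_left[symmetric] sum_distrib_right[symmetric] power2_eq_square)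
      finally have "re_ip ?P e (gen (\<lambda>_. 0) \<xi>) \<le> \<eta> * (2 * (\<Sum>j<J. ?Y (\<xi> j)))"
        by (intro e(2) CI) (simp_all add: sum_nonneg)
      moreover have "?E (\<lambda>_. 0) = 0" by (simp add: re_ip_def z)
      ultimately show ?thesis unfolding ip_gen by simp
    qed
    define Q where "Q = \<kappa> + 1 + H"
    have Q: "Q > 0" using \<kappa> \<eta> H by (simp add: Q_def)
    \<comment> \<open>The form of \<open>K\<close> is at most \<open>Q\<close> times the squared
      norm, so the surplus of 2 \<eta> times the squared norm is a definite fraction of it; adding 2
      \<eta> in the denominator keeps the radicand nonnegative.\<close>
    define r where "r = sqrt (1 - 2 * \<eta> / (Q + 2 * \<eta>))"
    have q1: "2 * \<eta> / (Q + 2 * \<eta>) \<le> 1" "0 < 2 * \<eta> / (Q + 2 * \<eta>)" using Q \<eta> by auto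
    have r: "0 \<le> r" "r < 1" "r\<^sup>2 = 1 - 2 * \<eta> / (Q + 2 * \<eta>)" using q1 by (auto simp: r_def real_sqrt_lt_1_iff)
    have rQ: "(1 - r\<^sup>2) * Q \<le> 2 * \<eta>" unfolding r(3) using Q \<eta> by (simp add: field_simps)
    have "qform N K f \<le> c\<^sup>2 * qform N K (\<lambda>_. 1)"
    proof (rule pos[OF _ _ r(1,2)])
      show "K b a = cnj (K a b)" for a b by (simp add: K_def add.commute)
      fix \<gamma> :: "nat \<Rightarrow> complex" and a assume a: "a < N" "\<gamma> a \<noteq> 0"
      have "(cmod (\<gamma> a))\<^sup>2 \<le> ?Y \<gamma>" unfolding norm_sq_def
        by (rule member_le_sum[of a "{..<N}" "\<lambda>a. (cmod (\<gamma> a))\<^sup>2"]) (use a in auto)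
      moreover have "0 < (cmod (\<gamma> a))\<^sup>2" using a by simp
      ultimately have "0 < ?Y \<gamma>" by linarith
      then have "0 < (\<kappa> - \<eta>) * ?Y \<gamma>" using \<kappa> \<eta> by (intro mult_pos_pos) auto
      then show "0 < qform N K \<gamma>" using E1[of \<gamma>] unfolding qK by (simp add: algebra_simps)
    next
      fix \<xi> :: "nat \<Rightarrow> nat \<Rightarrow> complex"
      let ?y = "\<Sum>j<J. ?Y (\<xi> j)"
      have y: "0 \<le> ?y" by (simp add: sum_nonneg)
      have "(\<Sum>i<I. qform N K (dg \<xi> i)) = \<kappa> * (\<Sum>i<I. ?Y (dg \<xi> i)) - (\<Sum>i<I. ?E (dg \<xi> i))"
        unfolding qK sum_subtractf sum_distrib_left ..
      also have "\<dots> \<le> \<kappa> * (\<rho>\<^sup>2 * ?y) + (2 * \<eta> * ?y - (\<Sum>j<J. ?E (\<xi> j)))"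
      proof -
        have "\<kappa> * (\<Sum>i<I. ?Y (dg \<xi> i)) \<le> \<kappa> * (\<rho>\<^sup>2 * ?y)" using \<kappa> \<eta> by (intro mult_left_mono dgY) simp
        with E3[of \<xi>] show ?thesis by linarith
      qed
      also have "\<dots> = \<kappa> * ?y - (\<Sum>j<J. ?E (\<xi> j)) - (\<kappa> * (1 - \<rho>\<^sup>2)) * ?y + 2 * \<eta> * ?y" by (simp add: algebra_simps)
      also have "\<dots> = \<kappa> * ?y - (\<Sum>j<J. ?E (\<xi> j)) - 2 * \<eta> * ?y" unfolding \<kappa>(1) by simp
      also have "\<kappa> * ?y - (\<Sum>j<J. ?E (\<xi> j)) = (\<Sum>j<J. qform N K (\<xi> j))"
        unfolding qK sum_subtractf sum_distrib_left ..
      also have "(\<Sum>j<J. qform N K (\<xi> j)) - 2 * \<eta> * ?y \<le> r\<^sup>2 * (\<Sum>j<J. qform N K (\<xi> j))"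
      proof -
        have "(\<Sum>j<J. qform N K (\<xi> j)) \<le> (\<Sum>j<J. Q * ?Y (\<xi> j))"
        proof (rule sum_mono)
          fix j show "qform N K (\<xi> j) \<le> Q * ?Y (\<xi> j)" using E2[of "\<xi> j"] unfolding qK Q_def by (simp add: algebra_simps)
        qed
        then have "(1 - r\<^sup>2) * (\<Sum>j<J. qform N K (\<xi> j)) \<le> (1 - r\<^sup>2) * (Q * ?y)"
          unfolding sum_distrib_left[symmetric] using r q1 by (intro mult_left_mono) auto
        also have "\<dots> \<le> 2 * \<eta> * ?y" unfolding mult.assoc[symmetric] by (intro mult_right_mono rQ y)
        finally show ?thesis by (simp add: algebra_simps)
      qed
      finally show "(\<Sum>i<I. qform N K (\<lambda>a. \<Sum>j<J. \<delta> a i j * \<xi> j a)) \<le> r\<^sup>2 * (\<Sum>j<J. qform N K (\<xi> j))"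
        unfolding dg_def .
    qed
    then have "re_ip ?P e t \<le> c\<^sup>2 * (\<kappa> * real N) - \<kappa> * ?Y f"
      unfolding qK ip_t by (simp add: norm_sq_def algebra_simps)
    moreover have "0 \<le> \<kappa> * ?Y f" using \<kappa> \<eta> by simp
    moreover have "c\<^sup>2 * (\<kappa> * real N) = \<eta> * (4 * c\<^sup>2 * real N / (1 - \<rho>\<^sup>2))" by (simp add: \<kappa>_def)
    ultimately have "\<epsilon>\<^sup>2 \<le> \<eta> * Z" using e(3) unfolding Z_def distrib_left by linarith
    with \<eta>(3) show False by simp
  qed
  then obtain h where h: "h \<in> \<C>" "norm_sq ?P (\<lambda>k. t k - h k) < \<epsilon>\<^sup>2" by blast
  from h(1)[unfolded \<C>_def mem_Collect_eq] obtain M :: nat and p g where hM: "h = (\<lambda>k. \<Sum>s<M. gen (p s) (g s) k)" by (elim exE)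
  show ?thesis
  proof (intro exI[of _ M] exI[of _ "\<lambda>a j s. g s j a"] allI)
    fix \<gamma> :: "nat \<Rightarrow> complex"
    \<comment> \<open>Pairing the approximation with this rank-one kernel evaluates all squares at
      \<gamma>; the error \<epsilon> gets multiplied by the norm of the kernel, which is the squared
      norm of \<gamma>.\<close>
    let ?y = "rank_one (\<lambda>a. cnj (\<gamma> a))"
    have ipy: "re_ip ?P ?y (rank_one x) = (cmod (\<Sum>a<N. \<gamma> a * x a))\<^sup>2" for x
      by (subst re_ip_commute) (rule re_ip_rank_one)
    have "\<bar>re_ip ?P ?y (\<lambda>k. t k - h k)\<bar> \<le> ?Y \<gamma> * \<epsilon>"
      using h(2) \<epsilon> by (intro re_ip_bound) (simp_all add: norm_sq_rank_one, simp add: norm_sq_def)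
    then have "- (\<epsilon> * ?Y \<gamma>) \<le> re_ip ?P ?y (\<lambda>k. t k - h k)" by (simp add: mult.commute)
    also have "\<dots> = c\<^sup>2 * (cmod (\<Sum>a<N. \<gamma> a))\<^sup>2 - (cmod (\<Sum>a<N. \<gamma> a * f a))\<^sup>2
      - (\<Sum>s<M. (cmod (\<Sum>a<N. \<gamma> a * p s a))\<^sup>2 + (\<Sum>j<J. (cmod (\<Sum>a<N. \<gamma> a * g s j a))\<^sup>2)
        - (\<Sum>i<I. (cmod (\<Sum>a<N. \<gamma> a * dg (g s) i a))\<^sup>2))"
      unfolding re_ip_diff ip_t hM re_ip_sum ip_gen ipy by simp
    also have "\<dots> \<le> c\<^sup>2 * (cmod (\<Sum>a<N. \<gamma> a))\<^sup>2 - (cmod (\<Sum>a<N. \<gamma> a * f a))\<^sup>2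
      - (\<Sum>s<M. (\<Sum>j<J. (cmod (\<Sum>a<N. \<gamma> a * g s j a))\<^sup>2) - (\<Sum>i<I. (cmod (\<Sum>a<N. \<gamma> a * dg (g s) i a))\<^sup>2))"
      by (intro diff_left_mono sum_mono) simp
    finally have "- (\<epsilon> * ?Y \<gamma>) \<le> c\<^sup>2 * (cmod (\<Sum>a<N. \<gamma> a))\<^sup>2 - (cmod (\<Sum>a<N. \<gamma> a * f a))\<^sup>2
      - ((\<Sum>s<M. \<Sum>j<J. (cmod (\<Sum>a<N. \<gamma> a * g s j a))\<^sup>2) - (\<Sum>s<M. \<Sum>i<I. (cmod (\<Sum>a<N. \<gamma> a * dg (g s) i a))\<^sup>2))"
      unfolding sum_subtractf .
    moreover have "(\<Sum>s<M. \<Sum>j<J. (cmod (\<Sum>a<N. \<gamma> a * g s j a))\<^sup>2) = (\<Sum>j<J. \<Sum>s<M. (cmod (\<Sum>a<N. \<gamma> a * g s j a))\<^sup>2)"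
      by (rule sum.swap)
    moreover have "(\<Sum>s<M. \<Sum>i<I. (cmod (\<Sum>a<N. \<gamma> a * dg (g s) i a))\<^sup>2) = (\<Sum>i<I. \<Sum>s<M. (cmod (\<Sum>a<N. \<gamma> a * dg (g s) i a))\<^sup>2)"
      by (rule sum.swap)
    ultimately show "(cmod (\<Sum>a<N. \<gamma> a * f a))\<^sup>2 + (\<Sum>j<J. \<Sum>s<M. (cmod (\<Sum>a<N. \<gamma> a * g s j a))\<^sup>2)
      \<le> c\<^sup>2 * (cmod (\<Sum>a<N. \<gamma> a))\<^sup>2 + (\<Sum>i<I. \<Sum>s<M. (cmod (\<Sum>a<N. \<gamma> a * (\<Sum>j<J. \<delta> a i j * g s j a)))\<^sup>2)
      + \<epsilon> * (\<Sum>a<N. (cmod (\<gamma> a))\<^sup>2)" unfolding dg_def norm_sq_def by linarith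
  qed
qed

section \<open>Gram matrices of positive definite kernels\<close>

lemma qform_gram:
  assumes "\<And>a b. a < N \<Longrightarrow> b < N \<Longrightarrow> K a b = (\<Sum>p<N. T p a * cnj (T p b))"
  shows "qform N K \<gamma> = (\<Sum>p<N. (cmod (\<Sum>a<N. T p a * \<gamma> a))\<^sup>2)"
proof -
  have "(\<Sum>a<N. \<Sum>b<N. K a b * \<gamma> a * cnj (\<gamma> b)) = (\<Sum>a<N. \<Sum>b<N. \<Sum>p<N. (T p a * \<gamma> a) * cnj (T p b * \<gamma> b))"
    by (intro sum.cong refl) (simp add: assms sum_distrib_left sum_distrib_right mult_ac)
  also have "\<dots> = (\<Sum>a<N. \<Sum>p<N. \<Sum>b<N. (T p a * \<gamma> a) * cnj (T p b * \<gamma> b))" by (intro sum.cong refl sum.swap)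
  also have "\<dots> = (\<Sum>p<N. \<Sum>a<N. \<Sum>b<N. (T p a * \<gamma> a) * cnj (T p b * \<gamma> b))" by (rule sum.swap)
  also have "\<dots> = (\<Sum>p<N. (\<Sum>a<N. T p a * \<gamma> a) * cnj (\<Sum>a<N. T p a * \<gamma> a))"
    unfolding cnj_sum sum_product ..
  also have "\<dots> = of_real (\<Sum>p<N. (cmod (\<Sum>a<N. T p a * \<gamma> a))\<^sup>2)" by (rule sum_mult_cnj)
  finally show ?thesis unfolding qform_def by simp
qed

text \<open>Cholesky factorization: \<open>K'\<close> is the Schur complement of the last diagonal
  entry, and it inherits positive definiteness.\<close>

lemma gram_factorization:
  assumes "\<And>a b. K b a = cnj (K a b)" "\<And>\<gamma> a. a < N \<Longrightarrow> \<gamma> a \<noteq> 0 \<Longrightarrow> 0 < qform N K \<gamma>"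
  shows "\<exists>T. \<forall>a<N. \<forall>b<N. K a b = (\<Sum>p<N. T p a * cnj (T p b))"
  using assms
proof (induction N arbitrary: K)
  case 0
  show ?case by simp
next
  case (Suc N)
  note herm = Suc.prems(1) and pd = Suc.prems(2)
  define k where "k = Re (K N N)"
  have "cnj (K N N) = K N N" by (rule herm[symmetric])
  then have "K N N \<in> \<real>" unfolding Reals_cnj_iff .
  then have kk: "K N N = of_real k" unfolding k_def by (rule of_real_Re[symmetric])
  have k: "k > 0"
  proof -
    define u :: "nat \<Rightarrow> complex" where "u a = (if a = N then 1 else 0)" for a
    have t: "K a b * u a * cnj (u b) = (if b = N then if a = N then K N N else 0 else 0)" for a b by (simp add: u_def)
    have "qform (Suc N) K u = k" unfolding qform_def t k_def by simp
    moreover have "0 < qform (Suc N) K u" by (rule pd[of N]) (simp_all add: u_def)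
    ultimately show ?thesis by simp
  qed
  define K' where "K' a b = K a b - K a N * cnj (K b N) / of_real k" for a b
  have "\<exists>T. \<forall>a<N. \<forall>b<N. K' a b = (\<Sum>p<N. T p a * cnj (T p b))"
  proof (rule Suc.IH)
    show "K' b a = cnj (K' a b)" for a b using herm[of a b] by (simp add: K'_def mult.commute)
    fix \<gamma> :: "nat \<Rightarrow> complex" and a assume a: "a < N" "\<gamma> a \<noteq> 0"
    define L where "L = (\<Sum>a<N. K a N * \<gamma> a)"
    \<comment> \<open>The last coordinate that minimizes the form; with it, completing the square
      leaves the form of \<open>K'\<close>.\<close>
    define x where "x = - L / of_real k"
    define \<gamma>' where "\<gamma>' a = (if a < N then \<gamma> a else x)" for a
    let ?Q = "\<Sum>a<N. \<Sum>b<N. K a b * \<gamma> a * cnj (\<gamma> b)"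
    have cL: "(\<Sum>b<N. K N b * x * cnj (\<gamma> b)) = x * cnj L"
      unfolding L_def cnj_sum sum_distrib_left by (intro sum.cong refl) (simp add: herm[of N] mult_ac)
    have "(\<Sum>a<Suc N. \<Sum>b<Suc N. K a b * \<gamma>' a * cnj (\<gamma>' b)) = ?Q + (\<Sum>a<N. K a N * \<gamma> a * cnj x)
      + ((\<Sum>b<N. K N b * x * cnj (\<gamma> b)) + K N N * x * cnj x)"
      by (simp add: \<gamma>'_def sum.distrib)
    also have "\<dots> = ?Q + L * cnj x + x * cnj L + of_real k * x * cnj x"
      unfolding cL kk by (simp add: L_def sum_distrib_right)
    also have "\<dots> = ?Q - L * cnj L / of_real k"
    proof -
      have "q + l * cnj (- l / of_real k) + (- l / of_real k) * cnj l + of_real k * (- l / of_real k) * cnj (- l / of_real k)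
        = q - l * cnj l / of_real k" for q l :: complex using k by (simp add: field_simps)
      then show ?thesis unfolding x_def .
    qed
    also have "\<dots> = (\<Sum>a<N. \<Sum>b<N. K' a b * \<gamma> a * cnj (\<gamma> b))"
    proof -
      have "L * cnj L / of_real k = (\<Sum>a<N. \<Sum>b<N. K a N * cnj (K b N) / of_real k * \<gamma> a * cnj (\<gamma> b))"
        unfolding L_def cnj_sum sum_product sum_divide_distrib by (intro sum.cong refl) (simp add: mult_ac)
      then show ?thesis unfolding K'_def left_diff_distrib sum_subtractf by simp
    qed
    finally have "qform (Suc N) K \<gamma>' = qform N K' \<gamma>" by (simp add: qform_def)
    moreover have "0 < qform (Suc N) K \<gamma>'" by (rule pd[of a]) (use a in \<open>simp_all add: \<gamma>'_def\<close>)
    ultimately show "0 < qform N K' \<gamma>" by simp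
  qed
  then obtain T' where "\<forall>a<N. \<forall>b<N. K' a b = (\<Sum>p<N. T' p a * cnj (T' p b))" ..
  note T' = this[rule_format]
  define T where "T p a = (if p = N then K a N / of_real (sqrt k) else if a < N then T' p a else 0)" for p a
  have KT: "K a b = (\<Sum>p<Suc N. T p a * cnj (T p b))" if ab: "a < Suc N" "b < Suc N" for a b
  proof -
    have sq: "complex_of_real (sqrt k) * complex_of_real (sqrt k) = of_real k" using k by (simp flip: of_real_mult)
    have 1: "(\<Sum>p<Suc N. T p a * cnj (T p b)) = (\<Sum>p<N. T p a * cnj (T p b)) + K a N * cnj (K b N) / of_real k"
      using sq by (simp add: T_def)
    have 2: "(\<Sum>p<N. T p a * cnj (T p b)) = (if a < N \<and> b < N then K' a b else 0)"
      using T'[of a b] by (auto simp: T_def)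
    show ?thesis
    proof (cases "a < N \<and> b < N")
      case True
      then show ?thesis unfolding 1 2 by (simp add: K'_def)
    next
      case False
      with ab consider "b = N" | "a = N" by linarith
      then have "K a b = K a N * cnj (K b N) / of_real k"
      proof cases
        case 1
        then show ?thesis using k by (simp add: kk)
      next
        case 2
        then show ?thesis using k herm[of b N] by (simp add: kk)
      qed
      then show ?thesis unfolding 1 2 if_not_P[OF False] by simp
    qed
  qed
  show ?case by (intro exI[of _ T] allI impI KT)
qed

section \<open>Simultaneously diagonalizable tuples\<close>

lemma scalar_mat_pow: "mat 1 1 (\<lambda>_. a) ^\<^sub>m k = mat 1 1 (\<lambda>_. a ^ k :: complex)"
proof (induction k)
  case 0
  show ?case by (rule eq_matI) auto
next
  case (Suc k)
  then show ?case by (simp only: pow_mat.simps mat_1_1_mult power_Suc2)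
qed

lemma monomial_value_scalar:
  fixes z :: "complex ^ 'd::finite"
  shows "monomial_value (scalar_tuple z) m = mat 1 1 (\<lambda>_. scalar_monomial z m)"
proof -
  have "foldr (\<lambda>i M. (scalar_tuple z i ^\<^sub>m Poly_Mapping.lookup m i) * M) js (1\<^sub>m 1)
    = mat 1 1 (\<lambda>_. \<Prod>i\<leftarrow>js. z $ i ^ Poly_Mapping.lookup m i)" for js
  proof (induction js)
    case Nil
    show ?case by (rule eq_matI) auto
  next
    case (Cons j js)
    then show ?case by (simp only: foldr.simps o_apply scalar_tuple_def scalar_mat_pow mat_1_1_mult list.map prod_list.Cons)
  qed
  moreover have "(\<Prod>i\<leftarrow>variables. z $ i ^ Poly_Mapping.lookup m i) = scalar_monomial z m"
  proof -
    have "distinct (variables :: 'd list)" "set (variables :: 'd list) = UNIV" using variables by auto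
    then show ?thesis using prod.distinct_set_conv_list[of variables "\<lambda>i. z $ i ^ Poly_Mapping.lookup m i"]
      by (simp add: scalar_monomial_def)
  qed
  ultimately show ?thesis by (simp add: monomial_value_def)
qed

lemma shift_scalar_tuple: "shift_tuple (scalar_tuple l) l = scalar_tuple 0"
proof
  show "shift_tuple (scalar_tuple l) l i = scalar_tuple 0 i" for i
    unfolding shift_tuple_def scalar_tuple_universe(2) unfolding scalar_tuple_def by (rule eq_matI) auto
qed

lemma scalar_tuple_spectrum: "joint_spectrum (scalar_tuple l) = {l}"
proof (rule joint_spectrum_nilpotent[where l = l and N = 1, OF scalar_tuple_comm])
  show "shift_tuple (scalar_tuple l) l i ^\<^sub>m 1 = 0\<^sub>m (level (scalar_tuple l)) (level (scalar_tuple l))" for i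
    unfolding shift_scalar_tuple scalar_tuple_universe(2) by (intro eq_matI) (auto simp: scalar_tuple_def)
qed

lemma scalar_monomial_origin: "scalar_monomial 0 m = (if m = 0 then 1 else 0)"
proof (cases "m = 0")
  case False
  then obtain i where "Poly_Mapping.lookup m i \<noteq> 0" by (metis lookup_zero poly_mapping_eqI)
  then have "(0 :: complex ^ 'a) $ i ^ Poly_Mapping.lookup m i = 0" by simp
  then have "(\<Prod>i\<in>UNIV. (0 :: complex ^ 'a) $ i ^ Poly_Mapping.lookup m i) = 0" by (intro prod_zero) auto
  then show ?thesis unfolding scalar_monomial_def using False by simp
qed (simp add: scalar_monomial_def)

text \<open>Only the constant monomial survives at a point, and the constant coefficient is the
  value at the centre.\<close>

lemma local_value_scalar:
  fixes l :: "complex ^ 'd::finite"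
  assumes "\<exists>c. power_series_at g l c"
  shows "local_value g (scalar_tuple l) = mat 1 1 (\<lambda>_. g l)"
proof -
  obtain c where c: "power_series_at g l c" using assms ..
  then obtain r where r: "r > 0" "\<And>z. z \<in> ball l r \<Longrightarrow> ((\<lambda>m. c m * scalar_monomial (z - l) m) has_sum g z) UNIV"
    unfolding power_series_at_def by blast
  have "((\<lambda>m. c m * scalar_monomial (l - l) m) has_sum g l) UNIV" by (rule r(2)) (use r(1) in simp)
  then have 1: "((\<lambda>m. c m * scalar_monomial 0 m) has_sum g l) UNIV" by simp
  have "((\<lambda>m. c m * scalar_monomial (0 :: complex ^ 'd) m) has_sum c 0) UNIV"
    by (rule has_sum_finite_neutralI[of "{0}"]) (simp_all add: scalar_monomial_origin)
  with 1 have gl: "g l = c 0" by (rule has_sum_unique)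
  have K: "{m. monomial_value (shift_tuple (scalar_tuple l) l) m \<noteq> 0\<^sub>m (level (scalar_tuple l)) (level (scalar_tuple l))} \<subseteq> {0}"
  proof
    fix m assume m: "m \<in> {m. monomial_value (shift_tuple (scalar_tuple l) l) m \<noteq> 0\<^sub>m (level (scalar_tuple l)) (level (scalar_tuple l))}"
    show "m \<in> {0}"
    proof (rule ccontr)
      assume "m \<notin> {0}"
      then have "monomial_value (shift_tuple (scalar_tuple l) l) m = 0\<^sub>m (level (scalar_tuple l)) (level (scalar_tuple l))"
        unfolding shift_scalar_tuple monomial_value_scalar scalar_tuple_universe(2)
        by (intro eq_matI) (simp_all add: scalar_monomial_origin)
      with m show False by simp
    qed
  qed
  have "local_value g (scalar_tuple l) = linear_combination 1 c (monomial_value (scalar_tuple 0)) {0}"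
    using local_value_eq[OF scalar_tuple_comm scalar_tuple_spectrum c _ K] unfolding shift_scalar_tuple scalar_tuple_universe(2) by simp
  also have "\<dots> = mat 1 1 (\<lambda>_. g l)"
    by (rule eq_matI) (auto simp: linear_combination_def monomial_value_scalar scalar_monomial_origin gl)
  finally show ?thesis .
qed

lemma mult_mat_vec_index:
  assumes "A \<in> carrier_mat n m" "v \<in> carrier_vec m" "p < n"
  shows "vec_index (A *\<^sub>v v) p = (\<Sum>q<m. A $$ (p, q) * vec_index v q)"
  using assms by (simp add: scalar_prod_def atLeast0LessThan)

section \<open>Conjugates of diagonal matrices\<close>

definition diag_fun :: "nat \<Rightarrow> (nat \<Rightarrow> complex) \<Rightarrow> complex mat" where
  "diag_fun N \<phi> = mat N N (\<lambda>(a, b). if a = b then \<phi> a else 0)"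

lemma diag_fun_carrier [simp]: "diag_fun N \<phi> \<in> carrier_mat N N"
  by (simp add: diag_fun_def)

lemma diag_fun_mult: "diag_fun N \<phi> * diag_fun N \<psi> = diag_fun N (\<lambda>a. \<phi> a * \<psi> a)"
proof (rule eq_matI)
  fix a b assume "a < dim_row (diag_fun N (\<lambda>a. \<phi> a * \<psi> a))" "b < dim_col (diag_fun N (\<lambda>a. \<phi> a * \<psi> a))"
  then have ab: "a < N" "b < N" by (simp_all add: diag_fun_def)
  have "(diag_fun N \<phi> * diag_fun N \<psi>) $$ (a, b) = (\<Sum>s<N. diag_fun N \<phi> $$ (a, s) * diag_fun N \<psi> $$ (s, b))"
    by (rule mat_mult_index[OF diag_fun_carrier diag_fun_carrier ab])
  also have "\<dots> = (\<Sum>s<N. if a = s then \<phi> a * diag_fun N \<psi> $$ (a, b) else 0)"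
    by (intro sum.cong refl) (use ab in \<open>simp add: diag_fun_def\<close>)
  also have "\<dots> = diag_fun N (\<lambda>a. \<phi> a * \<psi> a) $$ (a, b)" using ab by (simp add: diag_fun_def)
  finally show "(diag_fun N \<phi> * diag_fun N \<psi>) $$ (a, b) = diag_fun N (\<lambda>a. \<phi> a * \<psi> a) $$ (a, b)" .
qed (simp_all add: diag_fun_def)

lemma diag_block_mat_scalars:
  "diag_block_mat (map (\<lambda>a. mat 1 1 (\<lambda>_. \<phi> a)) [0..<N]) = diag_fun N \<phi>"
proof -
  have "diag_block_mat (map (\<lambda>a. mat 1 1 (\<lambda>_. \<phi> a)) xs)
    = mat (length xs) (length xs) (\<lambda>(a, b). if a = b then \<phi> (xs ! a) else 0)" for xs :: "nat list"
  proof (induction xs)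
    case Nil
    show ?case by (rule eq_matI) auto
  next
    case (Cons x xs)
    note IH = Cons[unfolded One_nat_def]
    show ?case
    proof (rule eq_matI)
      fix a b
      assume "a < dim_row (mat (length (x # xs)) (length (x # xs)) (\<lambda>(a, b). if a = b then \<phi> ((x # xs) ! a) else 0))"
        "b < dim_col (mat (length (x # xs)) (length (x # xs)) (\<lambda>(a, b). if a = b then \<phi> ((x # xs) ! a) else 0))"
      then have "a < Suc (length xs)" "b < Suc (length xs)" by simp_all
      then show "diag_block_mat (map (\<lambda>a. mat 1 1 (\<lambda>_. \<phi> a)) (x # xs)) $$ (a, b)
        = mat (length (x # xs)) (length (x # xs)) (\<lambda>(a, b). if a = b then \<phi> ((x # xs) ! a) else 0) $$ (a, b)"
        by (cases a; cases b) (simp_all add: IH Let_def)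
    qed (simp_all add: IH Let_def)
  qed
  then show ?thesis by (auto simp: diag_fun_def intro!: eq_matI)
qed

text \<open>The columns of \<open>T\<close> are eigenvectors of the conjugated diagonal matrix, and
  \<open>\<xi>\<close> are the coordinates of \<open>v\<close> in this basis.\<close>

lemma conj_diag_apply:
  assumes T: "T \<in> carrier_mat N N" and S: "S \<in> carrier_mat N N" and ST: "S * T = 1\<^sub>m N" and p: "p < N"
    and v: "\<And>q. q < N \<Longrightarrow> v q = (\<Sum>a<N. T $$ (q, a) * \<xi> a)"
  shows "(\<Sum>q<N. (T * diag_fun N \<phi> * S) $$ (p, q) * v q) = (\<Sum>a<N. T $$ (p, a) * (\<phi> a * \<xi> a))"
proof -
  have TD: "(T * diag_fun N \<phi>) $$ (p, a) = T $$ (p, a) * \<phi> a" if a: "a < N" for a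
  proof -
    have "(T * diag_fun N \<phi>) $$ (p, a) = (\<Sum>s<N. T $$ (p, s) * diag_fun N \<phi> $$ (s, a))"
      by (rule mat_mult_index[OF T diag_fun_carrier p a])
    also have "\<dots> = (\<Sum>s<N. if s = a then T $$ (p, a) * \<phi> a else 0)"
      by (intro sum.cong refl) (use a in \<open>auto simp: diag_fun_def\<close>)
    finally show ?thesis using a by simp
  qed
  have Sv: "(\<Sum>q<N. S $$ (a, q) * v q) = \<xi> a" if a: "a < N" for a
  proof -
    have "(\<Sum>q<N. S $$ (a, q) * v q) = (\<Sum>q<N. \<Sum>b<N. S $$ (a, q) * T $$ (q, b) * \<xi> b)"
      by (intro sum.cong refl) (simp add: v sum_distrib_left mult.assoc)
    also have "\<dots> = (\<Sum>b<N. \<Sum>q<N. S $$ (a, q) * T $$ (q, b) * \<xi> b)" by (rule sum.swap)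
    also have "\<dots> = (\<Sum>b<N. (S * T) $$ (a, b) * \<xi> b)"
      by (intro sum.cong refl) (simp add: mat_mult_index[OF S T a] sum_distrib_right del: index_mult_mat)
    also have "\<dots> = (\<Sum>b<N. if a = b then \<xi> a else 0)"
      unfolding ST by (intro sum.cong refl) (use a in auto)
    finally show ?thesis using a by simp
  qed
  have "(\<Sum>q<N. (T * diag_fun N \<phi> * S) $$ (p, q) * v q) = (\<Sum>q<N. \<Sum>a<N. T $$ (p, a) * \<phi> a * (S $$ (a, q) * v q))"
  proof (intro sum.cong refl)
    fix q assume "q \<in> {..<N}"
    then have q: "q < N" by simp
    show "(T * diag_fun N \<phi> * S) $$ (p, q) * v q = (\<Sum>a<N. T $$ (p, a) * \<phi> a * (S $$ (a, q) * v q))"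
      unfolding mat_mult_index[OF mult_carrier_mat[OF T diag_fun_carrier] S p q] sum_distrib_right
      by (intro sum.cong refl) (simp add: TD mult.assoc del: index_mult_mat)
  qed
  also have "\<dots> = (\<Sum>a<N. T $$ (p, a) * \<phi> a * (\<Sum>q<N. S $$ (a, q) * v q))"
    unfolding sum_distrib_left by (rule sum.swap)
  also have "\<dots> = (\<Sum>a<N. T $$ (p, a) * (\<phi> a * \<xi> a))"
    by (intro sum.cong refl) (simp add: Sv mult.assoc)
  finally show ?thesis .
qed

text \<open>A positive definite kernel on finitely many points of \<open>V\<close> is the Gram matrix of the columns of some \<open>T\<close>; conjugating
  the diagonal tuple of the points by \<open>T\<close> gives a test tuple in \<open>\<F>\<^sub>p\<^sub>,\<^sub>V\<close>.\<close>

lemma pick_positivity: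
  fixes D :: "'d::finite free_poly mat" and z :: "nat \<Rightarrow> complex ^ 'd"
  assumes f: "f \<in> Hol V" and nrm: "variety_norm (map_mat abelianize D) V f \<le> ennreal c" and c: "0 \<le> c"
    and z: "\<And>a. a < N \<Longrightarrow> z a \<in> V" and N: "N \<ge> 1"
    and herm: "\<And>a b. K b a = cnj (K a b)" and pd: "\<And>\<gamma> a. a < N \<Longrightarrow> \<gamma> a \<noteq> 0 \<Longrightarrow> 0 < qform N K \<gamma>"
    and r: "0 \<le> r" "r < 1"
    and cond: "\<And>\<xi>. (\<Sum>i<dim_row D. qform N K (\<lambda>a. \<Sum>j<dim_col D. free_scalar (D $$ (i, j)) (z a) * \<xi> j a))
      \<le> r\<^sup>2 * (\<Sum>j<dim_col D. qform N K (\<xi> j))"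
  shows "qform N K (\<lambda>a. f (z a)) \<le> c\<^sup>2 * qform N K (\<lambda>_. 1)"
proof -
  let ?I = "dim_row D" and ?J = "dim_col D"
  have "\<exists>T. \<forall>a<N. \<forall>b<N. K a b = (\<Sum>p<N. T p a * cnj (T p b))"
    by (rule gram_factorization) (rule herm, erule (1) pd)
  then obtain T0 where T0: "\<forall>a<N. \<forall>b<N. K a b = (\<Sum>p<N. T0 p a * cnj (T0 p b))" ..
  have gram0: "qform N K \<gamma> = (\<Sum>p<N. (cmod (\<Sum>a<N. T0 p a * \<gamma> a))\<^sup>2)" for \<gamma>
    by (rule qform_gram) (rule T0[rule_format])
  define T where "T = mat N N (\<lambda>(p, a). T0 p a)"
  have T: "T \<in> carrier_mat N N" by (simp add: T_def)
  have gram: "qform N K \<gamma> = (\<Sum>p<N. (cmod (\<Sum>a<N. T $$ (p, a) * \<gamma> a))\<^sup>2)" for \<gamma>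
    unfolding gram0 by (intro sum.cong refl arg_cong[of _ _ "\<lambda>z. (cmod z)\<^sup>2"]) (simp add: T_def)
  have Tv: "vec_index (T *\<^sub>v v) p = (\<Sum>a<N. T $$ (p, a) * vec_index v a)" if "v \<in> carrier_vec N" "p < N" for v p
    by (rule mult_mat_vec_index[OF T that])
  \<comment> \<open>Positive definiteness makes the kernel of \<open>T\<close> trivial, since the
    form vanishes at every vector that \<open>T\<close> annihilates.\<close>
  have "v = 0\<^sub>v N" if v: "v \<in> carrier_vec N" "T *\<^sub>v v = 0\<^sub>v N" for v
  proof (rule eq_vecI)
    fix a assume a: "a < dim_vec (0\<^sub>v N :: complex vec)"
    have "qform N K (vec_index v) = 0"
      unfolding gram using v by (intro sum.neutral ballI) (simp add: Tv[OF v(1), symmetric])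
    with pd[of a "vec_index v"] a show "vec_index v a = vec_index (0\<^sub>v N) a" by auto
  qed (use v in simp)
  from mat_inverse_exists[OF T this] obtain S where S: "S \<in> carrier_mat N N" and TS: "T * S = 1\<^sub>m N" and ST: "S * T = 1\<^sub>m N" by blast
  define y where "y i = T * diag_fun N (\<lambda>a. z a $ i) * S" for i
  have conj_c: "T * diag_fun N \<phi> * S \<in> carrier_mat N N" for \<phi>
    by (rule mult_carrier_mat[OF mult_carrier_mat[OF T diag_fun_carrier] S])
  have u: "y \<in> matrix_universe" "level y = N" using matrix_universeI[of y N] conj_c N by (simp_all add: y_def)
  have conj_mult: "(T * diag_fun N \<phi> * S) * (T * diag_fun N \<psi> * S) = T * diag_fun N (\<lambda>a. \<phi> a * \<psi> a) * S" for \<phi> \<psi>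
  proof -
    let ?A = "diag_fun N \<phi>" and ?B = "diag_fun N \<psi>"
    note TA = mult_carrier_mat[OF T diag_fun_carrier[of N \<phi>]] and BS = mult_carrier_mat[OF diag_fun_carrier[of N \<psi>] S]
    have "S * (T * ?B * S) = S * (T * (?B * S))" by (simp only: assoc_mult_mat[OF T diag_fun_carrier S])
    also have "\<dots> = S * T * (?B * S)" by (rule assoc_mult_mat[OF S T BS, symmetric])
    also have "\<dots> = ?B * S" unfolding ST by (rule left_mult_one_mat[OF BS])
    finally have 1: "S * (T * ?B * S) = ?B * S" .
    have "(T * ?A * S) * (T * ?B * S) = T * ?A * (S * (T * ?B * S))" by (rule assoc_mult_mat[OF TA S conj_c])
    also have "\<dots> = T * (?A * (?B * S))" unfolding 1 by (rule assoc_mult_mat[OF T diag_fun_carrier BS])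
    also have "?A * (?B * S) = diag_fun N (\<lambda>a. \<phi> a * \<psi> a) * S"
      unfolding diag_fun_mult[symmetric] by (rule assoc_mult_mat[OF diag_fun_carrier diag_fun_carrier S, symmetric])
    also have "T * (diag_fun N (\<lambda>a. \<phi> a * \<psi> a) * S) = T * diag_fun N (\<lambda>a. \<phi> a * \<psi> a) * S"
      by (rule assoc_mult_mat[OF T diag_fun_carrier S, symmetric])
    finally show ?thesis .
  qed
  have yc: "y \<in> comm_universe"
    unfolding comm_universe_def
  proof (intro CollectI conjI allI u)
    show "y i * y j = y j * y i" for i j unfolding y_def conj_mult by (simp only: mult.commute)
  qed
  define xs where "xs = map (\<lambda>a. scalar_tuple (z a)) [0..<N]"
  have db: "diag_block_mat (map h xs) = diag_fun N \<phi>" if "\<And>a. a < N \<Longrightarrow> h (scalar_tuple (z a)) = mat 1 1 (\<lambda>_. \<phi> a)" for h \<phi>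
  proof -
    have "map h xs = map (\<lambda>a. mat 1 1 (\<lambda>_. \<phi> a)) [0..<N]" unfolding xs_def map_map by (rule map_cong) (simp_all add: that)
    then show ?thesis by (simp only: diag_block_mat_scalars)
  qed
  have dec: "decomposition y T S xs"
    unfolding decomposition_def
  proof (intro conjI ballI allI)
    fix x assume "x \<in> set xs"
    then obtain a where a: "x = scalar_tuple (z a)" by (auto simp: xs_def)
    show "x \<in> comm_universe" "is_singleton (joint_spectrum x)" unfolding a by (simp_all add: scalar_tuple_spectrum)
  next
    fix i
    have "diag_block_mat (map (\<lambda>x. x i) xs) = diag_fun N (\<lambda>a. z a $ i)" by (rule db) (simp add: scalar_tuple_def)
    then show "similar_mat_wit (y i) (diag_block_mat (map (\<lambda>x. x i) xs)) T S"
      using T S TS ST conj_c by (simp add: similar_mat_wit_def y_def Let_def)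
  qed
  have spec: "joint_spectrum y = z ` {..<N}"
    unfolding decomposition_spectrum[OF dec u(1)] xs_def set_map image_image scalar_tuple_spectrum the_elem_eq set_upt atLeast0LessThan ..
  then have sV: "joint_spectrum y \<subseteq> V" using z by auto
  have ev: "free_eval q y = T * diag_fun N (\<lambda>a. free_scalar q (z a)) * S" for q
  proof -
    have "diag_block_mat (map (free_eval q) xs) = diag_fun N (\<lambda>a. free_scalar q (z a))"
      by (rule db) (simp add: free_eval_scalar free_scalar_def)
    then show ?thesis unfolding free_eval_block_similar[OF decomposition_block_similar[OF dec u(1)], of q] by simp
  qed
  have lv: "diag_block_mat (map (local_value g) xs) = diag_fun N (\<lambda>a. g (z a))"
    if g: "holomorphic_several g U" "joint_spectrum y \<subseteq> U" for g U
  proof (rule db)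
    fix a assume "a < N"
    then have "z a \<in> U" using g(2) spec by auto
    from holomorphic_several_power_series_at[OF g(1) this]
    show "local_value g (scalar_tuple (z a)) = mat 1 1 (\<lambda>_. g (z a))" by (rule local_value_scalar)
  qed
  \<comment> \<open>For a diagonalizable tuple the functional calculus depends only on the values at
    the points of the spectrum, which lie in \<open>V\<close>.\<close>
  have sub: "subordinate V y"
    unfolding subordinate_def
  proof (intro allI impI; elim conjE)
    fix U g assume g: "joint_spectrum y \<subseteq> U" "holomorphic_several g U" "\<forall>z\<in>U \<inter> V. g z = 0"
    have "hol_value g y = T * diag_block_mat (map (local_value g) xs) * S"
      by (rule hol_value_eq[OF yc dec]) (use holomorphic_several_power_series_at[OF g(2)] g(1) in blast)
    also have "diag_block_mat (map (local_value g) xs) = diag_fun N (\<lambda>a. g (z a))" by (rule lv[OF g(2,1)])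
    also have "\<dots> = 0\<^sub>m N N"
    proof -
      have "g (z a) = 0" if "a < N" for a using g(1,3) spec z[OF that] that by auto
      then show ?thesis by (intro eq_matI) (auto simp: diag_fun_def)
    qed
    finally show "hol_value g y = 0\<^sub>m (level y) (level y)" using T S u(2) by simp
  qed
  have "finite (z ` {..<N})" "z ` {..<N} \<subseteq> V" using z by auto
  from Hol_extension_near_finite[OF f this] obtain U G where G: "z ` {..<N} \<subseteq> U" "holomorphic_several G U" "\<forall>z\<in>U \<inter> V. G z = f z"
    by (elim exE conjE)
  have yV: "y \<in> spectrum_in V" using yc sV by (simp add: spectrum_in_def)
  have "variety_value V f y = T * diag_block_mat (map (local_value G) xs) * S"
    by (rule variety_value_eq[OF yV sub dec f _ G(2)]) (use G(1,3) spec in auto)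
  also have "diag_block_mat (map (local_value G) xs) = diag_fun N (\<lambda>a. G (z a))" by (rule lv[OF G(2)]) (use G(1) spec in simp)
  also have "\<dots> = diag_fun N (\<lambda>a. f (z a))"
  proof -
    have "G (z a) = f (z a)" if "a < N" for a using G(1,3) z[OF that] that by auto
    then show ?thesis by (intro eq_matI) (auto simp: diag_fun_def)
  qed
  finally have vv: "variety_value V f y = T * diag_fun N (\<lambda>a. f (z a)) * S" .
  have "block_bounded r N ?I ?J (\<lambda>i j. free_eval (D $$ (i, j)) y)"
    unfolding block_bounded_def
  proof
    fix \<zeta> :: "nat \<Rightarrow> nat \<Rightarrow> complex"
    \<comment> \<open>Coordinates of \<zeta> with respect to the columns of \<open>T\<close>. In
      them, evaluation becomes multiplication by the values at \<open>z a\<close>, and squared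
      Euclidean norms become values of the form of \<open>K\<close>.\<close>
    define \<xi> where "\<xi> j a = (\<Sum>b<N. S $$ (a, b) * \<zeta> j b)" for j a
    have \<zeta>: "\<zeta> j p = (\<Sum>a<N. T $$ (p, a) * \<xi> j a)" if p: "p < N" for j p
    proof -
      have "(\<Sum>a<N. T $$ (p, a) * \<xi> j a) = (\<Sum>a<N. \<Sum>b<N. T $$ (p, a) * S $$ (a, b) * \<zeta> j b)"
        by (simp add: \<xi>_def sum_distrib_left mult.assoc)
      also have "\<dots> = (\<Sum>b<N. \<Sum>a<N. T $$ (p, a) * S $$ (a, b) * \<zeta> j b)" by (rule sum.swap)
      also have "\<dots> = (\<Sum>b<N. (T * S) $$ (p, b) * \<zeta> j b)"
        by (intro sum.cong refl) (simp add: mat_mult_index[OF T S p] sum_distrib_right del: index_mult_mat)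
      also have "\<dots> = (\<Sum>b<N. if p = b then \<zeta> j p else 0)"
        unfolding TS by (intro sum.cong refl) (use p in auto)
      finally show ?thesis using p by simp
    qed
    have key: "(\<Sum>j<?J. \<Sum>b<N. free_eval (D $$ (i, j)) y $$ (a, b) * \<zeta> j b)
        = (\<Sum>b<N. T $$ (a, b) * (\<Sum>j<?J. free_scalar (D $$ (i, j)) (z b) * \<xi> j b))" if a: "a < N" for i a
    proof -
      have "(\<Sum>j<?J. \<Sum>b<N. free_eval (D $$ (i, j)) y $$ (a, b) * \<zeta> j b)
        = (\<Sum>j<?J. \<Sum>b<N. T $$ (a, b) * (free_scalar (D $$ (i, j)) (z b) * \<xi> j b))"
      proof (rule sum.cong[OF refl])
        fix j
        show "(\<Sum>b<N. free_eval (D $$ (i, j)) y $$ (a, b) * \<zeta> j b) = (\<Sum>b<N. T $$ (a, b) * (free_scalar (D $$ (i, j)) (z b) * \<xi> j b))"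
          unfolding ev by (rule conj_diag_apply[OF T S ST a \<zeta>])
      qed
      also have "\<dots> = (\<Sum>b<N. \<Sum>j<?J. T $$ (a, b) * (free_scalar (D $$ (i, j)) (z b) * \<xi> j b))" by (rule sum.swap)
      finally show ?thesis by (simp only: sum_distrib_left)
    qed
    have "(\<Sum>i<?I. \<Sum>a<N. (cmod (\<Sum>j<?J. \<Sum>b<N. free_eval (D $$ (i, j)) y $$ (a, b) * \<zeta> j b))\<^sup>2)
      = (\<Sum>i<?I. qform N K (\<lambda>a. \<Sum>j<?J. free_scalar (D $$ (i, j)) (z a) * \<xi> j a))"
      unfolding gram by (intro sum.cong refl) (simp only: key lessThan_iff)
    also have "\<dots> \<le> r\<^sup>2 * (\<Sum>j<?J. qform N K (\<xi> j))" by (rule cond)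
    also have "(\<Sum>j<?J. qform N K (\<xi> j)) = (\<Sum>j<?J. \<Sum>b<N. (cmod (\<zeta> j b))\<^sup>2)"
      unfolding gram by (intro sum.cong refl) (simp add: \<zeta>)
    finally show "(\<Sum>i<?I. \<Sum>a<N. (cmod (\<Sum>j<?J. \<Sum>b<N. free_eval (D $$ (i, j)) y $$ (a, b) * \<zeta> j b))\<^sup>2)
      \<le> r\<^sup>2 * (\<Sum>j<?J. \<Sum>b<N. (cmod (\<zeta> j b))\<^sup>2)" .
  qed
  then have yD: "y \<in> basic_set D" unfolding basic_set_iff using u r by blast
  then have "y \<in> subordinate_matrices (map_mat abelianize D) V"
    unfolding subordinate_matrices_def comm_basic_matrices_eq using yV sub yc by simp
  then have "ennreal (op_norm (variety_value V f y)) \<le> variety_norm (map_mat abelianize D) V f"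
    unfolding variety_norm_def sup_norm_on_def by (rule SUP_upper)
  also note nrm
  finally have op: "op_norm (T * diag_fun N (\<lambda>a. f (z a)) * S) \<le> c" using c by (simp add: ennreal_le_iff vv)
  let ?M = "T * diag_fun N (\<lambda>a. f (z a)) * S"
  \<comment> \<open>The sum of the columns of \<open>T\<close>, with all coordinates 1: testing the
    operator norm here compares the form at \<open>f\<close> with the form at 1.\<close>
  define w where "w = vec N (\<lambda>p. \<Sum>a<N. T $$ (p, a) * 1)"
  have w: "w \<in> carrier_vec (dim_col ?M)" unfolding carrier_matD(2)[OF conj_c] by (simp add: w_def)
  have "euclid_norm (?M *\<^sub>v w) \<le> op_norm ?M * euclid_norm w" by (rule op_norm_bound[OF w])
  also have "\<dots> \<le> c * euclid_norm w" by (intro mult_right_mono op) simp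
  finally have "(euclid_norm (?M *\<^sub>v w))\<^sup>2 \<le> (c * euclid_norm w)\<^sup>2" by (intro power_mono) auto
  moreover have "(euclid_norm w)\<^sup>2 = qform N K (\<lambda>_. 1)" unfolding euclid_norm_sq gram by (simp add: w_def)
  moreover have "(euclid_norm (?M *\<^sub>v w))\<^sup>2 = qform N K (\<lambda>a. f (z a))"
  proof -
    have dim: "dim_vec (?M *\<^sub>v w) = N" unfolding dim_mult_mat_vec carrier_matD(1)[OF conj_c] ..
    have "vec_index (?M *\<^sub>v w) p = (\<Sum>a<N. T $$ (p, a) * f (z a))" if p: "p < N" for p
    proof -
      have "vec_index (?M *\<^sub>v w) p = (\<Sum>q<N. ?M $$ (p, q) * vec_index w q)"
        by (rule mult_mat_vec_index[OF conj_c _ p]) (simp add: w_def)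
      also have "\<dots> = (\<Sum>a<N. T $$ (p, a) * (f (z a) * 1))"
        by (rule conj_diag_apply[OF T S ST p]) (simp add: w_def)
      finally show ?thesis by simp
    qed
    then show ?thesis unfolding euclid_norm_sq gram dim by (intro sum.cong refl) simp
  qed
  ultimately show ?thesis by (simp add: power_mult_distrib)
qed

section \<open>Free holomorphic functions from Schur series\<close>

primrec word_poly :: "'d free_poly mat \<Rightarrow> (nat \<times> nat) list \<Rightarrow> 'd free_poly" where
  "word_poly D [] = 1"
| "word_poly D (q # w) = D $$ (fst q, snd q) * word_poly D w"

definition series_poly :: "'d free_poly mat \<Rightarrow> ((nat \<times> nat) list \<Rightarrow> complex) \<Rightarrow> nat \<Rightarrow> 'd free_poly" where
  "series_poly D cf k = (\<Sum>w\<in>words (dim_row D) (dim_col D) k. Poly_Mapping.single 0 (cf w) * word_poly D w)"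

lemma word_poly_action:
  assumes x: "x \<in> matrix_universe" and a: "a < level x"
  shows "(\<Sum>b<level x. free_eval (word_poly D w) x $$ (a, b) * v b)
    = word_action (\<lambda>i j. free_eval (D $$ (i, j)) x) (level x) v w a"
  using a
proof (induction w arbitrary: a)
  case Nil
  have "(\<Sum>b<level x. 1\<^sub>m (level x) $$ (a, b) * v b) = (\<Sum>b<level x. if a = b then v a else 0)"
    by (intro sum.cong refl) (use Nil in auto)
  then show ?case using Nil by (simp add: free_eval_one[OF x])
next
  case (Cons q w)
  let ?A = "free_eval (D $$ (fst q, snd q)) x" and ?B = "free_eval (word_poly D w) x" and ?n = "level x"
  have "(\<Sum>b<?n. free_eval (word_poly D (q # w)) x $$ (a, b) * v b)
    = (\<Sum>b<?n. \<Sum>s<?n. ?A $$ (a, s) * (?B $$ (s, b) * v b))"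
  proof (rule sum.cong[OF refl])
    fix b assume "b \<in> {..<?n}"
    then have b: "b < ?n" by simp
    show "free_eval (word_poly D (q # w)) x $$ (a, b) * v b = (\<Sum>s<?n. ?A $$ (a, s) * (?B $$ (s, b) * v b))"
      unfolding word_poly.simps free_eval_mult[OF x] mat_mult_index[OF free_eval_carrier free_eval_carrier Cons.prems b]
        sum_distrib_right mult.assoc ..
  qed
  also have "\<dots> = (\<Sum>s<?n. ?A $$ (a, s) * (\<Sum>b<?n. ?B $$ (s, b) * v b))"
    unfolding sum_distrib_left by (rule sum.swap)
  also have "\<dots> = word_action (\<lambda>i j. free_eval (D $$ (i, j)) x) ?n v (q # w) a"
    by (simp add: Cons.IH)
  finally show ?case .
qed

text \<open>Connects the abstract series to the free setting: at the blocks of \<delta>(x), its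
  partial sums are values of free polynomials.\<close>

lemma series_poly_action:
  assumes x: "x \<in> matrix_universe" and a: "a < level x"
  shows "word_series cf (dim_row D) (dim_col D) (\<lambda>i j. free_eval (D $$ (i, j)) x) (level x) v k a
    = (\<Sum>b<level x. free_eval (series_poly D cf k) x $$ (a, b) * v b)"
proof -
  let ?W = "words (dim_row D) (dim_col D) k"
  have "(\<Sum>b<level x. free_eval (series_poly D cf k) x $$ (a, b) * v b)
    = (\<Sum>b<level x. \<Sum>w\<in>?W. cf w * (free_eval (word_poly D w) x $$ (a, b) * v b))"
  proof (rule sum.cong[OF refl])
    fix b assume "b \<in> {..<level x}"
    then have b: "b < level x" by simp
    show "free_eval (series_poly D cf k) x $$ (a, b) * v b
      = (\<Sum>w\<in>?W. cf w * (free_eval (word_poly D w) x $$ (a, b) * v b))"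
      unfolding series_poly_def free_eval_sum_index[OF a b] free_eval_const_mult[OF x] sum_distrib_right
      by (intro sum.cong refl) (use a b carrier_matD[OF free_eval_carrier] in \<open>simp add: mult.assoc\<close>)
  qed
  also have "\<dots> = (\<Sum>w\<in>?W. cf w * (\<Sum>b<level x. free_eval (word_poly D w) x $$ (a, b) * v b))"
    unfolding sum_distrib_left by (rule sum.swap)
  finally show ?thesis by (simp add: word_poly_action[OF x a] word_series_def)
qed

section \<open>Convergence of Schur series\<close>

lemma average_limit:
  fixes A :: "nat \<Rightarrow> real"
  assumes lim: "A \<longlonglongrightarrow> a" and nn: "\<And>m. 0 \<le> A m" and av: "\<And>k. (\<Sum>m<k. A m) \<le> real k * V"
  shows "a \<le> V"
proof (rule ccontr)
  assume "\<not> a \<le> V"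
  \<comment> \<open>A level strictly between the two: from some index on all terms exceed
    \<open>B\<close>, and in a long average the finitely many earlier terms, being nonnegative,
    cannot pull the mean down to \<open>V\<close>.\<close>
  define B where "B = (a + V) / 2"
  have B: "V < B" "B < a" using \<open>\<not> a \<le> V\<close> by (simp_all add: B_def)
  have "0 \<le> V" using nn[of 0] av[of 1] by simp
  obtain K where K: "\<And>m. m \<ge> K \<Longrightarrow> B < A m" using order_tendstoD(1)[OF lim B(2)] unfolding eventually_sequentially by blast
  have le: "real m * B \<le> (\<Sum>i<K + m. A i)" for m
  proof (induction m)
    case 0
    show ?case using nn by (simp add: sum_nonneg)
  next
    case (Suc m)
    have "real (Suc m) * B = real m * B + B" by (simp add: distrib_right)
    with Suc K[of "K + m"] show ?case by simp
  qed
  obtain m :: nat where m: "real K * V / (B - V) < real m" using reals_Archimedean2 by blast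
  have "real m * B \<le> real (K + m) * V" using le[of m] av[of "K + m"] by linarith
  then have "real m * (B - V) \<le> real K * V" by (simp add: algebra_simps)
  moreover have "real K * V < real m * (B - V)" using m B by (simp add: field_simps)
  ultimately show False by simp
qed

lemma L2_set_norm_triangle:
  "L2_set (\<lambda>k. cmod (x k + y k)) X \<le> L2_set (\<lambda>k. cmod (x k)) X + L2_set (\<lambda>k. cmod (y k)) X"
proof -
  have "L2_set (\<lambda>k. cmod (x k + y k)) X \<le> L2_set (\<lambda>k. cmod (x k) + cmod (y k)) X"
    by (intro L2_set_mono norm_triangle_ineq) simp
  also have "\<dots> \<le> L2_set (\<lambda>k. cmod (x k)) X + L2_set (\<lambda>k. cmod (y k)) X" by (rule L2_set_triangle_ineq)
  finally show ?thesis .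
qed

lemma L2_set_sq: "(L2_set (\<lambda>k. cmod (x k)) X)\<^sup>2 = (\<Sum>k\<in>X. (cmod (x k))\<^sup>2)"
  by (simp add: L2_set_def sum_nonneg)

lemma schur_seriesD:
  assumes s: "schur_series I J cf" and U: "block_bounded r n I J U" and r: "0 \<le> r" "r < 1"
  shows "(\<Sum>a<n. (cmod (word_series cf I J U n v (Suc k) a - word_series cf I J U n v k a))\<^sup>2) \<le> (r\<^sup>2) ^ k * (\<Sum>a<n. (cmod (v a))\<^sup>2)"
    and "(\<Sum>m<k. \<Sum>a<n. (cmod (word_series cf I J U n v (Suc m) a))\<^sup>2) \<le> real k * (\<Sum>a<n. (cmod (v a))\<^sup>2)"
proof -
  have "0 \<le> r \<and> r \<le> 1 \<and> block_bounded r n I J U" using U r by simp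
  note 1 = s[unfolded schur_series_def, THEN spec, of n, THEN spec, of U, THEN spec, of v, THEN spec, of r, THEN mp, OF this]
  show "(\<Sum>a<n. (cmod (word_series cf I J U n v (Suc k) a - word_series cf I J U n v k a))\<^sup>2) \<le> (r\<^sup>2) ^ k * (\<Sum>a<n. (cmod (v a))\<^sup>2)"
    by (rule 1[THEN conjunct1, THEN spec])
  show "(\<Sum>m<k. \<Sum>a<n. (cmod (word_series cf I J U n v (Suc m) a))\<^sup>2) \<le> real k * (\<Sum>a<n. (cmod (v a))\<^sup>2)"
    by (rule 1[THEN conjunct2, THEN spec])
qed

lemma schur_series_increment:
  assumes s: "schur_series I J cf" and U: "block_bounded r n I J U" and r: "0 \<le> r" "r < 1"
  shows "L2_set (\<lambda>a. cmod (word_series cf I J U n v (Suc k) a - word_series cf I J U n v k a)) {..<n}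
    \<le> r ^ k * L2_set (\<lambda>a. cmod (v a)) {..<n}"
proof (rule power2_le_imp_le)
  have "(\<Sum>a<n. (cmod (word_series cf I J U n v (Suc k) a - word_series cf I J U n v k a))\<^sup>2) \<le> (r\<^sup>2) ^ k * (\<Sum>a<n. (cmod (v a))\<^sup>2)"
    by (rule schur_seriesD(1)[OF s U r])
  also have "\<dots> = (r ^ k * L2_set (\<lambda>a. cmod (v a)) {..<n})\<^sup>2"
    unfolding power_mult_distrib L2_set_sq power_mult[of r 2 k, symmetric] power_mult[of r k 2, symmetric] mult.commute[of 2 k] ..
  finally show "(L2_set (\<lambda>a. cmod (word_series cf I J U n v (Suc k) a - word_series cf I J U n v k a)) {..<n})\<^sup>2
    \<le> (r ^ k * L2_set (\<lambda>a. cmod (v a)) {..<n})\<^sup>2" unfolding L2_set_sq .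
  show "0 \<le> r ^ k * L2_set (\<lambda>a. cmod (v a)) {..<n}" using r by (simp add: L2_set_nonneg)
qed

lemma schur_series_convergent:
  assumes s: "schur_series I J cf" and U: "block_bounded r n I J U" and r: "0 \<le> r" "r < 1" and a: "a < n"
  shows "convergent (\<lambda>k. word_series cf I J U n v k a)"
proof -
  let ?S = "\<lambda>k. word_series cf I J U n v k a" and ?L = "L2_set (\<lambda>a. cmod (v a)) {..<n}"
  have "norm (?S (Suc k) - ?S k) \<le> r ^ k * ?L" for k
  proof -
    have "cmod (?S (Suc k) - ?S k) \<le> L2_set (\<lambda>a. cmod (word_series cf I J U n v (Suc k) a - word_series cf I J U n v k a)) {..<n}"
      by (rule member_le_L2_set[of "{..<n}" a "\<lambda>a. cmod (word_series cf I J U n v (Suc k) a - word_series cf I J U n v k a)"]) (use a in auto)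
    also have "\<dots> \<le> r ^ k * ?L" by (rule schur_series_increment[OF s U r])
    finally show ?thesis .
  qed
  note inc = this
  have "summable (\<lambda>k. r ^ k * ?L)" using r by (intro summable_mult2 summable_geometric) simp
  then have "summable (\<lambda>k. ?S (Suc k) - ?S k)" by (rule summable_comparison_test'[where N = 0]) (rule inc)
  then have "convergent (\<lambda>m. \<Sum>k<m. ?S (Suc k) - ?S k)" unfolding summable_iff_convergent .
  moreover have "?S 0 = 0" by (simp add: word_series_def)
  ultimately show ?thesis unfolding sum_lessThan_telescope[of ?S] by (simp only: diff_zero)
qed

text \<open>Two different mechanisms: contractivity of the limit comes from the averages through
  \<open>average_limit\<close>, the rate from the geometric decay of the increments.\<close>

lemma schur_series_limit_bounds:
  assumes s: "schur_series I J cf" and U: "block_bounded r n I J U" and r: "0 \<le> r" "r < 1"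
    and L: "\<And>a. a < n \<Longrightarrow> (\<lambda>k. word_series cf I J U n v k a) \<longlonglongrightarrow> L a"
  shows "L2_set (\<lambda>a. cmod (L a)) {..<n} \<le> L2_set (\<lambda>a. cmod (v a)) {..<n}"
    and "L2_set (\<lambda>a. cmod (L a - word_series cf I J U n v k a)) {..<n} \<le> r ^ k / (1 - r) * L2_set (\<lambda>a. cmod (v a)) {..<n}"
proof -
  let ?S = "word_series cf I J U n v" and ?L = "L2_set (\<lambda>a. cmod (v a)) {..<n}"
  have "(\<Sum>a<n. (cmod (L a))\<^sup>2) \<le> (\<Sum>a<n. (cmod (v a))\<^sup>2)"
  proof (rule average_limit)
    show "(\<lambda>k. \<Sum>a<n. (cmod (?S (Suc k) a))\<^sup>2) \<longlonglongrightarrow> (\<Sum>a<n. (cmod (L a))\<^sup>2)"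
      by (intro tendsto_intros LIMSEQ_Suc L) simp
    show "0 \<le> (\<Sum>a<n. (cmod (?S (Suc m) a))\<^sup>2)" for m by (simp add: sum_nonneg)
    show "(\<Sum>m<k. \<Sum>a<n. (cmod (?S (Suc m) a))\<^sup>2) \<le> real k * (\<Sum>a<n. (cmod (v a))\<^sup>2)" for k
      by (rule schur_seriesD(2)[OF s U r])
  qed
  then show "L2_set (\<lambda>a. cmod (L a)) {..<n} \<le> ?L" unfolding L2_set_def by (rule real_sqrt_le_mono)
  have tail: "L2_set (\<lambda>a. cmod (?S (k + m) a - ?S k a)) {..<n} \<le> r ^ k / (1 - r) * ?L" for m
  proof -
    \<comment> \<open>The exact partial geometric sum makes the induction go through; it is relaxed
      only afterwards.\<close>
    have "L2_set (\<lambda>a. cmod (?S (k + m) a - ?S k a)) {..<n} \<le> (r ^ k * (1 - r ^ m) / (1 - r)) * ?L"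
    proof (induction m)
      case 0
      show ?case by (simp add: L2_set_0')
    next
      case (Suc m)
      have "L2_set (\<lambda>a. cmod (?S (k + Suc m) a - ?S k a)) {..<n}
        = L2_set (\<lambda>a. cmod ((?S (Suc (k + m)) a - ?S (k + m) a) + (?S (k + m) a - ?S k a))) {..<n}" by simp
      also have "\<dots> \<le> L2_set (\<lambda>a. cmod (?S (Suc (k + m)) a - ?S (k + m) a)) {..<n} + L2_set (\<lambda>a. cmod (?S (k + m) a - ?S k a)) {..<n}"
        by (rule L2_set_norm_triangle)
      also have "\<dots> \<le> r ^ (k + m) * ?L + (r ^ k * (1 - r ^ m) / (1 - r)) * ?L"
        by (intro add_mono Suc schur_series_increment[OF s U r])
      also have "\<dots> = (r ^ k * (1 - r ^ Suc m) / (1 - r)) * ?L" using r by (simp add: field_simps power_add)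
      finally show ?case .
    qed
    also have "\<dots> \<le> r ^ k / (1 - r) * ?L"
      by (intro mult_right_mono divide_right_mono L2_set_nonneg) (use r in \<open>auto simp: mult_left_le power_le_one\<close>)
    finally show ?thesis .
  qed
  have "(\<lambda>m. ?S (k + m) a) \<longlonglongrightarrow> L a" if "a < n" for a
    using LIMSEQ_ignore_initial_segment[OF L[OF that], of k] by (simp add: add.commute)
  then have "(\<lambda>m. L2_set (\<lambda>a. cmod (?S (k + m) a - ?S k a)) {..<n}) \<longlonglongrightarrow> L2_set (\<lambda>a. cmod (L a - ?S k a)) {..<n}"
    unfolding L2_set_def by (intro tendsto_intros) simp
  then show "L2_set (\<lambda>a. cmod (L a - ?S k a)) {..<n} \<le> r ^ k / (1 - r) * ?L"
    by (rule LIMSEQ_le_const2) (use tail in blast)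
qed

lemma euclid_norm_vec: "euclid_norm (vec n v) = L2_set (\<lambda>a. cmod (v a)) {..<n}"
  unfolding euclid_norm_def by (rule L2_set_cong) simp_all

lemma block_bounded_scale:
  assumes U: "block_bounded r n I J U"
    and eq: "\<And>i j a b. i < I \<Longrightarrow> j < J \<Longrightarrow> a < n \<Longrightarrow> b < n \<Longrightarrow> U' i j $$ (a, b) = of_real t * U i j $$ (a, b)"
  shows "block_bounded (t * r) n I J U'"
  unfolding block_bounded_def
proof
  fix \<zeta> :: "nat \<Rightarrow> nat \<Rightarrow> complex"
  have "(\<Sum>i<I. \<Sum>a<n. (cmod (\<Sum>j<J. \<Sum>b<n. U' i j $$ (a, b) * \<zeta> j b))\<^sup>2)
    = (\<Sum>i<I. \<Sum>a<n. t\<^sup>2 * (cmod (\<Sum>j<J. \<Sum>b<n. U i j $$ (a, b) * \<zeta> j b))\<^sup>2)"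
  proof (intro sum.cong refl)
    fix i a assume ia: "i \<in> {..<I}" "a \<in> {..<n}"
    have "(\<Sum>j<J. \<Sum>b<n. U' i j $$ (a, b) * \<zeta> j b) = (\<Sum>j<J. \<Sum>b<n. of_real t * (U i j $$ (a, b) * \<zeta> j b))"
      by (intro sum.cong refl) (use ia eq in \<open>simp add: mult.assoc\<close>)
    also have "\<dots> = of_real t * (\<Sum>j<J. \<Sum>b<n. U i j $$ (a, b) * \<zeta> j b)" by (simp only: sum_distrib_left)
    finally show "(cmod (\<Sum>j<J. \<Sum>b<n. U' i j $$ (a, b) * \<zeta> j b))\<^sup>2 = t\<^sup>2 * (cmod (\<Sum>j<J. \<Sum>b<n. U i j $$ (a, b) * \<zeta> j b))\<^sup>2"
      by (simp add: norm_mult power_mult_distrib)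
  qed
  also have "\<dots> = t\<^sup>2 * (\<Sum>i<I. \<Sum>a<n. (cmod (\<Sum>j<J. \<Sum>b<n. U i j $$ (a, b) * \<zeta> j b))\<^sup>2)" by (simp only: sum_distrib_left)
  also have "\<dots> \<le> t\<^sup>2 * (r\<^sup>2 * (\<Sum>j<J. \<Sum>b<n. (cmod (\<zeta> j b))\<^sup>2))"
    by (intro mult_left_mono U[unfolded block_bounded_def, rule_format]) simp
  finally show "(\<Sum>i<I. \<Sum>a<n. (cmod (\<Sum>j<J. \<Sum>b<n. U' i j $$ (a, b) * \<zeta> j b))\<^sup>2)
    \<le> (t * r)\<^sup>2 * (\<Sum>j<J. \<Sum>b<n. (cmod (\<zeta> j b))\<^sup>2)" by (simp add: power_mult_distrib mult.assoc)
qed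

lemma block_bounded_mono:
  assumes "block_bounded r n I J U" "0 \<le> r" "r \<le> r'"
  shows "block_bounded r' n I J U"
  unfolding block_bounded_def
proof
  fix \<zeta> :: "nat \<Rightarrow> nat \<Rightarrow> complex"
  have "(\<Sum>i<I. \<Sum>a<n. (cmod (\<Sum>j<J. \<Sum>b<n. U i j $$ (a, b) * \<zeta> j b))\<^sup>2) \<le> r\<^sup>2 * (\<Sum>j<J. \<Sum>b<n. (cmod (\<zeta> j b))\<^sup>2)"
    by (rule assms(1)[unfolded block_bounded_def, rule_format])
  also have "\<dots> \<le> r'\<^sup>2 * (\<Sum>j<J. \<Sum>b<n. (cmod (\<zeta> j b))\<^sup>2)"
    using assms(2,3) by (intro mult_right_mono power_mono sum_nonneg) auto
  finally show "(\<Sum>i<I. \<Sum>a<n. (cmod (\<Sum>j<J. \<Sum>b<n. U i j $$ (a, b) * \<zeta> j b))\<^sup>2) \<le> r'\<^sup>2 * (\<Sum>j<J. \<Sum>b<n. (cmod (\<zeta> j b))\<^sup>2)" .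
qed

text \<open>The basic set of \<delta> / \<rho>, with \<rho> between the bound at \<open>l\<close>
  and 1, is a neighbourhood of \<open>l\<close> on which \<delta> is bounded by \<rho>, so the
  partial sums, which are free polynomials, converge uniformly there. The factor \<open>c\<close> is
  applied to the sum and not to the coefficients, which keep the bounds of
  \<open>schur_series\<close>.\<close>

lemma schur_free_holomorphic:
  fixes D :: "'d::finite free_poly mat"
  assumes s: "schur_series (dim_row D) (dim_col D) cf" and c: "0 \<le> c"
  shows "\<exists>F. free_holomorphic (basic_set D) F \<and> (\<forall>x\<in>basic_set D. op_norm (F x) \<le> c \<and>
    (\<forall>a<level x. \<forall>b<level x. (\<lambda>k. of_real c * free_eval (series_poly D cf k) x $$ (a, b)) \<longlonglongrightarrow> F x $$ (a, b)))"
proof -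
  let ?I = "dim_row D" and ?J = "dim_col D"
  define F where "F x = mat (level x) (level x) (\<lambda>(a, b). of_real c * lim (\<lambda>k. free_eval (series_poly D cf k) x $$ (a, b)))"
    for x :: "'d \<Rightarrow> complex mat"
  have F: "F x \<in> carrier_mat (level x) (level x)" for x by (simp add: F_def)
  have conv: "(\<lambda>k. free_eval (series_poly D cf k) x $$ (a, b)) \<longlonglongrightarrow> lim (\<lambda>k. free_eval (series_poly D cf k) x $$ (a, b))"
    if x: "x \<in> matrix_universe" and r: "0 \<le> r" "r < 1" and U: "block_bounded r (level x) ?I ?J (\<lambda>i j. free_eval (D $$ (i, j)) x)"
      and ab: "a < level x" "b < level x" for x r a b
  proof -
    \<comment> \<open>Applying the series to the unit vector of index \<open>b\<close> reads off
      column \<open>b\<close>.\<close>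
    have "convergent (\<lambda>k. word_series cf ?I ?J (\<lambda>i j. free_eval (D $$ (i, j)) x) (level x) (\<lambda>b'. if b' = b then 1 else 0) k a)"
      by (rule schur_series_convergent[OF s U r ab(1)])
    moreover have "word_series cf ?I ?J (\<lambda>i j. free_eval (D $$ (i, j)) x) (level x) (\<lambda>b'. if b' = b then 1 else 0) k a
      = free_eval (series_poly D cf k) x $$ (a, b)" for k
      unfolding series_poly_action[OF x ab(1)] using ab(2) by (simp add: mult_delta_right)
    ultimately show ?thesis by (simp add: convergent_LIMSEQ_iff)
  qed
  have bounds: "op_norm (F x) \<le> c" "op_norm (F x - free_eval (Poly_Mapping.single 0 (of_real c) * series_poly D cf k) x) \<le> c * (r ^ k / (1 - r))"
    if x: "x \<in> matrix_universe" and r: "0 \<le> r" "r < 1" and U: "block_bounded r (level x) ?I ?J (\<lambda>i j. free_eval (D $$ (i, j)) x)"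
    for x r k
  proof -
    let ?n = "level x" and ?M = "\<lambda>k. free_eval (series_poly D cf k) x"
    let ?Q = "free_eval (Poly_Mapping.single 0 (of_real c) * series_poly D cf k) x"
    have Q: "?Q \<in> carrier_mat ?n ?n" by (rule free_eval_carrier)
    have Qi: "?Q $$ (a, b) = of_real c * ?M k $$ (a, b)" if "a < ?n" "b < ?n" for a b
      unfolding free_eval_const_mult[OF x] using that carrier_matD[OF free_eval_carrier[of "series_poly D cf k" x]] by simp
    have key: "euclid_norm (F x *\<^sub>v v) \<le> c * euclid_norm v \<and> euclid_norm ((F x - ?Q) *\<^sub>v v) \<le> c * (r ^ k / (1 - r)) * euclid_norm v"
      if v: "v \<in> carrier_vec ?n" for v
    proof -
      let ?v = "vec_index v"
      let ?S = "word_series cf ?I ?J (\<lambda>i j. free_eval (D $$ (i, j)) x) ?n ?v"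
      define L where "L a = (\<Sum>b<?n. lim (\<lambda>k. ?M k $$ (a, b)) * ?v b)" for a
      have lim: "(\<lambda>k. ?S k a) \<longlonglongrightarrow> L a" if a: "a < ?n" for a
        unfolding series_poly_action[OF x a] L_def
        by (intro tendsto_sum tendsto_mult tendsto_const conv[OF x r U a]) simp
      note B = schur_series_limit_bounds[OF s U r lim]
      have ev: "euclid_norm v = L2_set (\<lambda>a. cmod (?v a)) {..<?n}" using v by (simp add: euclid_norm_def)
      have "F x *\<^sub>v v = vec ?n (\<lambda>a. of_real c * L a)"
      proof (rule eq_vecI)
        fix a assume "a < dim_vec (vec ?n (\<lambda>a. of_real c * L a))"
        then have a: "a < ?n" by simp
        have "vec_index (F x *\<^sub>v v) a = (\<Sum>b<?n. F x $$ (a, b) * ?v b)" by (rule mult_mat_vec_index[OF F v a])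
        also have "\<dots> = of_real c * L a"
          unfolding L_def sum_distrib_left by (intro sum.cong refl) (use a in \<open>simp add: F_def mult.assoc\<close>)
        finally show "vec_index (F x *\<^sub>v v) a = vec_index (vec ?n (\<lambda>a. of_real c * L a)) a" using a by simp
      qed (use carrier_matD[OF F] in simp)
      then have "euclid_norm (F x *\<^sub>v v) = c * L2_set (\<lambda>a. cmod (L a)) {..<?n}"
        unfolding L2_set_right_distrib[OF c] by (simp add: euclid_norm_vec norm_mult c)
      also have "\<dots> \<le> c * euclid_norm v" unfolding ev by (intro mult_left_mono B(1) c)
      finally have 1: "euclid_norm (F x *\<^sub>v v) \<le> c * euclid_norm v" .
      have "(F x - ?Q) *\<^sub>v v = vec ?n (\<lambda>a. of_real c * (L a - ?S k a))"
      proof (rule eq_vecI)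
        fix a assume "a < dim_vec (vec ?n (\<lambda>a. of_real c * (L a - ?S k a)))"
        then have a: "a < ?n" by simp
        have "vec_index ((F x - ?Q) *\<^sub>v v) a = (\<Sum>b<?n. (F x - ?Q) $$ (a, b) * ?v b)"
          by (rule mult_mat_vec_index[OF minus_carrier_mat[OF Q] v a])
        also have "\<dots> = (\<Sum>b<?n. of_real c * (lim (\<lambda>k. ?M k $$ (a, b)) * ?v b) - of_real c * (?M k $$ (a, b) * ?v b))"
        proof (rule sum.cong[OF refl])
          fix b assume "b \<in> {..<?n}"
          then have b: "b < ?n" by simp
          have "(F x - ?Q) $$ (a, b) = F x $$ (a, b) - ?Q $$ (a, b)"
            by (rule index_minus_mat(1)) (use a b carrier_matD[OF Q] in simp_all)
          also have "\<dots> = of_real c * lim (\<lambda>k. ?M k $$ (a, b)) - of_real c * ?M k $$ (a, b)"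
            unfolding Qi[OF a b] using a b by (simp add: F_def)
          finally show "(F x - ?Q) $$ (a, b) * ?v b
            = of_real c * (lim (\<lambda>k. ?M k $$ (a, b)) * ?v b) - of_real c * (?M k $$ (a, b) * ?v b)"
            by (simp only: left_diff_distrib mult.assoc)
        qed
        also have "\<dots> = of_real c * (L a - ?S k a)"
          unfolding series_poly_action[OF x a] L_def by (simp only: sum_subtractf sum_distrib_left right_diff_distrib)
        finally show "vec_index ((F x - ?Q) *\<^sub>v v) a = vec_index (vec ?n (\<lambda>a. of_real c * (L a - ?S k a))) a" using a by simp
      qed (use carrier_matD[OF Q] in simp)
      then have "euclid_norm ((F x - ?Q) *\<^sub>v v) = c * L2_set (\<lambda>a. cmod (L a - ?S k a)) {..<?n}"
        unfolding L2_set_right_distrib[OF c] by (simp add: euclid_norm_vec norm_mult c)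
      also have "\<dots> \<le> c * (r ^ k / (1 - r) * euclid_norm v)" unfolding ev by (intro mult_left_mono B(2) c)
      finally have 2: "euclid_norm ((F x - ?Q) *\<^sub>v v) \<le> c * (r ^ k / (1 - r)) * euclid_norm v" by (simp only: mult.assoc)
      from 1 2 show ?thesis ..
    qed
    show "op_norm (F x) \<le> c" by (rule op_norm_le[OF c]) (use key carrier_matD[OF F] in simp)
    show "op_norm (F x - ?Q) \<le> c * (r ^ k / (1 - r))"
      by (rule op_norm_le) (use key c r carrier_matD[OF Q] in \<open>simp_all\<close>)
  qed
  have hol: "free_holomorphic (basic_set D) F"
    unfolding free_holomorphic_def
  proof (intro conjI ballI F)
    show "openin free_topology (basic_set D)" unfolding free_topology_def by (rule topology_generated_by_Basis) simp
    fix l assume l: "l \<in> basic_set D"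
    then obtain r where lu: "l \<in> matrix_universe" and r: "0 \<le> r" "r < 1"
      "block_bounded r (level l) ?I ?J (\<lambda>i j. free_eval (D $$ (i, j)) l)" unfolding basic_set_iff by blast
    define \<rho> where "\<rho> = (r + 1) / 2"
    have \<rho>: "0 < \<rho>" "r < \<rho>" "\<rho> < 1" using r by (simp_all add: \<rho>_def)
    define E where "E = map_mat (\<lambda>q. Poly_Mapping.single 0 (of_real (1 / \<rho>)) * q) D"
    have Ed: "dim_row E = ?I" "dim_col E = ?J" by (simp_all add: E_def)
    have Ee: "free_eval (E $$ (i, j)) x $$ (a, b) = of_real (1 / \<rho>) * free_eval (D $$ (i, j)) x $$ (a, b)"
      if "x \<in> matrix_universe" "i < ?I" "j < ?J" "a < level x" "b < level x" for x i j a b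
    proof -
      have "E $$ (i, j) = Poly_Mapping.single 0 (of_real (1 / \<rho>)) * D $$ (i, j)" using that by (simp add: E_def)
      then show ?thesis using that carrier_matD[OF free_eval_carrier[of "D $$ (i, j)" x]] free_eval_const_mult[OF that(1)] by simp
    qed
    have lE: "l \<in> basic_set E"
      unfolding basic_set_iff Ed
    proof (intro conjI exI[of _ "1 / \<rho> * r"] lu)
      show "0 \<le> 1 / \<rho> * r" "1 / \<rho> * r < 1" using r \<rho> by simp_all
      show "block_bounded (1 / \<rho> * r) (level l) ?I ?J (\<lambda>i j. free_eval (E $$ (i, j)) l)"
        by (rule block_bounded_scale[OF r(3)]) (rule Ee[OF lu])
    qed
    have EB: "x \<in> matrix_universe \<and> block_bounded \<rho> (level x) ?I ?J (\<lambda>i j. free_eval (D $$ (i, j)) x)" if x: "x \<in> basic_set E" for x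
    proof -
      obtain r' where xu: "x \<in> matrix_universe" and r': "0 \<le> r'" "r' < 1"
        "block_bounded r' (level x) ?I ?J (\<lambda>i j. free_eval (E $$ (i, j)) x)" using x unfolding basic_set_iff Ed by blast
      have "block_bounded (\<rho> * r') (level x) ?I ?J (\<lambda>i j. free_eval (D $$ (i, j)) x)"
        by (rule block_bounded_scale[OF r'(3)]) (use \<rho> Ee[OF xu] in simp)
      then have "block_bounded \<rho> (level x) ?I ?J (\<lambda>i j. free_eval (D $$ (i, j)) x)"
        by (rule block_bounded_mono) (use \<rho> r' in \<open>auto simp: mult_left_le\<close>)
      with xu show ?thesis ..
    qed
    show "\<exists>E. l \<in> basic_set E \<and> basic_set E \<subseteq> basic_set D \<and> (\<forall>\<epsilon>>0. \<exists>q. \<forall>x\<in>basic_set E. op_norm (F x - free_eval q x) < \<epsilon>)"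
    proof (intro exI[of _ E] conjI lE subsetI allI impI)
      fix x assume "x \<in> basic_set E"
      from EB[OF this] show "x \<in> basic_set D" unfolding basic_set_iff using \<rho> by (auto intro!: exI[of _ \<rho>])
    next
      fix \<epsilon> :: real assume \<epsilon>: "\<epsilon> > 0"
      have "(\<lambda>k. c * (\<rho> ^ k / (1 - \<rho>))) \<longlonglongrightarrow> c * (0 / (1 - \<rho>))"
        using \<rho> by (intro tendsto_intros LIMSEQ_power_zero) auto
      then have "\<forall>\<^sub>F k in sequentially. c * (\<rho> ^ k / (1 - \<rho>)) < \<epsilon>" by (rule order_tendstoD(2)) (use \<epsilon> in simp)
      then obtain k where k: "c * (\<rho> ^ k / (1 - \<rho>)) < \<epsilon>" unfolding eventually_sequentially by blast
      show "\<exists>q. \<forall>x\<in>basic_set E. op_norm (F x - free_eval q x) < \<epsilon>"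
      proof (intro exI[of _ "Poly_Mapping.single 0 (of_real c) * series_poly D cf k"] ballI)
        fix x assume "x \<in> basic_set E"
        from bounds(2)[OF conjunct1[OF EB[OF this]] _ _ conjunct2[OF EB[OF this]], of k] \<rho>
        have "op_norm (F x - free_eval (Poly_Mapping.single 0 (of_real c) * series_poly D cf k) x) \<le> c * (\<rho> ^ k / (1 - \<rho>))" by simp
        with k show "op_norm (F x - free_eval (Poly_Mapping.single 0 (of_real c) * series_poly D cf k) x) < \<epsilon>" by linarith
      qed
    qed
  qed
  show ?thesis
  proof (intro exI[of _ F] conjI hol ballI allI impI)
    fix x assume "x \<in> basic_set D"
    then obtain r where x: "x \<in> matrix_universe" and r: "0 \<le> r" "r < 1"
      "block_bounded r (level x) ?I ?J (\<lambda>i j. free_eval (D $$ (i, j)) x)" unfolding basic_set_iff by blast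
    show "op_norm (F x) \<le> c" by (rule bounds(1)[OF x r])
    fix a b assume ab: "a < level x" "b < level x"
    have "F x $$ (a, b) = of_real c * lim (\<lambda>k. free_eval (series_poly D cf k) x $$ (a, b))" using ab by (simp add: F_def)
    then show "(\<lambda>k. of_real c * free_eval (series_poly D cf k) x $$ (a, b)) \<longlonglongrightarrow> F x $$ (a, b)"
      using tendsto_mult[OF tendsto_const[of "of_real c"] conv[OF x r ab]] by simp
  qed
qed

section \<open>Interpolation on the variety\<close>

text \<open>The error bound \<open>err\<close> depends on the point, the word length and \<epsilon>
  but not on the colligation, which is why limits of coefficients alone preserve it. The order
  matters: for fixed word length the subsequence sends \<epsilon> to 0, and only then does the
  length tend to infinity.\<close>

lemma schur_interpolant:
  fixes D :: "'d::finite free_poly mat" and z :: "nat \<Rightarrow> complex ^ 'd"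
  assumes f: "f \<in> Hol V" and nrm: "variety_norm (map_mat abelianize D) V f \<le> ennreal c" and c: "0 \<le> c"
    and z: "\<And>m. z m \<in> V" and VD: "V \<subseteq> {z. scalar_tuple z \<in> basic_set D}"
  shows "\<exists>cf. schur_series (dim_row D) (dim_col D) cf \<and>
    (\<forall>m. (\<lambda>k. word_series cf (dim_row D) (dim_col D) (\<lambda>i j. mat 1 1 (\<lambda>_. free_scalar (D $$ (i, j)) (z m))) 1
      (\<lambda>_. of_real c) (Suc k) 0) \<longlonglongrightarrow> f (z m))"
proof -
  let ?I = "dim_row D" and ?J = "dim_col D"
  define \<delta> where "\<delta> m i j = free_scalar (D $$ (i, j)) (z m)" for m i j
  let ?U = "\<lambda>m i j. mat 1 1 (\<lambda>_. \<delta> m i j)"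
  have "\<exists>r. 0 \<le> r \<and> r < 1 \<and> block_bounded r 1 ?I ?J (?U m)" for m
  proof -
    have "scalar_tuple (z m) \<in> basic_set D" using z VD by blast
    then obtain r where "0 \<le> r" "r < 1" "block_bounded r (level (scalar_tuple (z m))) ?I ?J (\<lambda>i j. free_eval (D $$ (i, j)) (scalar_tuple (z m)))"
      unfolding basic_set_iff by blast
    then show ?thesis unfolding free_eval_scalar scalar_tuple_universe(2) \<delta>_def free_scalar_def by (intro exI[of _ r] conjI)
  qed
  then have "\<forall>m. \<exists>r. 0 \<le> r \<and> r < 1 \<and> block_bounded r 1 ?I ?J (?U m)" ..
  from choice[OF this] obtain r where r': "\<forall>m. 0 \<le> r m \<and> r m < 1 \<and> block_bounded (r m) 1 ?I ?J (?U m)" ..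
  have r: "0 \<le> r m" "r m < 1" and U: "block_bounded (r m) 1 ?I ?J (?U m)" for m using r' by simp_all
  have r2: "0 < 1 - (r m)\<^sup>2" for m using r[of m] by (simp add: abs_square_less_1)
  let ?W = "\<lambda>cf m k. word_series cf ?I ?J (?U m) 1 (\<lambda>_. of_real c) (Suc k) 0"
  define err where "err m k \<epsilon> = ((r m)\<^sup>2) ^ k * ((c\<^sup>2 + \<epsilon>) / (1 - (r m)\<^sup>2)) + 2 * (\<epsilon> / (1 - (r m)\<^sup>2))" for m k \<epsilon>
  have "\<forall>n. \<exists>cf. schur_series ?I ?J cf \<and> (\<forall>w. set w \<subseteq> {..<?I} \<times> {..<?J} \<longrightarrow> cmod (cf w) \<le> 1) \<and>
    (\<forall>m\<le>n. \<forall>k. (cmod (f (z m) - ?W cf m k))\<^sup>2 \<le> err m k (1 / real (Suc n)))"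
  proof
    fix n
    let ?N = "Suc n" and ?\<epsilon> = "1 / real (Suc n)"
    \<comment> \<open>One contraction constant for the first \<open>n + 1\<close> points; over the
      whole sequence the supremum may be 1.\<close>
    define \<rho> where "\<rho> = Max (r ` {..n})"
    have \<rho>r: "r a \<le> \<rho>" if "a < ?N" for a unfolding \<rho>_def using that by (intro Max_ge) auto
    have "0 \<le> \<rho>" by (rule order_trans[OF r(1)[of 0] \<rho>r]) simp
    moreover have "\<rho> < 1" unfolding \<rho>_def using r(2) by (subst Max_less_iff) auto
    ultimately have \<rho>: "0 \<le> \<rho>" "\<rho> < 1" .
    have "\<exists>(M :: nat) g. \<forall>\<gamma>. (cmod (\<Sum>a<?N. \<gamma> a * f (z a)))\<^sup>2 + (\<Sum>j<?J. \<Sum>s<M. (cmod (\<Sum>a<?N. \<gamma> a * g a j s))\<^sup>2)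
      \<le> c\<^sup>2 * (cmod (\<Sum>a<?N. \<gamma> a))\<^sup>2 + (\<Sum>i<?I. \<Sum>s<M. (cmod (\<Sum>a<?N. \<gamma> a * (\<Sum>j<?J. \<delta> a i j * g a j s)))\<^sup>2)
        + ?\<epsilon> * (\<Sum>a<?N. (cmod (\<gamma> a))\<^sup>2)"
    proof (rule schur_kernel_approximation[OF \<rho>])
      show "0 < ?\<epsilon>" by simp
      fix a :: nat and \<zeta> :: "nat \<Rightarrow> complex" assume a: "a < ?N"
      have "(\<Sum>i<?I. (cmod (\<Sum>j<?J. \<delta> a i j * \<zeta> j))\<^sup>2) \<le> (r a)\<^sup>2 * (\<Sum>j<?J. (cmod (\<zeta> j))\<^sup>2)"
        using U[of a, unfolded block_bounded_def, rule_format, of "\<lambda>j _. \<zeta> j"] by simp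
      also have "\<dots> \<le> \<rho>\<^sup>2 * (\<Sum>j<?J. (cmod (\<zeta> j))\<^sup>2)"
        by (intro mult_right_mono power_mono \<rho>r a r sum_nonneg) simp
      finally show "(\<Sum>i<?I. (cmod (\<Sum>j<?J. \<delta> a i j * \<zeta> j))\<^sup>2) \<le> \<rho>\<^sup>2 * (\<Sum>j<?J. (cmod (\<zeta> j))\<^sup>2)" .
    next
      fix K :: "nat \<Rightarrow> nat \<Rightarrow> complex" and q :: real
      assume K: "\<And>a b. K b a = cnj (K a b)" "\<And>\<gamma> a. a < ?N \<Longrightarrow> \<gamma> a \<noteq> 0 \<Longrightarrow> 0 < qform ?N K \<gamma>" "0 \<le> q" "q < 1"
        "\<And>\<xi>. (\<Sum>i<?I. qform ?N K (\<lambda>a. \<Sum>j<?J. \<delta> a i j * \<xi> j a)) \<le> q\<^sup>2 * (\<Sum>j<?J. qform ?N K (\<xi> j))"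
      show "qform ?N K (\<lambda>a. f (z a)) \<le> c\<^sup>2 * qform ?N K (\<lambda>_. 1)"
      proof (rule pick_positivity[OF f nrm c _ _ _ _ K(3,4)])
        show "z a \<in> V" for a by (rule z)
        show "1 \<le> ?N" by simp
        show "K b a = cnj (K a b)" for a b by (rule K(1))
        show "0 < qform ?N K \<gamma>" if "a < ?N" "\<gamma> a \<noteq> 0" for \<gamma> a using that by (rule K(2))
        show "(\<Sum>i<?I. qform ?N K (\<lambda>a. \<Sum>j<?J. free_scalar (D $$ (i, j)) (z a) * \<xi> j a)) \<le> q\<^sup>2 * (\<Sum>j<?J. qform ?N K (\<xi> j))" for \<xi>
          using K(5) unfolding \<delta>_def .
      qed
    qed
    then obtain M :: nat and g where g: "\<forall>\<gamma>. (cmod (\<Sum>a<?N. \<gamma> a * f (z a)))\<^sup>2 + (\<Sum>j<?J. \<Sum>s<M. (cmod (\<Sum>a<?N. \<gamma> a * g a j s))\<^sup>2)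
      \<le> c\<^sup>2 * (cmod (\<Sum>a<?N. \<gamma> a))\<^sup>2 + (\<Sum>i<?I. \<Sum>s<M. (cmod (\<Sum>a<?N. \<gamma> a * (\<Sum>j<?J. \<delta> a i j * g a j s)))\<^sup>2)
        + ?\<epsilon> * (\<Sum>a<?N. (cmod (\<gamma> a))\<^sup>2)" by (elim exE)
    have "0 \<le> ?\<epsilon>" by simp
    from realization[OF this g[THEN spec]] obtain A B C E where col: "colligation ?I ?J M A B C E"
      and near: "\<forall>a<?N. \<forall>\<alpha> h. (cmod (f (z a) - colligation.out_map ?I M A B \<alpha> (\<lambda>i s. \<Sum>j<?J. \<delta> a i j * h j s)))\<^sup>2
      + (\<Sum>j<?J. \<Sum>t<M. (cmod (g a j t - colligation.state_map ?I M C E \<alpha> (\<lambda>i s. \<Sum>j<?J. \<delta> a i j * h j s) j t))\<^sup>2)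
      \<le> (cmod (complex_of_real c - \<alpha>))\<^sup>2 + ?\<epsilon> + (\<Sum>i<?I. \<Sum>s<M. (cmod (\<Sum>j<?J. \<delta> a i j * (g a j s - h j s)))\<^sup>2)"
      by (elim exE conjE)
    interpret colligation ?I ?J M A B C E by (rule col)
    show "\<exists>cf. schur_series ?I ?J cf \<and> (\<forall>w. set w \<subseteq> {..<?I} \<times> {..<?J} \<longrightarrow> cmod (cf w) \<le> 1) \<and>
      (\<forall>m\<le>n. \<forall>k. (cmod (f (z m) - ?W cf m k))\<^sup>2 \<le> err m k ?\<epsilon>)"
    proof (intro exI[of _ transfer_coef] conjI allI impI schur_series_transfer)
      fix w assume "set w \<subseteq> {..<?I} \<times> {..<?J}"
      moreover have "0 \<le> (\<Sum>j<?J. \<Sum>t<M. (cmod (state_coef w j t))\<^sup>2)" by (intro sum_nonneg) simp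
      ultimately have "(cmod (transfer_coef w))\<^sup>2 \<le> 1" using coef_bound[of w] by linarith
      then show "cmod (transfer_coef w) \<le> 1" using power2_le_imp_le[of "cmod (transfer_coef w)" 1] by simp
    next
      fix m k assume m: "m \<le> n"
      then have mN: "m < ?N" by simp
      show "(cmod (f (z m) - ?W transfer_coef m k))\<^sup>2 \<le> err m k ?\<epsilon>"
        unfolding err_def by (rule interpolation_error[OF U r]) (simp, rule near[rule_format, OF mN])
    qed
  qed
  from choice[OF this] obtain cs where cs: "\<forall>n. schur_series ?I ?J (cs n) \<and> (\<forall>w. set w \<subseteq> {..<?I} \<times> {..<?J} \<longrightarrow> cmod (cs n w) \<le> 1) \<and>
    (\<forall>m\<le>n. \<forall>k. (cmod (f (z m) - ?W (cs n) m k))\<^sup>2 \<le> err m k (1 / real (Suc n)))" ..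
  have cs1: "schur_series ?I ?J (cs n)" and cs2: "set w \<subseteq> {..<?I} \<times> {..<?J} \<Longrightarrow> cmod (cs n w) \<le> 1"
    and cs3: "m \<le> n \<Longrightarrow> (cmod (f (z m) - ?W (cs n) m k))\<^sup>2 \<le> err m k (1 / real (Suc n))" for n w m k
    using cs by simp_all
  let ?S = "{w. set w \<subseteq> {..<?I} \<times> {..<?J}}"
  have cnt: "countable ?S" by simp
  have "\<exists>\<phi>. strict_mono (\<phi> :: nat \<Rightarrow> nat) \<and> (\<forall>w\<in>?S. \<exists>l. (\<lambda>n. cs (\<phi> n) w) \<longlonglongrightarrow> l)"
  proof (rule function_convergent_subsequence[OF cnt, of cs 1])
    fix n w assume "w \<in> ?S"
    then show "norm (cs n w) \<le> 1" by (intro cs2) simp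
  qed blast
  then obtain \<phi> where \<phi>: "strict_mono (\<phi> :: nat \<Rightarrow> nat)" "\<forall>w\<in>?S. \<exists>l. (\<lambda>n. cs (\<phi> n) w) \<longlonglongrightarrow> l"
    by (elim exE conjE)
  from bchoice[OF \<phi>(2)] obtain cf where cf: "\<forall>w\<in>?S. (\<lambda>n. cs (\<phi> n) w) \<longlonglongrightarrow> cf w" ..
  have sc: "schur_series ?I ?J cf"
  proof (rule schur_series_limit)
    show "schur_series ?I ?J (cs (\<phi> n))" for n by (rule cs1)
    show "(\<lambda>n. cs (\<phi> n) w) \<longlonglongrightarrow> cf w" if "set w \<subseteq> {..<?I} \<times> {..<?J}" for w using cf that by simp
  qed
  have bound: "(cmod (f (z m) - ?W cf m k))\<^sup>2 \<le> err m k 0" for m k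
  proof -
    have "(\<lambda>n. ?W (cs (\<phi> n)) m k) \<longlonglongrightarrow> ?W cf m k"
      unfolding word_series_def by (intro tendsto_intros cf[rule_format]) (simp add: words_def)
    then have 1: "(\<lambda>n. (cmod (f (z m) - ?W (cs (\<phi> n)) m k))\<^sup>2) \<longlonglongrightarrow> (cmod (f (z m) - ?W cf m k))\<^sup>2"
      by (intro tendsto_intros)
    have "(\<lambda>n. 1 / real (Suc n)) \<longlonglongrightarrow> 0" using LIMSEQ_inverse_real_of_nat by (simp add: inverse_eq_divide)
    from LIMSEQ_subseq_LIMSEQ[OF this \<phi>(1)] have "(\<lambda>n. 1 / real (Suc (\<phi> n))) \<longlonglongrightarrow> 0" by (simp add: o_def)
    then have 2: "(\<lambda>n. err m k (1 / real (Suc (\<phi> n)))) \<longlonglongrightarrow> err m k 0"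
      unfolding err_def by (intro tendsto_intros) (use r2[of m] in simp_all)
    show ?thesis
    \<comment> \<open>The point of index \<open>m\<close> is among those interpolated by
      \<open>cs n\<close> once \<open>m \<le> n\<close>, and passing to a subsequence only raises
      indices.\<close>
    proof (rule LIMSEQ_le[OF 1 2], intro exI[of _ m] allI impI)
      fix n assume "m \<le> n"
      then have "m \<le> \<phi> n" using seq_suble[OF \<phi>(1), of n] by simp
      then show "(cmod (f (z m) - ?W (cs (\<phi> n)) m k))\<^sup>2 \<le> err m k (1 / real (Suc (\<phi> n)))" by (rule cs3)
    qed
  qed
  have lim: "(\<lambda>k. ?W cf m k) \<longlonglongrightarrow> f (z m)" for m
  proof -
    have e0: "(\<lambda>k. err m k 0) \<longlonglongrightarrow> 0"
    proof -
      have "(\<lambda>k. ((r m)\<^sup>2) ^ k * ((c\<^sup>2 + 0) / (1 - (r m)\<^sup>2)) + 2 * (0 / (1 - (r m)\<^sup>2))) \<longlonglongrightarrow> 0 * ((c\<^sup>2 + 0) / (1 - (r m)\<^sup>2)) + 2 * (0 / (1 - (r m)\<^sup>2))"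
        by (intro tendsto_intros LIMSEQ_power_zero) (use r2[of m] in simp)
      then show ?thesis unfolding err_def by simp
    qed
    have "(\<lambda>k. (cmod (f (z m) - ?W cf m k))\<^sup>2) \<longlonglongrightarrow> 0"
    proof (rule tendsto_sandwich[OF _ _ tendsto_const e0])
      show "\<forall>\<^sub>F k in sequentially. 0 \<le> (cmod (f (z m) - ?W cf m k))\<^sup>2" by simp
      show "\<forall>\<^sub>F k in sequentially. (cmod (f (z m) - ?W cf m k))\<^sup>2 \<le> err m k 0" by (intro always_eventually allI bound)
    qed
    then have "(\<lambda>k. sqrt ((cmod (f (z m) - ?W cf m k))\<^sup>2)) \<longlonglongrightarrow> sqrt 0" by (rule tendsto_real_sqrt)
    then have "(\<lambda>k. f (z m) - ?W cf m k) \<longlonglongrightarrow> 0" by (simp add: tendsto_norm_zero_iff)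
    from tendsto_diff[OF tendsto_const[of "f (z m)"] this] show ?thesis by simp
  qed
  show ?thesis by (intro exI[of _ cf] conjI allI sc lim[unfolded \<delta>_def])
qed

text \<open>Serves to extend agreement with \<open>f\<close> from a dense sequence to all of
  \<open>V\<close>.\<close>

lemma Hol_continuous:
  assumes "f \<in> Hol V"
  shows "continuous_on V f"
  unfolding continuous_on_eq_continuous_within
proof
  fix z assume z: "z \<in> V"
  with assms have "\<exists>g. local_extension V f z g" unfolding Hol_def by blast
  then obtain g W where g: "z \<in> W" "holomorphic_several g W" "\<forall>w\<in>W \<inter> V. g w = f w"
    unfolding local_extension_def by (elim exE conjE)
  have W: "open W" using g(2) by (simp add: holomorphic_several_def)
  obtain c where "(g has_derivative (\<lambda>h. \<Sum>i\<in>UNIV. c $ i * h $ i)) (at z)"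
    using g(1,2) unfolding holomorphic_several_def by blast
  then have cg: "continuous (at z within V) g" by (rule continuous_at_imp_continuous_at_within[OF has_derivative_continuous])
  obtain e where e: "e > 0" "ball z e \<subseteq> W" using openE[OF W g(1)] by blast
  show "continuous (at z within V) f"
  proof (rule continuous_transform_within[OF cg e(1) z])
    fix w assume w: "w \<in> V" "dist w z < e"
    then have "w \<in> W" using e(2) by (auto simp: dist_commute)
    with w(1) show "g w = f w" using g(3) by blast
  qed
qed

theorem theorem10p18:
  fixes D :: "'d::finite free_poly mat" and p :: "'d comm_poly mat"
    and A V :: "(complex ^ 'd) set"
  assumes "p = map_mat abelianize D"
    and "algebraic_set A"
    and "V = A \<inter> comm_basic p"
  shows "(\<forall>f \<in> Hol_inf p V. \<exists>F. free_holomorphic (basic_set D) F \<and>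
            (\<forall>z\<in>V. F (scalar_tuple z) = mat 1 1 (\<lambda>_. f z)) \<and>
            sup_norm_on (basic_set D) F = variety_norm p V f) \<and>
         (\<forall>F f. free_holomorphic (basic_set D) F \<and> sup_norm_on (basic_set D) F < \<infinity> \<and>
            (\<forall>z\<in>V. mat 1 1 (\<lambda>_. f z) = F (scalar_tuple z)) \<longrightarrow>
            f \<in> Hol_inf p V \<and> variety_norm p V f \<le> sup_norm_on (basic_set D) F)"
proof -
  have VD: "V \<subseteq> {z. scalar_tuple z \<in> basic_set D}" using assms(1,3) by (auto simp: comm_basic_iff)
  have conv: "f \<in> Hol V \<and> variety_norm p V f \<le> sup_norm_on (basic_set D) F"
    if F: "free_holomorphic (basic_set D) F" and f: "\<forall>z\<in>V. mat 1 1 (\<lambda>_. f z) = F (scalar_tuple z)" for F f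
  proof
    note R = free_holomorphic_restriction[OF F VD f[rule_format]]
    show "f \<in> Hol V" by (rule R(1))
    show "variety_norm p V f \<le> sup_norm_on (basic_set D) F"
      unfolding variety_norm_def sup_norm_on_def
    proof (rule SUP_least)
      fix y assume "y \<in> subordinate_matrices p V"
      then have y: "y \<in> spectrum_in V" "subordinate V y" "y \<in> basic_set D"
        unfolding subordinate_matrices_def assms(1) comm_basic_matrices_eq by auto
      have vF: "variety_value V f y = F y" by (rule R(2)[OF _ y])
      show "ennreal (op_norm (variety_value V f y)) \<le> (SUP x\<in>basic_set D. ennreal (op_norm (F x)))"
        unfolding vF by (rule SUP_upper[OF y(3)])
    qed
  qed
  \<comment> \<open>Only one inequality is claimed here; the other is \<open>conv\<close> applied to
    the \<open>F\<close> obtained.\<close>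
  have ext: "\<exists>F. free_holomorphic (basic_set D) F \<and> (\<forall>z\<in>V. F (scalar_tuple z) = mat 1 1 (\<lambda>_. f z)) \<and>
      sup_norm_on (basic_set D) F \<le> variety_norm p V f" if f: "f \<in> Hol_inf p V" for f
  proof -
    have fH: "f \<in> Hol V" and fin: "variety_norm p V f < \<infinity>" using f by (auto simp: Hol_inf_def)
    define c where "c = enn2real (variety_norm p V f)"
    have c: "0 \<le> c" by (simp add: c_def)
    have cn: "variety_norm p V f = ennreal c" using fin by (simp add: c_def ennreal_enn2real)
    have bound: "sup_norm_on (basic_set D) F \<le> variety_norm p V f" if "\<forall>x\<in>basic_set D. op_norm (F x) \<le> c" for F
      unfolding sup_norm_on_def cn using that by (intro SUP_least ennreal_leI) simp
    show ?thesis
    proof (cases "V = {}")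
      case True
      \<comment> \<open>Without points of \<open>V\<close> there is no sequence to interpolate, and
        the zero series serves.\<close>
      have "schur_series (dim_row D) (dim_col D) (\<lambda>_. 0)"
        by (simp add: schur_series_def word_series_def sum_nonneg)
      from schur_free_holomorphic[OF this c] obtain F where "free_holomorphic (basic_set D) F" "\<forall>x\<in>basic_set D. op_norm (F x) \<le> c"
        by blast
      with bound True show ?thesis by (intro exI[of _ F]) simp
    next
      case False
      \<comment> \<open>\<open>schur_interpolant\<close> wants a sequence; a countable dense subset
        is enumerated, with repetitions if it is finite.\<close>
      obtain Z where Z: "countable Z" "Z \<subseteq> V" "V \<subseteq> closure Z" using separable by blast
      have Z0: "Z \<noteq> {}" using Z(3) False by auto
      define z where "z = from_nat_into Z"
      have zZ: "z m \<in> Z" for m unfolding z_def by (rule from_nat_into[OF Z0])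
      have rz: "range z = Z" unfolding z_def by (rule range_from_nat_into[OF Z0 Z(1)])
      have zV: "z m \<in> V" for m using zZ Z(2) by blast
      have nrm: "variety_norm (map_mat abelianize D) V f \<le> ennreal c" using cn assms(1) by simp
      from schur_interpolant[where z = z, OF fH nrm c zV VD] obtain cf where cf: "schur_series (dim_row D) (dim_col D) cf"
        "\<forall>m. (\<lambda>k. word_series cf (dim_row D) (dim_col D) (\<lambda>i j. mat 1 1 (\<lambda>_. free_scalar (D $$ (i, j)) (z m))) 1
          (\<lambda>_. of_real c) (Suc k) 0) \<longlonglongrightarrow> f (z m)" by (elim exE conjE)
      from schur_free_holomorphic[OF cf(1) c] obtain F where F: "free_holomorphic (basic_set D) F"
        and F': "\<forall>x\<in>basic_set D. op_norm (F x) \<le> c \<and>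
          (\<forall>a<level x. \<forall>b<level x. (\<lambda>k. of_real c * free_eval (series_poly D cf k) x $$ (a, b)) \<longlonglongrightarrow> F x $$ (a, b))"
        by (elim exE conjE)
      define g where "g w = F (scalar_tuple w) $$ (0, 0)" for w
      have Fg: "F (scalar_tuple w) = mat 1 1 (\<lambda>_. g w)" if "w \<in> V" for w
      proof -
        have "F (scalar_tuple w) \<in> carrier_mat (level (scalar_tuple w)) (level (scalar_tuple w))"
          using F VD that unfolding free_holomorphic_def by blast
        then show ?thesis unfolding scalar_tuple_universe(2) by (intro eq_matI) (auto simp: g_def)
      qed
      have gz: "g (z m) = f (z m)" for m
      proof -
        let ?x = "scalar_tuple (z m)"
        have xD: "?x \<in> basic_set D" using zV VD by blast
        have "(\<lambda>k. of_real c * free_eval (series_poly D cf k) ?x $$ (0, 0)) \<longlonglongrightarrow> g (z m)"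
          unfolding g_def using F' xD by simp
        then have 1: "(\<lambda>k. of_real c * free_eval (series_poly D cf (Suc k)) ?x $$ (0, 0)) \<longlonglongrightarrow> g (z m)" by (rule LIMSEQ_Suc)
        have l1: "0 < level ?x" by simp
        have eq: "word_series cf (dim_row D) (dim_col D) (\<lambda>i j. mat 1 1 (\<lambda>_. free_scalar (D $$ (i, j)) (z m))) 1 (\<lambda>_. of_real c) (Suc k) 0
          = of_real c * free_eval (series_poly D cf (Suc k)) ?x $$ (0, 0)" for k
          using series_poly_action[OF scalar_tuple_universe(1) l1, of cf D "\<lambda>_. of_real c" "Suc k"]
          unfolding free_eval_scalar[of "D $$ _"] free_scalar_def[symmetric] scalar_tuple_universe(2) by simp
        show ?thesis by (rule LIMSEQ_unique[OF 1 cf(2)[THEN spec, of m, unfolded eq]])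
      qed
      \<comment> \<open>Here \<open>conv\<close> is applied to \<open>F\<close> and its own
        restriction \<open>g\<close>, before \<open>g\<close> is known to equal
        \<open>f\<close>.\<close>
      have "g \<in> Hol V" by (rule conjunct1[OF conv[OF F]]) (simp add: Fg)
      then have cg: "continuous_on V (\<lambda>w. g w - f w)" by (intro continuous_on_diff Hol_continuous fH)
      have gf: "g w = f w" if w: "w \<in> V" for w
      proof -
        have "w \<in> closure Z" using Z(3) w by blast
        then obtain s where s: "\<forall>n. s n \<in> Z" "s \<longlonglongrightarrow> w" unfolding closure_sequential by blast
        have "(\<lambda>n. g (s n) - f (s n)) \<longlonglongrightarrow> g w - f w"
          by (rule continuous_on_tendsto_compose[OF cg s(2) w]) (rule always_eventually, use s(1) Z(2) in blast)
        moreover have "g (s n) - f (s n) = 0" for n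
        proof -
          have "s n \<in> range z" using s(1) rz by blast
          then obtain m where "s n = z m" by (elim rangeE)
          then show ?thesis using gz[of m] by simp
        qed
        ultimately have "(\<lambda>n::nat. 0) \<longlonglongrightarrow> g w - f w" by simp
        then show ?thesis by (simp add: LIMSEQ_const_iff)
      qed
      have "sup_norm_on (basic_set D) F \<le> variety_norm p V f" by (rule bound) (use F' in blast)
      with F Fg gf show ?thesis by (intro exI[of _ F]) simp
    qed
  qed
  show ?thesis
  proof (intro conjI ballI allI impI)
    fix f assume f: "f \<in> Hol_inf p V"
    from ext[OF f] obtain F where F: "free_holomorphic (basic_set D) F" "\<forall>z\<in>V. F (scalar_tuple z) = mat 1 1 (\<lambda>_. f z)"
      "sup_norm_on (basic_set D) F \<le> variety_norm p V f" by (elim exE conjE)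
    have "variety_norm p V f \<le> sup_norm_on (basic_set D) F"
      by (rule conjunct2[OF conv[OF F(1)]]) (use F(2) in simp)
    with F show "\<exists>F. free_holomorphic (basic_set D) F \<and> (\<forall>z\<in>V. F (scalar_tuple z) = mat 1 1 (\<lambda>_. f z)) \<and>
      sup_norm_on (basic_set D) F = variety_norm p V f" by (intro exI[of _ F] conjI antisym)
  next
    fix F f assume H: "free_holomorphic (basic_set D) F \<and> sup_norm_on (basic_set D) F < \<infinity> \<and>
      (\<forall>z\<in>V. mat 1 1 (\<lambda>_. f z) = F (scalar_tuple z))"
    have cv: "f \<in> Hol V \<and> variety_norm p V f \<le> sup_norm_on (basic_set D) F" by (rule conv[OF H[THEN conjunct1] H[THEN conjunct2, THEN conjunct2]])
    then show "variety_norm p V f \<le> sup_norm_on (basic_set D) F" ..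
    from cv H show "f \<in> Hol_inf p V" unfolding Hol_inf_def by (auto intro: le_less_trans)
  qed
qed

end
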